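(* Let $\alpha,\beta>0$ with $\alpha\beta>1$ and let $Q$ be the non-commutative harmonic oscillator $$Q=\begin{pmatrix}\alpha&0\\0&\beta\end{pmatrix}\left(-\frac12\frac{d^2}{dx^2}+\frac12x^2\right)+\begin{pmatrix}0&-1\\1&0\end{pmatrix}\left(x\frac{d}{dx}+\frac12\right)$$ acting on $L^2(\mathbb{R};\mathbb{C}^2)$, with eigenvalues $0<\lambda_1\le\lambda_2\le\cdots$ (counted with multiplicity), and spectral zeta function $\zeta_Q(s)=\sum_{m\ge1}\lambda_m^{-s}$ ($\operatorname{Re}s>1$). Put $q=1/\sqrt{\alpha\beta-1}$. Then for every integer $n\ge 2$, $$\zeta_Q(n)=2\left(\frac{\alpha+\beta}{2\sqrt{\alpha\beta(\alpha\beta-1)}}\right)^{n}\left(\zeta(n,1/2)+\sum_{0<2k\le n}\left(\frac{\alpha-\beta}{\alpha+\beta}\right)^{2k}R_{n,k}(q)\right),$$ where $$R_{n,k}(q)=\sum_{1\le j_1<j_2<\dots<j_{2k}\le n}\int_{[0,1]^n}\frac{2^n\,du_1\cdots du_n}{\sqrt{\det\bigl(\Delta_n(\boldsymbol{u})+q\,\Xi_n(j_1,\dots,j_{2k})\bigr)\prod_{j=1}^n(1-u_j^4)}}.$$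
   Context: Under the hypotheses $\alpha,\beta>0$, $\alpha\beta>1$, $Q$ is a positive self-adjoint operator with purely discrete spectrum, and the series defining $\zeta_Q(s)$ converges absolutely for $\operatorname{Re}s>1$. $\zeta(s,x)=\sum_{m=0}^\infty (m+x)^{-s}$ is the Hurwitz zeta function. For $\boldsymbol{u}=(u_1,\dots,u_n)\in(0,1)^n$, $\Delta_n(\boldsymbol{u})$ is the $n\times n$ real symmetric matrix $$\Delta_n(\boldsymbol{u})=\sum_{i=1}^n\left\{\bigl(E_{ii}+E_{i+1,i+1}\bigr)\left(\frac{1}{1-u_i^4}-\frac12\right)+\bigl(E_{i,i+1}+E_{i+1,i}\bigr)\frac{-u_i^2}{1-u_i^4}\right\},$$ where $E_{ij}$ are the $n\times n$ matrix units and indices are read modulo $n$ (so $E_{n+1,n+1}=E_{11}$, $E_{n,n+1}=E_{n,1}$, etc.). For $1\le j_1<\dots<j_{2k}\le n$, $\Xi_n(j_1,\dots,j_{2k})=\sqrt{-1}\sum_{r=1}^{2k}(-1)^r E_{j_r j_r}$. The quantity $\det(\Delta_n(\boldsymbol{u})+q\Xi_n(j_1,\dots,j_{2k}))$ is real for $\boldsymbol{u}\in(0,1)^n$; $\sqrt{\cdot}$ denotes the principal square root. The sum over $k$ runs over positive integers with $2k\le n$. *)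

theory Defs
  imports "HOL-Analysis.Analysis" "Jordan_Normal_Form.Determinant"
begin

section \<open>The non-commutative harmonic oscillator\<close>

definition schwartz :: "(real \<Rightarrow> complex ^ 2) \<Rightarrow> bool" where
  "schwartz \<phi> \<longleftrightarrow>
     (\<exists>D :: nat \<Rightarrow> real \<Rightarrow> complex ^ 2. D 0 = \<phi> \<and>
        (\<forall>k x. (D k has_vector_derivative D (Suc k) x) (at x)) \<and>
        (\<forall>j k. bounded (range (\<lambda>x. x ^ j *\<^sub>R D k x))))"

definition ncho_expr :: "real \<Rightarrow> real \<Rightarrow> (real \<Rightarrow> complex ^ 2) \<Rightarrow> real \<Rightarrow> complex ^ 2" where
  "ncho_expr \<alpha> \<beta> \<phi> x =
     (let \<phi>' = (\<lambda>y. vector_derivative \<phi> (at y));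
          \<phi>'' = (\<lambda>y. vector_derivative \<phi>' (at y));
          A = vector [vector [of_real \<alpha>, 0], vector [0, of_real \<beta>]] :: complex ^ 2 ^ 2;
          J = vector [vector [0, -1], vector [1, 0]] :: complex ^ 2 ^ 2
      in A *v (- (1/2) *\<^sub>R \<phi>'' x + (1/2 * x\<^sup>2) *\<^sub>R \<phi> x) + J *v (x *\<^sub>R \<phi>' x + (1/2) *\<^sub>R \<phi> x))"

text \<open>Elements of \<open>L\<^sup>2(\<real>; \<complex>\<^sup>2)\<close> are represented by functions; equality of elements is equality
  almost everywhere.\<close>

definition L2 :: "(real \<Rightarrow> complex ^ 2) set" where
  "L2 = {f. f \<in> borel_measurable lborel \<and> integrable lborel (\<lambda>x. (norm (f x))\<^sup>2)}"

definition L2_tendsto :: "(nat \<Rightarrow> real \<Rightarrow> complex ^ 2) \<Rightarrow> (real \<Rightarrow> complex ^ 2) \<Rightarrow> bool" where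
  "L2_tendsto F f \<longleftrightarrow> (\<lambda>k. \<integral>x. (norm (F k x - f x))\<^sup>2 \<partial>lborel) \<longlonglongrightarrow> 0"

text \<open>The unbounded self-adjoint operator \<open>Q\<close>, given by its graph. For \<open>\<alpha>, \<beta> > 0\<close> and \<open>\<alpha>\<beta> > 1\<close> the
  differential expression is essentially self-adjoint on the Schwartz space, so its unique
  self-adjoint realisation is the closure of its restriction to that space.\<close>

definition ncho :: "real \<Rightarrow> real \<Rightarrow> ((real \<Rightarrow> complex ^ 2) \<times> (real \<Rightarrow> complex ^ 2)) set" where
  "ncho \<alpha> \<beta> = {(f, g). f \<in> L2 \<and> g \<in> L2 \<and>
     (\<exists>F. (\<forall>k. schwartz (F k)) \<and> L2_tendsto F f \<and> L2_tendsto (\<lambda>k. ncho_expr \<alpha> \<beta> (F k)) g)}"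

definition ncho_eigenspace :: "real \<Rightarrow> real \<Rightarrow> complex \<Rightarrow> (real \<Rightarrow> complex ^ 2) set" where
  "ncho_eigenspace \<alpha> \<beta> \<mu> = {f. (f, \<lambda>x. \<mu> *s f x) \<in> ncho \<alpha> \<beta>}"

text \<open>\<open>V\<close> modulo almost everywhere equality is a complex vector space with a basis of \<open>d\<close> elements.\<close>

definition has_dim_ae :: "(real \<Rightarrow> complex ^ 2) set \<Rightarrow> nat \<Rightarrow> bool" where
  "has_dim_ae V d \<longleftrightarrow>
     (\<exists>b :: nat \<Rightarrow> real \<Rightarrow> complex ^ 2. (\<forall>i<d. b i \<in> V) \<and>
        (\<forall>c. (AE x in lborel. (\<Sum>i<d. c i *s b i x) = 0) \<longrightarrow> (\<forall>i<d. c i = 0)) \<and>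
        (\<forall>f\<in>V. \<exists>c. AE x in lborel. f x = (\<Sum>i<d. c i *s b i x)))"

text \<open>\<open>lam\<close> lists all eigenvalues of \<open>Q\<close> in nondecreasing order, each as often as its
  multiplicity (the dimension of the eigenspace); \<open>lam m\<close> is \<open>\<lambda>\<^bsub>m+1\<^esub>\<close>. Numbers that are not
  eigenvalues have multiplicity 0 and so do not occur.\<close>

definition ncho_eigenvalues :: "real \<Rightarrow> real \<Rightarrow> (nat \<Rightarrow> real) \<Rightarrow> bool" where
  "ncho_eigenvalues \<alpha> \<beta> lam \<longleftrightarrow> 0 < lam 0 \<and> incseq lam \<and>
     (\<forall>\<mu> :: complex. finite {m. complex_of_real (lam m) = \<mu>} \<and>
        has_dim_ae (ncho_eigenspace \<alpha> \<beta> \<mu>) (card {m. complex_of_real (lam m) = \<mu>}))"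

definition spectral_zeta :: "(nat \<Rightarrow> real) \<Rightarrow> complex \<Rightarrow> complex" where
  "spectral_zeta lam s = (\<Sum>m. complex_of_real (lam m) powr (- s))"

definition hurwitz_zeta :: "complex \<Rightarrow> real \<Rightarrow> complex" where
  "hurwitz_zeta s x = (\<Sum>m. complex_of_real (real m + x) powr (- s))"

section \<open>The integrals \<open>R\<^bsub>n,k\<^esub>(q)\<close>\<close>

text \<open>All indices \<open>1, \<dots>, n\<close> are shifted to \<open>0, \<dots>, n - 1\<close>; those of matrix units are read modulo \<open>n\<close>.\<close>

definition matrix_unit :: "nat \<Rightarrow> nat \<Rightarrow> nat \<Rightarrow> 'a :: zero_neq_one mat" where
  "matrix_unit n i j = Matrix.mat n n (\<lambda>(a, b). if a = i mod n \<and> b = j mod n then 1 else 0)"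

text \<open>The sums of matrices are taken entrywise, as \<open>'a mat\<close> (with no fixed dimension) has no \<open>sum\<close>.\<close>

definition Delta :: "nat \<Rightarrow> (nat \<Rightarrow> real) \<Rightarrow> real mat" where
  "Delta n u = Matrix.mat n n (\<lambda>(a, b). \<Sum>i<n.
       (matrix_unit n i i + matrix_unit n (i+1) (i+1)) $$ (a, b) * (1 / (1 - u i ^ 4) - 1/2)
     + (matrix_unit n i (i+1) + matrix_unit n (i+1) i) $$ (a, b) * (- (u i)\<^sup>2 / (1 - u i ^ 4)))"

text \<open>The list \<open>js\<close> is \<open>[j\<^sub>1, \<dots>, j\<^bsub>2k\<^esub>]\<close>, so its \<open>r\<close>-th entry, counted from 0, has sign \<open>(-1)\<^bsup>r+1\<^esup>\<close>.\<close>

definition Xi :: "nat \<Rightarrow> nat list \<Rightarrow> complex mat" where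
  "Xi n js = Matrix.mat n n (\<lambda>(a, b).
     \<i> * (\<Sum>r<length js. (-1) ^ (r+1) * matrix_unit n (js ! r) (js ! r) $$ (a, b)))"

text \<open>\<open>csqrt\<close> is the principal square root. The integrand is only meaningful on \<open>(0,1)\<^sup>n\<close>; the rest
  of the cube is a null set.\<close>

definition R :: "nat \<Rightarrow> nat \<Rightarrow> real \<Rightarrow> complex" where
  "R n k q = (\<Sum>js | sorted_wrt (<) js \<and> length js = 2 * k \<and> set js \<subseteq> {..<n}.
     set_lebesgue_integral (Pi\<^sub>M {..<n} (\<lambda>_. lborel)) ({..<n} \<rightarrow>\<^sub>E {0..1})
       (\<lambda>u. 2 ^ n / csqrt (
          Determinant.det (map_mat complex_of_real (Delta n u) + complex_of_real q \<cdot>\<^sub>m Xi n js)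
          * complex_of_real (\<Prod>j<n. 1 - u j ^ 4))))"

end

theory Submission imports Defs "HOL-Probability.Probability" "HOL-Real_Asymp.Real_Asymp" begin

text \<open>Write \<open>A = diag(\<alpha>, \<beta>)\<close> and let \<open>v\<^sub>\<sigma> = (1, -\<i>\<sigma>)\<close>, \<open>\<sigma> = \<plusminus>1\<close>, be the eigenvectors of the skew matrix. With
  \<open>\<kappa> = 1/\<surd>(\<alpha>\<beta>)\<close> and \<open>\<nu> = \<surd>(1 - \<kappa>\<^sup>2)\<close>, a chirp \<open>e\<^bsup>\<i>\<sigma>\<kappa>x\<^sup>2/2\<^esup>\<close> times a Hermite function \<open>\<eta>\<^sub>m\<close> of width \<open>\<nu>\<^bsup>-1/2\<^esup>\<close>
  absorbs the first order term: \<open>\<psi>\<^bsub>m\<sigma>\<^esub> = A\<^bsup>-1/2\<^esup>v\<^sub>\<sigma> e\<^bsup>\<i>\<sigma>\<kappa>x\<^sup>2/2\<^esup> \<eta>\<^sub>m\<close> satisfies \<open>Q\<psi>\<^bsub>m\<sigma>\<^esub> = \<nu>(m + 1/2) A\<psi>\<^bsub>m\<sigma>\<^esub>\<close>.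
  Hence \<open>Q f = \<lambda> f\<close> becomes an eigenvector equation with eigenvalue \<open>1/\<lambda>\<close> for the Hilbert-Schmidt matrix
  \<open>G = \<nu>\<^bsup>-1\<^esup> D\<^bsup>-1/2\<^esup> \<Gamma> D\<^bsup>-1/2\<^esup>\<close>, where \<open>\<Gamma>\<close> is the Gram matrix of the \<open>\<psi>\<^bsub>m\<sigma>\<^esub>\<close> and \<open>D = diag(m + 1/2)\<close>.
  So \<open>\<zeta>\<^sub>Q(n)\<close> is the trace of \<open>G\<^sup>n\<close>, a sum over closed paths in \<open>\<nat> \<times> {\<plusminus>1}\<close>. For a fixed sequence of
  signs, \<open>1/(m + 1/2) = 2\<integral>u\<^bsup>2m\<^esup>du\<close> and Mehler's formula turn the sum over the oscillator indices into
  an integral over the cube of a Gaussian integral with matrix \<open>\<Delta>\<^sub>n(u) + q\<Xi>\<^sub>n\<close>, where \<open>j\<^sub>1 < \<dots> < j\<^bsub>2k\<^esub>\<close> are the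
  positions at which the sign flips. Each set of flips comes from two sign sequences; the empty one gives the
  Hurwitz zeta value.\<close>

section \<open>Square-summable families and Hilbert-Schmidt matrices\<close>

text \<open>\<open>G\<close> is only shown to be Hilbert-Schmidt, so the path sum for the trace of
  its n-th power converges absolutely from n = 2 on. The eigenvalues are given only through
  dimensions of eigenspaces of a closed graph. Eigenspaces of Q and G are therefore matched in both
  directions, and the listed eigenvectors must exhaust G up to its kernel. The latter is
  variational: a nonzero quadratic form on their orthogonal complement would produce one more
  eigenvector. The Gaussian integral in n variables comes out of a recursion only up to sign, and
  the matrix is complex symmetric, so neither realness nor positivity of its determinant is evident.
  Realness comes from an intertwining of the matrix with its conjugate, which rests on p^2 - b^2 =
  1/4 for the entries contributed by each u_i. Constants: with J the skew matrix, A^(-1/2) J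
  A^(-1/2) = \<open>\<kappa>\<close> J. Rescaling the Hermite functions to width 1 turns the chirp
  rate \<open>\<kappa>\<close> into q = \<open>\<kappa> / \<nu>\<close>. The number (\<beta> -
  \<alpha>)/(\<alpha> + \<beta>) is the ratio of the off-diagonal to the diagonal entries of A^(-1)
  in the basis of the two spin vectors; every cycle has an even number of flips, so only even powers
  occur.\<close>

definition ell2 :: "('i \<Rightarrow> complex) \<Rightarrow> bool" where
  "ell2 x \<longleftrightarrow> (\<lambda>i. (norm (x i))\<^sup>2) summable_on UNIV"

text \<open>The index type is arbitrary so that a matrix is itself a vector over pairs:
  Hilbert-Schmidt means \<open>ell2\<close> of the uncurried matrix, and the vector estimates apply
  to matrices, with \<open>nsq\<close> as the squared Hilbert-Schmidt norm.\<close>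

definition nsq :: "('i \<Rightarrow> complex) \<Rightarrow> real" where
  "nsq x = infsum (\<lambda>i. (norm (x i))\<^sup>2) UNIV"

definition ip :: "('i \<Rightarrow> complex) \<Rightarrow> ('i \<Rightarrow> complex) \<Rightarrow> complex" where
  "ip x y = infsum (\<lambda>i. cnj (x i) * y i) UNIV"

lemma nsq_nonneg [simp]: "0 \<le> nsq x"
  unfolding nsq_def by (rule infsum_nonneg) auto

lemma ell2_fin: "ell2 x \<Longrightarrow> finite F \<Longrightarrow> (\<Sum>i\<in>F. (norm (x i))\<^sup>2) \<le> nsq x"
  unfolding ell2_def nsq_def by (rule finite_sum_le_infsum) auto

lemma ell2I:
  assumes "\<And>F. finite F \<Longrightarrow> (\<Sum>i\<in>F. (norm (x i))\<^sup>2) \<le> C"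
  shows "ell2 x" "nsq x \<le> C"
proof -
  show *: "ell2 x" unfolding ell2_def
    by (rule nonneg_bdd_above_summable_on) (auto intro!: bdd_aboveI2[where M=C] assms)
  show "nsq x \<le> C" unfolding nsq_def
    by (rule infsum_le_finite_sums) (use * assms in \<open>auto simp: ell2_def\<close>)
qed

lemma ell2_mult:
  assumes "ell2 x" "ell2 y"
  shows "(\<lambda>i. norm (x i) * norm (y i)) summable_on UNIV"
    and "infsum (\<lambda>i. norm (x i) * norm (y i)) UNIV \<le> sqrt (nsq x) * sqrt (nsq y)"
proof -
  have b: "(\<Sum>i\<in>F. norm (x i) * norm (y i)) \<le> sqrt (nsq x) * sqrt (nsq y)" if "finite F" for F
  proof -
    have "(\<Sum>i\<in>F. norm (x i) * norm (y i)) \<le> L2_set (\<lambda>i. norm (x i)) F * L2_set (\<lambda>i. norm (y i)) F"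
      using L2_set_mult_ineq[of "\<lambda>i. norm (x i)" "\<lambda>i. norm (y i)" F] by simp
    also have "\<dots> \<le> sqrt (nsq x) * sqrt (nsq y)"
      unfolding L2_set_def by (intro mult_mono real_sqrt_le_mono ell2_fin assms that) (auto intro: sum_nonneg)
    finally show ?thesis .
  qed
  show *: "(\<lambda>i. norm (x i) * norm (y i)) summable_on UNIV"
    by (rule nonneg_bdd_above_summable_on) (auto intro!: bdd_aboveI2 b)
  show "infsum (\<lambda>i. norm (x i) * norm (y i)) UNIV \<le> sqrt (nsq x) * sqrt (nsq y)"
    by (rule infsum_le_finite_sums[OF *]) (use b in auto)
qed

lemma ell2_ip_abs: "ell2 x \<Longrightarrow> ell2 y \<Longrightarrow> (\<lambda>i. norm (cnj (x i) * y i)) summable_on UNIV"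
  using ell2_mult(1) by (simp add: norm_mult)

lemma ell2_ip_summable: "ell2 x \<Longrightarrow> ell2 y \<Longrightarrow> (\<lambda>i. cnj (x i) * y i) summable_on UNIV"
  by (rule abs_summable_summable[OF ell2_ip_abs])

lemma ell2_mult_summable: "ell2 x \<Longrightarrow> ell2 y \<Longrightarrow> (\<lambda>i. x i * y i) summable_on UNIV"
  by (rule abs_summable_summable) (use ell2_mult(1) in \<open>simp add: norm_mult\<close>)

lemma ip_CS: "ell2 x \<Longrightarrow> ell2 y \<Longrightarrow> norm (ip x y) \<le> sqrt (nsq x) * sqrt (nsq y)"
  unfolding ip_def
  by (rule order_trans[OF norm_infsum_bound[OF ell2_ip_abs]]) (auto simp: norm_mult ell2_mult(2))

lemma ell2_add:
  assumes "ell2 x" "ell2 y" shows "ell2 (\<lambda>i. x i + y i)"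
proof -
  have "(\<lambda>i. 2 * (norm (x i))\<^sup>2 + 2 * (norm (y i))\<^sup>2) summable_on UNIV"
    using assms unfolding ell2_def by (intro summable_on_add summable_on_cmult_right)
  then show ?thesis unfolding ell2_def
  proof (rule summable_on_comparison_test)
    fix i
    have "(norm (x i + y i))\<^sup>2 \<le> (norm (x i) + norm (y i))\<^sup>2"
      by (intro power_mono norm_triangle_ineq) auto
    also have "\<dots> \<le> 2 * (norm (x i))\<^sup>2 + 2 * (norm (y i))\<^sup>2"
      using sum_squares_bound[of "norm (x i)" "norm (y i)"] by (simp add: power2_sum)
    finally show "(norm (x i + y i))\<^sup>2 \<le> 2 * (norm (x i))\<^sup>2 + 2 * (norm (y i))\<^sup>2" .
  qed auto
qed

lemma ell2_scale: "ell2 x \<Longrightarrow> ell2 (\<lambda>i. c * x i)"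
  unfolding ell2_def by (simp add: norm_mult power_mult_distrib summable_on_cmult_right)

lemma ell2_0: "ell2 (\<lambda>i. 0)" unfolding ell2_def by simp

lemma ell2_sum: "finite A \<Longrightarrow> (\<And>k. k \<in> A \<Longrightarrow> ell2 (x k)) \<Longrightarrow> ell2 (\<lambda>i. \<Sum>k\<in>A. x k i)"
  by (induction A rule: finite_induct) (auto simp: ell2_0 intro: ell2_add)

lemma ell2_diff: "ell2 x \<Longrightarrow> ell2 y \<Longrightarrow> ell2 (\<lambda>i. x i - y i)"
  using ell2_add[of x "\<lambda>i. (-1) * y i"] ell2_scale[of y "-1"] by simp

lemma ip_add_right: "ell2 x \<Longrightarrow> ell2 y \<Longrightarrow> ell2 z \<Longrightarrow> ip x (\<lambda>i. y i + z i) = ip x y + ip x z"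
  unfolding ip_def by (subst infsum_add[symmetric]) (auto simp: ell2_ip_summable distrib_left)

lemma ip_scale_right: "ip x (\<lambda>i. c * y i) = c * ip x y"
  unfolding ip_def by (subst infsum_cmult_right'[symmetric]) (simp add: mult_ac)

lemma ip_cnj: "cnj (ip x y) = ip y x"
  unfolding ip_def by (subst infsum_cnj[symmetric]) (simp add: mult_ac)

lemma ip_sum_right: "finite A \<Longrightarrow> ell2 x \<Longrightarrow> (\<And>k. k \<in> A \<Longrightarrow> ell2 (y k)) \<Longrightarrow>
   ip x (\<lambda>i. \<Sum>k\<in>A. y k i) = (\<Sum>k\<in>A. ip x (y k))"
proof (induction A rule: finite_induct)
  case empty then show ?case by (simp add: ip_def)
next
  case (insert a A) then show ?case by (simp add: ip_add_right ell2_sum)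
qed

lemma ip_add_left: "ell2 x \<Longrightarrow> ell2 y \<Longrightarrow> ell2 z \<Longrightarrow> ip (\<lambda>i. y i + z i) x = ip y x + ip z x"
  using ip_add_right[of x y z] ip_cnj by (metis complex_cnj_add)

lemma ip_scale_left: "ip (\<lambda>i. c * y i) x = cnj c * ip y x"
  using ip_scale_right[of x c y] ip_cnj by (metis complex_cnj_mult)

lemma ip_sum_left: "finite A \<Longrightarrow> ell2 x \<Longrightarrow> (\<And>k. k \<in> A \<Longrightarrow> ell2 (y k)) \<Longrightarrow>
   ip (\<lambda>i. \<Sum>k\<in>A. y k i) x = (\<Sum>k\<in>A. ip (y k) x)"
proof (induction A rule: finite_induct)
  case empty then show ?case by (simp add: ip_def)
next
  case (insert a A) then show ?case by (simp add: ip_add_left ell2_sum)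
qed

lemma ip_diff_right: "ell2 x \<Longrightarrow> ell2 y \<Longrightarrow> ell2 z \<Longrightarrow> ip x (\<lambda>i. y i - z i) = ip x y - ip x z"
  using ip_add_right[of x y "\<lambda>i. (-1) * z i"] ell2_scale[of z "-1"] ip_scale_right[of x "-1" z] by simp

lemma ip_self: "ip x x = of_real (nsq x)"
proof -
  have "ip x x = infsum (\<lambda>i. of_real ((norm (x i))\<^sup>2)) UNIV"
    unfolding ip_def by (simp add: complex_norm_square mult_ac del: of_real_power)
  also have "\<dots> = of_real (nsq x)"
  proof (cases "ell2 x")
    case True
    then have "((\<lambda>i. (norm (x i))\<^sup>2) has_sum nsq x) UNIV"
      unfolding ell2_def nsq_def by (rule has_sum_infsum)
    then have "((\<lambda>i. complex_of_real ((norm (x i))\<^sup>2)) has_sum of_real (nsq x)) UNIV"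
      by (rule has_sum_of_real)
    then show ?thesis by (rule infsumI)
  next
    \<comment> \<open>Both sides are 0 here, the default value of \<open>infsum\<close> for a family
      that is not summable.\<close>
    case False
    then have "\<not> (\<lambda>i. complex_of_real ((norm (x i))\<^sup>2)) summable_on UNIV"
      unfolding ell2_def using summable_on_Re by fastforce
    then show ?thesis using False by (simp add: infsum_not_exists nsq_def ell2_def)
  qed
  finally show ?thesis .
qed

lemma nsq_scale: "nsq (\<lambda>i. c * x i) = (norm c)\<^sup>2 * nsq x"
  unfolding nsq_def by (simp add: norm_mult power_mult_distrib infsum_cmult_right')

lemma nsq_eq_0: "ell2 x \<Longrightarrow> nsq x = 0 \<Longrightarrow> x = (\<lambda>_. 0)"
proof
  fix i assume "ell2 x" "nsq x = 0"
  then show "x i = 0" using ell2_fin[of x "{i}"] by simp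
qed

lemma nsq_add: "ell2 x \<Longrightarrow> ell2 y \<Longrightarrow> nsq (\<lambda>i. x i + y i) = nsq x + nsq y + 2 * Re (ip x y)"
proof -
  assume a: "ell2 x" "ell2 y"
  have "complex_of_real (nsq (\<lambda>i. x i + y i)) = ip (\<lambda>i. x i + y i) (\<lambda>i. x i + y i)"
    by (simp add: ip_self)
  also have "\<dots> = ip x x + ip y y + (ip x y + cnj (ip x y))"
    using a by (simp add: ip_add_left ip_add_right ell2_add ip_cnj)
  also have "\<dots> = of_real (nsq x + nsq y + 2 * Re (ip x y))"
    by (simp add: ip_self complex_add_cnj)
  finally show ?thesis using of_real_eq_iff by blast
qed

definition kd :: "'i \<Rightarrow> 'i \<Rightarrow> complex" where "kd j i = (if i = j then 1 else 0)"

lemma kd_has_sum: "((\<lambda>i. f i * kd j i) has_sum f j) UNIV"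
  by (rule has_sum_finite_neutralI[where B="{j}"]) (auto simp: kd_def)

lemma ell2_kd: "ell2 (kd j)" "nsq (kd j) = 1"
proof -
  have "((\<lambda>i. (norm (kd j i))\<^sup>2) has_sum 1) UNIV"
    by (rule has_sum_finite_neutralI[where B="{j}"]) (auto simp: kd_def)
  then show "ell2 (kd j)" "nsq (kd j) = 1"
    unfolding ell2_def nsq_def by (auto simp: summable_on_def infsumI)
qed

lemma ip_kd: "ip x (kd j) = cnj (x j)"
  unfolding ip_def using kd_has_sum[of "\<lambda>i. cnj (x i)" j] by (simp add: infsumI)

section \<open>Orthonormal families and weak convergence\<close>

definition ortho :: "(nat \<Rightarrow> 'i \<Rightarrow> complex) \<Rightarrow> nat set \<Rightarrow> bool" where
  "ortho e S \<longleftrightarrow> (\<forall>m\<in>S. ell2 (e m)) \<and> (\<forall>m\<in>S. \<forall>k\<in>S. ip (e m) (e k) = (if m = k then 1 else 0))"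

lemma ortho_ip_sum:
  assumes "ortho e S" "finite A" "A \<subseteq> S" "k \<in> S"
  shows "ip (e k) (\<lambda>i. \<Sum>m\<in>A. c m * e m i) = (if k \<in> A then c k else 0)"
proof -
  have "ip (e k) (\<lambda>i. \<Sum>m\<in>A. c m * e m i) = (\<Sum>m\<in>A. ip (e k) (\<lambda>i. c m * e m i))"
    using assms by (intro ip_sum_right ell2_scale) (auto simp: ortho_def)
  also have "\<dots> = (\<Sum>m\<in>A. if m = k then c m else 0)"
    using assms by (intro sum.cong) (auto simp: ip_scale_right ortho_def subset_iff)
  finally show ?thesis using assms by simp
qed

text \<open>Pythagoras for the projection onto finitely many orthonormal vectors. Bessel's
  inequality is the nonnegativity of the residual.\<close>

lemma ortho_residual:
  assumes "ortho e S" "finite A" "A \<subseteq> S" "ell2 x"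
  defines "r \<equiv> (\<lambda>i. x i - (\<Sum>m\<in>A. ip (e m) x * e m i))"
  shows "ell2 r" "nsq r = nsq x - (\<Sum>m\<in>A. (norm (ip (e m) x))\<^sup>2)" "k \<in> A \<Longrightarrow> ip (e k) r = 0"
proof -
  define s where "s = (\<lambda>i. \<Sum>m\<in>A. ip (e m) x * e m i)"
  have ee: "\<And>m. m \<in> S \<Longrightarrow> ell2 (e m)" using assms by (auto simp: ortho_def)
  have es: "ell2 s" unfolding s_def using assms ee by (intro ell2_sum ell2_scale) auto
  have r: "r = (\<lambda>i. x i - s i)" by (simp add: r_def s_def)
  show er: "ell2 r" unfolding r using es assms by (simp add: ell2_diff)
  show 0: "ip (e k) r = 0" if "k \<in> A" for k
    unfolding r using that assms ee es ortho_ip_sum[of e S A k "\<lambda>m. ip (e m) x"]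
    by (simp add: ip_diff_right subset_iff s_def)
  have rs: "ip s r = 0"
    unfolding s_def using assms ee er 0 by (subst ip_sum_left) (auto simp: ell2_scale ip_scale_left)
  have ss: "ip s s = (\<Sum>m\<in>A. (norm (ip (e m) x))\<^sup>2)"
  proof -
    have "ip s s = (\<Sum>m\<in>A. ip (\<lambda>i. ip (e m) x * e m i) s)"
      unfolding s_def using assms ee es by (subst ip_sum_left) (auto simp: ell2_scale s_def)
    also have "\<dots> = (\<Sum>m\<in>A. cnj (ip (e m) x) * ip (e m) x)"
      using assms ortho_ip_sum[of e S A _ "\<lambda>m. ip (e m) x"]
      by (intro sum.cong) (auto simp: ip_scale_left s_def subset_iff)
    finally show ?thesis by (simp add: complex_norm_square mult.commute del: of_real_power)
  qed
  have "nsq x = nsq (\<lambda>i. s i + r i)" by (simp add: r)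
  also have "\<dots> = nsq s + nsq r" using nsq_add[OF es er] rs by simp
  finally show "nsq r = nsq x - (\<Sum>m\<in>A. (norm (ip (e m) x))\<^sup>2)"
    using ss ip_self[of s] by (metis add_diff_cancel_left' of_real_eq_iff)
qed

lemma bessel:
  assumes "ortho e S" "finite A" "A \<subseteq> S" "ell2 x"
  shows "(\<Sum>m\<in>A. (norm (ip (e m) x))\<^sup>2) \<le> nsq x"
proof -
  have "0 \<le> nsq (\<lambda>i. x i - (\<Sum>m\<in>A. ip (e m) x * e m i))" by simp
  then show ?thesis using ortho_residual(2)[OF assms] by linarith
qed

text \<open>For bounded sequences coordinatewise convergence is weak convergence, and the norm is
  weakly lower semicontinuous.\<close>

lemma weak_limit:
  assumes e: "\<And>k. ell2 (X k)" and b: "\<And>k. nsq (X k) \<le> C"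
    and l: "\<And>i. (\<lambda>k. X k i) \<longlonglongrightarrow> x i"
  shows "ell2 x" "nsq x \<le> C" "ell2 y \<Longrightarrow> (\<lambda>k. ip y (X k)) \<longlonglongrightarrow> ip y x"
proof -
  have f: "(\<Sum>i\<in>F. (norm (x i))\<^sup>2) \<le> C" if "finite F" for F
  proof (rule LIMSEQ_le_const2)
    show "(\<lambda>k. \<Sum>i\<in>F. (norm (X k i))\<^sup>2) \<longlonglongrightarrow> (\<Sum>i\<in>F. (norm (x i))\<^sup>2)"
      by (intro tendsto_intros l)
    show "\<exists>N. \<forall>n\<ge>N. (\<Sum>i\<in>F. (norm (X n i))\<^sup>2) \<le> C"
      using ell2_fin[OF e that] b order_trans by blast
  qed
  show ex: "ell2 x" and nx: "nsq x \<le> C" using ell2I[OF f] by auto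
  assume ey: "ell2 y"
  have C0: "C \<ge> 0" using b nsq_nonneg order_trans by blast
  show "(\<lambda>k. ip y (X k)) \<longlonglongrightarrow> ip y x"
  proof (rule LIMSEQ_I)
    fix r :: real assume r: "r > 0"
    \<comment> \<open>Chosen so that Cauchy-Schwarz bounds the tail by r/4; the added 1 keeps the
      denominator positive when C = 0.\<close>
    define \<epsilon> where "\<epsilon> = (r / (4 * (sqrt C + 1)))\<^sup>2"
    have s0: "sqrt C + 1 > 0" using real_sqrt_ge_zero[OF C0] by linarith
    have \<epsilon>: "\<epsilon> > 0" unfolding \<epsilon>_def using r s0 by (intro zero_less_power divide_pos_pos) auto
    have se: "sqrt \<epsilon> = r / (4 * (sqrt C + 1))" unfolding \<epsilon>_def using r s0 by (subst real_sqrt_abs) auto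
    obtain F where F: "finite F" "dist (\<Sum>i\<in>F. (norm (y i))\<^sup>2) (nsq y) \<le> \<epsilon>"
      using infsum_finite_approximation[of "\<lambda>i. (norm (y i))\<^sup>2" UNIV \<epsilon>] ey \<epsilon>
      unfolding ell2_def nsq_def by blast
    \<comment> \<open>\<open>y\<close> is cut into a finite part \<open>w\<close>, for which
      convergence of coordinates suffices, and a tail \<open>z\<close> of small norm.\<close>
    define z where "z = (\<lambda>i. if i \<in> F then 0 else y i)"
    define w where "w = (\<lambda>i. if i \<in> F then y i else 0)"
    have wz: "y = (\<lambda>i. w i + z i)" by (auto simp: w_def z_def)
    have ew: "ell2 w" "nsq w = (\<Sum>i\<in>F. (norm (y i))\<^sup>2)"
    proof -
      have "((\<lambda>i. (norm (w i))\<^sup>2) has_sum (\<Sum>i\<in>F. (norm (y i))\<^sup>2)) UNIV"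
        by (rule has_sum_finite_neutralI[where B=F]) (auto simp: w_def F)
      then show "ell2 w" "nsq w = (\<Sum>i\<in>F. (norm (y i))\<^sup>2)"
        unfolding ell2_def nsq_def by (auto simp: summable_on_def infsumI)
    qed
    have ez: "ell2 z" using ell2_diff[OF ey ew(1)]
      by (rule back_subst[of ell2]) (auto simp: z_def w_def)
    have "ip w z = 0" unfolding ip_def by (rule infsum_0) (auto simp: w_def z_def)
    then have "nsq y = nsq w + nsq z" using nsq_add[OF ew(1) ez] wz by simp
    then have nz: "nsq z \<le> \<epsilon>" using F ew by (simp add: dist_real_def)
    have ipw: "ip w v = (\<Sum>i\<in>F. cnj (y i) * v i)" for v
      unfolding ip_def
      by (rule infsumI, rule has_sum_finite_neutralI[where B=F]) (auto simp: w_def F)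
    have ipz: "norm (ip z v) \<le> r / 4" if "ell2 v" "nsq v \<le> C" for v
    proof -
      have "norm (ip z v) \<le> sqrt (nsq z) * sqrt (nsq v)" by (rule ip_CS[OF ez that(1)])
      also have "\<dots> \<le> sqrt \<epsilon> * sqrt C" using \<epsilon> by (intro mult_mono real_sqrt_le_mono nz that) auto
      also have "\<dots> = (r / 4) * (sqrt C / (sqrt C + 1))" unfolding se using r s0 by (simp add: field_simps)
      also have "\<dots> \<le> (r/4) * 1" using r s0 by (intro mult_left_mono) (auto simp: divide_simps)
      finally show ?thesis by simp
    qed
    have ya: "ip y v = ip w v + ip z v" if "ell2 v" for v
      by (subst wz) (rule ip_add_left[OF that ew(1) ez])
    have "(\<lambda>k. ip w (X k)) \<longlonglongrightarrow> ip w x" unfolding ipw by (intro tendsto_intros l)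
    then obtain N where N: "\<And>k. k \<ge> N \<Longrightarrow> norm (ip w (X k) - ip w x) < r / 4"
      using LIMSEQ_D[of _ _ "r/4"] r by (metis zero_less_divide_iff zero_less_numeral)
    show "\<exists>no. \<forall>n\<ge>no. norm (ip y (X n) - ip y x) < r"
    proof (intro exI allI impI)
      fix k assume "k \<ge> N"
      have "ip y (X k) - ip y x = (ip w (X k) - ip w x) + ip z (X k) - ip z x"
        using ya[OF e] ya[OF ex] by simp
      also have "norm \<dots> \<le> norm (ip w (X k) - ip w x) + norm (ip z (X k)) + norm (ip z x)"
        using norm_triangle_ineq4[of "(ip w (X k) - ip w x) + ip z (X k)" "ip z x"]
          norm_triangle_ineq[of "ip w (X k) - ip w x" "ip z (X k)"] by linarith
      also have "\<dots> < r" using N[OF \<open>k \<ge> N\<close>] ipz[OF e b, of k] ipz[OF ex nx] r by linarith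
      finally show "norm (ip y (X k) - ip y x) < r" .
    qed
  qed
qed

text \<open>The sequence lives in a product of discs, compact by Tychonoff. As there are countably
  many coordinates, compactness there is sequential compactness. Together with
  \<open>weak_limit\<close> this is weak sequential compactness of the unit ball.\<close>

lemma weak_compact:
  fixes X :: "nat \<Rightarrow> 'i::countable \<Rightarrow> complex"
  assumes e: "\<And>k. ell2 (X k)" and b: "\<And>k. nsq (X k) \<le> 1"
  shows "\<exists>r x. strict_mono r \<and> (\<forall>i. (\<lambda>k. X (r k) i) \<longlonglongrightarrow> x i)"
proof -
  have "compactin (product_topology (\<lambda>i::'i. euclidean :: complex topology) UNIV) (PiE UNIV (\<lambda>_. cball 0 1))"
    by (subst compactin_PiE) auto
  then have "compact (PiE UNIV (\<lambda>_::'i. cball (0::complex) 1))"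
    by (simp add: euclidean_product_topology flip: compactin_euclidean_iff)
  moreover have "X k \<in> PiE UNIV (\<lambda>_::'i. cball (0::complex) 1)" for k
  proof -
    have "norm (X k i) \<le> 1" for i
    proof -
      have "(norm (X k i))\<^sup>2 \<le> 1\<^sup>2" using ell2_fin[OF e, of "{i}" k] b[of k] by simp
      then show ?thesis by (rule power2_le_imp_le) auto
    qed
    then show ?thesis by auto
  qed
  ultimately obtain x r where "strict_mono r" "(X \<circ> r) \<longlonglongrightarrow> x"
    using compact_imp_seq_compact unfolding seq_compact_def by metis
  then show ?thesis
    using continuous_on_tendsto_compose[OF continuous_on_product_coordinates, of "X \<circ> r" x sequentially]
    by (intro exI[of _ r] exI[of _ x]) (auto simp: o_def)
qed

lemma ell2_bounded_mult:
  assumes "ell2 x" "\<And>i. norm (c i) \<le> K" shows "ell2 (\<lambda>i. c i * x i)"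
proof -
  have "(\<lambda>i. K\<^sup>2 * (norm (x i))\<^sup>2) summable_on UNIV"
    using assms unfolding ell2_def by (intro summable_on_cmult_right)
  then show ?thesis unfolding ell2_def
  proof (rule summable_on_comparison_test)
    fix i show "(norm (c i * x i))\<^sup>2 \<le> K\<^sup>2 * (norm (x i))\<^sup>2"
      using assms(2)[of i] by (simp add: norm_mult power_mult_distrib mult_right_mono power_mono)
  qed auto
qed

lemma ell2_norm_le: "ell2 x \<Longrightarrow> norm (x i) \<le> sqrt (nsq x)"
  using ell2_fin[of x "{i}"] by (simp add: real_le_rsqrt)

lemma ell2_le: "ell2 x \<Longrightarrow> (\<And>i. norm (y i) \<le> norm (x i)) \<Longrightarrow> ell2 y"
  unfolding ell2_def by (erule summable_on_comparison_test) (auto intro: power_mono)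

lemma ell2_row: "ell2 (\<lambda>(i, j). X i j) \<Longrightarrow> ell2 (X i)"
proof (rule ell2I(1)[of _ "nsq (\<lambda>(i, j). X i j)"])
  fix F :: "'b set" assume e: "ell2 (\<lambda>(i, j). X i j)" "finite F"
  show "(\<Sum>j\<in>F. (norm (X i j))\<^sup>2) \<le> nsq (\<lambda>(i, j). X i j)"
    using ell2_fin[OF e(1), of "Pair i ` F"] e(2) by (simp add: sum.reindex inj_on_def)
qed

lemma ell2_swap: "ell2 (\<lambda>(i, j). X i j) \<longleftrightarrow> ell2 (\<lambda>(j, i). X i j)"
  unfolding ell2_def
  by (subst summable_on_reindex_bij_betw[of prod.swap UNIV UNIV, symmetric])
     (auto simp: case_prod_unfold bij_swap)

lemma ell2_col: "ell2 (\<lambda>(i, j). X i j) \<Longrightarrow> ell2 (\<lambda>i. X i j)"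
  using ell2_row[of "\<lambda>j i. X i j" j] ell2_swap[of X] by simp

lemma nsq_rows:
  assumes "ell2 (\<lambda>(i, j). X i j)"
  shows "(\<lambda>i. nsq (X i)) summable_on UNIV" "infsum (\<lambda>i. nsq (X i)) UNIV = nsq (\<lambda>(i, j). X i j)"
proof -
  have s: "(\<lambda>(i, j). (norm (X i j))\<^sup>2) summable_on UNIV \<times> UNIV"
    using assms unfolding ell2_def by (simp add: case_prod_unfold)
  show "(\<lambda>i. nsq (X i)) summable_on UNIV"
    unfolding nsq_def using summable_on_Sigma_banach[OF s] by simp
  show "infsum (\<lambda>i. nsq (X i)) UNIV = nsq (\<lambda>(i, j). X i j)"
    unfolding nsq_def using infsum_Sigma'_banach[OF s] by (simp add: case_prod_unfold)
qed

lemma ell2_tensor: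
  assumes "ell2 u" "ell2 v" shows "ell2 (\<lambda>(i, j). u i * v j)" "nsq (\<lambda>(i, j). u i * v j) \<le> nsq u * nsq v"
proof -
  have "(\<Sum>p\<in>F. (norm (case p of (i, j) \<Rightarrow> u i * v j))\<^sup>2) \<le> nsq u * nsq v" if "finite F" for F
  proof -
    have "(\<Sum>p\<in>F. (norm (case p of (i, j) \<Rightarrow> u i * v j))\<^sup>2)
        \<le> (\<Sum>p\<in>fst ` F \<times> snd ` F. (norm (case p of (i, j) \<Rightarrow> u i * v j))\<^sup>2)"
      using that by (intro sum_mono2) (auto simp: image_iff, force+)
    also have "\<dots> = (\<Sum>i\<in>fst ` F. (norm (u i))\<^sup>2) * (\<Sum>j\<in>snd ` F. (norm (v j))\<^sup>2)"
      by (simp add: sum_product sum.cartesian_product norm_mult power_mult_distrib case_prod_unfold)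
    also have "\<dots> \<le> nsq u * nsq v"
      using that by (intro mult_mono ell2_fin assms) (auto intro: sum_nonneg)
    finally show ?thesis .
  qed
  then show "ell2 (\<lambda>(i, j). u i * v j)" "nsq (\<lambda>(i, j). u i * v j) \<le> nsq u * nsq v"
    using ell2I by blast+
qed

lemma ell2_sqrt_nsq:
  assumes "ell2 (\<lambda>(i, j). X i j)" shows "ell2 (\<lambda>i. of_real (sqrt (nsq (X i))))"
  unfolding ell2_def using nsq_rows(1)[OF assms] by simp

text \<open>Entry (i, j) is bounded by the norm of row i of \<open>X\<close> times the norm of
  column j of \<open>Y\<close>, and both are square-summable. The version with absolute values
  inside is what makes sums over paths converge absolutely.\<close>

lemma hs_mult:
  assumes X: "ell2 (\<lambda>(i, j). X i j)" and Y: "ell2 (\<lambda>(i, j). Y i j)"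
  shows "(\<lambda>k. X i k * Y k j) summable_on UNIV" "(\<lambda>k. norm (X i k * Y k j)) summable_on UNIV"
    and "ell2 (\<lambda>(i, j). infsum (\<lambda>k. X i k * Y k j) UNIV)"
    and "ell2 (\<lambda>(i, j). of_real (infsum (\<lambda>k. norm (X i k) * norm (Y k j)) UNIV))"
proof -
  show "(\<lambda>k. X i k * Y k j) summable_on UNIV" for i j
    using ell2_mult_summable[OF ell2_row[OF X] ell2_col[OF Y]] .
  show abs: "(\<lambda>k. norm (X i k * Y k j)) summable_on UNIV" for i j
    using ell2_mult(1)[OF ell2_row[OF X] ell2_col[OF Y]] by (simp add: norm_mult)
  define w where "w = (\<lambda>(i, j). complex_of_real (sqrt (nsq (X i))) * of_real (sqrt (nsq (\<lambda>k. Y k j))))"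
  have w: "ell2 w" unfolding w_def
    using ell2_tensor(1)[OF ell2_sqrt_nsq[OF X] ell2_sqrt_nsq[of "\<lambda>j k. Y k j"]] Y ell2_swap[of Y] by simp
  have b: "infsum (\<lambda>k. norm (X i k) * norm (Y k j)) UNIV \<le> norm (w (i, j))" for i j
    unfolding w_def using ell2_mult(2)[OF ell2_row[OF X] ell2_col[OF Y]] by (simp add: norm_mult)
  show "ell2 (\<lambda>(i, j). of_real (infsum (\<lambda>k. norm (X i k) * norm (Y k j)) UNIV))"
    by (rule ell2_le[OF w]) (use b in \<open>auto simp: infsum_nonneg\<close>)
  show "ell2 (\<lambda>(i, j). infsum (\<lambda>k. X i k * Y k j) UNIV)"
  proof (rule ell2_le[OF w])
    fix p :: "'a \<times> 'c"
    obtain i j where p: "p = (i, j)" by fastforce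
    have "norm (infsum (\<lambda>k. X i k * Y k j) UNIV) \<le> norm (w (i, j))"
      by (rule order_trans[OF norm_infsum_bound[OF abs]]) (use b[of i j] in \<open>simp add: norm_mult\<close>)
    then show "norm (case p of (i, j) \<Rightarrow> infsum (\<lambda>k. X i k * Y k j) UNIV) \<le> norm (w p)" by (simp add: p)
  qed
qed

section \<open>Hermitian Hilbert-Schmidt matrices and their eigenvectors\<close>

definition mapp :: "('i \<Rightarrow> 'i \<Rightarrow> complex) \<Rightarrow> ('i \<Rightarrow> complex) \<Rightarrow> 'i \<Rightarrow> complex" where
  "mapp G x i = infsum (\<lambda>j. G i j * x j) UNIV"

locale hs_hermitian =
  fixes G :: "'i::countable \<Rightarrow> 'i \<Rightarrow> complex"
  assumes hs: "ell2 (\<lambda>(i, j). G i j)" and herm: "cnj (G i j) = G j i"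
begin

lemma mapp_ip: "mapp G x i = ip (\<lambda>j. G j i) x"
  unfolding mapp_def ip_def by (simp add: herm)

lemma mapp_ell2:
  assumes "ell2 x" shows "ell2 (mapp G x)"
proof -
  have "ell2 (\<lambda>i. of_real (sqrt (nsq x)) * complex_of_real (sqrt (nsq (G i))))"
    by (intro ell2_scale ell2_sqrt_nsq hs)
  then show ?thesis
  proof (rule ell2_le)
    fix i
    have "norm (mapp G x i) \<le> sqrt (nsq (\<lambda>j. cnj (G i j))) * sqrt (nsq x)"
      using ip_CS[OF ell2_col[OF hs] assms, of i] by (simp add: mapp_ip herm)
    also have "nsq (\<lambda>j. cnj (G i j)) = nsq (G i)" by (simp add: nsq_def)
    finally show "norm (mapp G x i) \<le> norm (of_real (sqrt (nsq x)) * complex_of_real (sqrt (nsq (G i))))"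
      by (simp add: norm_mult mult.commute)
  qed
qed

lemma mapp_add: "ell2 x \<Longrightarrow> ell2 y \<Longrightarrow> mapp G (\<lambda>i. x i + y i) = (\<lambda>i. mapp G x i + mapp G y i)"
  by (auto simp: mapp_ip ip_add_right ell2_col[OF hs])

lemma mapp_diff: "ell2 x \<Longrightarrow> ell2 y \<Longrightarrow> mapp G (\<lambda>i. x i - y i) = (\<lambda>i. mapp G x i - mapp G y i)"
  by (auto simp: mapp_ip ip_diff_right ell2_col[OF hs])

lemma mapp_scale: "mapp G (\<lambda>i. c * x i) = (\<lambda>i. c * mapp G x i)"
  by (auto simp: mapp_ip ip_scale_right)

lemma mapp_sum: "finite A \<Longrightarrow> (\<And>k. k \<in> A \<Longrightarrow> ell2 (x k)) \<Longrightarrow>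
    mapp G (\<lambda>i. \<Sum>k\<in>A. x k i) = (\<lambda>i. \<Sum>k\<in>A. mapp G (x k) i)"
  by (auto simp: mapp_ip ip_sum_right ell2_col[OF hs])

lemma quad_summable:
  assumes "ell2 x" "ell2 y"
  shows "(\<lambda>(i, j). cnj (x i) * (G i j * y j)) summable_on UNIV \<times> UNIV"
proof -
  have "ell2 (\<lambda>(i, j). cnj (x i) * y j)"
    using ell2_tensor(1)[of "\<lambda>i. cnj (x i)" y] assms by (simp add: ell2_def)
  from ell2_mult_summable[OF hs this] show ?thesis by (simp add: case_prod_unfold mult_ac)
qed

lemma quad_eq:
  assumes "ell2 x" "ell2 y"
  shows "ip x (mapp G y) = infsum (\<lambda>(i, j). cnj (x i) * (G i j * y j)) UNIV"
proof -
  have "ip x (mapp G y) = infsum (\<lambda>i. infsum (\<lambda>j. cnj (x i) * (G i j * y j)) UNIV) UNIV"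
    unfolding ip_def mapp_def by (simp add: infsum_cmult_right')
  also have "\<dots> = infsum (\<lambda>(i, j). cnj (x i) * (G i j * y j)) (UNIV \<times> UNIV)"
    by (rule infsum_Sigma'_banach[OF quad_summable[OF assms]])
  finally show ?thesis by simp
qed

text \<open>Pairing the fixed square-summable family \<open>G\<close> with a rank-one tensor makes
  the quadratic form weakly continuous: \<open>weak_limit\<close> applies to families over pairs.
  This is the point where Hilbert-Schmidt stands in for compactness.\<close>

lemma quad_ip: "ell2 x \<Longrightarrow> ell2 y \<Longrightarrow> ip x (mapp G y) = ip (\<lambda>(i, j). G j i) (\<lambda>(i, j). cnj (x i) * y j)"
  unfolding quad_eq by (simp add: ip_def case_prod_unfold herm mult_ac)

lemma symm:
  assumes "ell2 x" "ell2 y" shows "ip x (mapp G y) = ip (mapp G x) y"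
proof -
  have "ip (mapp G x) y = cnj (ip y (mapp G x))" by (simp add: ip_cnj)
  also have "\<dots> = infsum (\<lambda>(i, j). cnj (x j) * (G j i * y i)) UNIV"
    unfolding quad_eq[OF assms(2,1)] by (subst infsum_cnj[symmetric]) (simp add: case_prod_unfold herm mult_ac)
  also have "\<dots> = infsum (\<lambda>(i, j). cnj (x i) * (G i j * y j)) UNIV"
    by (subst infsum_reindex_bij_betw[of prod.swap UNIV UNIV, symmetric]) (auto simp: case_prod_unfold bij_swap)
  finally show ?thesis using quad_eq[OF assms] by simp
qed

text \<open>Variational principle on the subspace orthogonal to \<open>B\<close>, which
  \<open>inv\<close> makes invariant: the supremum of the quadratic form is attained by weak
  compactness and weak continuity, and stationarity at a maximiser is the eigenvalue
  equation.\<close>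

lemma pos_eigenvector:
  assumes B: "\<And>b. b \<in> B \<Longrightarrow> ell2 b"
    and inv: "\<And>x b. ell2 x \<Longrightarrow> \<forall>b\<in>B. ip b x = 0 \<Longrightarrow> b \<in> B \<Longrightarrow> ip b (mapp G x) = 0"
    and x0: "ell2 x0" "\<forall>b\<in>B. ip b x0 = 0" "Re (ip x0 (mapp G x0)) > 0"
  shows "\<exists>x M. ell2 x \<and> (\<forall>b\<in>B. ip b x = 0) \<and> x \<noteq> (\<lambda>_. 0) \<and> M > 0 \<and> mapp G x = (\<lambda>i. of_real M * x i)"
proof -
  define V where "V = {x. ell2 x \<and> (\<forall>b\<in>B. ip b x = 0)}"
  define q where "q x = Re (ip x (mapp G x))" for x
  define K where "K = sqrt (nsq (\<lambda>(i, j). G j i))"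
  have hs': "ell2 (\<lambda>(i, j). G j i)" using hs ell2_swap[of G] by simp
  have ten: "ell2 (\<lambda>(i, j). cnj (x i) * x j)" "nsq (\<lambda>(i, j). cnj (x i) * x j) \<le> nsq x * nsq x" if "ell2 x" for x :: "'i \<Rightarrow> complex"
    using ell2_tensor[of "\<lambda>i. cnj (x i)" x] that by (simp_all add: ell2_def nsq_def)
  have qb: "q x \<le> K * nsq x" if "ell2 x" for x
  proof -
    have "q x \<le> norm (ip x (mapp G x))" unfolding q_def by (rule complex_Re_le_cmod)
    also have "\<dots> \<le> K * sqrt (nsq (\<lambda>(i, j). cnj (x i) * x j))"
      unfolding quad_ip[OF that that] K_def by (rule ip_CS[OF hs' ten(1)[OF that]])
    also have "\<dots> \<le> K * sqrt (nsq x * nsq x)"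
      using ten(2)[OF that] by (intro mult_left_mono real_sqrt_le_mono) (auto simp: K_def)
    finally show ?thesis by simp
  qed
  have Vs: "(\<lambda>i. c * x i) \<in> V" if "x \<in> V" for c x
    using that unfolding V_def by (auto simp: ell2_scale ip_scale_right)
  have Vadd: "(\<lambda>i. x i + y i) \<in> V" if "x \<in> V" "y \<in> V" for x y
    using that unfolding V_def by (auto simp: ell2_add ip_add_right B)
  have VG: "mapp G x \<in> V" if "x \<in> V" for x
    using that inv unfolding V_def by (auto simp: mapp_ell2)
  have qs: "q (\<lambda>i. of_real t * x i) = t\<^sup>2 * q x" for t x
    unfolding q_def by (simp add: mapp_scale ip_scale_left ip_scale_right power2_eq_square mult.assoc)
  \<comment> \<open>The ball, not the sphere, because a weak limit can lose norm. The bound obtained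
    from the supremum extends to all of \<open>V\<close> by homogeneity.\<close>
  define S where "S = q ` {x \<in> V. nsq x \<le> 1}"
  have Sb: "bdd_above S"
    unfolding S_def
  proof (rule bdd_aboveI2[where M=K])
    fix x assume "x \<in> {x \<in> V. nsq x \<le> 1}"
    then show "q x \<le> K" using qb[of x] mult_left_mono[of "nsq x" 1 K] by (auto simp: V_def K_def)
  qed
  define M where "M = Sup S"
  have bound: "q x \<le> M * nsq x" if "x \<in> V" for x
  proof (cases "nsq x = 0")
    case True
    then show ?thesis using qb[of x] that by (auto simp: V_def)
  next
    case False
    then have p: "nsq x > 0" using nsq_nonneg[of x] by linarith
    define t where "t = 1 / sqrt (nsq x)"
    have t2: "t\<^sup>2 = 1 / nsq x" using p by (simp add: t_def power_divide)
    have "nsq (\<lambda>i. of_real t * x i) = 1" unfolding nsq_scale using p t2 by simp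
    then have "(\<lambda>i. of_real t * x i) \<in> {x \<in> V. nsq x \<le> 1}" using Vs[OF that, of "of_real t"] by simp
    then have "q (\<lambda>i. of_real t * x i) \<in> S" unfolding S_def by (rule imageI)
    then have "q (\<lambda>i. of_real t * x i) \<le> M" unfolding M_def using Sb by (rule cSup_upper)
    then show ?thesis unfolding qs t2 using p by (simp add: field_simps)
  qed
  have "0 < q x0" "x0 \<in> V" using x0 by (auto simp: V_def q_def)
  with bound[of x0] have "0 < M * nsq x0" by linarith
  then have Mpos: "M > 0" using nsq_nonneg[of x0] by (simp add: zero_less_mult_iff)
  have "\<exists>x. x \<in> V \<and> nsq x \<le> 1 \<and> q x > M - 1 / (real k + 1)" for k
  proof -
    have "S \<noteq> {}" unfolding S_def V_def using ell2_0
      by (auto simp: ip_def nsq_def intro!: exI[of _ "\<lambda>_. 0"])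
    moreover have "M - 1 / (real k + 1) < Sup S" unfolding M_def by simp
    ultimately obtain s where "s \<in> S" "M - 1 / (real k + 1) < s" using less_cSupD by blast
    then show ?thesis unfolding S_def by blast
  qed
  then obtain X where X: "\<And>k. X k \<in> V" "\<And>k. nsq (X k) \<le> 1" "\<And>k. q (X k) > M - 1 / (real k + 1)" by metis
  have eX: "\<And>k. ell2 (X k)" using X(1) by (auto simp: V_def)
  obtain r x where r: "strict_mono r" and lim: "\<And>i. (\<lambda>k. X (r k) i) \<longlonglongrightarrow> x i"
    using weak_compact[of X, OF eX X(2)] by blast
  have ex: "ell2 x" and nx: "nsq x \<le> 1"
    using weak_limit(1,2)[of "\<lambda>k. X (r k)" 1 x, OF eX X(2) lim] by auto
  have xV: "x \<in> V" unfolding V_def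
  proof (safe intro!: ex)
    fix b assume b: "b \<in> B"
    have "(\<lambda>k. ip b (X (r k))) \<longlonglongrightarrow> ip b x"
      by (rule weak_limit(3)[OF eX X(2) lim B[OF b]])
    moreover have "(\<lambda>k. ip b (X (r k))) = (\<lambda>k. 0)" using X(1) b by (auto simp: V_def)
    ultimately show "ip b x = 0" by (simp add: LIMSEQ_const_iff)
  qed
  have "(\<lambda>k. ip (\<lambda>(i, j). G j i) (\<lambda>(i, j). cnj (X (r k) i) * X (r k) j))
      \<longlonglongrightarrow> ip (\<lambda>(i, j). G j i) (\<lambda>(i, j). cnj (x i) * x j)"
  proof (rule weak_limit(3)[where C=1, OF _ _ _ hs'])
    fix k
    show "ell2 (\<lambda>(i, j). cnj (X (r k) i) * X (r k) j)" by (rule ten(1)[OF eX])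
    have "nsq (X (r k)) * nsq (X (r k)) \<le> 1 * 1" by (intro mult_mono X(2)) auto
    then show "nsq (\<lambda>(i, j). cnj (X (r k) i) * X (r k) j) \<le> 1" using ten(2)[OF eX, of "r k"] by linarith
  next
    fix p :: "'i \<times> 'i"
    show "(\<lambda>k. case p of (i, j) \<Rightarrow> cnj (X (r k) i) * X (r k) j) \<longlonglongrightarrow> (case p of (i, j) \<Rightarrow> cnj (x i) * x j)"
      by (cases p) (auto intro!: tendsto_intros lim)
  qed
  then have "(\<lambda>k. q (X (r k))) \<longlonglongrightarrow> q x"
    unfolding q_def by (simp add: quad_ip eX ex tendsto_Re)
  moreover have "(\<lambda>k. M - 1 / (real (r k) + 1)) \<longlonglongrightarrow> M - 0"
  proof (intro tendsto_intros)
    have "(\<lambda>k. 1 / (real k + 1)) \<longlonglongrightarrow> 0" using LIMSEQ_inverse_real_of_nat by (simp add: inverse_eq_divide add.commute)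
    from LIMSEQ_subseq_LIMSEQ[OF this r] show "(\<lambda>k. 1 / (real (r k) + 1)) \<longlonglongrightarrow> 0" by (simp add: o_def)
  qed
  ultimately have "M - 0 \<le> q x"
    using X(3) by (intro LIMSEQ_le[of "\<lambda>k. M - 1 / (real (r k) + 1)" _ "\<lambda>k. q (X (r k))"]) (auto intro: less_imp_le)
  then have qM: "q x \<ge> M" by simp
  have xn: "x \<noteq> (\<lambda>_. 0)"
  proof
    assume "x = (\<lambda>_. 0)" then have "q x = 0" by (simp add: q_def ip_def) with qM Mpos show False by simp
  qed
  define z where "z = (\<lambda>i. mapp G x i + of_real (-M) * x i)"
  have zV: "z \<in> V" unfolding z_def by (intro Vadd VG Vs xV)
  have ez: "ell2 z" using zV by (auto simp: V_def)
  have eg: "ell2 (mapp G x)" "ell2 (mapp G z)" using ex ez by (auto simp: mapp_ell2)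
  have nz: "nsq z = Re (ip z (mapp G x)) - M * Re (ip z x)"
  proof -
    have "ip z z = ip z (mapp G x) + of_real (-M) * ip z x"
      by (subst (2) z_def) (simp add: ip_add_right ip_scale_right ez eg ex ell2_scale del: of_real_minus)
    then show ?thesis by (simp add: ip_self complex_eq_iff)
  qed
  \<comment> \<open>The bound is tested at \<open>x + t z\<close>. The terms of order zero are
    absorbed by \<open>qM\<close>, the first order difference is 2t times \<open>nsq z\<close>, and
    dividing by t leaves a remainder of order t.\<close>
  have key: "2 * nsq z \<le> t * (M * nsq z - q z)" if t: "t > 0" for t
  proof -
    let ?y = "\<lambda>i. x i + of_real t * z i"
    have etz: "ell2 (\<lambda>i. of_real t * z i)" by (intro ell2_scale ez)
    have 1: "nsq ?y = nsq x + t\<^sup>2 * nsq z + 2 * t * Re (ip z x)"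
    proof -
      have "Re (ip x z) = Re (ip z x)" using ip_cnj[of x z] by (metis cnj.simps(1))
      then show ?thesis unfolding nsq_add[OF ex etz] by (simp add: nsq_scale ip_scale_right)
    qed
    have 2: "q ?y = q x + t\<^sup>2 * q z + 2 * t * Re (ip z (mapp G x))"
    proof -
      have "ip x (mapp G z) = cnj (ip z (mapp G x))" using symm[OF ex ez] ip_cnj by metis
      then show ?thesis unfolding q_def
        by (simp add: mapp_add mapp_scale ex etz ip_add_left ip_add_right ip_scale_left ip_scale_right eg ell2_scale ell2_add ez power2_eq_square algebra_simps)
    qed
    have "q ?y \<le> M * nsq ?y" by (rule bound) (intro Vadd xV Vs zV)
    then have "q x + t\<^sup>2 * q z + 2 * t * Re (ip z (mapp G x)) \<le> M * nsq x + M * (t\<^sup>2 * nsq z) + M * (2 * t * Re (ip z x))"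
      unfolding 1 2 by (simp add: algebra_simps)
    moreover have "M * nsq x \<le> M * 1" using nx Mpos by (intro mult_left_mono) auto
    then have "M * nsq x \<le> q x" using qM by simp
    ultimately have "t * (2 * nsq z) \<le> t * (t * (M * nsq z - q z))"
      unfolding nz by (simp add: power2_eq_square algebra_simps)
    then show ?thesis using t by simp
  qed
  have "nsq z \<le> 0"
  proof (rule ccontr)
    assume "\<not> nsq z \<le> 0"
    \<comment> \<open>The step length \<open>nsq z / c\<close> keeps the remainder below
      \<open>nsq z\<close>, which contradicts the factor 2 on the left.\<close>
    define c where "c = \<bar>M * nsq z - q z\<bar> + 1"
    have c: "c > 0" "M * nsq z - q z \<le> c" unfolding c_def by auto
    have "2 * nsq z \<le> nsq z / c * (M * nsq z - q z)" using key[of "nsq z / c"] c \<open>\<not> nsq z \<le> 0\<close> by simp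
    also have "\<dots> \<le> nsq z / c * c" using c by (intro mult_left_mono) auto
    finally show False using c \<open>\<not> nsq z \<le> 0\<close> by simp
  qed
  then have "z = (\<lambda>_. 0)" using nsq_eq_0[OF ez] nsq_nonneg[of z] by simp
  then have "mapp G x = (\<lambda>i. of_real M * x i)" unfolding z_def by (auto simp: fun_eq_iff)
  then show ?thesis using xV xn Mpos unfolding V_def by blast
qed

lemma neg: "hs_hermitian (\<lambda>i j. - G i j)"
proof
  show "ell2 (\<lambda>(i, j). - G i j)" using hs unfolding ell2_def by (simp add: case_prod_unfold)
qed (simp add: herm)

lemma mapp_neg: "mapp (\<lambda>i j. - G i j) x = (\<lambda>i. - mapp G x i)"
  unfolding mapp_def by (auto simp: infsum_uminus)

text \<open>A nonzero value of the quadratic form, of either sign, would yield an eigenvector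
  through \<open>pos_eigenvector\<close> for \<open>G\<close> or for \<open>- G\<close>, so the form
  vanishes on the subspace. Polarisation then kills \<open>G\<close> itself there.\<close>

lemma invariant_zero:
  assumes B: "\<And>b. b \<in> B \<Longrightarrow> ell2 b"
    and inv: "\<And>x b. ell2 x \<Longrightarrow> \<forall>b\<in>B. ip b x = 0 \<Longrightarrow> b \<in> B \<Longrightarrow> ip b (mapp G x) = 0"
    and no: "\<And>x M. ell2 x \<Longrightarrow> \<forall>b\<in>B. ip b x = 0 \<Longrightarrow> M \<noteq> 0 \<Longrightarrow> mapp G x = (\<lambda>i. complex_of_real M * x i) \<Longrightarrow> x = (\<lambda>_. 0)"
    and x: "ell2 x" "\<forall>b\<in>B. ip b x = 0"
  shows "mapp G x = (\<lambda>_. 0)"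
proof -
  have q0: "Re (ip x (mapp G x)) = 0" if x: "ell2 x" "\<forall>b\<in>B. ip b x = 0" for x
  proof (rule ccontr)
    assume "Re (ip x (mapp G x)) \<noteq> 0"
    then consider "Re (ip x (mapp G x)) > 0" | "Re (ip x (mapp G x)) < 0" by linarith
    then show False
    proof cases
      case 1
      obtain y M where y: "ell2 y" "\<forall>b\<in>B. ip b y = 0" "y \<noteq> (\<lambda>_. 0)" "M > 0" "mapp G y = (\<lambda>i. of_real M * y i)"
        using pos_eigenvector[OF B inv x 1] by blast
      with no[OF y(1,2), of M] show False by simp
    next
      case 2
      interpret n: hs_hermitian "\<lambda>i j. - G i j" by (rule neg)
      have "ip b (\<lambda>i. - y i) = - ip b y" for b y :: "'i \<Rightarrow> complex"
        using ip_scale_right[of b "-1" y] by simp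
      then have "\<exists>x M. ell2 x \<and> (\<forall>b\<in>B. ip b x = 0) \<and> x \<noteq> (\<lambda>_. 0) \<and> M > 0 \<and> mapp (\<lambda>i j. - G i j) x = (\<lambda>i. of_real M * x i)"
        by (intro n.pos_eigenvector[of B x]) (use B inv x 2 in \<open>auto simp: mapp_neg\<close>)
      then obtain y M where y: "ell2 y" "\<forall>b\<in>B. ip b y = 0" "y \<noteq> (\<lambda>_. 0)" "M > 0" "mapp (\<lambda>i j. - G i j) y = (\<lambda>i. of_real M * y i)"
        by blast
      have "mapp G y = (\<lambda>i. of_real (-M) * y i)"
      proof
        fix i
        have "- mapp G y i = of_real M * y i" using fun_cong[OF y(5), of i] by (simp add: mapp_neg)
        then have "mapp G y i = - (of_real M * y i)" by (simp add: minus_equation_iff[of "mapp G y i"] eq_commute)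
        then show "mapp G y i = of_real (-M) * y i" by simp
      qed
      with no[OF y(1,2), of "-M"] y show False by simp
    qed
  qed
  \<comment> \<open>The form vanishes at x, at \<open>y\<close> and at x + \<open>y\<close>; the
    mixed terms of the last one add up to twice the squared norm of \<open>y\<close>.\<close>
  define y where "y = mapp G x"
  have ey: "ell2 y" "\<forall>b\<in>B. ip b y = 0" unfolding y_def using x inv by (auto simp: mapp_ell2)
  have "Re (ip (\<lambda>i. x i + y i) (mapp G (\<lambda>i. x i + y i))) = 0"
    by (rule q0) (use x ey B in \<open>auto simp: ell2_add ip_add_right\<close>)
  moreover have "ip x (mapp G y) = ip y y" using symm[OF x(1) ey(1)] by (simp add: y_def)
  ultimately have "Re (ip y y) = 0"
    using q0[OF x] q0[OF ey] by (simp add: mapp_add x ey ip_add_left ip_add_right mapp_ell2 ell2_add flip: y_def)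
  then show ?thesis using nsq_eq_0[OF ey(1)] by (simp add: ip_self y_def)
qed

end

text \<open>Both changes of basis are recorded: one shows that the new vectors remain in the
  eigenspace, the other that they still span it.\<close>

lemma gram_schmidt:
  fixes b :: "nat \<Rightarrow> 'i \<Rightarrow> complex"
  assumes "\<And>i. i < d \<Longrightarrow> ell2 (b i)"
    and "\<And>c. (\<lambda>x. \<Sum>i<d. c i * b i x) = (\<lambda>_. 0) \<Longrightarrow> \<forall>i<d. c i = 0"
  shows "\<exists>e. ortho e {..<d} \<and> (\<forall>i<d. \<exists>c. e i = (\<lambda>x. \<Sum>j<d. c j * b j x))
    \<and> (\<forall>i<d. \<exists>c. b i = (\<lambda>x. \<Sum>j<d. c j * e j x))"
  using assms
proof (induction d)
  case 0
  then show ?case by (auto simp: ortho_def)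
next
  case (Suc d)
  have ind: "\<forall>i<d. c i = 0" if "(\<lambda>x. \<Sum>i<d. c i * b i x) = (\<lambda>_. 0)" for c
  proof -
    have "(\<lambda>x. \<Sum>i<Suc d. (c(d := 0)) i * b i x) = (\<lambda>_. 0)" using that by (simp add: fun_eq_iff)
    note z = Suc.prems(2)[OF this]
    show ?thesis
    proof (intro allI impI)
      fix i assume "i < d" with spec[OF z, of i] show "c i = 0" by simp
    qed
  qed
  have "\<exists>e. ortho e {..<d} \<and> (\<forall>i<d. \<exists>c. e i = (\<lambda>x. \<Sum>j<d. c j * b j x))
    \<and> (\<forall>i<d. \<exists>c. b i = (\<lambda>x. \<Sum>j<d. c j * e j x))"
    by (rule Suc.IH) (use Suc.prems(1) ind in auto)
  then obtain e where e: "ortho e {..<d}" "\<forall>i<d. \<exists>c. e i = (\<lambda>x. \<Sum>j<d. c j * b j x)"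
      "\<forall>i<d. \<exists>c. b i = (\<lambda>x. \<Sum>j<d. c j * e j x)"
    by blast
  obtain C where C: "\<And>i. i < d \<Longrightarrow> e i = (\<lambda>x. \<Sum>j<d. C i j * b j x)" using e(2) by metis
  obtain D where D: "\<And>i. i < d \<Longrightarrow> b i = (\<lambda>x. \<Sum>j<d. D i j * e j x)" using e(3) by metis
  define p where "p j = ip (e j) (b d)" for j
  define r where "r = (\<lambda>x. b d x - (\<Sum>j<d. p j * e j x))"
  have er: "ell2 r" and or: "\<And>k. k < d \<Longrightarrow> ip (e k) r = 0"
    using ortho_residual(1,3)[OF e(1), of "{..<d}" "b d"] Suc.prems(1)[of d] by (auto simp: r_def p_def)
  have rb: "r = (\<lambda>x. \<Sum>j<Suc d. (if j = d then 1 else - (\<Sum>i<d. p i * C i j)) * b j x)"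
  proof
    fix x
    have "(\<Sum>j<d. p j * e j x) = (\<Sum>i<d. p i * (\<Sum>j<d. C i j * b j x))"
      by (intro sum.cong) (auto dest: C[THEN fun_cong])
    also have "\<dots> = (\<Sum>i<d. \<Sum>j<d. p i * C i j * b j x)"
      by (simp add: sum_distrib_left mult.assoc)
    also have "\<dots> = (\<Sum>j<d. \<Sum>i<d. p i * C i j * b j x)" by (rule sum.swap)
    also have "\<dots> = (\<Sum>j<d. (\<Sum>i<d. p i * C i j) * b j x)" by (simp add: sum_distrib_right)
    finally show "r x = (\<Sum>j<Suc d. (if j = d then 1 else - (\<Sum>i<d. p i * C i j)) * b j x)"
      by (simp add: r_def sum_negf)
  qed
  have "nsq r \<noteq> 0"
  proof
    assume "nsq r = 0"
    then have "r = (\<lambda>_. 0)" using nsq_eq_0[OF er] by simp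
    from Suc.prems(2)[OF trans[OF rb[symmetric] this]] show False by auto
  qed
  then have np: "nsq r > 0" using nsq_nonneg[of r] by linarith
  define s where "s = complex_of_real (1 / sqrt (nsq r))"
  have s: "s \<noteq> 0" using np by (simp add: s_def)
  define e' where "e' = e(d := (\<lambda>x. s * r x))"
  have e'd: "e' d = (\<lambda>x. s * r x)" "\<And>i. i < d \<Longrightarrow> e' i = e i" by (auto simp: e'_def)
  have n1: "ip (e' d) (e' d) = 1"
  proof -
    have "ip (e' d) (e' d) = of_real ((norm s)\<^sup>2 * nsq r)" by (simp add: e'd ip_self nsq_scale)
    also have "(norm s)\<^sup>2 * nsq r = 1" using np by (simp add: s_def norm_divide power_divide)
    finally show ?thesis by simp
  qed
  have n0: "ip (e' k) (e' d) = 0" "ip (e' d) (e' k) = 0" if "k < d" for k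
  proof -
    show *: "ip (e' k) (e' d) = 0" using or[OF that] that by (simp add: e'd ip_scale_right)
    show "ip (e' d) (e' k) = 0" using * ip_cnj by (metis complex_cnj_zero)
  qed
  have "ortho e' {..<Suc d}"
    unfolding ortho_def
  proof (intro conjI ballI)
    fix m assume "m \<in> {..<Suc d}"
    then show "ell2 (e' m)" using e(1) er by (cases "m = d") (auto simp: e'd ell2_scale ortho_def)
  next
    fix m k assume "m \<in> {..<Suc d}" "k \<in> {..<Suc d}"
    then show "ip (e' m) (e' k) = (if m = k then 1 else 0)"
      using e(1) n0 n1 by (cases "m = d"; cases "k = d") (auto simp: e'd(2) ortho_def)
  qed
  moreover have "\<exists>c. e' i = (\<lambda>x. \<Sum>j<Suc d. c j * b j x)" if "i < Suc d" for i
  proof (cases "i = d")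
    case True
    have "e' i = (\<lambda>x. \<Sum>j<Suc d. (s * (if j = d then 1 else - (\<Sum>i<d. p i * C i j))) * b j x)"
      unfolding True e'd by (subst rb, rule ext) (simp add: sum_distrib_left distrib_left mult.assoc)
    then show ?thesis by (rule exI[of _ "\<lambda>j. s * (if j = d then 1 else - (\<Sum>i<d. p i * C i j))"])
  next
    case False
    then have "i < d" using that by simp
    then have "e' i = (\<lambda>x. \<Sum>j<Suc d. ((C i)(d := 0)) j * b j x)" using C by (simp add: e'd)
    then show ?thesis by blast
  qed
  moreover have "\<exists>c. b i = (\<lambda>x. \<Sum>j<Suc d. c j * e' j x)" if "i < Suc d" for i
  proof (cases "i = d")
    case True
    have "b d = (\<lambda>x. \<Sum>j<Suc d. (p(d := 1 / s)) j * e' j x)"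
      using s by (simp add: e'd r_def fun_eq_iff)
    then show ?thesis using True by blast
  next
    case False
    then have "i < d" using that by simp
    then have "b i = (\<lambda>x. \<Sum>j<Suc d. ((D i)(d := 0)) j * e' j x)" using D by (simp add: e'd)
    then show ?thesis by blast
  qed
  ultimately show ?case by blast
qed

section \<open>Eigenbases adapted to a prescribed list of eigenvalues\<close>

definition eigenfamily :: "('i \<Rightarrow> 'i \<Rightarrow> complex) \<Rightarrow> real \<Rightarrow> nat \<Rightarrow> (nat \<Rightarrow> 'i \<Rightarrow> complex) \<Rightarrow> bool" where
  "eigenfamily G z d b \<longleftrightarrow> (\<forall>i<d. ell2 (b i) \<and> mapp G (b i) = (\<lambda>x. complex_of_real z * b i x)) \<and>
    (\<forall>y. ell2 y \<longrightarrow> mapp G y = (\<lambda>x. complex_of_real z * y x) \<longrightarrow> (\<exists>c. y = (\<lambda>x. \<Sum>i<d. c i * b i x)))"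

definition independent_family :: "nat \<Rightarrow> (nat \<Rightarrow> 'i \<Rightarrow> complex) \<Rightarrow> bool" where
  "independent_family d b \<longleftrightarrow> (\<forall>c. (\<lambda>x. \<Sum>i<d. c i * b i x) = (\<lambda>_. 0) \<longrightarrow> (\<forall>i<d. c i = 0))"

context hs_hermitian begin

lemma eigen_ortho:
  assumes "ell2 x" "ell2 y" "mapp G x = (\<lambda>i. complex_of_real a * x i)" "mapp G y = (\<lambda>i. complex_of_real b * y i)" "a \<noteq> b"
  shows "ip x y = 0"
proof -
  have "of_real b * ip x y = of_real a * ip x y"
    using symm[OF assms(1,2)] unfolding assms(3,4) ip_scale_right ip_scale_left by simp
  then show ?thesis using assms(5) by auto
qed

text \<open>The list \<open>mu\<close> knows only multiplicities. An orthonormal basis of each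
  eigenspace is distributed over the positions carrying that eigenvalue. The last conclusion says
  that nothing with nonzero eigenvalue is left over; the kernel of \<open>G\<close> is left
  open.\<close>

lemma eigenbasis:
  fixes mu :: "nat \<Rightarrow> real"
  assumes fin: "\<And>z. z \<noteq> 0 \<Longrightarrow> finite {m. mu m = z}" and mu0: "\<And>m. mu m \<noteq> 0"
    and bas: "\<And>z. z \<noteq> 0 \<Longrightarrow> \<exists>b. eigenfamily G z (card {m. mu m = z}) b \<and> independent_family (card {m. mu m = z}) b"
  obtains e where "ortho e UNIV" "\<And>m. mapp G (e m) = (\<lambda>x. complex_of_real (mu m) * e m x)"
    "\<And>y z. ell2 y \<Longrightarrow> \<forall>m. ip (e m) y = 0 \<Longrightarrow> z \<noteq> 0 \<Longrightarrow> mapp G y = (\<lambda>x. complex_of_real z * y x) \<Longrightarrow> y = (\<lambda>_. 0)"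
proof -
  let ?d = "\<lambda>z. card {m. mu m = z}"
  have "\<exists>b. ortho b {..<?d z} \<and> eigenfamily G z (?d z) b" if z: "z \<noteq> 0" for z
  proof -
    obtain b where b0: "eigenfamily G z (?d z) b" "independent_family (?d z) b" using bas[OF z] by blast
    then have b: "\<And>i. i < ?d z \<Longrightarrow> ell2 (b i)" "\<And>i. i < ?d z \<Longrightarrow> mapp G (b i) = (\<lambda>x. complex_of_real z * b i x)"
       "\<And>c. (\<lambda>x. \<Sum>i<?d z. c i * b i x) = (\<lambda>_. 0) \<Longrightarrow> (\<forall>i<?d z. c i = 0)"
       "\<And>y. ell2 y \<Longrightarrow> mapp G y = (\<lambda>x. complex_of_real z * y x) \<Longrightarrow> (\<exists>c. y = (\<lambda>x. \<Sum>i<?d z. c i * b i x))"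
      unfolding eigenfamily_def independent_family_def by simp_all
    obtain e where e: "ortho e {..<?d z}" "\<forall>i<?d z. \<exists>c. e i = (\<lambda>x. \<Sum>j<?d z. c j * b j x)"
        "\<forall>i<?d z. \<exists>c. b i = (\<lambda>x. \<Sum>j<?d z. c j * e j x)"
      using gram_schmidt[of "?d z" b, OF b(1,3)] by blast
    have "mapp G (e i) = (\<lambda>x. complex_of_real z * e i x)" if i: "i < ?d z" for i
    proof -
      obtain c where c: "e i = (\<lambda>x. \<Sum>j<?d z. c j * b j x)" using e(2) i by blast
      have "mapp G (e i) = (\<lambda>x. \<Sum>j<?d z. c j * (complex_of_real z * b j x))"
        unfolding c using b(1,2) by (subst mapp_sum) (auto simp: ell2_scale mapp_scale fun_eq_iff intro!: sum.cong)
      then show ?thesis unfolding c by (simp add: sum_distrib_left mult_ac)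
    qed
    moreover have "\<exists>c. y = (\<lambda>x. \<Sum>i<?d z. c i * e i x)" if y: "ell2 y" "mapp G y = (\<lambda>x. complex_of_real z * y x)" for y
    proof -
      obtain c where c: "y = (\<lambda>x. \<Sum>j<?d z. c j * b j x)" using b(4)[OF y] by blast
      obtain D where D: "\<And>i. i < ?d z \<Longrightarrow> b i = (\<lambda>x. \<Sum>j<?d z. D i j * e j x)" using e(3) by metis
      have "y = (\<lambda>x. \<Sum>j<?d z. (\<Sum>i<?d z. c i * D i j) * e j x)"
      proof
        fix x
        have "y x = (\<Sum>i<?d z. c i * (\<Sum>j<?d z. D i j * e j x))"
          unfolding c by (intro sum.cong) (auto dest: D[THEN fun_cong])
        also have "\<dots> = (\<Sum>i<?d z. \<Sum>j<?d z. c i * D i j * e j x)" by (simp add: sum_distrib_left mult.assoc)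
        also have "\<dots> = (\<Sum>j<?d z. \<Sum>i<?d z. c i * D i j * e j x)" by (rule sum.swap)
        finally show "y x = (\<Sum>j<?d z. (\<Sum>i<?d z. c i * D i j) * e j x)" by (simp add: sum_distrib_right)
      qed
      then show ?thesis by (rule exI[of _ "\<lambda>j. \<Sum>i<?d z. c i * D i j"])
    qed
    ultimately have "eigenfamily G z (?d z) e" using e(1) unfolding eigenfamily_def ortho_def by simp
    then show ?thesis using e(1) by blast
  qed
  then obtain ob where ob0: "\<And>z. z \<noteq> 0 \<Longrightarrow> ortho (ob z) {..<?d z} \<and> eigenfamily G z (?d z) (ob z)"
    by metis
  then have ob: "\<And>z. z \<noteq> 0 \<Longrightarrow> ortho (ob z) {..<?d z}"
      "\<And>z i. z \<noteq> 0 \<Longrightarrow> i < ?d z \<Longrightarrow> mapp G (ob z i) = (\<lambda>x. complex_of_real z * ob z i x)"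
      "\<And>z y. z \<noteq> 0 \<Longrightarrow> ell2 y \<Longrightarrow> mapp G y = (\<lambda>x. complex_of_real z * y x) \<Longrightarrow> \<exists>c. y = (\<lambda>x. \<Sum>i<?d z. c i * ob z i x)"
    unfolding eigenfamily_def by simp_all
  have "\<exists>f. bij_betw f {m. mu m = z} {..<?d z}" if "z \<noteq> 0" for z
    using ex_bij_betw_finite_nat[OF fin[OF that]] by (simp add: atLeast0LessThan)
  then obtain f where f: "\<And>z. z \<noteq> 0 \<Longrightarrow> bij_betw (f z) {m. mu m = z} {..<?d z}" by metis
  \<comment> \<open>\<open>f z\<close> numbers the positions of z in the list, so every basis vector
    of that eigenspace is used exactly once.\<close>
  define e where "e m = ob (mu m) (f (mu m) m)" for m
  have fl: "f (mu m) m < ?d (mu m)" for m using bij_betwE[OF f[OF mu0[of m]]] by auto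
  have eig: "mapp G (e m) = (\<lambda>x. complex_of_real (mu m) * e m x)" for m
    unfolding e_def using ob(2)[OF mu0 fl] .
  have ee: "ell2 (e m)" for m using ob(1)[OF mu0] fl unfolding e_def ortho_def by blast
  have "ip (e m) (e k) = (if m = k then 1 else 0)" for m k
  proof (cases "mu m = mu k")
    case True
    have "ip (e m) (e k) = (if f (mu m) m = f (mu m) k then 1 else 0)"
      using ob(1)[OF mu0[of m]] fl[of m] fl[of k] True unfolding e_def ortho_def by simp
    also have "f (mu m) m = f (mu m) k \<longleftrightarrow> m = k"
      using bij_betw_imp_inj_on[OF f[OF mu0[of m]]] True by (auto simp: inj_on_def)
    finally show ?thesis .
  next
    case False
    then show ?thesis using eigen_ortho[OF ee ee eig eig False] by auto
  qed
  then have "ortho e UNIV" using ee by (simp add: ortho_def)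
  moreover have "y = (\<lambda>_. 0)" if y: "ell2 y" "\<forall>m. ip (e m) y = 0" "z \<noteq> 0" "mapp G y = (\<lambda>x. complex_of_real z * y x)" for y z
  proof -
    obtain c where c: "y = (\<lambda>x. \<Sum>i<?d z. c i * ob z i x)" using ob(3)[OF y(3,1,4)] by blast
    have "c i = 0" if i: "i < ?d z" for i
    proof -
      obtain m where m: "mu m = z" "f z m = i" using bij_betw_imp_surj_on[OF f[OF y(3)]] i
        by (metis (mono_tags, lifting) imageE lessThan_iff mem_Collect_eq)
      have "ip (ob z i) y = c i"
        unfolding c using ortho_ip_sum[OF ob(1)[OF y(3)], of "{..<?d z}" i c] i by simp
      then show ?thesis using y(2) m unfolding e_def by metis
    qed
    then show ?thesis unfolding c by simp
  qed
  ultimately show ?thesis using that eig by blast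
qed

end

section \<open>Traces of powers as sums over closed paths\<close>

lemma ell2_pairI:
  assumes X: "\<And>i. ell2 (X i)" and b: "\<And>i. nsq (X i) \<le> g i" and g: "g summable_on UNIV"
  shows "ell2 (\<lambda>(i, j). X i j)"
proof -
  have "(\<lambda>(i, j). (norm (X i j))\<^sup>2) summable_on UNIV \<times> UNIV"
  proof (rule summable_on_SigmaI[where g="\<lambda>i. nsq (X i)"])
    show "((\<lambda>y. case (x, y) of (i, j) \<Rightarrow> (norm (X i j))\<^sup>2) has_sum nsq (X x)) UNIV" for x
      using X unfolding ell2_def nsq_def by simp
    show "(\<lambda>i. nsq (X i)) summable_on UNIV"
      by (rule summable_on_comparison_test[OF g b]) auto
  qed auto
  then show ?thesis unfolding ell2_def by (simp add: case_prod_unfold)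
qed

text \<open>Exponents are shifted by one: \<open>pw G n\<close> is the matrix power with exponent n
  + 1, and \<open>pwa G n\<close> is that power of the matrix of absolute values.\<close>

primrec pw :: "('i \<Rightarrow> 'i \<Rightarrow> complex) \<Rightarrow> nat \<Rightarrow> 'i \<Rightarrow> 'i \<Rightarrow> complex" where
  "pw G 0 = G"
| "pw G (Suc n) = (\<lambda>i j. infsum (\<lambda>k. pw G n i k * G k j) UNIV)"

primrec pwa :: "('i \<Rightarrow> 'i \<Rightarrow> complex) \<Rightarrow> nat \<Rightarrow> 'i \<Rightarrow> 'i \<Rightarrow> real" where
  "pwa G 0 = (\<lambda>i j. norm (G i j))"
| "pwa G (Suc n) = (\<lambda>i j. infsum (\<lambda>k. pwa G n i k * norm (G k j)) UNIV)"

text \<open>A path from a to b through n interior vertices, hence with n + 1 edges, in accordance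
  with the shifted exponent of \<open>pw\<close>. In contrast \<open>cycw G n\<close> has n vertices
  and n edges.\<close>

definition pathw :: "('i \<Rightarrow> 'i \<Rightarrow> complex) \<Rightarrow> nat \<Rightarrow> 'i \<Rightarrow> 'i \<Rightarrow> (nat \<Rightarrow> 'i) \<Rightarrow> complex" where
  "pathw G n a b p = (\<Prod>j<n. G (if j = 0 then a else p (j - 1)) (p j)) * G (if n = 0 then a else p (n - 1)) b"

definition cycw :: "('i \<Rightarrow> 'i \<Rightarrow> complex) \<Rightarrow> nat \<Rightarrow> (nat \<Rightarrow> 'i) \<Rightarrow> complex" where
  "cycw G n p = (\<Prod>j<n. G (p (if j = 0 then n - 1 else j - 1)) (p j))"

lemma pathw_Suc: "pathw G (Suc n) a b (p(n := k)) = pathw G n a k p * G k b"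
proof -
  have "(\<Prod>j<n. G (if j = 0 then a else (p(n := k)) (j - 1)) ((p(n := k)) j)) =
        (\<Prod>j<n. G (if j = 0 then a else p (j - 1)) (p j))"
    by (intro prod.cong) auto
  then show ?thesis unfolding pathw_def by (cases n) simp_all
qed

text \<open>The last vertex of a cycle is both endpoints of a path, which turns diagonal entries of
  a power into cycles.\<close>

lemma cycw_Suc: "cycw G (Suc n) (p(n := a)) = pathw G n a a p"
proof -
  have "(\<Prod>j<n. G ((p(n := a)) (if j = 0 then n else j - 1)) ((p(n := a)) j)) =
        (\<Prod>j<n. G (if j = 0 then a else p (j - 1)) (p j))"
    by (intro prod.cong) auto
  then show ?thesis unfolding pathw_def cycw_def diff_Suc_1 prod.lessThan_Suc by (cases n) simp_all
qed

lemma PiE_lessThan_Suc: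
  fixes n :: nat
  shows
  "PiE {..<Suc n} (\<lambda>_. UNIV) = (\<lambda>(k, p). p(n := k)) ` (UNIV \<times> PiE {..<n} (\<lambda>_. UNIV))"
  using PiE_insert_eq[of n "{..<n}" "\<lambda>_. UNIV"] by (simp add: lessThan_Suc)

lemma inj_PiE_Suc: "inj_on (\<lambda>(k, p). p(n :: nat := k)) (UNIV \<times> PiE {..<n} (\<lambda>_. UNIV))"
  using inj_combinator[of n "{..<n}" "\<lambda>_. UNIV"] by simp

lemma pwa_nonneg: "0 \<le> pwa G n i j"
  by (induction n arbitrary: i j) (auto intro: infsum_nonneg)

lemma pwa_hs:
  assumes hs: "ell2 (\<lambda>(i, j). G i j)"
  shows "ell2 (\<lambda>(i, j). of_real (pwa G n i j))"
proof (induction n)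
  case 0
  then show ?case using hs by (simp add: ell2_def case_prod_unfold)
next
  case (Suc n)
  from hs_mult(4)[OF this hs] show ?case by (simp add: abs_of_nonneg pwa_nonneg)
qed

lemma path_abs:
  assumes hs: "ell2 (\<lambda>(i, j). G i j)"
  shows "((\<lambda>p. norm (pathw G n a b p)) has_sum pwa G n a b) (PiE {..<n} (\<lambda>_. UNIV))"
proof (induction n arbitrary: b)
  case 0
  show ?case by (simp add: pathw_def has_sum_finite_iff)
next
  case (Suc n)
  have s: "(\<lambda>k. pwa G n a k * norm (G k b)) summable_on UNIV"
    using hs_mult(2)[OF pwa_hs[OF hs] hs, of n a b] by (simp add: norm_mult abs_of_nonneg pwa_nonneg)
  have f: "((\<lambda>p. norm (pathw G n a k p * G k b)) has_sum pwa G n a k * norm (G k b)) (PiE {..<n} (\<lambda>_. UNIV))" for k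
    unfolding norm_mult by (rule has_sum_cmult_left[OF Suc])
  have "(\<lambda>(k, p). norm (pathw G n a k p * G k b)) summable_on UNIV \<times> PiE {..<n} (\<lambda>_. UNIV)"
    by (rule summable_on_SigmaI[OF _ s]) (use f in auto)
  then have "((\<lambda>(k, p). norm (pathw G n a k p * G k b)) has_sum pwa G (Suc n) a b) (UNIV \<times> PiE {..<n} (\<lambda>_. UNIV))"
    using has_sum_infsum[OF s] f by (intro has_sum_SigmaI[where g="\<lambda>k. pwa G n a k * norm (G k b)"]) auto
  then show ?case unfolding PiE_lessThan_Suc
    by (subst has_sum_reindex[OF inj_PiE_Suc]) (simp add: o_def case_prod_unfold pathw_Suc)
qed

lemma path_sum:
  assumes hs: "ell2 (\<lambda>(i, j). G i j)"
  shows "(pathw G n a b has_sum pw G n a b) (PiE {..<n} (\<lambda>_. UNIV))"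
proof (induction n arbitrary: b)
  case 0
  show ?case by (simp add: pathw_def has_sum_finite_iff)
next
  case (Suc n)
  have pw_hs: "ell2 (\<lambda>(i, j). pw G n i j)"
  proof (induction n)
    case (Suc n)
    from hs_mult(3)[OF this hs] show ?case by simp
  qed (simp add: hs)
  have s: "(\<lambda>k. pw G n a k * G k b) summable_on UNIV" by (rule hs_mult(1)[OF pw_hs hs])
  have f: "((\<lambda>p. pathw G n a k p * G k b) has_sum pw G n a k * G k b) (PiE {..<n} (\<lambda>_. UNIV))" for k
    by (rule has_sum_cmult_left[OF Suc])
  have "(\<lambda>p. norm (pathw G (Suc n) a b p)) summable_on (\<lambda>(k, p). p(n := k)) ` (UNIV \<times> PiE {..<n} (\<lambda>_. UNIV))"
    using path_abs[OF hs, of "Suc n" a b] unfolding PiE_lessThan_Suc summable_on_def by blast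
  then have "(\<lambda>(k, p). pathw G n a k p * G k b) summable_on UNIV \<times> PiE {..<n} (\<lambda>_. UNIV)"
    by (subst (asm) summable_on_reindex[OF inj_PiE_Suc], rule_tac abs_summable_summable)
       (simp add: o_def case_prod_unfold pathw_Suc)
  then have "((\<lambda>(k, p). pathw G n a k p * G k b) has_sum pw G (Suc n) a b) (UNIV \<times> PiE {..<n} (\<lambda>_. UNIV))"
    using has_sum_infsum[OF s] f by (intro has_sum_SigmaI[where g="\<lambda>k. pw G n a k * G k b"]) auto
  then show ?case unfolding PiE_lessThan_Suc
    by (subst has_sum_reindex[OF inj_PiE_Suc]) (simp add: o_def case_prod_unfold pathw_Suc)
qed

text \<open>The trace of a product of two Hilbert-Schmidt matrices is an absolutely convergent
  pairing, here of \<open>pwa\<close> with the absolute values of \<open>G\<close>. Two factors are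
  required for this, hence the double successor.\<close>

lemma cyc_sum:
  assumes hs: "ell2 (\<lambda>(i, j). G i j)"
  shows "(\<lambda>p. norm (cycw G (Suc (Suc n)) p)) summable_on PiE {..<Suc (Suc n)} (\<lambda>_. UNIV)"
    and "infsum (cycw G (Suc (Suc n))) (PiE {..<Suc (Suc n)} (\<lambda>_. UNIV)) = infsum (\<lambda>a. pw G (Suc n) a a) UNIV"
proof -
  let ?n = "Suc n"
  have 1: "(\<lambda>(a, k). pwa G n a k * norm (G k a)) summable_on UNIV \<times> UNIV"
    using ell2_mult(1)[OF pwa_hs[OF hs, of n], of "\<lambda>(a, k). G k a"] hs ell2_swap[of G]
    by (simp add: case_prod_unfold abs_of_nonneg pwa_nonneg)
  have s: "(\<lambda>a. pwa G ?n a a) summable_on UNIV"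
    using summable_on_Sigma_banach[OF 1] by simp
  have sa: "(\<lambda>(a, p). norm (pathw G ?n a a p)) summable_on UNIV \<times> PiE {..<?n} (\<lambda>_. UNIV)"
    by (rule summable_on_SigmaI[OF _ s]) (use path_abs[OF hs, of ?n] in auto)
  then show "(\<lambda>p. norm (cycw G (Suc ?n) p)) summable_on PiE {..<Suc ?n} (\<lambda>_. UNIV)"
    unfolding PiE_lessThan_Suc[of ?n]
    by (subst summable_on_reindex[OF inj_PiE_Suc]) (simp add: o_def case_prod_unfold cycw_Suc)
  have "(\<lambda>(a, p). pathw G ?n a a p) summable_on UNIV \<times> PiE {..<?n} (\<lambda>_. UNIV)"
    by (rule abs_summable_summable) (use sa in \<open>simp add: case_prod_unfold\<close>)
  from infsum_Sigma'_banach[OF this]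
  have "infsum (\<lambda>(a, p). pathw G ?n a a p) (UNIV \<times> PiE {..<?n} (\<lambda>_. UNIV)) = infsum (\<lambda>a. pw G ?n a a) UNIV"
    by (simp only: infsumI[OF path_sum[OF hs]])
  then show "infsum (cycw G (Suc ?n)) (PiE {..<Suc ?n} (\<lambda>_. UNIV)) = infsum (\<lambda>a. pw G ?n a a) UNIV"
    unfolding PiE_lessThan_Suc[of ?n]
    by (subst infsum_reindex[OF inj_PiE_Suc]) (simp add: o_def case_prod_unfold cycw_Suc)
qed

section \<open>Spectral expansion of a Hermitian Hilbert-Schmidt matrix\<close>

locale hs_eigen = hs_hermitian G for G :: "'i::countable \<Rightarrow> 'i \<Rightarrow> complex" +
  fixes e :: "nat \<Rightarrow> 'i \<Rightarrow> complex" and mu :: "nat \<Rightarrow> real"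
  assumes on: "ortho e UNIV"
    and eig: "mapp G (e m) = (\<lambda>x. complex_of_real (mu m) * e m x)"
    and total: "ell2 y \<Longrightarrow> \<forall>m. ip (e m) y = 0 \<Longrightarrow> z \<noteq> 0 \<Longrightarrow> mapp G y = (\<lambda>x. complex_of_real z * y x) \<Longrightarrow> y = (\<lambda>_. 0)"
begin

lemma ee: "ell2 (e m)" using on by (auto simp: ortho_def)

lemma e1: "nsq (e m) = 1"
  using on ip_self[of "e m"] unfolding ortho_def by (metis UNIV_I of_real_eq_1_iff)

lemma coef: "ell2 (\<lambda>m. e m i)"
proof (rule ell2I)
  fix F :: "nat set" assume "finite F"
  from bessel[OF on this _ ell2_kd(1), of i] show "(\<Sum>m\<in>F. (norm (e m i))\<^sup>2) \<le> 1"
    by (simp add: ip_kd ell2_kd)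
qed

text \<open>By the eigenvalue equation \<open>mu m * e m i\<close> is, up to conjugation, the
  coefficient of column i of \<open>G\<close> along \<open>e m\<close>, so Bessel's inequality
  applies to that column.\<close>

lemma mu_coef: "ell2 (\<lambda>m. of_real (mu m) * e m i)" "nsq (\<lambda>m. of_real (mu m) * e m i) \<le> nsq (\<lambda>j. G j i)"
proof -
  have *: "(\<Sum>m\<in>F. (norm (of_real (mu m) * e m i))\<^sup>2) \<le> nsq (\<lambda>j. G j i)" if "finite F" for F
  proof -
    have "norm (of_real (mu m) * e m i) = norm (ip (e m) (\<lambda>j. G j i))" for m
      using fun_cong[OF eig, of m i] mapp_ip[of "e m" i] ip_cnj[of "e m" "\<lambda>j. G j i"] by (metis complex_mod_cnj)
    then show ?thesis using bessel[OF on that _ ell2_col[OF hs], of i] by simp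
  qed
  show "ell2 (\<lambda>m. of_real (mu m) * e m i)" "nsq (\<lambda>m. of_real (mu m) * e m i) \<le> nsq (\<lambda>j. G j i)"
    using ell2I[OF *] by auto
qed

text \<open>The column bounds of \<open>mu_coef\<close> are summed over i; since \<open>e m\<close>
  has norm 1, only the square of \<open>mu m\<close> remains.\<close>

lemma mu_ell2: "ell2 (\<lambda>m. complex_of_real (mu m))"
proof -
  have "ell2 (\<lambda>(j, i). G i j)" using hs ell2_swap[of G] by simp
  from nsq_rows(1)[OF this] have s: "(\<lambda>j. nsq (\<lambda>i. G i j)) summable_on UNIV" .
  have "ell2 (\<lambda>(i, m). of_real (mu m) * e m i)"
    by (rule ell2_pairI[OF mu_coef s])
  then have "ell2 (\<lambda>(m, i). of_real (mu m) * e m i)" using ell2_swap[of "\<lambda>i m. of_real (mu m) * e m i"] by simp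
  from nsq_rows(1)[OF this] show ?thesis unfolding ell2_def by (simp add: nsq_scale e1)
qed

lemma mu_power: "ell2 (\<lambda>m. complex_of_real (mu m) ^ n * x m)" if "ell2 x"
proof (rule ell2_bounded_mult[OF that])
  show "norm (complex_of_real (mu m) ^ n) \<le> sqrt (nsq (\<lambda>m. complex_of_real (mu m))) ^ n" for m
    unfolding norm_power by (intro power_mono ell2_norm_le[OF mu_ell2]) auto
qed

text \<open>The projections onto the first N eigenvectors leave residuals of unit vector j. Applying
  \<open>G\<close> to them gives the error of the partial sums, and the weak limit of the residuals
  lies in the kernel of \<open>G\<close>.\<close>

lemma expand: "((\<lambda>m. of_real (mu m) * e m i * cnj (e m j)) has_sum G i j) UNIV"
proof -
  have abs: "summable (\<lambda>m. norm (of_real (mu m) * e m i * cnj (e m j)))"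
    using ell2_mult(1)[OF mu_coef(1) coef, of i j] by (intro summable_on_imp_summable) (simp add: norm_mult)
  define X where "X N = (\<lambda>x. kd j x - (\<Sum>m<N. ip (e m) (kd j) * e m x))" for N
  have X: "ell2 (X N)" "nsq (X N) \<le> 1" "\<And>k. k < N \<Longrightarrow> ip (e k) (X N) = 0" for N
    using ortho_residual[OF on, of "{..<N}" "kd j"] unfolding X_def by (auto simp: ell2_kd sum_nonneg)
  \<comment> \<open>\<open>p\<close> need not be 0, since \<open>G\<close> may have a kernel. It is
    orthogonal to all \<open>e m\<close>, and that is enough for
    \<open>invariant_zero\<close>.\<close>
  define p where "p x = kd j x - (\<Sum>m. cnj (e m j) * e m x)" for x
  have lim: "(\<lambda>N. X N x) \<longlonglongrightarrow> p x" for x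
  proof -
    have "summable (\<lambda>m. cnj (e m j) * e m x)"
      using ell2_ip_summable[OF coef coef, of j x] by (rule summable_on_imp_summable)
    then show ?thesis unfolding X_def p_def ip_kd by (intro tendsto_intros summable_LIMSEQ)
  qed
  have ep: "ell2 p" by (rule weak_limit(1)[OF X(1,2) lim])
  have op: "ip (e l) p = 0" for l
  proof -
    have "(\<lambda>N. ip (e l) (X N)) \<longlonglongrightarrow> ip (e l) p" by (rule weak_limit(3)[OF X(1,2) lim ee])
    moreover have "(\<lambda>N. ip (e l) (X N)) \<longlonglongrightarrow> 0"
      by (rule tendsto_eventually, rule eventually_mono[OF eventually_gt_at_top[of l]]) (rule X(3))
    ultimately show ?thesis by (rule LIMSEQ_unique)
  qed
  have "mapp G p = (\<lambda>_. 0)"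
  proof (rule invariant_zero[of "range e", OF _ _ _ ep])
    fix x b assume "ell2 x" "\<forall>b\<in>range e. ip b x = 0" "b \<in> range e"
    then show "ip b (mapp G x) = 0" using symm[OF ee] by (auto simp: eig ip_scale_left)
  qed (use ee op total in auto)
  then have "ip (\<lambda>a. G a i) p = 0" using mapp_ip[of p i] by simp
  moreover have "(\<lambda>N. ip (\<lambda>a. G a i) (X N)) \<longlonglongrightarrow> ip (\<lambda>a. G a i) p"
    by (rule weak_limit(3)[OF X(1,2) lim ell2_col[OF hs]])
  moreover have "ip (\<lambda>a. G a i) (X N) = G i j - (\<Sum>m<N. of_real (mu m) * e m i * cnj (e m j))" for N
  proof -
    have "mapp G (kd j) i = G i j" by (simp add: mapp_ip ip_kd herm)
    moreover have "mapp G (\<lambda>x. \<Sum>m<N. ip (e m) (kd j) * e m x) = (\<lambda>x. \<Sum>m<N. ip (e m) (kd j) * (of_real (mu m) * e m x))"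
      by (subst mapp_sum) (auto simp: ell2_scale ee mapp_scale eig)
    ultimately have "mapp G (X N) i = G i j - (\<Sum>m<N. ip (e m) (kd j) * (of_real (mu m) * e m i))"
      unfolding X_def by (subst mapp_diff) (auto simp: ell2_kd ell2_sum ell2_scale ee)
    then show ?thesis by (simp add: mapp_ip[symmetric] ip_kd mult_ac)
  qed
  ultimately have "(\<lambda>N. G i j - (\<Sum>m<N. of_real (mu m) * e m i * cnj (e m j))) \<longlonglongrightarrow> 0" by simp
  then have "(\<lambda>N. G i j - (G i j - (\<Sum>m<N. of_real (mu m) * e m i * cnj (e m j)))) \<longlonglongrightarrow> G i j - 0"
    by (intro tendsto_intros)
  then have "(\<lambda>m. of_real (mu m) * e m i * cnj (e m j)) sums G i j" by (simp add: sums_def)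
  then show ?thesis by (rule norm_summable_imp_has_sum[OF abs])
qed

lemma pw_expand: "((\<lambda>m. of_real (mu m) ^ Suc n * e m i * cnj (e m j)) has_sum pw G n i j) UNIV"
proof (induction n arbitrary: j)
  case 0
  show ?case using expand by simp
next
  case (Suc n)
  define A where "A m = of_real (mu m) ^ Suc n * e m i" for m
  have sA: "(\<lambda>m. norm (A m)) summable_on UNIV"
    using ell2_mult(1)[OF mu_ell2 mu_power[OF coef, of n i]] by (simp add: A_def norm_mult mult_ac)
  have eA: "ell2 A" unfolding A_def by (rule mu_power[OF coef])
  have inner: "(\<lambda>k. cnj (e m k) * G k j) summable_on UNIV" "(\<lambda>k. norm (e m k) * norm (G k j)) summable_on UNIV"
    "infsum (\<lambda>k. norm (e m k) * norm (G k j)) UNIV \<le> sqrt (nsq (\<lambda>k. G k j))"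
    "infsum (\<lambda>k. cnj (e m k) * G k j) UNIV = of_real (mu m) * cnj (e m j)" for m
  proof -
    show "(\<lambda>k. cnj (e m k) * G k j) summable_on UNIV" by (rule ell2_ip_summable[OF ee ell2_col[OF hs]])
    show "(\<lambda>k. norm (e m k) * norm (G k j)) summable_on UNIV" by (rule ell2_mult(1)[OF ee ell2_col[OF hs]])
    show "infsum (\<lambda>k. norm (e m k) * norm (G k j)) UNIV \<le> sqrt (nsq (\<lambda>k. G k j))"
      using ell2_mult(2)[OF ee ell2_col[OF hs], of m j] by (simp add: e1)
    have "infsum (\<lambda>k. cnj (e m k) * G k j) UNIV = cnj (ip (\<lambda>k. G k j) (e m))"
      by (simp add: ip_cnj) (simp add: ip_def)
    also have "ip (\<lambda>k. G k j) (e m) = mapp G (e m) j" by (simp add: mapp_ip)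
    finally show "infsum (\<lambda>k. cnj (e m k) * G k j) UNIV = of_real (mu m) * cnj (e m j)" by (simp add: eig)
  qed
  have "(\<lambda>(m, k). norm (A m * (cnj (e m k) * G k j))) summable_on UNIV \<times> UNIV"
  proof (rule summable_on_SigmaI[where g="\<lambda>m. norm (A m) * infsum (\<lambda>k. norm (e m k) * norm (G k j)) UNIV"])
    show "((\<lambda>k. case (m, k) of (m, k) \<Rightarrow> norm (A m * (cnj (e m k) * G k j))) has_sum
        norm (A m) * infsum (\<lambda>k. norm (e m k) * norm (G k j)) UNIV) UNIV" for m
      using has_sum_cmult_right[OF has_sum_infsum[OF inner(2)[of m]], of "norm (A m)"] by (simp add: norm_mult)
    have "(\<lambda>m. norm (A m) * sqrt (nsq (\<lambda>k. G k j))) summable_on UNIV"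
      using sA by (rule summable_on_cmult_left)
    then show "(\<lambda>m. norm (A m) * infsum (\<lambda>k. norm (e m k) * norm (G k j)) UNIV) summable_on UNIV"
      by (rule summable_on_comparison_test) (auto intro!: mult_left_mono inner(3) mult_nonneg_nonneg infsum_nonneg)
  qed auto
  then have sw: "(\<lambda>(m, k). A m * (cnj (e m k) * G k j)) summable_on UNIV \<times> UNIV"
    by (rule_tac abs_summable_summable) (simp add: case_prod_unfold)
  have "pw G (Suc n) i j = infsum (\<lambda>k. infsum (\<lambda>m. A m * (cnj (e m k) * G k j)) UNIV) UNIV"
  proof -
    have "pw G n i k * G k j = infsum (\<lambda>m. A m * (cnj (e m k) * G k j)) UNIV" for k
    proof -
      have "((\<lambda>m. A m * (cnj (e m k) * G k j)) has_sum pw G n i k * G k j) UNIV"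
        using has_sum_cmult_left[OF Suc[of k], of "G k j"] by (simp only: A_def mult.assoc)
      then show ?thesis by (rule infsumI[symmetric])
    qed
    then show ?thesis by simp
  qed
  also have "\<dots> = infsum (\<lambda>m. infsum (\<lambda>k. A m * (cnj (e m k) * G k j)) UNIV) UNIV"
    by (rule infsum_swap_banach[OF sw, symmetric])
  also have "\<dots> = infsum (\<lambda>m. of_real (mu m) ^ Suc (Suc n) * e m i * cnj (e m j)) UNIV"
    by (simp only: infsum_cmult_right' inner(4)) (simp add: A_def mult_ac)
  finally have eq: "pw G (Suc n) i j = infsum (\<lambda>m. of_real (mu m) ^ Suc (Suc n) * e m i * cnj (e m j)) UNIV" .
  have "(\<lambda>m. of_real (mu m) ^ Suc (Suc n) * e m i * cnj (e m j)) summable_on UNIV"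
    using ell2_ip_summable[OF coef mu_power[OF coef, of "Suc (Suc n)" i], of j] by (simp add: mult_ac)
  from has_sum_infsum[OF this] show ?case unfolding eq .
qed

text \<open>Each \<open>e m\<close> has norm 1 and so contributes its power of \<open>mu m\<close>
  once. The powers are absolutely summable from exponent 2 on, which justifies the exchange of the
  two sums.\<close>

lemma trace_pw:
  shows "(\<lambda>m. norm (complex_of_real (mu m) ^ Suc (Suc n))) summable_on UNIV"
    and "infsum (\<lambda>a. pw G (Suc n) a a) UNIV = infsum (\<lambda>m. complex_of_real (mu m) ^ Suc (Suc n)) UNIV"
proof -
  let ?p = "\<lambda>m. complex_of_real (mu m) ^ Suc (Suc n)"
  show s: "(\<lambda>m. norm (?p m)) summable_on UNIV"
    using ell2_mult(1)[OF mu_ell2 mu_power[OF mu_ell2, of n]] by (simp add: norm_mult mult_ac)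
  have h: "((\<lambda>a. e m a * cnj (e m a)) has_sum 1) UNIV" for m
    using has_sum_infsum[OF ell2_ip_summable[OF ee ee, of m m]] on
    unfolding ip_def[symmetric] by (simp add: ortho_def mult.commute)
  have h': "((\<lambda>a. norm (e m a) * norm (e m a)) has_sum 1) UNIV" for m
    using has_sum_infsum[OF ee[of m, unfolded ell2_def]] e1[of m] by (simp add: nsq_def power2_eq_square)
  have "(\<lambda>(m, a). norm (?p m * (e m a * cnj (e m a)))) summable_on UNIV \<times> UNIV"
  proof (rule summable_on_SigmaI[OF _ s])
    show "((\<lambda>a. case (m, a) of (m, a) \<Rightarrow> norm (?p m * (e m a * cnj (e m a)))) has_sum norm (?p m)) UNIV" for m
      using has_sum_cmult_right[OF h'[of m], of "norm (?p m)"] by (simp add: norm_mult)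
  qed auto
  then have sw: "(\<lambda>(m, a). ?p m * (e m a * cnj (e m a))) summable_on UNIV \<times> UNIV"
    by (rule_tac abs_summable_summable) (simp add: case_prod_unfold)
  have "infsum (\<lambda>a. pw G (Suc n) a a) UNIV = infsum (\<lambda>a. infsum (\<lambda>m. ?p m * (e m a * cnj (e m a))) UNIV) UNIV"
  proof (rule infsum_cong)
    fix a
    show "pw G (Suc n) a a = infsum (\<lambda>m. ?p m * (e m a * cnj (e m a))) UNIV"
      using infsumI[OF pw_expand[of "Suc n" a a], symmetric] by (simp only: mult.assoc)
  qed
  also have "\<dots> = infsum (\<lambda>m. infsum (\<lambda>a. ?p m * (e m a * cnj (e m a))) UNIV) UNIV"
    by (rule infsum_swap_banach[OF sw, symmetric])
  also have "\<dots> = infsum ?p UNIV"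
    by (simp only: infsum_cmult_right' infsumI[OF h] mult_1_right)
  finally show "infsum (\<lambda>a. pw G (Suc n) a a) UNIV = infsum ?p UNIV" .
qed

end

section \<open>Square-integrable functions on the line\<close>

definition l2 :: "(real \<Rightarrow> complex) \<Rightarrow> bool" where
  "l2 f \<longleftrightarrow> f \<in> borel_measurable lborel \<and> integrable lborel (\<lambda>x. (norm (f x))\<^sup>2)"

definition sq :: "(real \<Rightarrow> complex) \<Rightarrow> real" where
  "sq f = (\<integral>x. (norm (f x))\<^sup>2 \<partial>lborel)"

definition sp :: "(real \<Rightarrow> complex) \<Rightarrow> (real \<Rightarrow> complex) \<Rightarrow> complex" where
  "sp f g = (\<integral>x. cnj (f x) * g x \<partial>lborel)"

lemma l2_meas [measurable_dest]: "l2 f \<Longrightarrow> f \<in> borel_measurable borel"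
  by (simp add: l2_def)

lemma l2_sq_int: "l2 f \<Longrightarrow> integrable lborel (\<lambda>x. (norm (f x))\<^sup>2)"
  by (simp add: l2_def)

lemma sq_nonneg [simp]: "0 \<le> sq f" by (simp add: sq_def)

lemma l2_norm_mult:
  assumes "l2 f" "l2 g" shows "integrable lborel (\<lambda>x. norm (f x) * norm (g x))"
proof (rule Bochner_Integration.integrable_bound)
  show "integrable lborel (\<lambda>x. (norm (f x))\<^sup>2 + (norm (g x))\<^sup>2)"
    using assms by (intro Bochner_Integration.integrable_add l2_sq_int)
  show "(\<lambda>x. norm (f x) * norm (g x)) \<in> borel_measurable lborel"
    using l2_meas[OF assms(1)] l2_meas[OF assms(2)] by measurable
  have "a * b \<le> a\<^sup>2 + b\<^sup>2" if "0 \<le> a" "0 \<le> b" for a b :: real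
    using sum_squares_bound[of a b] mult_nonneg_nonneg[OF that] by linarith
  then show "AE x in lborel. norm (norm (f x) * norm (g x)) \<le> norm ((norm (f x))\<^sup>2 + (norm (g x))\<^sup>2)"
    by (auto simp: abs_mult)
qed

lemma l2_mult:
  assumes "l2 f" "l2 g" shows "integrable lborel (\<lambda>x. f x * g x)"
  by (rule Bochner_Integration.integrable_bound[OF l2_norm_mult[OF assms]])
     (use l2_meas[OF assms(1)] l2_meas[OF assms(2)] in \<open>auto simp: norm_mult\<close>)

lemma l2_cnj: "l2 f \<Longrightarrow> l2 (\<lambda>x. cnj (f x))"
  unfolding l2_def
  using measurable_compose[OF _ borel_measurable_continuous_onI[OF continuous_on_cnj[OF continuous_on_id]], of f lborel]
  by simp

lemma l2_ip: "l2 f \<Longrightarrow> l2 g \<Longrightarrow> integrable lborel (\<lambda>x. cnj (f x) * g x)"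
  using l2_mult[OF l2_cnj] by blast

lemma l2_add: assumes "l2 f" "l2 g" shows "l2 (\<lambda>x. f x + g x)"
  unfolding l2_def
proof
  show m: "(\<lambda>x. f x + g x) \<in> borel_measurable lborel"
    using l2_meas[OF assms(1)] l2_meas[OF assms(2)] by simp
  show "integrable lborel (\<lambda>x. (norm (f x + g x))\<^sup>2)"
  proof (rule Bochner_Integration.integrable_bound)
    show "integrable lborel (\<lambda>x. 2 * (norm (f x))\<^sup>2 + 2 * (norm (g x))\<^sup>2)"
      using assms by (intro Bochner_Integration.integrable_add integrable_mult_right l2_sq_int)
    show "AE x in lborel. norm ((norm (f x + g x))\<^sup>2) \<le> norm (2 * (norm (f x))\<^sup>2 + 2 * (norm (g x))\<^sup>2)"
    proof (rule AE_I2)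
      fix x
      have "(norm (f x + g x))\<^sup>2 \<le> (norm (f x) + norm (g x))\<^sup>2"
        by (intro power_mono norm_triangle_ineq) auto
      also have "\<dots> \<le> 2 * (norm (f x))\<^sup>2 + 2 * (norm (g x))\<^sup>2"
        using sum_squares_bound[of "norm (f x)" "norm (g x)"] by (simp add: power2_sum)
      finally show "norm ((norm (f x + g x))\<^sup>2) \<le> norm (2 * (norm (f x))\<^sup>2 + 2 * (norm (g x))\<^sup>2)" by simp
    qed
  qed (use m in simp)
qed

lemma l2_bounded_mult:
  assumes "l2 f" "c \<in> borel_measurable borel" "\<And>x. norm (c x) \<le> K" shows "l2 (\<lambda>x. c x * f x)"
  unfolding l2_def
proof
  show m: "(\<lambda>x. c x * f x) \<in> borel_measurable lborel" using assms(2) l2_meas[OF assms(1)] by simp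
  show "integrable lborel (\<lambda>x. (norm (c x * f x))\<^sup>2)"
  proof (rule Bochner_Integration.integrable_bound)
    show "integrable lborel (\<lambda>x. K\<^sup>2 * (norm (f x))\<^sup>2)"
      using assms by (intro integrable_mult_right l2_sq_int)
    show "AE x in lborel. norm ((norm (c x * f x))\<^sup>2) \<le> norm (K\<^sup>2 * (norm (f x))\<^sup>2)"
      using assms(3) by (auto simp: norm_mult power_mult_distrib intro!: mult_right_mono power_mono)
  qed (use m in simp)
qed

lemma l2_scale: "l2 f \<Longrightarrow> l2 (\<lambda>x. c * f x)"
  by (rule l2_bounded_mult[where K="norm c"]) auto

lemma l2_0: "l2 (\<lambda>x. 0)" by (simp add: l2_def)

lemma l2_sum: "finite A \<Longrightarrow> (\<And>k. k \<in> A \<Longrightarrow> l2 (f k)) \<Longrightarrow> l2 (\<lambda>x. \<Sum>k\<in>A. f k x)"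
  by (induction A rule: finite_induct) (auto simp: l2_0 intro: l2_add)

lemma l2_diff: "l2 f \<Longrightarrow> l2 g \<Longrightarrow> l2 (\<lambda>x. f x - g x)"
  using l2_add[of f "\<lambda>x. (-1) * g x"] l2_scale[of g "-1"] by simp

lemma sp_add_right: "l2 f \<Longrightarrow> l2 g \<Longrightarrow> l2 h \<Longrightarrow> sp f (\<lambda>x. g x + h x) = sp f g + sp f h"
  unfolding sp_def by (simp add: distrib_left l2_ip)

lemma sp_scale_right: "sp f (\<lambda>x. c * g x) = c * sp f g"
  unfolding sp_def by (simp add: mult.left_commute[of _ c])

lemma sp_cnj: "cnj (sp f g) = sp g f"
  unfolding sp_def by (simp flip: Bochner_Integration.integral_cnj add: mult.commute)

lemma sp_diff_right: "l2 f \<Longrightarrow> l2 g \<Longrightarrow> l2 h \<Longrightarrow> sp f (\<lambda>x. g x - h x) = sp f g - sp f h"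
  unfolding sp_def by (simp add: right_diff_distrib l2_ip)

lemma sp_sum_right: "finite A \<Longrightarrow> l2 f \<Longrightarrow> (\<And>k. k \<in> A \<Longrightarrow> l2 (g k)) \<Longrightarrow>
   sp f (\<lambda>x. \<Sum>k\<in>A. g k x) = (\<Sum>k\<in>A. sp f (g k))"
  unfolding sp_def by (subst Bochner_Integration.integral_sum[symmetric]) (auto simp: sum_distrib_left l2_ip)

lemma sp_add_left: "l2 f \<Longrightarrow> l2 g \<Longrightarrow> l2 h \<Longrightarrow> sp (\<lambda>x. g x + h x) f = sp g f + sp h f"
  using sp_add_right[of f g h] sp_cnj by (metis complex_cnj_add)

lemma sp_scale_left: "sp (\<lambda>x. c * g x) f = cnj c * sp g f"
  using sp_scale_right[of f c g] sp_cnj by (metis complex_cnj_mult)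

lemma sp_sum_left: "finite A \<Longrightarrow> l2 f \<Longrightarrow> (\<And>k. k \<in> A \<Longrightarrow> l2 (g k)) \<Longrightarrow>
   sp (\<lambda>x. \<Sum>k\<in>A. g k x) f = (\<Sum>k\<in>A. sp (g k) f)"
  using sp_sum_right[of A f g] sp_cnj by (metis (no_types, lifting) cnj_sum sum.cong)

lemma sp_self: "sp f f = of_real (sq f)"
proof -
  have "sp f f = (\<integral>x. complex_of_real ((norm (f x))\<^sup>2) \<partial>lborel)"
    unfolding sp_def by (simp add: complex_norm_square mult.commute del: of_real_power)
  then show ?thesis by (simp add: sq_def del: of_real_power)
qed

lemma sq_add:
  assumes "l2 f" "l2 g" shows "sq (\<lambda>x. f x + g x) = sq f + sq g + 2 * Re (sp f g)"
proof -
  have "complex_of_real (sq (\<lambda>x. f x + g x)) = sp (\<lambda>x. f x + g x) (\<lambda>x. f x + g x)"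
    by (simp add: sp_self)
  also have "\<dots> = sp f f + sp g g + (sp f g + cnj (sp f g))"
    using assms by (simp add: sp_add_left sp_add_right l2_add sp_cnj)
  also have "\<dots> = of_real (sq f + sq g + 2 * Re (sp f g))"
    by (simp add: sp_self complex_add_cnj)
  finally show ?thesis using of_real_eq_iff by blast
qed

lemma l2_CS_norm:
  assumes "l2 f" "l2 g"
  shows "(\<integral>x. norm (f x) * norm (g x) \<partial>lborel) \<le> sqrt (sq f) * sqrt (sq g)"
proof -
  define N where "N = (\<integral>x. norm (f x) * norm (g x) \<partial>lborel)"
  have N0: "N \<ge> 0" unfolding N_def by simp
  have q: "0 \<le> t\<^sup>2 * sq f - 2 * t * N + sq g" for t
  proof -
    have "0 \<le> (\<integral>x. (t * norm (f x) - norm (g x))\<^sup>2 \<partial>lborel)" by simp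
    also have "(\<lambda>x. (t * norm (f x) - norm (g x))\<^sup>2) =
        (\<lambda>x. t\<^sup>2 * (norm (f x))\<^sup>2 - 2 * t * (norm (f x) * norm (g x)) + (norm (g x))\<^sup>2)"
      by (auto simp: power2_eq_square algebra_simps)
    also have "(\<integral>x. t\<^sup>2 * (norm (f x))\<^sup>2 - 2 * t * (norm (f x) * norm (g x)) + (norm (g x))\<^sup>2 \<partial>lborel)
        = t\<^sup>2 * sq f - 2 * t * N + sq g"
      unfolding sq_def N_def
      using l2_sq_int[OF assms(1)] l2_sq_int[OF assms(2)] l2_norm_mult[OF assms]
      by (simp del: power_mult_distrib)
    finally show ?thesis .
  qed
  have "N\<^sup>2 \<le> sq f * sq g"
  proof (cases "sq f = 0")
    case True
    have "N = 0"
    proof (rule ccontr)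
      assume "N \<noteq> 0"
      then show False using q[of "(sq g + 1) / (2 * N)"] True by (simp add: field_simps)
    qed
    then show ?thesis using True by simp
  next
    case False
    then have p: "sq f > 0" using sq_nonneg[of f] by linarith
    have "0 \<le> (N / sq f)\<^sup>2 * sq f - 2 * (N / sq f) * N + sq g" by (rule q)
    also have "\<dots> = sq g - N\<^sup>2 / sq f" using p by (simp add: power2_eq_square field_simps)
    finally show ?thesis using p by (simp add: field_simps)
  qed
  then have "N \<le> sqrt (sq f * sq g)" by (rule real_le_rsqrt)
  then show ?thesis by (simp add: N_def real_sqrt_mult)
qed

lemma sp_CS: "l2 f \<Longrightarrow> l2 g \<Longrightarrow> norm (sp f g) \<le> sqrt (sq f) * sqrt (sq g)"
  unfolding sp_def
  by (rule order_trans[OF integral_norm_bound]) (use l2_CS_norm[of f g] in \<open>simp add: norm_mult\<close>)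

lemma sp_tendsto:
  assumes "l2 f" "\<And>k. l2 (F k)" "l2 g" "(\<lambda>k. sq (\<lambda>x. F k x - g x)) \<longlonglongrightarrow> 0"
  shows "(\<lambda>k. sp f (F k)) \<longlonglongrightarrow> sp f g"
proof -
  have "(\<lambda>k. sqrt (sq f) * sqrt (sq (\<lambda>x. F k x - g x))) \<longlonglongrightarrow> sqrt (sq f) * sqrt 0"
    by (intro tendsto_intros assms)
  then have "(\<lambda>k. sqrt (sq f) * sqrt (sq (\<lambda>x. F k x - g x))) \<longlonglongrightarrow> 0" by simp
  then have "(\<lambda>k. sp f (F k) - sp f g) \<longlonglongrightarrow> 0"
  proof (rule Lim_null_comparison[rotated], intro always_eventually allI)
    fix k
    have "sp f (F k) - sp f g = sp f (\<lambda>x. F k x - g x)" by (simp add: sp_diff_right assms)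
    then show "norm (sp f (F k) - sp f g) \<le> sqrt (sq f) * sqrt (sq (\<lambda>x. F k x - g x))"
      using sp_CS[OF assms(1) l2_diff[OF assms(2,3)], of k] by simp
  qed
  then show ?thesis by (simp add: LIM_zero_iff)
qed

text \<open>An almost everywhere convergent subsequence is obtained from the corresponding statement
  in L1 after multiplication with a fixed weight; Fatou's lemma then gives convergence of the full
  sequence in the mean.\<close>

lemma l2_complete:
  assumes S: "\<And>k. l2 (S k)"
    and C: "\<And>\<epsilon>. \<epsilon> > 0 \<Longrightarrow> \<exists>N. \<forall>i\<ge>N. \<forall>j\<ge>N. sq (\<lambda>x. S i x - S j x) < \<epsilon>"
  shows "\<exists>g. l2 g \<and> (\<lambda>k. sq (\<lambda>x. S k x - g x)) \<longlonglongrightarrow> 0"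
proof -
  \<comment> \<open>The weight is square-integrable, so that Cauchy in L2 becomes Cauchy in L1, and
    nowhere zero, so that pointwise limits can be divided by it.\<close>
  define w where "w x = complex_of_real (sqrt (normal_density 0 1 x))" for x
  have w: "l2 w" "\<And>x. w x \<noteq> 0"
    unfolding w_def l2_def by (auto simp: normal_density_nonneg normal_density_pos less_imp_neq[symmetric] intro: integrable_normal_density)
  have Sm [measurable]: "S k \<in> borel_measurable borel" for k using l2_meas[OF S] .
  have wm [measurable]: "w \<in> borel_measurable borel" using l2_meas[OF w(1)] .
  obtain r where r: "strict_mono r" "AE x in lborel. Cauchy (\<lambda>i. w x * S (r i) x)"
  proof (rule cauchy_L1_AE_cauchy_subseq[of lborel "\<lambda>k x. w x * S k x"])
    show "integrable lborel (\<lambda>x. w x * S n x)" for n by (rule l2_mult[OF w(1) S])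
    fix \<epsilon> :: real assume \<epsilon>: "\<epsilon> > 0"
    define d where "d = (\<epsilon> / (sqrt (sq w) + 1))\<^sup>2"
    have sp0: "sqrt (sq w) + 1 > 0" by (simp add: add_nonneg_pos)
    have "d > 0" unfolding d_def using \<epsilon> sp0 by simp
    then obtain N where N: "\<forall>i\<ge>N. \<forall>j\<ge>N. sq (\<lambda>x. S i x - S j x) < d" using C by blast
    show "\<exists>N. \<forall>i\<ge>N. \<forall>j\<ge>N. (\<integral>x. norm (w x * S i x - w x * S j x) \<partial>lborel) < \<epsilon>"
    proof (intro exI allI impI)
      fix i j assume ij: "N \<le> i" "N \<le> j"
      have "(\<integral>x. norm (w x * S i x - w x * S j x) \<partial>lborel) = (\<integral>x. norm (w x) * norm (S i x - S j x) \<partial>lborel)"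
        by (simp add: norm_mult flip: right_diff_distrib)
      also have "\<dots> \<le> sqrt (sq w) * sqrt (sq (\<lambda>x. S i x - S j x))" by (rule l2_CS_norm[OF w(1) l2_diff[OF S S]])
      also have "\<dots> \<le> sqrt (sq w) * sqrt d" using N ij by (intro mult_left_mono real_sqrt_le_mono) (auto intro: less_imp_le)
      also have "sqrt d = \<epsilon> / (sqrt (sq w) + 1)" unfolding d_def using \<epsilon> sp0 by (subst real_sqrt_abs) auto
      also have "sqrt (sq w) * (\<epsilon> / (sqrt (sq w) + 1)) < \<epsilon>" using \<epsilon> sp0 by (simp add: field_simps)
      finally show "(\<integral>x. norm (w x * S i x - w x * S j x) \<partial>lborel) < \<epsilon>" .
    qed
  qed
  define g where "g x = lim (\<lambda>i. S (r i) x)" for x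
  have gm [measurable]: "g \<in> borel_measurable borel"
    unfolding g_def by (rule borel_measurable_lim_metric) simp
  have lim: "AE x in lborel. (\<lambda>i. S (r i) x) \<longlonglongrightarrow> g x"
    using r(2)
  proof eventually_elim
    case (elim x)
    then have "convergent (\<lambda>i. w x * S (r i) x)" by (simp add: Cauchy_convergent_iff)
    then obtain L where "(\<lambda>i. w x * S (r i) x) \<longlonglongrightarrow> L" by (auto simp: convergent_def)
    then have "(\<lambda>i. inverse (w x) * (w x * S (r i) x)) \<longlonglongrightarrow> inverse (w x) * L" by (rule tendsto_mult_left)
    then have "(\<lambda>i. S (r i) x) \<longlonglongrightarrow> inverse (w x) * L" using w(2)[of x] by (simp flip: mult.assoc)
    then show ?case unfolding g_def by (simp add: limI)
  qed
  have nn: "(\<integral>\<^sup>+x. ennreal ((norm (S i x - S k x))\<^sup>2) \<partial>lborel) = ennreal (sq (\<lambda>x. S i x - S k x))" for i k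
    unfolding sq_def by (rule nn_integral_eq_integral[OF l2_sq_int[OF l2_diff[OF S S]]]) simp
  have fatou: "(\<integral>\<^sup>+x. ennreal ((norm (g x - S k x))\<^sup>2) \<partial>lborel) \<le> ennreal \<epsilon>"
    if N: "\<forall>i\<ge>N. \<forall>j\<ge>N. sq (\<lambda>x. S i x - S j x) < \<epsilon>" and k: "k \<ge> N" for k N \<epsilon>
  proof -
    have "(\<integral>\<^sup>+x. ennreal ((norm (g x - S k x))\<^sup>2) \<partial>lborel)
        = (\<integral>\<^sup>+x. liminf (\<lambda>i. ennreal ((norm (S (r i) x - S k x))\<^sup>2)) \<partial>lborel)"
    proof (rule nn_integral_cong_AE, use lim in eventually_elim)
      case (elim x)
      then have "(\<lambda>i. ennreal ((norm (S (r i) x - S k x))\<^sup>2)) \<longlonglongrightarrow> ennreal ((norm (g x - S k x))\<^sup>2)"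
        by (intro tendsto_intros)
      then show ?case by (rule lim_imp_Liminf[symmetric, OF trivial_limit_sequentially])
    qed
    also have "\<dots> \<le> liminf (\<lambda>i. \<integral>\<^sup>+x. ennreal ((norm (S (r i) x - S k x))\<^sup>2) \<partial>lborel)"
      by (rule nn_integral_liminf) measurable
    also have "\<dots> \<le> ennreal \<epsilon>"
    proof (rule Liminf_le, simp, rule eventually_mono[OF eventually_ge_at_top[of N]])
      fix i assume "N \<le> i"
      then have "N \<le> r i" using seq_suble[OF r(1), of i] by linarith
      then show "(\<integral>\<^sup>+x. ennreal ((norm (S (r i) x - S k x))\<^sup>2) \<partial>lborel) \<le> ennreal \<epsilon>"
        unfolding nn using N k by (intro ennreal_leI) (auto intro: less_imp_le)
    qed
    finally show ?thesis .
  qed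
  obtain N1 where N1: "\<forall>i\<ge>N1. \<forall>j\<ge>N1. sq (\<lambda>x. S i x - S j x) < 1" using C[of 1] by auto
  have "l2 (\<lambda>x. g x - S N1 x)" unfolding l2_def
  proof
    show "integrable lborel (\<lambda>x. (norm (g x - S N1 x))\<^sup>2)"
    proof (rule integrableI_bounded)
      have "(\<integral>\<^sup>+x. ennreal ((norm (g x - S N1 x))\<^sup>2) \<partial>lborel) \<le> ennreal 1" by (rule fatou[OF N1]) simp
      then show "(\<integral>\<^sup>+x. ennreal (norm ((norm (g x - S N1 x))\<^sup>2)) \<partial>lborel) < \<infinity>"
        by (simp add: order_le_less_trans)
    qed simp
  qed simp
  from l2_add[OF this S[of N1]] have gl: "l2 g" by simp
  have "(\<lambda>k. sq (\<lambda>x. S k x - g x)) \<longlonglongrightarrow> 0"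
  proof (rule LIMSEQ_I)
    fix \<epsilon> :: real assume \<epsilon>: "\<epsilon> > 0"
    then obtain N where N: "\<forall>i\<ge>N. \<forall>j\<ge>N. sq (\<lambda>x. S i x - S j x) < \<epsilon> / 2" using C[of "\<epsilon> / 2"] by auto
    show "\<exists>no. \<forall>n\<ge>no. norm (sq (\<lambda>x. S n x - g x) - 0) < \<epsilon>"
    proof (intro exI allI impI)
      fix k assume "k \<ge> N"
      have "ennreal (sq (\<lambda>x. g x - S k x)) = (\<integral>\<^sup>+x. ennreal ((norm (g x - S k x))\<^sup>2) \<partial>lborel)"
        unfolding sq_def by (rule nn_integral_eq_integral[OF l2_sq_int[OF l2_diff[OF gl S]], symmetric]) simp
      also have "\<dots> \<le> ennreal (\<epsilon> / 2)" by (rule fatou[OF N \<open>k \<ge> N\<close>])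
      finally have "sq (\<lambda>x. g x - S k x) \<le> \<epsilon> / 2" using \<epsilon> by (simp add: ennreal_le_iff)
      moreover have "sq (\<lambda>x. g x - S k x) = sq (\<lambda>x. S k x - g x)" unfolding sq_def by (simp add: norm_minus_commute)
      ultimately show "norm (sq (\<lambda>x. S k x - g x) - 0) < \<epsilon>" using \<epsilon> by simp
    qed
  qed
  with gl show ?thesis by blast
qed

locale l2_basis =
  fixes \<eta> :: "nat \<Rightarrow> real \<Rightarrow> complex"
  assumes l2: "l2 (\<eta> m)" and on: "sp (\<eta> m) (\<eta> k) = (if m = k then 1 else 0)"
    and total: "l2 g \<Longrightarrow> (\<And>m. sp (\<eta> m) g = 0) \<Longrightarrow> AE x in lborel. g x = 0"
begin

lemma l2_comb: "l2 (\<lambda>x. \<Sum>m<N. c m * \<eta> m x)" by (intro l2_sum l2_scale l2) simp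

lemma sp_comb: "sp (\<eta> k) (\<lambda>x. \<Sum>m<N. c m * \<eta> m x) = (if k < N then c k else 0)"
proof -
  have "sp (\<eta> k) (\<lambda>x. \<Sum>m<N. c m * \<eta> m x) = (\<Sum>m<N. sp (\<eta> k) (\<lambda>x. c m * \<eta> m x))"
    by (rule sp_sum_right) (auto intro: l2 l2_scale)
  also have "\<dots> = (\<Sum>m<N. if m = k then c m else 0)"
    by (rule sum.cong) (auto simp: sp_scale_right on)
  finally show ?thesis by simp
qed

lemma sq_diff_comb:
  assumes "M \<le> N"
  shows "sq (\<lambda>x. (\<Sum>m<N. c m * \<eta> m x) - (\<Sum>m<M. c m * \<eta> m x)) = (\<Sum>m\<in>{M..<N}. (norm (c m))\<^sup>2)"
proof -
  let ?d = "\<lambda>x. \<Sum>m\<in>{M..<N}. c m * \<eta> m x"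
  have d: "(\<lambda>x. (\<Sum>m<N. c m * \<eta> m x) - (\<Sum>m<M. c m * \<eta> m x)) = ?d"
    using sum_diff_nat_ivl[of 0 M N] assms by (auto simp: atLeast0LessThan)
  have k: "sp (\<eta> k) ?d = (if k \<in> {M..<N} then c k else 0)" for k
  proof -
    have "sp (\<eta> k) ?d = (\<Sum>m\<in>{M..<N}. sp (\<eta> k) (\<lambda>x. c m * \<eta> m x))"
      by (rule sp_sum_right) (auto intro: l2 l2_scale)
    also have "\<dots> = (\<Sum>m\<in>{M..<N}. if m = k then c m else 0)"
      by (rule sum.cong) (auto simp: sp_scale_right on)
    finally show ?thesis by simp
  qed
  have "sp ?d ?d = (\<Sum>k\<in>{M..<N}. cnj (c k) * c k)"
    by (subst sp_sum_left) (auto simp: l2 l2_scale l2_sum sp_scale_left k)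
  then have "complex_of_real (sq ?d) = of_real (\<Sum>k\<in>{M..<N}. (norm (c k))\<^sup>2)"
    by (simp add: sp_self complex_norm_square mult.commute del: of_real_power)
  then show ?thesis unfolding d using of_real_eq_iff by blast
qed

lemma bessel_eq:
  assumes "l2 f"
  shows "sq (\<lambda>x. f x - (\<Sum>m<N. sp (\<eta> m) f * \<eta> m x)) = sq f - (\<Sum>m<N. (norm (sp (\<eta> m) f))\<^sup>2)"
proof -
  let ?s = "\<lambda>x. \<Sum>m<N. sp (\<eta> m) f * \<eta> m x"
  let ?r = "\<lambda>x. f x - ?s x"
  have lr: "l2 ?r" by (rule l2_diff[OF assms l2_comb])
  have "sp (\<eta> k) ?r = 0" if "k < N" for k
    using that by (simp add: sp_diff_right l2 assms l2_comb sp_comb)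
  then have "sp ?s ?r = 0" by (subst sp_sum_left) (auto simp: l2 l2_scale lr sp_scale_left)
  moreover have "sq (\<lambda>x. ?s x + ?r x) = sq ?s + sq ?r + 2 * Re (sp ?s ?r)" by (rule sq_add[OF l2_comb lr])
  moreover have "sq ?s = (\<Sum>m<N. (norm (sp (\<eta> m) f))\<^sup>2)"
    using sq_diff_comb[of 0 N "\<lambda>m. sp (\<eta> m) f"] by (simp add: atLeast0LessThan)
  ultimately show ?thesis by simp
qed

lemma bessel:
  assumes "l2 f" shows "(\<Sum>m<N. (norm (sp (\<eta> m) f))\<^sup>2) \<le> sq f"
  using bessel_eq[OF assms, of N] sq_nonneg[of "\<lambda>x. f x - (\<Sum>m<N. sp (\<eta> m) f * \<eta> m x)"] by linarith

lemma bessel_summable: assumes "l2 f" shows "summable (\<lambda>m. (norm (sp (\<eta> m) f))\<^sup>2)"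
  by (rule summableI_nonneg_bounded[where x="sq f"]) (auto intro: bessel[OF assms])

lemma riesz_fischer:
  assumes c: "summable (\<lambda>m. (norm (c m))\<^sup>2)"
  shows "\<exists>g. l2 g \<and> (\<forall>m. sp (\<eta> m) g = c m) \<and> (\<lambda>N. sq (\<lambda>x. (\<Sum>m<N. c m * \<eta> m x) - g x)) \<longlonglongrightarrow> 0"
proof -
  let ?S = "\<lambda>N x. \<Sum>m<N. c m * \<eta> m x"
  have "\<exists>g. l2 g \<and> (\<lambda>k. sq (\<lambda>x. ?S k x - g x)) \<longlonglongrightarrow> 0"
  proof (rule l2_complete)
    show "l2 (?S k)" for k by (rule l2_comb)
    fix \<epsilon> :: real assume \<epsilon>: "\<epsilon> > 0"
    from c have "\<forall>e>0. \<exists>N. \<forall>m\<ge>N. \<forall>n. norm (sum (\<lambda>m. (norm (c m))\<^sup>2) {m..<n}) < e"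
      by (simp add: summable_Cauchy)
    then obtain N where N: "\<forall>m\<ge>N. \<forall>n. norm (sum (\<lambda>m. (norm (c m))\<^sup>2) {m..<n}) < \<epsilon>" using \<epsilon> by blast
    have s: "sq (\<lambda>x. ?S i x - ?S j x) < \<epsilon>" if "j \<ge> N" "j \<le> i" for i j
    proof -
      have "norm (sum (\<lambda>m. (norm (c m))\<^sup>2) {j..<i}) < \<epsilon>" using N that(1) by blast
      then show ?thesis unfolding sq_diff_comb[OF that(2)] by (auto simp: abs_less_iff)
    qed
    have "sq (\<lambda>x. ?S i x - ?S j x) = sq (\<lambda>x. ?S j x - ?S i x)" for i j unfolding sq_def by (simp add: norm_minus_commute)
    then have "sq (\<lambda>x. ?S i x - ?S j x) < \<epsilon>" if "i \<ge> N" "j \<ge> N" for i j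
      using s[of j i] s[of i j] that by (cases "j \<le> i") auto
    then show "\<exists>N. \<forall>i\<ge>N. \<forall>j\<ge>N. sq (\<lambda>x. ?S i x - ?S j x) < \<epsilon>" by blast
  qed
  then obtain g where g: "l2 g" "(\<lambda>k. sq (\<lambda>x. ?S k x - g x)) \<longlonglongrightarrow> 0" by blast
  have "sp (\<eta> m) g = c m" for m
  proof -
    have "(\<lambda>k. sp (\<eta> m) (?S k)) \<longlonglongrightarrow> sp (\<eta> m) g" by (rule sp_tendsto[OF l2 l2_comb g])
    moreover have "(\<lambda>k. sp (\<eta> m) (?S k)) \<longlonglongrightarrow> c m"
      by (rule tendsto_eventually, rule eventually_mono[OF eventually_gt_at_top[of m]]) (simp add: sp_comb)
    ultimately show ?thesis by (rule LIMSEQ_unique)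
  qed
  then show ?thesis using g by blast
qed

text \<open>Riesz-Fischer yields some limit of the partial sums with the coefficients of f, and
  totality identifies that limit with f almost everywhere.\<close>

lemma expansion:
  assumes f: "l2 f"
  shows "(\<lambda>N. sq (\<lambda>x. (\<Sum>m<N. sp (\<eta> m) f * \<eta> m x) - f x)) \<longlonglongrightarrow> 0"
proof -
  obtain g where g: "l2 g" "\<And>m. sp (\<eta> m) g = sp (\<eta> m) f"
      "(\<lambda>N. sq (\<lambda>x. (\<Sum>m<N. sp (\<eta> m) f * \<eta> m x) - g x)) \<longlonglongrightarrow> 0"
    using riesz_fischer[OF bessel_summable[OF f]] by blast
  have ae: "AE x in lborel. f x - g x = 0"
    by (rule total[OF l2_diff[OF f g(1)]]) (simp add: sp_diff_right l2 f g)
  have "sq (\<lambda>x. (\<Sum>m<N. sp (\<eta> m) f * \<eta> m x) - g x) = sq (\<lambda>x. (\<Sum>m<N. sp (\<eta> m) f * \<eta> m x) - f x)" for N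
    unfolding sq_def
  proof (rule integral_cong_AE)
    show "AE x in lborel. (norm ((\<Sum>m<N. sp (\<eta> m) f * \<eta> m x) - g x))\<^sup>2 = (norm ((\<Sum>m<N. sp (\<eta> m) f * \<eta> m x) - f x))\<^sup>2"
      using ae by eventually_elim simp
  qed (use l2_meas[OF l2_diff[OF l2_comb g(1)]] l2_meas[OF l2_diff[OF l2_comb f]] in simp_all)
  then show ?thesis using g(3) by simp
qed

lemma parseval:
  assumes "l2 f" "l2 g"
  shows "(\<lambda>m. sp f (\<eta> m) * sp (\<eta> m) g) sums sp f g"
proof -
  have "(\<lambda>N. sp f (\<lambda>x. \<Sum>m<N. sp (\<eta> m) g * \<eta> m x)) \<longlonglongrightarrow> sp f g"
    by (rule sp_tendsto[OF assms(1) l2_comb assms(2) expansion[OF assms(2)]])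
  moreover have "sp f (\<lambda>x. \<Sum>m<N. sp (\<eta> m) g * \<eta> m x) = (\<Sum>m<N. sp f (\<eta> m) * sp (\<eta> m) g)" for N
    by (subst sp_sum_right[OF _ assms(1) l2_scale[OF l2]]) (simp_all add: sp_scale_right mult.commute[of "sp f _"])
  ultimately show ?thesis by (simp add: sums_def)
qed

end

section \<open>Gaussian integrals and Hermite functions\<close>

lemma gauss_real:
  fixes a :: real assumes a: "a > 0"
  shows "integrable lborel (\<lambda>x. exp (- a * x\<^sup>2))" "(\<integral>x. exp (- a * x\<^sup>2) \<partial>lborel) = sqrt (pi / a)"
proof -
  define \<sigma> where "\<sigma> = 1 / sqrt (2 * a)"
  have \<sigma>: "\<sigma> > 0" "2 * \<sigma>\<^sup>2 = 1 / a" using a by (auto simp: \<sigma>_def power_divide)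
  have "normal_density 0 \<sigma> x = exp (- a * x\<^sup>2) / sqrt (pi / a)" for x
  proof -
    have "2 * pi * \<sigma>\<^sup>2 = pi / a" using \<sigma>(2) by (metis mult.assoc mult.commute times_divide_eq_right mult.right_neutral)
    moreover have "(x - 0)\<^sup>2 / (2 * \<sigma>\<^sup>2) = a * x\<^sup>2" unfolding \<sigma>(2) by simp
    moreover have "normal_density 0 \<sigma> x = 1 / sqrt (2 * pi * \<sigma>\<^sup>2) * exp (- ((x - 0)\<^sup>2 / (2 * \<sigma>\<^sup>2)))"
      by (simp add: normal_density_def)
    ultimately show ?thesis by (simp only:) simp
  qed
  then have e: "exp (- a * x\<^sup>2) = sqrt (pi / a) * normal_density 0 \<sigma> x" for x using a by simp
  have "has_bochner_integral lborel (normal_density 0 \<sigma>) 1"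
    using integrable_normal_density[OF \<sigma>(1), of 0] integral_normal_density[OF \<sigma>(1), of 0] by (simp add: has_bochner_integral_iff)
  then have "has_bochner_integral lborel (\<lambda>x. sqrt (pi / a) * normal_density 0 \<sigma> x) (sqrt (pi / a) * 1)"
    by (rule has_bochner_integral_mult_right)
  then show "integrable lborel (\<lambda>x. exp (- a * x\<^sup>2))" "(\<integral>x. exp (- a * x\<^sup>2) \<partial>lborel) = sqrt (pi / a)"
    unfolding e by (auto simp: has_bochner_integral_iff)
qed

text \<open>The common domination behind integrability and decay at infinity: polynomial and
  exponential growth is absorbed by half of the Gaussian.\<close>

lemma gauss_dom:
  fixes a c :: real assumes a: "a > 0"
  obtains C where "C \<ge> 0" "\<And>x. \<bar>x\<bar> ^ k * exp (c * \<bar>x\<bar> - a * x\<^sup>2) \<le> C * exp (- (a / 2) * x\<^sup>2)"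
proof
  \<comment> \<open>The power is at most \<open>fact k * exp \<bar>x\<bar>\<close>, which raises c
    to c + 1; the rest is completing the square against a/2 times x^2.\<close>
  let ?C = "fact k * exp ((c + 1)\<^sup>2 / (2 * a))"
  show "?C \<ge> 0" by simp
  fix x :: real
  have "\<bar>x\<bar> ^ k / fact k \<le> exp \<bar>x\<bar>"
  proof -
    have "(\<Sum>i\<in>{k}. \<bar>x\<bar> ^ i /\<^sub>R fact i) \<le> (\<Sum>i. \<bar>x\<bar> ^ i /\<^sub>R fact i)"
      by (rule sum_le_suminf[OF summable_exp_generic]) auto
    then show ?thesis by (simp add: exp_def divide_inverse mult.commute)
  qed
  then have 1: "\<bar>x\<bar> ^ k \<le> fact k * exp \<bar>x\<bar>" by (simp add: field_simps)
  have "0 \<le> ((c + 1) - a * \<bar>x\<bar>)\<^sup>2 / (2 * a)" using a by simp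
  also have "\<dots> = (c + 1)\<^sup>2 / (2 * a) - (c + 1) * \<bar>x\<bar> + a / 2 * x\<^sup>2"
    using a by (simp add: power2_eq_square field_simps)
  finally have 2: "\<bar>x\<bar> + (c * \<bar>x\<bar> - a * x\<^sup>2) \<le> (c + 1)\<^sup>2 / (2 * a) + (- (a / 2) * x\<^sup>2)"
    by (simp add: algebra_simps)
  have "\<bar>x\<bar> ^ k * exp (c * \<bar>x\<bar> - a * x\<^sup>2) \<le> fact k * exp \<bar>x\<bar> * exp (c * \<bar>x\<bar> - a * x\<^sup>2)"
    using 1 by (rule mult_right_mono) simp
  also have "\<dots> = fact k * exp (\<bar>x\<bar> + (c * \<bar>x\<bar> - a * x\<^sup>2))" by (simp only: exp_add mult.assoc)
  also have "\<dots> \<le> fact k * exp ((c + 1)\<^sup>2 / (2 * a) + (- (a / 2) * x\<^sup>2))"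
    using 2 by simp
  also have "\<dots> = ?C * exp (- (a / 2) * x\<^sup>2)" by (simp only: exp_add mult.assoc)
  finally show "\<bar>x\<bar> ^ k * exp (c * \<bar>x\<bar> - a * x\<^sup>2) \<le> ?C * exp (- (a / 2) * x\<^sup>2)" .
qed

lemma integrable_gauss_dom:
  fixes f :: "real \<Rightarrow> 'a :: {banach, second_countable_topology}"
  assumes "f \<in> borel_measurable borel" "a > 0" "\<And>x. norm (f x) \<le> B * \<bar>x\<bar> ^ k * exp (c * \<bar>x\<bar> - a * x\<^sup>2)"
  shows "integrable lborel f"
proof -
  obtain C where C: "C \<ge> 0" "\<And>x. \<bar>x\<bar> ^ k * exp (c * \<bar>x\<bar> - a * x\<^sup>2) \<le> C * exp (- (a / 2) * x\<^sup>2)"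
    using gauss_dom[OF assms(2)] by metis
  show ?thesis
  proof (rule Bochner_Integration.integrable_bound)
    show "integrable lborel (\<lambda>x. \<bar>B\<bar> * C * exp (- (a / 2) * x\<^sup>2))"
      by (rule integrable_mult_right) (use gauss_real(1)[of "a / 2"] assms(2) in simp)
    show "AE x in lborel. norm (f x) \<le> norm (\<bar>B\<bar> * C * exp (- (a / 2) * x\<^sup>2))"
    proof (rule AE_I2)
      fix x
      have "norm (f x) \<le> B * (\<bar>x\<bar> ^ k * exp (c * \<bar>x\<bar> - a * x\<^sup>2))" using assms(3)[of x] by (simp add: mult.assoc)
      also have "\<dots> \<le> \<bar>B\<bar> * (\<bar>x\<bar> ^ k * exp (c * \<bar>x\<bar> - a * x\<^sup>2))" by (intro mult_right_mono) auto
      also have "\<dots> \<le> \<bar>B\<bar> * (C * exp (- (a / 2) * x\<^sup>2))" by (intro mult_left_mono C) auto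
      also have "\<dots> = norm (\<bar>B\<bar> * C * exp (- (a / 2) * x\<^sup>2))" using C(1) by (simp add: abs_mult)
      finally show "norm (f x) \<le> norm (\<bar>B\<bar> * C * exp (- (a / 2) * x\<^sup>2))" .
    qed
  qed (use assms in simp)
qed

lemma tendsto_gauss_dom:
  fixes f :: "real \<Rightarrow> 'a :: real_normed_vector"
  assumes "a > 0" "\<And>x. norm (f x) \<le> B * \<bar>x\<bar> ^ k * exp (c * \<bar>x\<bar> - a * x\<^sup>2)"
  shows "(f \<longlongrightarrow> 0) at_top" "(f \<longlongrightarrow> 0) at_bot"
proof -
  obtain C where C: "C \<ge> 0" "\<And>x. \<bar>x\<bar> ^ k * exp (c * \<bar>x\<bar> - a * x\<^sup>2) \<le> C * exp (- (a / 2) * x\<^sup>2)"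
    using gauss_dom[OF assms(1)] by metis
  have b: "norm (f x) \<le> \<bar>B\<bar> * C * exp (- (a / 2) * x\<^sup>2)" for x
  proof -
    have "norm (f x) \<le> B * (\<bar>x\<bar> ^ k * exp (c * \<bar>x\<bar> - a * x\<^sup>2))" using assms(2)[of x] by (simp add: mult.assoc)
    also have "\<dots> \<le> \<bar>B\<bar> * (\<bar>x\<bar> ^ k * exp (c * \<bar>x\<bar> - a * x\<^sup>2))" by (intro mult_right_mono) auto
    also have "\<dots> \<le> \<bar>B\<bar> * (C * exp (- (a / 2) * x\<^sup>2))" by (intro mult_left_mono C) auto
    finally show ?thesis by (simp add: mult.assoc)
  qed
  have t: "((\<lambda>x. \<bar>B\<bar> * C * exp (- (a / 2) * x\<^sup>2)) \<longlongrightarrow> \<bar>B\<bar> * C * 0) at_top"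
    "((\<lambda>x. \<bar>B\<bar> * C * exp (- (a / 2) * x\<^sup>2)) \<longlongrightarrow> \<bar>B\<bar> * C * 0) at_bot"
    by (rule tendsto_mult_left, use assms(1) in real_asymp)+
  show "(f \<longlongrightarrow> 0) at_top" by (rule Lim_null_comparison[OF always_eventually[OF allI[OF b]]]) (use t(1) in simp)
  show "(f \<longlongrightarrow> 0) at_bot" by (rule Lim_null_comparison[OF always_eventually[OF allI[OF b]]]) (use t(2) in simp)
qed

lemma integral_derivative_zero:
  fixes F f :: "real \<Rightarrow> 'a::euclidean_space"
  assumes "\<And>x. (F has_vector_derivative f x) (at x)" "continuous_on UNIV f" "integrable lborel f"
    "(F \<longlongrightarrow> 0) at_top" "(F \<longlongrightarrow> 0) at_bot"
  shows "(\<integral>x. f x \<partial>lborel) = 0"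
proof -
  have "(LBINT x=-\<infinity>..\<infinity>. f x) = 0 - 0"
  proof (rule interval_integral_FTC_integrable[of "-\<infinity>" "\<infinity>" F])
    show "isCont f x" for x using assms(2) by (simp add: continuous_on_eq_continuous_at)
    show "set_integrable lborel (einterval (- \<infinity>) \<infinity>) f"
      using assms(3) by (simp add: set_integrable_def)
    show "((F \<circ> real_of_ereal) \<longlongrightarrow> 0) (at_right (- \<infinity>))" "((F \<circ> real_of_ereal) \<longlongrightarrow> 0) (at_left \<infinity>)"
      using assms(4,5) by (simp_all add: ereal_tendsto_simps)
  qed (use assms(1) in auto)
  then show ?thesis by (simp add: interval_lebesgue_integral_def set_lebesgue_integral_def)
qed

text \<open>Termwise integration, dominated by \<open>norm (g x) * exp (norm (h x))\<close>. It
  takes the place of contour shifts and analytic continuation for Gaussian integrals, links moments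
  with Fourier transforms, and produces Mehler's sum.\<close>

lemma integral_exp_series:
  fixes g h :: "'a \<Rightarrow> complex"
  assumes [measurable]: "g \<in> borel_measurable M" "h \<in> borel_measurable M"
    and i: "integrable M (\<lambda>x. norm (g x) * exp (norm (h x)))"
  shows "(\<lambda>k. \<integral>x. g x * h x ^ k / fact k \<partial>M) sums (\<integral>x. g x * exp (h x) \<partial>M)"
    and "integrable M (\<lambda>x. g x * exp (h x))" "integrable M (\<lambda>x. g x * h x ^ k / fact k)"
proof -
  have term_le: "norm (h x ^ k / fact k) \<le> exp (norm (h x))" for x k
  proof -
    have "(\<Sum>i\<in>{k}. norm (h x) ^ i /\<^sub>R fact i) \<le> (\<Sum>i. norm (h x) ^ i /\<^sub>R fact i)"
      by (rule sum_le_suminf[OF summable_exp_generic]) auto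
    then show ?thesis by (simp add: exp_def divide_inverse mult.commute norm_mult norm_power norm_inverse)
  qed
  show ik: "integrable M (\<lambda>x. g x * h x ^ k / fact k)" for k
  proof (rule Bochner_Integration.integrable_bound[OF i])
    show "AE x in M. norm (g x * h x ^ k / fact k) \<le> norm (norm (g x) * exp (norm (h x)))"
    proof (rule AE_I2)
      fix x
      have "norm (g x * h x ^ k / fact k) = norm (g x) * norm (h x ^ k / fact k)" by (simp add: norm_mult norm_divide)
      also have "\<dots> \<le> norm (g x) * exp (norm (h x))" by (intro mult_left_mono term_le) auto
      finally show "norm (g x * h x ^ k / fact k) \<le> norm (norm (g x) * exp (norm (h x)))" by simp
    qed
  qed measurable
  show "integrable M (\<lambda>x. g x * exp (h x))"
    by (rule Bochner_Integration.integrable_bound[OF i]) (auto simp: norm_mult norm_exp intro!: mult_left_mono complex_Re_le_cmod AE_I2)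
  have "(\<lambda>N. \<integral>x. (\<Sum>k<N. g x * h x ^ k / fact k) \<partial>M) \<longlonglongrightarrow> (\<integral>x. g x * exp (h x) \<partial>M)"
  proof (rule integral_dominated_convergence[OF _ _ i])
    show "AE x in M. (\<lambda>N. \<Sum>k<N. g x * h x ^ k / fact k) \<longlonglongrightarrow> g x * exp (h x)"
    proof (rule AE_I2)
      fix x
      have "(\<lambda>k. g x * (h x ^ k /\<^sub>R fact k)) sums (g x * exp (h x))" by (intro sums_mult exp_converges)
      then show "(\<lambda>N. \<Sum>k<N. g x * h x ^ k / fact k) \<longlonglongrightarrow> g x * exp (h x)"
        by (simp add: sums_def scaleR_conv_of_real field_simps)
    qed
    fix N
    show "AE x in M. norm (\<Sum>k<N. g x * h x ^ k / fact k) \<le> norm (g x) * exp (norm (h x))"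
    proof (rule AE_I2)
      fix x
      have "norm (\<Sum>k<N. g x * h x ^ k / fact k) \<le> (\<Sum>k<N. norm (g x) * (norm (h x) ^ k /\<^sub>R fact k))"
        by (rule sum_norm_le) (simp add: norm_mult norm_divide norm_power norm_inverse divide_inverse mult_ac)
      also have "\<dots> = norm (g x) * (\<Sum>k<N. norm (h x) ^ k /\<^sub>R fact k)" by (simp add: sum_distrib_left)
      also have "\<dots> \<le> norm (g x) * exp (norm (h x))"
        unfolding exp_def by (intro mult_left_mono sum_le_suminf[OF summable_exp_generic]) auto
      finally show "norm (\<Sum>k<N. g x * h x ^ k / fact k) \<le> norm (g x) * exp (norm (h x))" .
    qed
  qed measurable
  moreover have "(\<integral>x. (\<Sum>k<N. g x * h x ^ k / fact k) \<partial>M) = (\<Sum>k<N. \<integral>x. g x * h x ^ k / fact k \<partial>M)" for N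
    by (rule Bochner_Integration.integral_sum) (rule ik)
  ultimately show "(\<lambda>k. \<integral>x. g x * h x ^ k / fact k \<partial>M) sums (\<integral>x. g x * exp (h x) \<partial>M)"
    by (simp add: sums_def)
qed

section \<open>Moments of complex Gaussians\<close>

definition cg :: "complex \<Rightarrow> nat \<Rightarrow> complex" where
  "cg a k = (\<integral>x. of_real x ^ k * exp (- a * of_real x ^ 2) \<partial>lborel)"

lemma norm_exp_gauss: "norm (exp (- a * (of_real x :: complex)\<^sup>2)) = exp (- Re a * x\<^sup>2)"
  by (simp add: norm_exp)

lemma cg_integrable:
  assumes "Re a > 0" shows "integrable lborel (\<lambda>x. of_real x ^ k * exp (- a * (of_real x :: complex) ^ 2))"
proof (rule integrable_gauss_dom[OF _ assms, where B=1 and k=k and c=0])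
  show "(\<lambda>x. of_real x ^ k * exp (- a * (of_real x :: complex) ^ 2)) \<in> borel_measurable borel"
    by (intro borel_measurable_continuous_onI continuous_intros)
qed (simp add: norm_mult norm_power norm_exp)

text \<open>The derivative of x^k exp(-a x^2) integrates to 0. For k = 0 the truncated index
  \<open>k - 1\<close> is harmless because its coefficient is 0.\<close>

lemma cg_rec: "Re a > 0 \<Longrightarrow> 2 * a * cg a (Suc k) = of_nat k * cg a (k - 1)"
proof -
  assume a: "Re a > 0"
  let ?e = "\<lambda>x. exp (- a * (complex_of_real x) ^ 2)"
  let ?F = "\<lambda>x. complex_of_real x ^ k * ?e x"
  let ?f = "\<lambda>x. of_nat k * (complex_of_real x ^ (k - 1) * ?e x) - 2 * a * (of_real x ^ Suc k * ?e x)"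
  have "(\<integral>x. ?f x \<partial>lborel) = 0"
  proof (rule integral_derivative_zero)
    show "(?F has_vector_derivative ?f x) (at x)" for x
    proof -
      have "((\<lambda>z. z ^ k * exp (- a * z ^ 2)) has_field_derivative
          (of_nat k * (z ^ (k - 1) * exp (- a * z ^ 2)) - 2 * a * (z ^ Suc k * exp (- a * z ^ 2)))) (at z)" for z
        by (auto intro!: derivative_eq_intros simp: algebra_simps power2_eq_square)
      from this[of "of_real x"] show ?thesis
        by (rule has_vector_derivative_real_field)
    qed
    show "continuous_on UNIV ?f" by (intro continuous_intros)
    show "integrable lborel ?f"
      by (intro Bochner_Integration.integrable_diff integrable_mult_right cg_integrable a)
    show "(?F \<longlongrightarrow> 0) at_top" "(?F \<longlongrightarrow> 0) at_bot"
      by (rule tendsto_gauss_dom[OF a, where B=1 and k=k and c=0]; simp add: norm_mult norm_power norm_exp)+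
  qed
  moreover have "(\<integral>x. ?f x \<partial>lborel) = of_nat k * cg a (k - 1) - 2 * a * cg a (Suc k)"
    unfolding cg_def
    by (subst Bochner_Integration.integral_diff[OF integrable_mult_right[OF cg_integrable[OF a]] integrable_mult_right[OF cg_integrable[OF a]]])
       (simp only: integral_mult_right_zero)
  ultimately show ?thesis by simp
qed

lemma cg_even:
  assumes a: "Re a > 0" shows "cg a (2 * k) = fact (2 * k) / (fact k * (4 * a) ^ k) * cg a 0"
proof (induction k)
  case (Suc k)
  have a0: "a \<noteq> 0" using a by auto
  have "2 * a * cg a (Suc (Suc (2 * k))) = of_nat (Suc (2 * k)) * cg a (2 * k)"
    using cg_rec[OF a, of "Suc (2 * k)"] by simp
  then have "cg a (2 * Suc k) = of_nat (Suc (2 * k)) / (2 * a) * cg a (2 * k)"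
    using a0 by (simp add: field_simps)
  also have "\<dots> = (of_nat (Suc (2 * k)) / (2 * a)) * (fact (2 * k) / (fact k * (4 * a) ^ k)) * cg a 0"
    unfolding Suc by simp
  also have "(of_nat (Suc (2 * k)) / (2 * a)) * (fact (2 * k) / (fact k * (4 * a) ^ k)) =
      fact (2 * Suc k) / (fact (Suc k) * (4 * a) ^ Suc k)"
  proof -
    have f: "(fact (2 * Suc k) :: complex) = of_nat (2 * Suc k) * of_nat (Suc (2 * k)) * fact (2 * k)"
      by (simp add: algebra_simps)
    have g: "(fact (Suc k) :: complex) = of_nat (Suc k) * fact k" by simp
    have s: "(of_nat (2 * Suc k) :: complex) = 2 * of_nat (Suc k)" by (simp only: of_nat_mult of_nat_numeral)
    have "(of_nat (Suc k) :: complex) \<noteq> 0" by (simp only: of_nat_eq_0_iff)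
    then show ?thesis using a0 unfolding f g s power_Suc by (simp add: divide_simps del: of_nat_Suc)
  qed
  finally show ?case .
qed simp

lemma cg_odd: assumes a: "Re a > 0" shows "cg a (Suc (2 * k)) = 0"
proof (induction k)
  case 0
  show ?case using cg_rec[OF a, of 0] a by auto
next
  case (Suc k)
  show ?case using cg_rec[OF a, of "Suc (Suc (2 * k))"] Suc a by auto
qed

text \<open>For complex b a real translation cannot complete the square. Instead exp(b x) is
  expanded: odd moments vanish, and the even ones reassemble into an exponential series.\<close>

lemma cg_shift:
  assumes a: "Re a > 0"
  shows "(\<integral>x. exp (b * of_real x - a * of_real x ^ 2) \<partial>lborel) = cg a 0 * exp (b\<^sup>2 / (4 * a))"
    and "integrable lborel (\<lambda>x. exp (b * of_real x - a * of_real x ^ 2))"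
proof -
  have a0: "a \<noteq> 0" using a by auto
  let ?g = "\<lambda>x. exp (- a * (complex_of_real x) ^ 2)" let ?h = "\<lambda>x. b * complex_of_real x"
  have m: "?g \<in> borel_measurable lborel" "?h \<in> borel_measurable lborel"
    by (auto intro!: borel_measurable_continuous_onI continuous_intros)
  have i: "integrable lborel (\<lambda>x. norm (?g x) * exp (norm (?h x)))"
  proof (rule integrable_gauss_dom[OF _ a, where B=1 and k=0 and c="norm b"])
    show "(\<lambda>x. norm (?g x) * exp (norm (?h x))) \<in> borel_measurable borel"
      by (intro borel_measurable_continuous_onI continuous_intros)
  qed (simp add: norm_mult norm_exp flip: exp_add)
  have e: "?g x * exp (?h x) = exp (b * of_real x - a * of_real x ^ 2)" for x by (simp flip: exp_add)
  show "integrable lborel (\<lambda>x. exp (b * of_real x - a * of_real x ^ 2))"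
    using integral_exp_series(2)[OF m i] unfolding e .
  have t: "(\<integral>x. ?g x * ?h x ^ k / fact k \<partial>lborel) = b ^ k / fact k * cg a k" for k
    unfolding cg_def by (subst integral_mult_right_zero[symmetric]) (simp add: power_mult_distrib mult_ac)
  from integral_exp_series(1)[OF m i] have s: "(\<lambda>k. b ^ k / fact k * cg a k) sums (\<integral>x. exp (b * of_real x - a * of_real x ^ 2) \<partial>lborel)"
    unfolding t e .
  have "(\<lambda>k. b ^ (2 * k) / fact (2 * k) * cg a (2 * k)) sums (\<integral>x. exp (b * of_real x - a * of_real x ^ 2) \<partial>lborel)"
  proof (subst sums_mono_reindex[of "\<lambda>k. 2 * k" "\<lambda>k. b ^ k / fact k * cg a k"])
    show "strict_mono (times (2::nat))" by (auto simp: strict_mono_def)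
    fix n :: nat assume "n \<notin> range (times 2)"
    then obtain k where "n = Suc (2 * k)" by (metis oddE evenE rangeI Suc_eq_plus1)
    then show "b ^ n / fact n * cg a n = 0" using cg_odd[OF a] by simp
  qed (rule s)
  moreover have "b ^ (2 * k) / fact (2 * k) * cg a (2 * k) = cg a 0 * ((b\<^sup>2 / (4 * a)) ^ k /\<^sub>R fact k)" for k
  proof -
    have p: "(b\<^sup>2) ^ k = b ^ (2 * k)" by (simp add: power_mult)
    show ?thesis unfolding cg_even[OF a] power_divide p by (simp add: scaleR_conv_of_real divide_simps)
  qed
  moreover have "(\<lambda>k. cg a 0 * ((b\<^sup>2 / (4 * a)) ^ k /\<^sub>R fact k)) sums (cg a 0 * exp (b\<^sup>2 / (4 * a)))"
    by (intro sums_mult exp_converges)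
  ultimately show "(\<integral>x. exp (b * of_real x - a * of_real x ^ 2) \<partial>lborel) = cg a 0 * exp (b\<^sup>2 / (4 * a))"
    using sums_unique2 by (simp only:) blast
qed

lemma cg_real: "r > 0 \<Longrightarrow> cg (of_real r) 0 = of_real (sqrt (pi / r))"
proof -
  assume r: "r > 0"
  have "cg (of_real r) 0 = (\<integral>x. complex_of_real (exp (- r * x\<^sup>2)) \<partial>lborel)"
    unfolding cg_def by (simp add: exp_of_real[symmetric])
  also have "\<dots> = of_real (\<integral>x. exp (- r * x\<^sup>2) \<partial>lborel)" by (rule integral_complex_of_real)
  finally show ?thesis using gauss_real(2)[OF r] by simp
qed

lemma gbinomial_half:
  "((- 1 / 2 :: complex) gchoose k) = (- 1) ^ k * fact (2 * k) / (4 ^ k * fact k * fact k)"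
proof (induction k)
  case (Suc k)
  have "of_nat (Suc k) * ((- 1 / 2 :: complex) gchoose (Suc k)) = (- 1 / 2 - of_nat k) * ((- 1 / 2) gchoose k)"
    unfolding left_diff_distrib gbinomial_mult_1[of "- 1 / 2 :: complex" k] by simp
  moreover have n: "(of_nat (Suc k) :: complex) \<noteq> 0" by (simp only: of_nat_eq_0_iff)
  ultimately have "((- 1 / 2 :: complex) gchoose (Suc k)) = (- 1 / 2 - of_nat k) / of_nat (Suc k) * ((- 1 / 2) gchoose k)"
    by (simp add: field_simps del: of_nat_Suc)
  also have "\<dots> = (- 1) ^ Suc k * fact (2 * Suc k) / (4 ^ Suc k * fact (Suc k) * fact (Suc k))"
  proof -
    have f: "(fact (2 * Suc k) :: complex) = 2 * of_nat (Suc k) * of_nat (Suc (2 * k)) * fact (2 * k)"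
      by (simp add: algebra_simps)
    have g: "(fact (Suc k) :: complex) = of_nat (Suc k) * fact k" by simp
    have h: "(- 1 / 2 - of_nat k :: complex) = - of_nat (Suc (2 * k)) / 2" by (simp add: field_simps)
    show ?thesis using n unfolding Suc f g h power_Suc by (simp add: divide_simps del: of_nat_Suc)
  qed
  finally show ?case .
qed simp

text \<open>Continuation from a real parameter r: exp((r - a) x^2) is expanded, and the even moments
  at r form the binomial series with exponent -1/2. The statement is squared so that no branch of
  the root has to be named.\<close>

lemma cg_square:
  assumes a: "Re a > 0" shows "cg a 0 ^ 2 = of_real pi / a"
proof -
  have a0: "a \<noteq> 0" using a by auto
  \<comment> \<open>With this r the squared distance from a to r is r^2 - |a|^2, so a lies in the
    disc of convergence around r.\<close>
  define r where "r = (norm a)\<^sup>2 / Re a"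
  have r: "r > 0" unfolding r_def using a a0 by simp
  define d where "d = norm (of_real r - a)"
  have "d\<^sup>2 = r\<^sup>2 - 2 * r * Re a + (norm a)\<^sup>2"
    unfolding d_def cmod_power2 by (simp add: power2_eq_square algebra_simps)
  also have "\<dots> = r\<^sup>2 - (norm a)\<^sup>2" using a by (simp add: r_def)
  finally have "d\<^sup>2 < r\<^sup>2" using a0 by simp
  then have d: "d < r" using r by (simp add: power_less_imp_less_base)
  let ?g = "\<lambda>x. exp (- of_real r * (complex_of_real x) ^ 2)" let ?h = "\<lambda>x. (of_real r - a) * (complex_of_real x)\<^sup>2"
  have m: "?g \<in> borel_measurable lborel" "?h \<in> borel_measurable lborel"
    by (auto intro!: borel_measurable_continuous_onI continuous_intros)
  have i: "integrable lborel (\<lambda>x. norm (?g x) * exp (norm (?h x)))"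
  proof (rule integrable_gauss_dom[of _ "r - d", where B=1 and k=0 and c=0])
    show "(\<lambda>x. norm (?g x) * exp (norm (?h x))) \<in> borel_measurable borel"
      by (intro borel_measurable_continuous_onI continuous_intros)
    show "norm (norm (?g x) * exp (norm (?h x))) \<le> 1 * \<bar>x\<bar> ^ 0 * exp (0 * \<bar>x\<bar> - (r - d) * x\<^sup>2)" for x
    proof -
      have h: "norm (?h x) = d * x\<^sup>2" by (simp add: norm_mult norm_power d_def)
      show ?thesis unfolding h by (simp add: norm_exp left_diff_distrib flip: exp_add)
    qed
  qed (use d in simp)
  have e: "?g x * exp (?h x) = of_real x ^ 0 * exp (- a * of_real x ^ 2)" for x by (simp add: algebra_simps flip: exp_add)
  have t: "(\<integral>x. ?g x * ?h x ^ k / fact k \<partial>lborel) = (of_real r - a) ^ k / fact k * cg (of_real r) (2 * k)" for k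
  proof -
    have "?g x * ?h x ^ k / fact k = (of_real r - a) ^ k / fact k * (of_real x ^ (2 * k) * ?g x)" for x
      by (simp add: power_mult_distrib power_mult)
    then show ?thesis unfolding cg_def by (simp only: integral_mult_right_zero)
  qed
  from integral_exp_series(1)[OF m i] have s: "(\<lambda>k. (of_real r - a) ^ k / fact k * cg (of_real r) (2 * k)) sums cg a 0"
    unfolding t e cg_def[symmetric] .
  define z where "z = (a - of_real r) / of_real r"
  have nz: "norm z < 1" using d r unfolding z_def d_def by (simp add: norm_divide norm_minus_commute)
  have "(of_real r - a) ^ k / fact k * cg (of_real r) (2 * k) = cg (of_real r) 0 * (((- 1 / 2) gchoose k) * z ^ k)" for k
  proof -
    have u: "(of_real r - a) ^ k = (- 1) ^ k * (a - of_real r) ^ k" by (simp flip: power_mult_distrib)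
    have c: "cg (of_real r) (2 * k) = fact (2 * k) / (fact k * (4 * of_real r) ^ k) * cg (of_real r) 0"
      by (rule cg_even) (use r in simp)
    show ?thesis unfolding c u gbinomial_half z_def power_divide power_mult_distrib using r by (simp add: divide_simps)
  qed
  moreover have "(\<lambda>k. cg (of_real r) 0 * (((- 1 / 2) gchoose k) * z ^ k)) sums (cg (of_real r) 0 * (1 + z) powr (- 1 / 2))"
    by (intro sums_mult gen_binomial_complex nz)
  ultimately have eq: "cg a 0 = cg (of_real r) 0 * (1 + z) powr (- 1 / 2)" using s sums_unique2 by (simp only:) blast
  have z1: "1 + z = a / of_real r" using r by (simp add: z_def field_simps)
  have "((1 + z) powr (- 1 / 2)) ^ 2 = of_real r / a"
  proof -
    have n0: "a / of_real r \<noteq> 0" using a0 r by simp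
    have "((a / of_real r) powr (- 1 / 2)) ^ 2 = exp (- Ln (a / of_real r))"
      using n0 by (simp add: powr_def power2_eq_square flip: exp_add)
    also have "\<dots> = of_real r / a" using n0 by (simp add: exp_minus exp_Ln)
    finally show ?thesis unfolding z1 .
  qed
  moreover have "cg (of_real r) 0 ^ 2 = of_real (pi / r)"
    unfolding cg_real[OF r] using r by (simp flip: of_real_power)
  ultimately show ?thesis unfolding eq power_mult_distrib using r by simp
qed

text \<open>Closed under products, under multiplication by x and under differentiation, so
  integration by parts becomes algebra with polynomials.\<close>

definition pg :: "complex poly \<Rightarrow> complex \<Rightarrow> real \<Rightarrow> complex" where
  "pg p z x = poly p (of_real x) * exp (- z * of_real x ^ 2)"

lemma poly_exp_bound:
  fixes p :: "'a :: real_normed_field poly"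
  obtains B where "B \<ge> 0" "\<And>z. norm (poly p z) \<le> B * exp (norm z)"
proof
  let ?B = "\<Sum>i\<le>degree p. norm (coeff p i) * fact i"
  show "?B \<ge> 0" by (intro sum_nonneg) auto
  fix z :: 'a
  have f: "norm z ^ i \<le> fact i * exp (norm z)" for i
  proof -
    have "(\<Sum>i\<in>{i}. norm z ^ i /\<^sub>R fact i) \<le> (\<Sum>i. norm z ^ i /\<^sub>R fact i)"
      by (rule sum_le_suminf[OF summable_exp_generic]) auto
    then show ?thesis by (simp add: exp_def divide_inverse[symmetric] field_simps)
  qed
  have "norm (poly p z) \<le> (\<Sum>i\<le>degree p. norm (coeff p i) * (fact i * exp (norm z)))"
    unfolding poly_altdef
    by (rule sum_norm_le) (auto simp: norm_mult norm_power intro!: mult_left_mono f)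
  then show "norm (poly p z) \<le> ?B * exp (norm z)" by (simp add: sum_distrib_right mult.assoc)
qed

lemma pg_bound:
  obtains B where "B \<ge> 0" "\<And>x. norm (pg p z x) \<le> B * \<bar>x\<bar> ^ 0 * exp (1 * \<bar>x\<bar> - Re z * x\<^sup>2)"
proof -
  obtain B where B: "B \<ge> 0" "\<And>z. norm (poly p z) \<le> B * exp (norm z)" using poly_exp_bound[of p] by metis
  have "norm (pg p z x) \<le> B * \<bar>x\<bar> ^ 0 * exp (1 * \<bar>x\<bar> - Re z * x\<^sup>2)" for x
  proof -
    have "norm (pg p z x) = norm (poly p (of_real x)) * exp (- Re z * x\<^sup>2)"
      unfolding pg_def norm_mult norm_exp_gauss ..
    also have "\<dots> \<le> (B * exp \<bar>x\<bar>) * exp (- Re z * x\<^sup>2)"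
      using B(2)[of "of_real x"] by (intro mult_right_mono) auto
    also have "\<dots> = B * exp (\<bar>x\<bar> + - Re z * x\<^sup>2)" by (simp only: exp_add mult.assoc)
    finally show ?thesis by simp
  qed
  then show ?thesis using B(1) that by blast
qed

lemma pg_continuous: "continuous_on A (pg p z)"
  unfolding pg_def by (intro continuous_intros)

lemma pg_measurable [measurable]: "pg p z \<in> borel_measurable borel"
  by (rule borel_measurable_continuous_onI[OF pg_continuous])

lemma pg_integrable: assumes "Re z > 0" shows "integrable lborel (pg p z)"
proof -
  obtain B where "\<And>x. norm (pg p z x) \<le> B * \<bar>x\<bar> ^ 0 * exp (1 * \<bar>x\<bar> - Re z * x\<^sup>2)"
    using pg_bound[of p z] by metis
  from integrable_gauss_dom[OF pg_measurable assms this] show ?thesis .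
qed

lemma pg_tendsto: assumes "Re z > 0" shows "(pg p z \<longlongrightarrow> 0) at_top" "(pg p z \<longlongrightarrow> 0) at_bot"
proof -
  obtain B where "\<And>x. norm (pg p z x) \<le> B * \<bar>x\<bar> ^ 0 * exp (1 * \<bar>x\<bar> - Re z * x\<^sup>2)"
    using pg_bound[of p z] by metis
  from tendsto_gauss_dom[OF assms this] show "(pg p z \<longlongrightarrow> 0) at_top" "(pg p z \<longlongrightarrow> 0) at_bot" by auto
qed

lemma pg_mult: "pg p z x * pg q w x = pg (p * q) (z + w) x"
  unfolding pg_def by (simp add: exp_add[symmetric] algebra_simps)

lemma pg_smult: "pg (Polynomial.smult c p) z x = c * pg p z x"
  by (simp add: pg_def)

lemma pg_deriv: "(pg p z has_vector_derivative pg (pderiv p - [:0, 2 * z:] * p) z x) (at x)"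
proof -
  have "((\<lambda>w. poly p w * exp (- z * w ^ 2)) has_field_derivative
     (poly (pderiv p - [:0, 2 * z:] * p) w * exp (- z * w ^ 2))) (at w)" for w
    by (auto intro!: derivative_eq_intros simp: algebra_simps power2_eq_square)
  from has_vector_derivative_real_field[OF this[of "of_real x"]]
  show ?thesis unfolding pg_def .
qed

lemma pg_l2: assumes "Re z > 0" shows "l2 (pg p z)"
  unfolding l2_def
proof
  obtain B where B: "B \<ge> 0" "\<And>x. norm (pg p z x) \<le> B * \<bar>x\<bar> ^ 0 * exp (1 * \<bar>x\<bar> - Re z * x\<^sup>2)"
    using pg_bound[of p z] by metis
  show "integrable lborel (\<lambda>x. (norm (pg p z x))\<^sup>2)"
  proof (rule integrable_gauss_dom[of _ "2 * Re z"])
    fix x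
    have "(norm (pg p z x))\<^sup>2 \<le> (B * \<bar>x\<bar> ^ 0 * exp (1 * \<bar>x\<bar> - Re z * x\<^sup>2))\<^sup>2" by (intro power_mono B) auto
    also have "\<dots> = B\<^sup>2 * \<bar>x\<bar> ^ 0 * exp (2 * \<bar>x\<bar> - 2 * Re z * x\<^sup>2)"
      by (simp add: power_mult_distrib power2_eq_square[of "exp _"] algebra_simps flip: exp_add)
    finally show "norm ((norm (pg p z x))\<^sup>2) \<le> B\<^sup>2 * \<bar>x\<bar> ^ 0 * exp (2 * \<bar>x\<bar> - 2 * Re z * x\<^sup>2)" by simp
  qed (use assms in \<open>simp_all add: pg_measurable\<close>)
qed (simp add: pg_measurable)

lemma pg_integral_deriv: "Re z > 0 \<Longrightarrow> (\<integral>x. pg (pderiv p - [:0, 2 * z:] * p) z x \<partial>lborel) = 0"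
  by (rule integral_derivative_zero[OF pg_deriv]) (auto simp: pg_continuous pg_integrable pg_tendsto)

section \<open>Physicists' Hermite polynomials and Hermite functions\<close>

primrec hp :: "nat \<Rightarrow> complex poly" where
  "hp 0 = 1"
| "hp (Suc m) = [:0, 2:] * hp m - pderiv (hp m)"

lemma pderiv_hp: "pderiv (hp (Suc m)) = Polynomial.smult (2 * of_nat (Suc m)) (hp m)"
proof (induction m)
  case 0
  show ?case by (simp add: pderiv_pCons one_pCons)
next
  case (Suc m)
  have "pderiv (hp (Suc (Suc m))) = pderiv ([:0, 2:] * hp (Suc m)) - pderiv (pderiv (hp (Suc m)))"
    by (simp only: hp.simps(2)[of "Suc m"] pderiv_diff)
  also have "pderiv ([:0, 2:] * hp (Suc m)) = Polynomial.smult 2 (hp (Suc m)) + [:0, 2:] * pderiv (hp (Suc m))"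
    by (simp only: pderiv_mult) (simp add: pderiv_pCons mult.commute)
  also have "[:0, 2:] * pderiv (hp (Suc m)) = Polynomial.smult (2 * of_nat (Suc m)) ([:0, 2:] * hp m)"
    by (simp only: Suc mult_smult_right)
  also have "pderiv (pderiv (hp (Suc m))) = Polynomial.smult (2 * of_nat (Suc m)) (pderiv (hp m))"
    by (simp only: Suc pderiv_smult)
  also have "Polynomial.smult 2 (hp (Suc m)) + Polynomial.smult (2 * of_nat (Suc m)) ([:0, 2:] * hp m) - Polynomial.smult (2 * of_nat (Suc m)) (pderiv (hp m))
     = Polynomial.smult 2 (hp (Suc m)) + Polynomial.smult (2 * of_nat (Suc m)) (hp (Suc m))"
    by (simp only: hp.simps(2)[of m] smult_diff_right add_diff_eq)
  also have "\<dots> = Polynomial.smult (2 * of_nat (Suc (Suc m))) (hp (Suc m))"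
    by (simp only: smult_add_left[symmetric]) (simp add: algebra_simps)
  finally show ?case .
qed

lemma hp_rec: "hp (Suc (Suc m)) = [:0, 2:] * hp (Suc m) - Polynomial.smult (2 * of_nat (Suc m)) (hp m)"
  using pderiv_hp[of m] by (simp only: hp.simps(2)[of "Suc m"])

lemma hp_x: "[:0, 2:] * hp m = hp (Suc m) + Polynomial.smult (2 * of_nat m) (hp (m - 1))"
proof (cases m)
  case 0
  then show ?thesis by (simp add: one_pCons pderiv_pCons)
next
  case (Suc k)
  show ?thesis unfolding Suc hp_rec[of k] by simp
qed

lemma hp_ode: "pderiv (pderiv (hp m)) - [:0, 2:] * pderiv (hp m) + Polynomial.smult (2 * of_nat m) (hp m) = 0"
proof (cases m)
  case 0
  then show ?thesis by simp
next
  case (Suc k)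
  have "pderiv (pderiv (hp m)) - [:0, 2:] * pderiv (hp m) =
      Polynomial.smult (2 * of_nat (Suc k)) (pderiv (hp k)) - Polynomial.smult (2 * of_nat (Suc k)) ([:0, 2:] * hp k)"
    unfolding Suc by (simp only: pderiv_hp pderiv_smult mult_smult_right)
  also have "\<dots> = - Polynomial.smult (2 * of_nat (Suc k)) (hp (Suc k))"
    by (simp only: hp.simps(2) smult_diff_right minus_diff_eq)
  finally have h: "pderiv (pderiv (hp m)) - [:0, 2:] * pderiv (hp m) = - Polynomial.smult (2 * of_nat (Suc k)) (hp (Suc k))" .
  show ?thesis unfolding h by (simp add: Suc del: hp.simps of_nat_Suc)
qed

lemma hp_real: "cnj (poly (hp m) (of_real x)) = poly (hp m) (of_real x)"
proof (induction m rule: induct_nat_012)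
  case (ge2 m)
  then show ?case unfolding hp_rec[of m] by (simp del: hp.simps)
qed (simp_all add: one_pCons pderiv_pCons)

text \<open>The L2 norm of the unnormalised Hermite function with polynomial
  \<open>hp m\<close>.\<close>

definition hh :: "nat \<Rightarrow> real" where "hh m = sqrt (2 ^ m * fact m * sqrt pi)"

definition hf :: "nat \<Rightarrow> real \<Rightarrow> complex" where
  "hf m = pg (Polynomial.smult (1 / of_real (hh m)) (hp m)) (1 / 2)"

lemma hh_pos: "hh m > 0" by (simp add: hh_def)

lemma hh_sq: "(hh m)\<^sup>2 = 2 ^ m * fact m * sqrt pi" by (simp add: hh_def)

lemma hf_alt: "hf m x = poly (hp m) (of_real x) * exp (- (of_real x)\<^sup>2 / 2) / of_real (hh m)"
  by (simp add: hf_def pg_def)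

lemma hf_real: "cnj (hf m x) = hf m x"
  unfolding hf_alt by (simp add: hp_real exp_cnj)

text \<open>For the weight exp(-x^2) the recursion of \<open>hp\<close> is the adjoint of
  differentiation. Integration by parts moves a derivative to the other factor and lowers both
  indices by one.\<close>

lemma hp_integral:
  "(\<integral>x. pg (hp m * hp n) 1 x \<partial>lborel) = (if m = n then 2 ^ m * fact m * of_real (sqrt pi) else 0)"
proof (induction m arbitrary: n)
  case 0
  have "pg (hp 0 * hp (Suc k)) 1 x = - pg (pderiv (hp k) - [:0, 2 * 1:] * hp k) 1 x" for k x
    by (simp add: pg_def algebra_simps)
  then have 1: "(\<integral>x. pg (hp 0 * hp (Suc k)) 1 x \<partial>lborel) = 0" for k
    using pg_integral_deriv[of 1 "hp k"]
    by (simp only: Bochner_Integration.integral_minus one_complex.simps zero_less_one minus_zero simp_thms)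
  have 2: "(\<integral>x. pg (hp 0 * hp 0) 1 x \<partial>lborel) = of_real (sqrt pi)"
    using cg_real[of 1] by (simp add: pg_def cg_def)
  show ?case using 1 2 by (cases n) auto
next
  case (Suc m)
  have e: "hp (Suc m) * hp n = hp m * pderiv (hp n) - (pderiv (hp m * hp n) - [:0, 2 * 1:] * (hp m * hp n))"
    by (simp add: pderiv_mult algebra_simps)
  have "(\<integral>x. pg (hp (Suc m) * hp n) 1 x \<partial>lborel) =
     (\<integral>x. pg (hp m * pderiv (hp n)) 1 x - pg (pderiv (hp m * hp n) - [:0, 2 * 1:] * (hp m * hp n)) 1 x \<partial>lborel)"
    unfolding e by (simp add: pg_def algebra_simps)
  also have "\<dots> = (\<integral>x. pg (hp m * pderiv (hp n)) 1 x \<partial>lborel)"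
    by (subst Bochner_Integration.integral_diff) (simp_all only: pg_integrable pg_integral_deriv one_complex.simps zero_less_one diff_zero)
  also have "\<dots> = (if Suc m = n then 2 ^ Suc m * fact (Suc m) * of_real (sqrt pi) else 0)"
  proof (cases n)
    case 0
    then show ?thesis by (simp add: pg_def)
  next
    case (Suc k)
    have "(\<integral>x. pg (hp m * pderiv (hp n)) 1 x \<partial>lborel) = 2 * of_nat (Suc k) * (\<integral>x. pg (hp m * hp k) 1 x \<partial>lborel)"
      unfolding Suc pderiv_hp by (simp only: mult_smult_right pg_smult integral_mult_right_zero)
    then show ?thesis using Suc.IH[of k] Suc by (simp del: of_nat_Suc)
  qed
  finally show ?case .
qed

lemma hf_l2: "l2 (hf m)" unfolding hf_def by (rule pg_l2) simp

lemma hf_sp: "sp (hf m) (hf n) = (if m = n then 1 else 0)"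
proof -
  have "sp (hf m) (hf n) = (\<integral>x. pg (hp m * hp n) 1 x * (1 / of_real (hh m * hh n)) \<partial>lborel)"
    unfolding sp_def hf_real by (simp add: hf_def pg_mult) (simp add: pg_def mult_ac)
  also have "\<dots> = (if m = n then 2 ^ m * fact m * of_real (sqrt pi) else 0) / of_real (hh m * hh n)"
    by (subst integral_mult_left_zero) (simp add: hp_integral)
  also have "\<dots> = (if m = n then 1 else 0)"
  proof (cases "m = n")
    case True
    have "of_real (hh n * hh n) = (of_real (2 ^ n * fact n * sqrt pi) :: complex)"
      using hh_sq[of n] by (simp only: power2_eq_square)
    then show ?thesis using True hh_pos[of n] by simp
  qed simp
  finally show ?thesis .
qed

text \<open>The positive and negative parts of \<open>u\<close> have the same Fourier transform.
  Normalised to probability densities they have equal characteristic functions, so Levy's uniqueness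
  theorem makes them equal.\<close>

lemma fourier_unique:
  fixes u :: "real \<Rightarrow> real"
  assumes u: "integrable lborel u" and z: "\<And>t. (\<integral>x. of_real (u x) * iexp (t * x) \<partial>lborel) = 0"
  shows "AE x in lborel. u x = 0"
proof -
  define P where "P x = max (u x) 0" for x
  define N where "N x = max (- u x) 0" for x
  have [measurable]: "u \<in> borel_measurable borel" using u by auto
  have [measurable]: "P \<in> borel_measurable borel" "N \<in> borel_measurable borel" unfolding P_def N_def by measurable
  have iP: "integrable lborel P" and iN: "integrable lborel N"
    unfolding P_def N_def using u by (auto intro!: integrable_max)
  have PN: "u x = P x - N x" "P x \<ge> 0" "N x \<ge> 0" for x by (auto simp: P_def N_def)
  have ie: "integrable lborel (\<lambda>x. of_real (f x) * iexp (t * x))" if "integrable lborel f" for f :: "real \<Rightarrow> real" and t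
  proof (rule Bochner_Integration.integrable_bound[OF that])
    show "(\<lambda>x. complex_of_real (f x) * iexp (t * x)) \<in> borel_measurable lborel"
      using borel_measurable_integrable[OF that] by measurable
  qed (simp add: norm_mult)
  have eq: "(\<integral>x. of_real (P x) * iexp (t * x) \<partial>lborel) = (\<integral>x. of_real (N x) * iexp (t * x) \<partial>lborel)" for t
  proof -
    have "(\<integral>x. of_real (P x) * iexp (t * x) \<partial>lborel) - (\<integral>x. of_real (N x) * iexp (t * x) \<partial>lborel)
        = (\<integral>x. of_real (u x) * iexp (t * x) \<partial>lborel)"
      by (subst Bochner_Integration.integral_diff[symmetric, OF ie[OF iP] ie[OF iN]]) (simp add: PN(1) algebra_simps)
    then show ?thesis using z by simp
  qed
  define c where "c = (\<integral>x. P x \<partial>lborel)"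
  \<comment> \<open>The transform at 0 shows that both parts have the same mass, so one constant
    normalises both.\<close>
  have cN: "c = (\<integral>x. N x \<partial>lborel)"
    using eq[of 0] by (simp add: c_def)
  show ?thesis
  proof (cases "c = 0")
    case True
    have "AE x in lborel. P x = 0" using integral_nonneg_eq_0_iff_AE[OF iP] PN True by (simp add: c_def)
    moreover have "AE x in lborel. N x = 0" using integral_nonneg_eq_0_iff_AE[OF iN] PN True cN by simp
    ultimately show ?thesis by eventually_elim (simp add: PN(1))
  next
    case False
    have c: "c > 0" using False Bochner_Integration.integral_nonneg[of lborel P] PN by (simp add: c_def less_le)
    have rd: "real_distribution (density lborel (\<lambda>x. ennreal (f x / c)))"
      if f: "integrable lborel f" "\<And>x. f x \<ge> 0" "(\<integral>x. f x \<partial>lborel) = c" for f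
    proof -
      have [measurable]: "f \<in> borel_measurable borel" using f(1) by auto
      have "emeasure (density lborel (\<lambda>x. ennreal (f x / c))) UNIV = (\<integral>\<^sup>+x. ennreal (f x / c) \<partial>lborel)"
        by (simp add: emeasure_density)
      also have "\<dots> = ennreal (\<integral>x. f x / c \<partial>lborel)"
        by (rule nn_integral_eq_integral) (use f c in auto)
      also have "\<dots> = 1" using f c by simp
      finally show ?thesis
        unfolding real_distribution_def real_distribution_axioms_def by (auto intro!: prob_spaceI)
    qed
    have ch: "char (density lborel (\<lambda>x. ennreal (f x / c))) t = (\<integral>x. of_real (f x) * iexp (t * x) \<partial>lborel) / of_real c"
      if f: "integrable lborel f" "\<And>x. f x \<ge> 0" for f t
    proof -
      have [measurable]: "f \<in> borel_measurable borel" using f(1) by auto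
      have "char (density lborel (\<lambda>x. ennreal (f x / c))) t = (\<integral>x. (f x / c) *\<^sub>R iexp (t * x) \<partial>lborel)"
        unfolding char_def by (rule integral_density) (use f c in auto)
      also have "\<dots> = (\<integral>x. (of_real (f x) * iexp (t * x)) / of_real c \<partial>lborel)"
        by (simp add: scaleR_conv_of_real)
      finally show ?thesis by simp
    qed
    have "density lborel (\<lambda>x. ennreal (P x / c)) = density lborel (\<lambda>x. ennreal (N x / c))"
    proof (rule Levy_uniqueness)
      show "real_distribution (density lborel (\<lambda>x. ennreal (P x / c)))" by (rule rd) (use iP PN in \<open>auto simp: c_def\<close>)
      show "real_distribution (density lborel (\<lambda>x. ennreal (N x / c)))" by (rule rd) (use iN PN in \<open>auto simp: cN\<close>)
      show "char (density lborel (\<lambda>x. ennreal (P x / c))) = char (density lborel (\<lambda>x. ennreal (N x / c)))"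
        using ch[OF iP] ch[OF iN] PN eq by (intro ext) simp
    qed
    then have "AE x in lborel. ennreal (P x / c) = ennreal (N x / c)"
      by (intro sigma_finite_measure.density_unique[OF sigma_finite_lborel]) auto
    then show ?thesis
      by eventually_elim (use PN c in simp)
  qed
qed

text \<open>Orthogonality to all Hermite functions kills the moments of \<open>g(x)e\<^bsup>-x\<^sup>2/2\<^esup>\<close>, hence its Fourier transform.\<close>

lemma hf_total:
  assumes g: "l2 g" and z: "\<And>m. sp (hf m) g = 0"
  shows "AE x in lborel. g x = 0"
proof -
  note gm [measurable] = l2_meas[OF g]
  have xk: "of_real x ^ k * hf m x = pg (monom 1 k * Polynomial.smult (1 / of_real (hh m)) (hp m)) (1/2) x" for k m x
    by (auto simp: hf_def pg_def poly_monom)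
  have int: "integrable lborel (\<lambda>x. (of_real x ^ k * hf m x) * g x)" for k m
    unfolding xk by (rule l2_mult[OF pg_l2 g]) simp
  have mom: "(\<integral>x. (of_real x ^ k * hf m x) * g x \<partial>lborel) = 0" for k m
  proof (induction k arbitrary: m)
    case 0
    show ?case using z[of m] by (simp add: sp_def hf_real)
  next
    case (Suc k)
    have "of_real x * hf m x = of_real (hh (Suc m) / (2 * hh m)) * hf (Suc m) x + of_real (of_nat m * hh (m - 1) / hh m) * hf (m - 1) x" for x
    proof -
      have "2 * of_real x * poly (hp m) (of_real x) = poly ([:0, 2:] * hp m) (of_real x)" by (simp del: hp.simps)
      also have "\<dots> = poly (hp (Suc m) + Polynomial.smult (2 * of_nat m) (hp (m - 1))) (of_real x)" by (simp only: hp_x)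
      also have "\<dots> = poly (hp (Suc m)) (of_real x) + 2 * of_nat m * poly (hp (m - 1)) (of_real x)" by (simp del: hp.simps)
      finally have two: "2 * of_real x * poly (hp m) (of_real x) = poly (hp (Suc m)) (of_real x) + 2 * of_nat m * poly (hp (m - 1)) (of_real x)" .
      have "of_real x * poly (hp m) (of_real x) = (2 * of_real x * poly (hp m) (of_real x)) / 2" by simp
      also have "\<dots> = poly (hp (Suc m)) (of_real x) / 2 + of_nat m * poly (hp (m - 1)) (of_real x)"
        unfolding two by (simp add: add_divide_distrib del: hp.simps)
      finally have xp: "of_real x * poly (hp m) (of_real x) = poly (hp (Suc m)) (of_real x) / 2 + of_nat m * poly (hp (m - 1)) (of_real x)" .
      have "of_real x * hf m x = (of_real x * poly (hp m) (of_real x)) * exp (- (of_real x)\<^sup>2 / 2) / of_real (hh m)"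
        by (simp add: hf_alt)
      also have "\<dots> = (poly (hp (Suc m)) (of_real x) / 2 + of_nat m * poly (hp (m - 1)) (of_real x)) * exp (- (of_real x)\<^sup>2 / 2) / of_real (hh m)"
        by (simp only: xp)
      also have "\<dots> = of_real (hh (Suc m) / (2 * hh m)) * hf (Suc m) x + of_real (of_nat m * hh (m - 1) / hh m) * hf (m - 1) x"
        unfolding hf_alt using hh_pos[of m] hh_pos[of "Suc m"] hh_pos[of "m - 1"]
        by (simp add: field_simps del: hp.simps)
      finally show ?thesis .
    qed
    then have "(of_real x ^ Suc k * hf m x) * g x = of_real (hh (Suc m) / (2 * hh m)) * ((of_real x ^ k * hf (Suc m) x) * g x)
        + of_real (of_nat m * hh (m - 1) / hh m) * ((of_real x ^ k * hf (m - 1) x) * g x)" for x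
      by (simp add: power_Suc2 mult.assoc del: power_Suc) (simp add: algebra_simps)
    then show ?case
      using Suc by (simp only: Bochner_Integration.integral_add[OF integrable_mult_right[OF int] integrable_mult_right[OF int]] integral_mult_right_zero)
        simp
  qed
  define G where "G x = exp (- (of_real x)\<^sup>2 / 2) * g x" for x
  have Gm [measurable]: "G \<in> borel_measurable borel" unfolding G_def by measurable
  have G0: "G x = of_real (hh 0) * (hf 0 x * g x)" for x
    using hh_pos[of 0] by (simp add: G_def hf_alt)
  have mom': "(\<integral>x. G x * of_real x ^ k \<partial>lborel) = 0" for k
  proof -
    have "(\<integral>x. G x * of_real x ^ k \<partial>lborel) = (\<integral>x. of_real (hh 0) * ((of_real x ^ k * hf 0 x) * g x) \<partial>lborel)"
      unfolding G0 by (simp add: mult_ac)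
    then show ?thesis using mom[of k 0] by (simp only: integral_mult_right_zero) simp
  qed
  have four: "(\<integral>x. G x * iexp (t * x) \<partial>lborel) = 0" for t
  proof -
    have i: "integrable lborel (\<lambda>x. norm (G x) * exp (norm (\<i> * of_real t * complex_of_real x)))"
    proof -
      have "l2 (\<lambda>x. complex_of_real (exp (\<bar>t\<bar> * \<bar>x\<bar> - x\<^sup>2 / 2)))"
        unfolding l2_def
      proof
        show "(\<lambda>x. complex_of_real (exp (\<bar>t\<bar> * \<bar>x\<bar> - x\<^sup>2 / 2))) \<in> borel_measurable lborel" by measurable
        show "integrable lborel (\<lambda>x. (cmod (complex_of_real (exp (\<bar>t\<bar> * \<bar>x\<bar> - x\<^sup>2 / 2))))\<^sup>2)"
          by (rule integrable_gauss_dom[of _ 1 1 0 "2 * \<bar>t\<bar>"])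
             (auto simp: power2_eq_square algebra_simps simp flip: exp_add)
      qed
      note l = l2_norm_mult[OF this g]
      have n: "norm (G x) = exp (- x\<^sup>2 / 2) * norm (g x)" for x
        by (simp add: G_def norm_mult norm_exp)
      have e: "exp (\<bar>t\<bar> * \<bar>x\<bar> - x\<^sup>2 / 2) = exp (- x\<^sup>2 / 2) * exp (\<bar>t\<bar> * \<bar>x\<bar>)" for x
        by (simp flip: exp_add)
      have "norm (G x) * exp (norm (\<i> * of_real t * complex_of_real x)) =
         norm (complex_of_real (exp (\<bar>t\<bar> * \<bar>x\<bar> - x\<^sup>2 / 2))) * norm (g x)" for x
        unfolding n e by (simp add: norm_mult abs_mult)
      then show ?thesis using l by (simp only:)
    qed
    have "(\<lambda>k. \<integral>x. G x * (\<i> * of_real t * of_real x) ^ k / fact k \<partial>lborel) sums (\<integral>x. G x * exp (\<i> * of_real t * of_real x) \<partial>lborel)"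
      by (rule integral_exp_series(1)[OF _ _ i]) measurable
    moreover have "(\<integral>x. G x * (\<i> * of_real t * of_real x) ^ k / fact k \<partial>lborel) = 0" for k
    proof -
      have "(\<integral>x. G x * (\<i> * of_real t * of_real x) ^ k / fact k \<partial>lborel) = (\<integral>x. (\<i> * of_real t) ^ k / fact k * (G x * of_real x ^ k) \<partial>lborel)"
        by (simp add: power_mult_distrib mult_ac)
      then show ?thesis using mom'[of k] by (simp only: integral_mult_right_zero) simp
    qed
    ultimately have "(\<integral>x. G x * exp (\<i> * of_real t * of_real x) \<partial>lborel) = 0"
      using sums_unique2[OF _ sums_zero] by simp
    then show ?thesis by (simp add: mult.assoc)
  qed
  have Gi: "integrable lborel G"
    unfolding G0 using int[of 0 0] by simp
  \<comment> \<open>\<open>fourier_unique\<close> is about real functions; the transform of the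
    conjugate serves to separate real and imaginary part.\<close>
  have four': "(\<integral>x. cnj (G x) * iexp (t * x) \<partial>lborel) = 0" for t
  proof -
    have "(\<integral>x. cnj (G x) * iexp (t * x) \<partial>lborel) = (\<integral>x. cnj (G x * iexp (- t * x)) \<partial>lborel)"
      by (simp add: exp_cnj)
    also have "\<dots> = 0" using four[of "- t"] by (simp only: Bochner_Integration.integral_cnj) simp
    finally show ?thesis .
  qed
  have ie: "integrable lborel (\<lambda>x. f x * iexp (t * x))" if "integrable lborel f" for f :: "real \<Rightarrow> complex" and t
  proof (rule Bochner_Integration.integrable_bound[OF that])
    show "(\<lambda>x. f x * iexp (t * x)) \<in> borel_measurable lborel"
      using borel_measurable_integrable[OF that] by measurable
  qed (simp add: norm_mult)
  have Gc: "integrable lborel (\<lambda>x. cnj (G x))" using Gi by simp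
  have "AE x in lborel. Re (G x) = 0"
  proof (rule fourier_unique)
    fix t
    have "(\<integral>x. of_real (Re (G x)) * iexp (t * x) \<partial>lborel) = (\<integral>x. (G x * iexp (t * x) + cnj (G x) * iexp (t * x)) / 2 \<partial>lborel)"
    proof -
      have "of_real (Re w) = (w + cnj w) / 2" for w :: complex by (simp add: complex_add_cnj)
      then show ?thesis by (simp only: distrib_right add_divide_distrib times_divide_eq_left)
    qed
    also have "\<dots> = 0"
      using four four' by (simp only: integral_divide_zero Bochner_Integration.integral_add[OF ie[OF Gi] ie[OF Gc]]) simp
    finally show "(\<integral>x. of_real (Re (G x)) * iexp (t * x) \<partial>lborel) = 0" .
  qed (use Gi in simp)
  moreover have "AE x in lborel. Im (G x) = 0"
  proof (rule fourier_unique)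
    fix t
    have "(\<integral>x. of_real (Im (G x)) * iexp (t * x) \<partial>lborel) = (\<integral>x. (G x * iexp (t * x) - cnj (G x) * iexp (t * x)) / (2 * \<i>) \<partial>lborel)"
    proof -
      have "of_real (Im w) = (w - cnj w) / (2 * \<i>)" for w :: complex by (simp add: complex_eq_iff)
      then show ?thesis by (simp only: left_diff_distrib diff_divide_distrib times_divide_eq_left)
    qed
    also have "\<dots> = 0"
      using four four' by (simp only: integral_divide_zero Bochner_Integration.integral_diff[OF ie[OF Gi] ie[OF Gc]]) simp
    finally show "(\<integral>x. of_real (Im (G x)) * iexp (t * x) \<partial>lborel) = 0" .
  qed (use Gi in simp)
  ultimately show ?thesis
  proof eventually_elim
    case (elim x)
    then have "G x = 0" by (simp add: complex_eq_iff)
    then show ?case by (simp add: G_def)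
  qed
qed

definition eta :: "real \<Rightarrow> nat \<Rightarrow> real \<Rightarrow> complex" where
  "eta \<rho> m x = of_real (sqrt \<rho>) * hf m (\<rho> * x)"

lemma eta_pg: "eta \<rho> m = pg (Polynomial.smult (of_real (sqrt \<rho> / hh m)) (pcompose (hp m) [:0, of_real \<rho>:])) (of_real (\<rho>\<^sup>2 / 2))"
  by (rule ext) (simp add: eta_def hf_def pg_def poly_pcompose power_mult_distrib mult_ac)

lemma eta_real: "cnj (eta \<rho> m x) = eta \<rho> m x" by (simp add: eta_def hf_real)

lemma l2_basis_eta: assumes r: "\<rho> > 0" shows "l2_basis (eta \<rho>)"
proof
  show l: "l2 (eta \<rho> m)" for m unfolding eta_pg by (rule pg_l2) (use r in simp)
  have aff: "(\<integral>x. f (\<rho> * x) \<partial>lborel) = (\<integral>x. f x \<partial>lborel) / of_real \<rho>" for f :: "real \<Rightarrow> complex"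
    using lborel_integral_real_affine[of \<rho> f 0] r by (simp add: scaleR_conv_of_real)
  have rr: "of_real (sqrt \<rho>) * (of_real (sqrt \<rho>) * w) = of_real \<rho> * w" for w :: complex
    using r by (simp flip: mult.assoc of_real_mult)
  show "sp (eta \<rho> m) (eta \<rho> k) = (if m = k then 1 else 0)" for m k
  proof -
    have "sp (eta \<rho> m) (eta \<rho> k) = (\<integral>x. of_real \<rho> * (cnj (hf m (\<rho> * x)) * hf k (\<rho> * x)) \<partial>lborel)"
      unfolding sp_def eta_def by (simp add: rr mult_ac)
    also have "\<dots> = of_real \<rho> * (sp (hf m) (hf k) / of_real \<rho>)"
      unfolding sp_def by (simp only: integral_mult_right_zero aff[of "\<lambda>x. cnj (hf m x) * hf k x"])
    finally show ?thesis using r by (simp add: hf_sp)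
  qed
  fix g assume g: "l2 g" and z: "\<And>m. sp (eta \<rho> m) g = 0"
  have gm [measurable]: "g \<in> borel_measurable borel" using l2_meas[OF g] .
  have g': "l2 (\<lambda>x. g (x / \<rho>))" unfolding l2_def
  proof
    show "integrable lborel (\<lambda>x. (norm (g (x / \<rho>)))\<^sup>2)"
      using lborel_integrable_real_affine_iff[of "1 / \<rho>" "\<lambda>x. (norm (g x))\<^sup>2" 0] r l2_sq_int[OF g] by simp
  qed simp
  have "sp (hf m) (\<lambda>x. g (x / \<rho>)) = 0" for m
  proof -
    have "sp (eta \<rho> m) g = (\<integral>x. of_real (sqrt \<rho>) * (cnj (hf m (\<rho> * x)) * g ((\<rho> * x) / \<rho>)) \<partial>lborel)"
      unfolding sp_def eta_def using r by (simp add: mult.assoc)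
    also have "\<dots> = of_real (sqrt \<rho>) * (sp (hf m) (\<lambda>x. g (x / \<rho>)) / of_real \<rho>)"
      unfolding sp_def by (simp only: integral_mult_right_zero aff[of "\<lambda>x. cnj (hf m x) * g (x / \<rho>)"])
    finally show ?thesis using z[of m] r by simp
  qed
  from hf_total[OF g' this] have "AE x in lborel. g (x / \<rho>) = 0" .
  from AE_borel_affine[OF _ _ this, of \<rho> 0] show "AE x in lborel. g x = 0" using r by simp
qed

lemma integral_lin3:
  fixes f g h :: "'a \<Rightarrow> complex"
  assumes "integrable M f" "integrable M g" "integrable M h"
  shows "(\<integral>x. a * f x - b * g x - c * h x \<partial>M) = a * (\<integral>x. f x \<partial>M) - b * (\<integral>x. g x \<partial>M) - c * (\<integral>x. h x \<partial>M)"
  using assms by simp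

text \<open>The integral obeys the same three-term recursion as \<open>hp\<close>. Its merit is that
  the index occurs only as an exponent, so that a generating sum over m becomes an exponential
  series.\<close>

lemma hp_repr:
  "poly (hp m) (of_real x) = 2 ^ m / of_real (sqrt pi) * (\<integral>s. pg ([:of_real x, \<i>:] ^ m) 1 s \<partial>lborel)"
proof -
  let ?L = "[:of_real x, \<i>:]"
  define I where "I m = (\<integral>s. pg (?L ^ m) 1 s \<partial>lborel)" for m
  have I0: "I 0 = of_real (sqrt pi)" using cg_real[of 1] by (simp add: I_def pg_def cg_def)
  have rec: "I (Suc m) = of_real x * I m - of_nat m / 2 * I (m - 1)" for m
  proof -
    have d: "pderiv (?L ^ m) = Polynomial.smult (\<i> * of_nat m) (?L ^ (m - 1))"
    proof (cases m)
      case 0 then show ?thesis by simp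
    next
      case (Suc k)
      show ?thesis unfolding Suc pderiv_power_Suc by (simp add: pderiv_pCons mult.commute del: of_nat_Suc)
    qed
    have e: "pg (?L ^ Suc m) 1 s = of_real x * pg (?L ^ m) 1 s - of_nat m / 2 * pg (?L ^ (m - 1)) 1 s
        - \<i> / 2 * pg (pderiv (?L ^ m) - [:0, 2 * 1:] * ?L ^ m) 1 s" for s
      unfolding d by (simp add: pg_def algebra_simps)
    have "I (Suc m) = of_real x * I m - of_nat m / 2 * I (m - 1)
        - \<i> / 2 * (\<integral>s. pg (pderiv (?L ^ m) - [:0, 2 * 1:] * ?L ^ m) 1 s \<partial>lborel)"
      unfolding I_def e
      by (rule integral_lin3) (simp_all add: pg_integrable)
    then show ?thesis using pg_integral_deriv[of 1 "?L ^ m"] by simp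
  qed
  have "poly (hp m) (of_real x) = 2 ^ m / of_real (sqrt pi) * I m"
  proof (induction m rule: induct_nat_012)
    case 0
    show ?case by (simp add: I0)
  next
    case 1
    show ?case using rec[of 0] by (simp add: I0 one_pCons pderiv_pCons)
  next
    case (ge2 m)
    have "poly (hp (Suc (Suc m))) (of_real x) = 2 * of_real x * poly (hp (Suc m)) (of_real x) - 2 * of_nat (Suc m) * poly (hp m) (of_real x)"
      unfolding hp_rec[of m] by (simp del: hp.simps of_nat_Suc)
    also have "\<dots> = 2 ^ Suc (Suc m) / of_real (sqrt pi) * (of_real x * I (Suc m) - of_nat (Suc m) / 2 * I m)"
      unfolding ge2 by (simp add: algebra_simps del: of_nat_Suc)
    also have "of_real x * I (Suc m) - of_nat (Suc m) / 2 * I m = I (Suc (Suc m))"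
      unfolding rec[of "Suc m"] by simp
    finally show ?case .
  qed
  then show ?thesis by (simp add: I_def)
qed

section \<open>Mehler's formula\<close>

definition mehler :: "real \<Rightarrow> real \<Rightarrow> real \<Rightarrow> real" where
  "mehler w x y = 1 / sqrt (pi * (1 - w\<^sup>2)) * exp (- (x\<^sup>2 + y\<^sup>2) * (1 / (1 - w\<^sup>2) - 1 / 2) + 2 * x * y * w / (1 - w\<^sup>2))"

text \<open>With \<open>hp_repr\<close> for both factors the sum is the exponential series of 2w(x +
  is)(y + it) under a double Gaussian integral, which two applications of \<open>cg_shift\<close>
  evaluate.\<close>

lemma mehler_sums:
  assumes w: "0 \<le> w" "w < 1"
  shows "(\<lambda>m. of_real w ^ m * (hf m x * hf m y)) sums of_real (mehler w x y)"
proof -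
  define M2 where "M2 = (lborel :: real measure) \<Otimes>\<^sub>M (lborel :: real measure)"
  let ?g = "\<lambda>(s, t). exp (- (complex_of_real s)\<^sup>2 - (complex_of_real t)\<^sup>2)"
  let ?h = "\<lambda>(s, t). 2 * complex_of_real w * ((of_real x + \<i> * of_real s) * (of_real y + \<i> * of_real t))"
  have w2: "1 - w\<^sup>2 > 0" using w by (simp add: power2_eq_square mult_less_cancel_left2 mult_le_one less_1_mult' abs_square_less_1 flip: power2_eq_square)
  have gm: "?g \<in> borel_measurable M2" unfolding M2_def by measurable
  have hm: "?h \<in> borel_measurable M2" unfolding M2_def by measurable
  have n2: "norm (complex_of_real a + \<i> * of_real b) ^ 2 = a\<^sup>2 + b\<^sup>2" for a b by (simp add: cmod_power2)
  \<comment> \<open>This leaves the factors exp(-(1 - w) s^2) and exp(-(1 - w) t^2) as a dominating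
    function, integrable because w < 1.\<close>
  have nb: "norm (?h (s, t)) \<le> w * (x\<^sup>2 + s\<^sup>2) + w * (y\<^sup>2 + t\<^sup>2)" for s t
  proof -
    let ?a = "norm (complex_of_real x + \<i> * of_real s)" and ?b = "norm (complex_of_real y + \<i> * of_real t)"
    have "norm (?h (s, t)) = w * (2 * ?a * ?b)" using w by (simp add: norm_mult)
    also have "\<dots> \<le> w * (?a\<^sup>2 + ?b\<^sup>2)" using w by (intro mult_left_mono sum_squares_bound) auto
    finally show ?thesis unfolding n2 by (simp add: algebra_simps)
  qed
  have bi: "integrable M2 (\<lambda>(s, t). exp (w * x\<^sup>2 + w * y\<^sup>2) * exp (- (1 - w) * s\<^sup>2) * exp (- (1 - w) * t\<^sup>2))"
    unfolding M2_def
  proof (rule lborel_pair.Fubini_integrable)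
    show "integrable lborel (\<lambda>s. \<integral>t. norm (case (s, t) of (s, t) \<Rightarrow> exp (w * x\<^sup>2 + w * y\<^sup>2) * exp (- (1 - w) * s\<^sup>2) * exp (- (1 - w) * t\<^sup>2)) \<partial>lborel)"
      using gauss_real(1)[of "1 - w"] w by simp
    show "AE s in lborel. integrable lborel (\<lambda>t. case (s, t) of (s, t) \<Rightarrow> exp (w * x\<^sup>2 + w * y\<^sup>2) * exp (- (1 - w) * s\<^sup>2) * exp (- (1 - w) * t\<^sup>2))"
      using gauss_real(1)[of "1 - w"] w by simp
  qed measurable
  have gi: "integrable M2 (\<lambda>p. norm (?g p) * exp (norm (?h p)))"
  proof (rule Bochner_Integration.integrable_bound[OF bi])
    show "(\<lambda>p. norm (?g p) * exp (norm (?h p))) \<in> borel_measurable M2" using gm hm by measurable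
    show "AE p in M2. norm (norm (?g p) * exp (norm (?h p))) \<le> norm (case p of (s, t) \<Rightarrow> exp (w * x\<^sup>2 + w * y\<^sup>2) * exp (- (1 - w) * s\<^sup>2) * exp (- (1 - w) * t\<^sup>2))"
    proof (rule AE_I2)
      fix p :: "real \<times> real" obtain s t where p: "p = (s, t)" by fastforce
      have "norm (?g (s, t)) * exp (norm (?h (s, t))) = exp (- s\<^sup>2 - t\<^sup>2 + norm (?h (s, t)))"
        by (simp add: norm_exp exp_add)
      also have "\<dots> \<le> exp ((w * x\<^sup>2 + w * y\<^sup>2) + (- (1 - w) * s\<^sup>2) + (- (1 - w) * t\<^sup>2))"
        using nb[of s t] by (simp add: algebra_simps)
      also have "\<dots> = exp (w * x\<^sup>2 + w * y\<^sup>2) * exp (- (1 - w) * s\<^sup>2) * exp (- (1 - w) * t\<^sup>2)" by (simp only: exp_add)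
      finally show "norm (norm (?g p) * exp (norm (?h p))) \<le> norm (case p of (s, t) \<Rightarrow> exp (w * x\<^sup>2 + w * y\<^sup>2) * exp (- (1 - w) * s\<^sup>2) * exp (- (1 - w) * t\<^sup>2))"
        by (simp add: p)
    qed
  qed
  note ser = integral_exp_series[OF gm hm gi]
  have trm: "(\<integral>p. ?g p * ?h p ^ k / fact k \<partial>M2) =
     of_real pi * (of_real w ^ k * (poly (hp k) (of_real x) * poly (hp k) (of_real y)) / (2 ^ k * fact k))" for k
  proof -
    have e: "(case (s, t) of p \<Rightarrow> ?g p * ?h p ^ k / fact k) = (2 * of_real w) ^ k / fact k * (pg ([:of_real x, \<i>:] ^ k) 1 s * pg ([:of_real y, \<i>:] ^ k) 1 t)" for s t
    proof -
      have a: "pg ([:of_real z, \<i>:] ^ k) 1 r = (of_real z + \<i> * of_real r) ^ k * exp (- (complex_of_real r)\<^sup>2)" for z r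
        by (simp add: pg_def poly_power mult.commute)
      have ee: "exp (- (complex_of_real s)\<^sup>2 - (complex_of_real t)\<^sup>2) = exp (- (complex_of_real s)\<^sup>2) * exp (- (complex_of_real t)\<^sup>2)"
        by (simp flip: exp_add)
      show ?thesis
        by (simp only: prod.case a ee power_mult_distrib times_divide_eq_left times_divide_eq_right mult_ac)
    qed
    have "(\<integral>p. ?g p * ?h p ^ k / fact k \<partial>M2) = (\<integral>s. \<integral>t. ?g (s, t) * ?h (s, t) ^ k / fact k \<partial>lborel \<partial>lborel)"
      unfolding M2_def by (rule lborel_pair.integral_fst'[OF ser(3)[unfolded M2_def], symmetric])
    also have "\<dots> = (2 * of_real w) ^ k / fact k * ((\<integral>s. pg ([:of_real x, \<i>:] ^ k) 1 s \<partial>lborel) * (\<integral>t. pg ([:of_real y, \<i>:] ^ k) 1 t \<partial>lborel))"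
      using e by (simp only: integral_mult_right_zero integral_mult_left_zero prod.case)
    finally show ?thesis
      unfolding hp_repr by (simp add: power_mult_distrib field_simps flip: of_real_mult)
  qed
  have total: "(\<integral>p. ?g p * exp (?h p) \<partial>M2) =
     of_real (pi / sqrt (1 - w\<^sup>2) * exp ((2 * w * x * y - w\<^sup>2 * x\<^sup>2 - w\<^sup>2 * y\<^sup>2) / (1 - w\<^sup>2)))"
  proof -
    have in1: "(\<integral>t. ?g (s, t) * exp (?h (s, t)) \<partial>lborel) = of_real (sqrt pi) *
        (exp (2 * of_real (w * x * y) - of_real (w\<^sup>2 * x\<^sup>2)) * exp ((2 * \<i> * of_real (w * y - w\<^sup>2 * x)) * of_real s - of_real (1 - w\<^sup>2) * of_real s ^ 2))" for s
    proof -
      let ?z = "complex_of_real x + \<i> * of_real s"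
      have "?g (s, t) * exp (?h (s, t)) = exp (2 * of_real (w * y) * ?z - of_real s ^ 2) * exp ((2 * \<i> * of_real w * ?z) * of_real t - 1 * of_real t ^ 2)" for t
        by (simp add: algebra_simps flip: exp_add)
      then have "(\<integral>t. ?g (s, t) * exp (?h (s, t)) \<partial>lborel) = exp (2 * of_real (w * y) * ?z - of_real s ^ 2) *
          (cg 1 0 * exp ((2 * \<i> * of_real w * ?z)\<^sup>2 / (4 * 1)))"
        by (simp only: integral_mult_right_zero cg_shift one_complex.simps zero_less_one)
      also have "cg 1 0 = of_real (sqrt pi)" using cg_real[of 1] by simp
      also have "exp (2 * of_real (w * y) * ?z - of_real s ^ 2) * (of_real (sqrt pi) * exp ((2 * \<i> * of_real w * ?z)\<^sup>2 / (4 * 1)))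
         = of_real (sqrt pi) * exp (2 * of_real (w * y) * ?z - of_real s ^ 2 + (2 * \<i> * of_real w * ?z)\<^sup>2 / (4 * 1))"
        by (simp only: exp_add mult_ac)
      also have "2 * of_real (w * y) * ?z - of_real s ^ 2 + (2 * \<i> * of_real w * ?z)\<^sup>2 / (4 * 1) =
          (2 * of_real (w * x * y) - of_real (w\<^sup>2 * x\<^sup>2)) + ((2 * \<i> * of_real (w * y - w\<^sup>2 * x)) * of_real s - of_real (1 - w\<^sup>2) * of_real s ^ 2)"
      proof -
        have "(2 * \<i> * of_real w * ?z)\<^sup>2 / (4 * 1) = - (of_real (w\<^sup>2) * ?z\<^sup>2)" by (simp add: power_mult_distrib)
        moreover have "?z\<^sup>2 = of_real (x\<^sup>2) - of_real (s\<^sup>2) + 2 * \<i> * of_real (x * s)"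
          by (simp add: power2_eq_square algebra_simps)
        ultimately show ?thesis by (simp add: algebra_simps)
      qed
      finally show ?thesis by (simp only: exp_add)
    qed
    have "(\<integral>p. ?g p * exp (?h p) \<partial>M2) = (\<integral>s. \<integral>t. ?g (s, t) * exp (?h (s, t)) \<partial>lborel \<partial>lborel)"
      unfolding M2_def by (rule lborel_pair.integral_fst'[OF ser(2)[unfolded M2_def], symmetric])
    also have "\<dots> = of_real (sqrt pi) * (exp (2 * of_real (w * x * y) - of_real (w\<^sup>2 * x\<^sup>2)) *
        (cg (of_real (1 - w\<^sup>2)) 0 * exp ((2 * \<i> * of_real (w * y - w\<^sup>2 * x))\<^sup>2 / (4 * of_real (1 - w\<^sup>2)))))"
      unfolding in1 by (subst cg_shift(1)[symmetric]) (use w2 in \<open>simp_all only: integral_mult_right_zero Re_complex_of_real\<close>)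
    also have "cg (of_real (1 - w\<^sup>2)) 0 = of_real (sqrt (pi / (1 - w\<^sup>2)))" by (rule cg_real[OF w2])
    also have "(2 * \<i> * complex_of_real (w * y - w\<^sup>2 * x))\<^sup>2 / (4 * of_real (1 - w\<^sup>2)) = of_real (- ((w * y - w\<^sup>2 * x)\<^sup>2 / (1 - w\<^sup>2)))"
    proof -
      have "(2 * \<i> * complex_of_real a)\<^sup>2 / (4 * of_real d) = of_real (- (a\<^sup>2 / d))" for a d
        by (simp add: power_mult_distrib)
      then show ?thesis by blast
    qed
    also have "2 * complex_of_real (w * x * y) - of_real (w\<^sup>2 * x\<^sup>2) = of_real (2 * w * x * y - w\<^sup>2 * x\<^sup>2)" by simp
    also have "complex_of_real (sqrt pi) * (exp (of_real (2 * w * x * y - w\<^sup>2 * x\<^sup>2)) * (of_real (sqrt (pi / (1 - w\<^sup>2))) * exp (of_real (- ((w * y - w\<^sup>2 * x)\<^sup>2 / (1 - w\<^sup>2))))))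
       = of_real ((sqrt pi * sqrt (pi / (1 - w\<^sup>2))) * exp ((2 * w * x * y - w\<^sup>2 * x\<^sup>2) + (- ((w * y - w\<^sup>2 * x)\<^sup>2 / (1 - w\<^sup>2)))))"
      by (simp only: exp_of_real of_real_mult exp_add mult_ac)
    also have "sqrt pi * sqrt (pi / (1 - w\<^sup>2)) = pi / sqrt (1 - w\<^sup>2)" by (simp add: real_sqrt_divide)
    also have "(2 * w * x * y - w\<^sup>2 * x\<^sup>2) + (- ((w * y - w\<^sup>2 * x)\<^sup>2 / (1 - w\<^sup>2))) = (2 * w * x * y - w\<^sup>2 * x\<^sup>2 - w\<^sup>2 * y\<^sup>2) / (1 - w\<^sup>2)"
      using w2 by (simp add: field_simps power2_eq_square)
    finally show ?thesis .
  qed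
  \<comment> \<open>Collects the two Gaussian weights, the sqrt pi from the norms \<open>hh\<close>,
    and the pi that \<open>trm\<close> carries.\<close>
  define c where "c = exp (- (x\<^sup>2 + y\<^sup>2) / 2) / (pi * sqrt pi)"
  have "(\<lambda>k. of_real c * (of_real pi * (of_real w ^ k * (poly (hp k) (of_real x) * poly (hp k) (of_real y)) / (2 ^ k * fact k)))) sums
     (of_real c * of_real (pi / sqrt (1 - w\<^sup>2) * exp ((2 * w * x * y - w\<^sup>2 * x\<^sup>2 - w\<^sup>2 * y\<^sup>2) / (1 - w\<^sup>2))))"
    using ser(1) unfolding trm total by (rule sums_mult)
  moreover have "of_real c * (of_real pi * (of_real w ^ k * (poly (hp k) (of_real x) * poly (hp k) (of_real y)) / (2 ^ k * fact k)))
      = of_real w ^ k * (hf k x * hf k y)" for k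
  proof -
    have "complex_of_real (hh k) * of_real (hh k) = of_real (2 ^ k * fact k * sqrt pi)"
      using hh_sq[of k] by (simp only: power2_eq_square of_real_mult[symmetric])
    then have "hf k x * hf k y = poly (hp k) (of_real x) * poly (hp k) (of_real y) * (exp (- (of_real x)\<^sup>2 / 2) * exp (- (of_real y)\<^sup>2 / 2)) / of_real (2 ^ k * fact k * sqrt pi)"
      unfolding hf_alt by (simp add: field_simps)
    also have "exp (- (complex_of_real x)\<^sup>2 / 2) * exp (- (of_real y)\<^sup>2 / 2) = of_real (exp (- (x\<^sup>2 + y\<^sup>2) / 2))"
    proof -
      have "- (complex_of_real x)\<^sup>2 / 2 + - (of_real y)\<^sup>2 / 2 = of_real (- (x\<^sup>2 + y\<^sup>2) / 2)"
        by (simp add: field_simps)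
      then show ?thesis by (simp only: exp_add[symmetric] exp_of_real)
    qed
    finally show ?thesis by (simp add: c_def field_simps)
  qed
  moreover have "c * (pi / sqrt (1 - w\<^sup>2) * exp ((2 * w * x * y - w\<^sup>2 * x\<^sup>2 - w\<^sup>2 * y\<^sup>2) / (1 - w\<^sup>2))) = mehler w x y"
  proof -
    have "exp (- (x\<^sup>2 + y\<^sup>2) / 2) * exp ((2 * w * x * y - w\<^sup>2 * x\<^sup>2 - w\<^sup>2 * y\<^sup>2) / (1 - w\<^sup>2)) =
       exp (- (x\<^sup>2 + y\<^sup>2) * (1 / (1 - w\<^sup>2) - 1 / 2) + 2 * x * y * w / (1 - w\<^sup>2))"
    proof -
      have wd: "w\<^sup>2 / (1 - w\<^sup>2) = 1 / (1 - w\<^sup>2) - 1" using w2 by (simp add: field_simps)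
      have "(2 * w * x * y - w\<^sup>2 * x\<^sup>2 - w\<^sup>2 * y\<^sup>2) / (1 - w\<^sup>2) = 2 * x * y * w / (1 - w\<^sup>2) - (x\<^sup>2 + y\<^sup>2) * (w\<^sup>2 / (1 - w\<^sup>2))"
        by (simp add: diff_divide_distrib add_divide_distrib algebra_simps)
      also have "- (x\<^sup>2 + y\<^sup>2) / 2 + \<dots> = - (x\<^sup>2 + y\<^sup>2) * (1 / (1 - w\<^sup>2) - 1 / 2) + 2 * x * y * w / (1 - w\<^sup>2)"
      proof -
        have gen: "- A / 2 + (B - A * (r - 1)) = - A * (r - 1 / 2) + B" for A B r :: real
          by (simp add: algebra_simps)
        show ?thesis unfolding wd by (rule gen)
      qed
      finally show ?thesis unfolding exp_add[symmetric] by (rule arg_cong)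
    qed
    note ex = this
    have "c * (pi / sqrt (1 - w\<^sup>2) * exp ((2 * w * x * y - w\<^sup>2 * x\<^sup>2 - w\<^sup>2 * y\<^sup>2) / (1 - w\<^sup>2))) =
       1 / (sqrt pi * sqrt (1 - w\<^sup>2)) * (exp (- (x\<^sup>2 + y\<^sup>2) / 2) * exp ((2 * w * x * y - w\<^sup>2 * x\<^sup>2 - w\<^sup>2 * y\<^sup>2) / (1 - w\<^sup>2)))"
      unfolding c_def by simp
    then show ?thesis unfolding mehler_def ex real_sqrt_mult .
  qed
  ultimately show ?thesis by (simp only: flip: of_real_mult)
qed

section \<open>Gaussian integrals in several variables and cyclic determinants\<close>

definition qf :: "nat \<Rightarrow> (nat \<Rightarrow> nat \<Rightarrow> complex) \<Rightarrow> (nat \<Rightarrow> real) \<Rightarrow> complex" where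
  "qf n A x = (\<Sum>i<n. \<Sum>j<n. A i j * of_real (x i) * of_real (x j))"

text \<open>Tested on complex vectors although \<open>qf\<close> is evaluated at real ones: the
  Schur complement inherits the bound through a last coordinate that is complex in general.\<close>

definition coercive :: "nat \<Rightarrow> (nat \<Rightarrow> nat \<Rightarrow> complex) \<Rightarrow> real \<Rightarrow> bool" where
  "coercive n A \<delta> \<longleftrightarrow> \<delta> > 0 \<and> (\<forall>z. \<delta> * (\<Sum>i<n. (norm (z i))\<^sup>2) \<le> Re (\<Sum>i<n. \<Sum>j<n. cnj (z i) * A i j * z j))"

abbreviation leb :: "nat \<Rightarrow> (nat \<Rightarrow> real) measure" where
  "leb n \<equiv> Pi\<^sub>M {..<n} (\<lambda>_. lborel)"

interpretation lebp: product_sigma_finite "\<lambda>_ :: nat. lborel :: real measure"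
  by standard

lemma qf_bound: "coercive n A \<delta> \<Longrightarrow> \<delta> * (\<Sum>i<n. (x i)\<^sup>2) \<le> Re (qf n A x)"
  unfolding coercive_def qf_def by (elim conjE allE[of _ "\<lambda>i. of_real (x i)"]) (simp add: mult_ac)

lemma norm_exp_qf: "coercive n A \<delta> \<Longrightarrow> norm (exp (- qf n A x)) \<le> (\<Prod>i<n. exp (- \<delta> * (x i)\<^sup>2))"
  using qf_bound[of n A \<delta> x] by (simp add: norm_exp exp_sum[symmetric] sum_distrib_left sum_negf)

lemma qf_measurable [measurable]: "qf n A \<in> borel_measurable (leb n)"
  unfolding qf_def
  by (intro borel_measurable_sum borel_measurable_times borel_measurable_const measurable_compose[OF _ borel_measurable_of_real] measurable_component_singleton) auto

lemma gauss_prod_integrable: "\<delta> > 0 \<Longrightarrow> integrable (leb n) (\<lambda>x. \<Prod>i<n. exp (- \<delta> * (x i)\<^sup>2))"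
  by (rule lebp.product_integrable_prod) (use gauss_real(1)[of \<delta>] in auto)

lemma qf_integrable:
  assumes c: "coercive n A \<delta>" shows "integrable (leb n) (\<lambda>x. exp (- qf n A x))"
proof (rule Bochner_Integration.integrable_bound[OF gauss_prod_integrable[of \<delta> n]])
  show "AE x in leb n. norm (exp (- qf n A x)) \<le> norm (\<Prod>i<n. exp (- \<delta> * (x i)\<^sup>2))"
    using norm_exp_qf[OF c] by (auto simp: abs_prod)
qed (use c in \<open>auto simp: coercive_def\<close>)

lemma det_schur:
  fixes A :: "nat \<Rightarrow> nat \<Rightarrow> complex"
  assumes a: "A n n \<noteq> 0"
  shows "Determinant.det (mat (Suc n) (Suc n) (\<lambda>(i, j). A i j)) =
    A n n * Determinant.det (mat n n (\<lambda>(i, j). A i j - A i n * A n j / A n n))"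
proof -
  let ?A' = "mat n n (\<lambda>(i, j). A i j - A i n * A n j / A n n)"
  let ?U = "mat n 1 (\<lambda>(i, j). A i n)" let ?D = "mat 1 1 (\<lambda>(i, j). A n n)"
  let ?V = "mat 1 n (\<lambda>(i, j). A n j / A n n)"
  have "mat (Suc n) (Suc n) (\<lambda>(i, j). A i j) =
      four_block_mat ?A' ?U (0\<^sub>m 1 n) ?D * four_block_mat (1\<^sub>m n) (0\<^sub>m n 1) ?V (1\<^sub>m 1)"
  proof (subst mult_four_block_mat)
    show "mat (Suc n) (Suc n) (\<lambda>(i, j). A i j) =
      four_block_mat (?A' * 1\<^sub>m n + ?U * ?V) (?A' * 0\<^sub>m n 1 + ?U * 1\<^sub>m 1) (0\<^sub>m 1 n * 1\<^sub>m n + ?D * ?V) (0\<^sub>m 1 n * 0\<^sub>m n 1 + ?D * 1\<^sub>m 1)"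
      by (rule eq_matI) (use a in \<open>auto simp: scalar_prod_def less_Suc_eq\<close>)
  qed auto
  then have "Determinant.det (mat (Suc n) (Suc n) (\<lambda>(i, j). A i j)) =
     Determinant.det (four_block_mat ?A' ?U (0\<^sub>m 1 n) ?D) * Determinant.det (four_block_mat (1\<^sub>m n) (0\<^sub>m n 1) ?V (1\<^sub>m 1))"
    by (simp only:) (rule det_mult[of _ "n + 1"], auto)
  also have "Determinant.det (four_block_mat ?A' ?U (0\<^sub>m 1 n) ?D) = Determinant.det ?A' * Determinant.det ?D"
    by (rule det_four_block_mat_lower_left_zero) auto
  also have "Determinant.det (four_block_mat (1\<^sub>m n) (0\<^sub>m n 1) ?V (1\<^sub>m 1)) = Determinant.det (1\<^sub>m n) * Determinant.det (1\<^sub>m 1)"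
    by (rule det_four_block_mat_upper_right_zero) auto
  also have "Determinant.det ?D = A n n"
    by (subst det_single) auto
  finally show ?thesis by simp
qed

lemma coercive_diag: assumes c: "coercive (Suc n) A \<delta>" shows "Re (A n n) \<ge> \<delta>"
proof -
  have "\<forall>z. \<delta> * (\<Sum>i<Suc n. (norm (z i))\<^sup>2) \<le> Re (\<Sum>i<Suc n. \<Sum>j<Suc n. cnj (z i) * A i j * z j)"
    using c unfolding coercive_def by blast
  from spec[OF this, of "\<lambda>i. if i = n then 1 else 0"] show ?thesis by simp
qed

lemma coercive_schur:
  assumes c: "coercive (Suc n) A \<delta>"
  shows "coercive n (\<lambda>i j. A i j - A i n * A n j / A n n) \<delta>"
  unfolding coercive_def
proof (intro conjI allI)
  have d: "\<delta> > 0" using c by (simp add: coercive_def)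
  then have a: "A n n \<noteq> 0" using coercive_diag[OF c] by auto
  show "\<delta> > 0" by (rule d)
  fix z :: "nat \<Rightarrow> complex"
  \<comment> \<open>This last coordinate annihilates the last row, and the form of \<open>A\<close>
    at the extended vector is then the form of the Schur complement at \<open>z\<close>.\<close>
  define t where "t = - (\<Sum>j<n. A n j * z j) / A n n"
  define y where "y = z(n := t)"
  have y: "\<And>i. i < n \<Longrightarrow> y i = z i" "y n = t" by (auto simp: y_def)
  have sy: "(\<Sum>j<n. g j * y j) = (\<Sum>j<n. g j * z j)" for g by (intro sum.cong) (auto simp: y)
  have row: "(\<Sum>j<Suc n. A i j * y j) = (\<Sum>j<n. (A i j - A i n * A n j / A n n) * z j)" for i
  proof -
    have "(\<Sum>j<n. (A i j - A i n * A n j / A n n) * z j) = (\<Sum>j<n. A i j * z j) - (\<Sum>j<n. A i n * A n j / A n n * z j)"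
      by (simp only: left_diff_distrib sum_subtractf)
    also have "(\<Sum>j<n. A i n * A n j / A n n * z j) = A i n / A n n * (\<Sum>j<n. A n j * z j)"
      by (simp add: sum_distrib_left mult_ac)
    finally show ?thesis by (simp add: sy y t_def)
  qed
  have last: "(\<Sum>j<Suc n. A n j * y j) = 0"
    using a by (simp add: sy y t_def)
  have "(\<Sum>i<Suc n. \<Sum>j<Suc n. cnj (y i) * A i j * y j) = (\<Sum>i<Suc n. cnj (y i) * (\<Sum>j<Suc n. A i j * y j))"
    by (simp only: sum_distrib_left mult.assoc)
  also have "\<dots> = (\<Sum>i<n. cnj (y i) * (\<Sum>j<Suc n. A i j * y j)) + cnj (y n) * (\<Sum>j<Suc n. A n j * y j)"
    by (simp only: sum.lessThan_Suc)
  also have "\<dots> = (\<Sum>i<n. cnj (z i) * (\<Sum>j<n. (A i j - A i n * A n j / A n n) * z j))"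
    unfolding last by (simp add: y row del: sum.lessThan_Suc)
  also have "\<dots> = (\<Sum>i<n. \<Sum>j<n. cnj (z i) * (A i j - A i n * A n j / A n n) * z j)"
    by (simp only: sum_distrib_left mult.assoc)
  finally have e: "(\<Sum>i<Suc n. \<Sum>j<Suc n. cnj (y i) * A i j * y j) = (\<Sum>i<n. \<Sum>j<n. cnj (z i) * (A i j - A i n * A n j / A n n) * z j)" .
  have "(\<Sum>i<n. (norm (z i))\<^sup>2) = (\<Sum>i<n. (norm (y i))\<^sup>2)" by (intro sum.cong) (auto simp: y)
  then have "\<delta> * (\<Sum>i<n. (norm (z i))\<^sup>2) \<le> \<delta> * (\<Sum>i<Suc n. (norm (y i))\<^sup>2)"
    using d by (simp add: mult_left_mono)
  also have "\<dots> \<le> Re (\<Sum>i<Suc n. \<Sum>j<Suc n. cnj (y i) * A i j * y j)" using c unfolding coercive_def by blast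
  finally show "\<delta> * (\<Sum>i<n. (norm (z i))\<^sup>2) \<le> Re (\<Sum>i<n. \<Sum>j<n. cnj (z i) * (A i j - A i n * A n j / A n n) * z j)"
    unfolding e .
qed

text \<open>The last variable is integrated out. Each step contributes \<open>cg a 0\<close>, whose
  square times a is pi, while \<open>det_schur\<close> splits the same a off the
  determinant.\<close>

lemma gauss_nd:
  assumes "coercive n A \<delta>" "\<And>i j. i < n \<Longrightarrow> j < n \<Longrightarrow> A i j = A j i"
  shows "(\<integral>x. exp (- qf n A x) \<partial>leb n)\<^sup>2 * Determinant.det (mat n n (\<lambda>(i, j). A i j)) = of_real pi ^ n"
  using assms
proof (induction n arbitrary: A)
  case 0
  have "(\<integral>x. exp (- qf 0 A x) \<partial>leb 0) = 1"
    using lebp.product_integral_prod[of "{}" "\<lambda>_ _. 1 :: complex"] by (simp add: qf_def)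
  then show ?case by (simp add: det_dim_zero)
next
  case (Suc n)
  note c = Suc.prems(1) note sym = Suc.prems(2)
  define a where "a = A n n"
  have d: "\<delta> > 0" using c by (simp add: coercive_def)
  have ra: "Re a > 0" using coercive_diag[OF c] d by (simp add: a_def)
  then have a0: "a \<noteq> 0" by auto
  define A' where "A' = (\<lambda>i j. A i j - A i n * A n j / a)"
  have c': "coercive n A' \<delta>" using coercive_schur[OF c] by (simp add: A'_def a_def)
  have sym': "\<And>i j. i < n \<Longrightarrow> j < n \<Longrightarrow> A' i j = A' j i"
    unfolding A'_def using sym by (simp add: mult.commute less_Suc_eq)
  define b where "b x = - 2 * (\<Sum>j<n. A n j * of_real (x j))" for x :: "nat \<Rightarrow> real"
  have split: "- qf (Suc n) A (x(n := y)) = - qf n A x + (b x * of_real y - a * of_real y ^ 2)" for x y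
  proof -
    have l: "(\<Sum>j<n. g j * of_real ((x(n := y)) j)) = (\<Sum>j<n. g j * of_real (x j))" for g :: "nat \<Rightarrow> complex"
      by (intro sum.cong) auto
    have "qf (Suc n) A (x(n := y)) = (\<Sum>i<Suc n. of_real ((x(n := y)) i) * (\<Sum>j<Suc n. A i j * of_real ((x(n := y)) j)))"
      unfolding qf_def by (simp only: sum_distrib_left mult_ac)
    also have "\<dots> = (\<Sum>i<n. of_real (x i) * ((\<Sum>j<n. A i j * of_real (x j)) + A i n * of_real y)) + of_real y * ((\<Sum>j<n. A n j * of_real (x j)) + A n n * of_real y)"
      by (simp add: l)
    also have "\<dots> = qf n A x + (\<Sum>i<n. A i n * of_real (x i)) * of_real y + of_real y * (\<Sum>j<n. A n j * of_real (x j)) + a * of_real y ^ 2"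
      unfolding qf_def a_def by (simp add: distrib_left sum.distrib sum_distrib_left sum_distrib_right power2_eq_square mult_ac)
    also have "(\<Sum>i<n. A i n * of_real (x i)) = (\<Sum>j<n. A n j * of_real (x j))" by (intro sum.cong) (auto simp: sym)
    finally have e: "qf (Suc n) A (x(n := y)) = qf n A x + (\<Sum>j<n. A n j * of_real (x j)) * of_real y + of_real y * (\<Sum>j<n. A n j * of_real (x j)) + a * of_real y ^ 2" .
    show ?thesis unfolding e b_def by (simp add: algebra_simps)
  qed
  \<comment> \<open>Completing the square in the last variable produces the Schur complement;
    symmetry identifies the last row with the last column.\<close>
  have bq: "- qf n A x + b x ^ 2 / (4 * a) = - qf n A' x" for x
  proof -
    have "b x ^ 2 = 4 * ((\<Sum>i<n. A i n * of_real (x i)) * (\<Sum>j<n. A n j * of_real (x j)))"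
    proof -
      have "(\<Sum>i<n. A i n * of_real (x i)) = (\<Sum>j<n. A n j * of_real (x j))" by (intro sum.cong) (auto simp: sym)
      then show ?thesis unfolding b_def by (simp add: power2_eq_square)
    qed
    also have "(\<Sum>i<n. A i n * of_real (x i)) * (\<Sum>j<n. A n j * of_real (x j)) = a * (\<Sum>i<n. \<Sum>j<n. A i n * A n j / a * of_real (x i) * of_real (x j))"
    proof -
      have "a * (\<Sum>i<n. \<Sum>j<n. A i n * A n j / a * of_real (x i) * of_real (x j)) = (\<Sum>i<n. \<Sum>j<n. a * (A i n * A n j / a * of_real (x i) * of_real (x j)))"
        by (simp only: sum_distrib_left)
      also have "\<dots> = (\<Sum>i<n. \<Sum>j<n. (A i n * of_real (x i)) * (A n j * of_real (x j)))"
        by (intro sum.cong refl) (use a0 in simp)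
      finally show ?thesis by (simp only: sum_product)
    qed
    finally show ?thesis using a0 unfolding qf_def A'_def by (simp add: left_diff_distrib sum_subtractf)
  qed
  have "(\<integral>x. exp (- qf (Suc n) A x) \<partial>leb (Suc n)) = (\<integral>x. (\<integral>y. exp (- qf (Suc n) A (x(n := y))) \<partial>lborel) \<partial>leb n)"
    using lebp.product_integral_insert[of "{..<n}" n "\<lambda>x. exp (- qf (Suc n) A x)"] qf_integrable[OF c]
    by (simp add: lessThan_Suc)
  also have "\<dots> = (\<integral>x. cg a 0 * exp (- qf n A' x) \<partial>leb n)"
  proof -
    have "(\<integral>y. exp (- qf (Suc n) A (x(n := y))) \<partial>lborel) = cg a 0 * exp (- qf n A' x)" for x
    proof -
      have "(\<integral>y. exp (- qf (Suc n) A (x(n := y))) \<partial>lborel) = exp (- qf n A x) * (cg a 0 * exp (b x ^ 2 / (4 * a)))"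
        unfolding split by (simp only: exp_add integral_mult_right_zero cg_shift(1)[OF ra])
      also have "\<dots> = cg a 0 * exp (- qf n A x + b x ^ 2 / (4 * a))" by (simp only: exp_add mult_ac)
      finally show ?thesis by (simp only: bq)
    qed
    then show ?thesis by simp
  qed
  finally have I: "(\<integral>x. exp (- qf (Suc n) A x) \<partial>leb (Suc n)) = cg a 0 * (\<integral>x. exp (- qf n A' x) \<partial>leb n)" by simp
  have "Determinant.det (mat (Suc n) (Suc n) (\<lambda>(i, j). A i j)) = a * Determinant.det (mat n n (\<lambda>(i, j). A' i j))"
    using det_schur[of A n] a0 by (simp add: a_def A'_def)
  then have "(\<integral>x. exp (- qf (Suc n) A x) \<partial>leb (Suc n))\<^sup>2 * Determinant.det (mat (Suc n) (Suc n) (\<lambda>(i, j). A i j)) =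
     (cg a 0 ^ 2 * a) * ((\<integral>x. exp (- qf n A' x) \<partial>leb n)\<^sup>2 * Determinant.det (mat n n (\<lambda>(i, j). A' i j)))"
    unfolding I by (simp add: power_mult_distrib)
  also have "\<dots> = of_real pi * of_real pi ^ n"
  proof -
    have ih: "(\<integral>x. exp (- qf n A' x) \<partial>leb n)\<^sup>2 * Determinant.det (mat n n (\<lambda>(i, j). A' i j)) = of_real pi ^ n"
      by (rule Suc.IH[OF c' sym'])
    show ?thesis unfolding ih cg_square[OF ra] using a0 by simp
  qed
  finally show ?case by simp
qed

text \<open>Cyclic tridiagonal matrix. The entries are added up instead of chosen by cases so that
  coinciding positions, for n = 1 and n = 2, accumulate correctly.\<close>

definition mat3 :: "nat \<Rightarrow> (nat \<Rightarrow> complex) \<Rightarrow> (nat \<Rightarrow> complex) \<Rightarrow> (nat \<Rightarrow> complex) \<Rightarrow> complex mat" where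
  "mat3 n f g h = mat n n (\<lambda>(i, j). (if j = i then f i else 0) + (if j = (i + 1) mod n then g i else 0) + (if j = (i + n - 1) mod n then h i else 0))"

lemma mat3_carrier [simp]: "mat3 n f g h \<in> carrier_mat n n" "dim_row (mat3 n f g h) = n" "dim_col (mat3 n f g h) = n"
  by (auto simp: mat3_def)

lemma mat3_vec:
  assumes "i < n" "x \<in> carrier_vec n"
  shows "vec_index (mat3 n f g h *\<^sub>v x) i = f i * vec_index x i + g i * vec_index x ((i + 1) mod n) + h i * vec_index x ((i + n - 1) mod n)"
proof -
  have n: "0 < n" using assms by simp
  have "vec_index (mat3 n f g h *\<^sub>v x) i = (\<Sum>j\<in>{0..<n}. (if j = i then f i * vec_index x j else 0)
     + (if j = (i + 1) mod n then g i * vec_index x j else 0) + (if j = (i + n - 1) mod n then h i * vec_index x j else 0))"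
    using assms by (auto simp: mat3_def scalar_prod_def distrib_right intro!: sum.cong)
  also have "\<dots> = f i * vec_index x i + g i * vec_index x ((i + 1) mod n) + h i * vec_index x ((i + n - 1) mod n)"
    using assms n by (simp add: sum.distrib)
  finally show ?thesis .
qed

lemma mat_eq_vecI:
  fixes A B :: "complex mat"
  assumes A: "A \<in> carrier_mat n n" and B: "B \<in> carrier_mat n n"
    and e: "\<And>x i. x \<in> carrier_vec n \<Longrightarrow> i < n \<Longrightarrow> vec_index (A *\<^sub>v x) i = vec_index (B *\<^sub>v x) i"
  shows "A = B"
proof (rule eq_matI)
  fix i j assume ij: "i < dim_row B" "j < dim_col B"
  then have ij': "i < n" "j < n" using B by auto
  have "vec_index (A *\<^sub>v unit_vec n j) i = vec_index (B *\<^sub>v unit_vec n j) i" by (rule e) (use ij' in auto)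
  then show "A $$ (i, j) = B $$ (i, j)"
    using ij' A B by simp
qed (use A B in auto)

text \<open>Diagonal dominance: at a coordinate of largest modulus of a kernel vector the diagonal
  term cannot be cancelled by the single other term.\<close>

lemma det_mat3_nonzero:
  assumes n: "n > 0" and d: "\<And>i. i < n \<Longrightarrow> norm (g i) < norm (f i)"
  shows "Determinant.det (mat3 n f g (\<lambda>_. 0)) \<noteq> 0"
proof
  assume "Determinant.det (mat3 n f g (\<lambda>_. 0)) = 0"
  then obtain v where v: "v \<in> carrier_vec n" "v \<noteq> 0\<^sub>v n" "mat3 n f g (\<lambda>_. 0) *\<^sub>v v = 0\<^sub>v n"
    using det_0_iff_vec_prod_zero_field[OF mat3_carrier(1)] by metis
  define M where "M = Max ((\<lambda>i. norm (vec_index v i)) ` {..<n})"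
  have "M \<in> (\<lambda>i. norm (vec_index v i)) ` {..<n}" unfolding M_def by (rule Max_in) (use n in auto)
  then obtain k where k: "k < n" "M = norm (vec_index v k)" by auto
  have le: "norm (vec_index v i) \<le> M" if "i < n" for i unfolding M_def using that by (intro Max_ge) auto
  have "vec_index (mat3 n f g (\<lambda>_. 0) *\<^sub>v v) k = 0" using v(3) k by simp
  then have "f k * vec_index v k = - (g k * vec_index v ((k + 1) mod n))"
    using mat3_vec[OF k(1) v(1), of f g "\<lambda>_. 0"] by (simp add: add_eq_0_iff)
  then have "norm (f k) * M = norm (g k) * norm (vec_index v ((k + 1) mod n))"
    by (metis k(2) norm_minus_cancel norm_mult)
  also have "\<dots> \<le> norm (g k) * M" using le[of "(k + 1) mod n"] n by (intro mult_left_mono) auto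
  finally have "(norm (f k) - norm (g k)) * M \<le> 0" by (simp add: left_diff_distrib)
  then have M0: "M \<le> 0" using d[OF k(1)] by (simp add: mult_le_0_iff)
  have "vec_index v i = 0" if "i < n" for i
  proof -
    have "norm (vec_index v i) \<le> 0" using le[OF that] M0 by linarith
    then show ?thesis by simp
  qed
  then have "v = 0\<^sub>v n" using v(1) by (intro eq_vecI) auto
  then show False using v(2) by simp
qed

text \<open>The bidiagonal matrices \<open>Rm\<close> and \<open>Z\<close> intertwine \<open>M s\<close> with \<open>M (- s)\<close>, and they are conjugate by the
  weighted cyclic shift \<open>C\<close>. As \<open>M (- s)\<close> is the complex conjugate of \<open>M s\<close>, the determinant is real.\<close>

lemma det_cyclic_real:
  fixes p b \<sigma> :: "nat \<Rightarrow> real" and s :: real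
  assumes n: "n > 0" and b: "\<And>i. i < n \<Longrightarrow> b i \<noteq> 0" and pb: "\<And>i. i < n \<Longrightarrow> (p i)\<^sup>2 - (b i)\<^sup>2 = 1 / 4"
    and \<sigma>: "\<And>i. i < n \<Longrightarrow> (\<sigma> i)\<^sup>2 = 1"
  defines "M \<equiv> (\<lambda>s. mat3 n (\<lambda>i. of_real (p i + p ((i + n - 1) mod n)) + \<i> * of_real (s * (\<sigma> i - \<sigma> ((i + n - 1) mod n))))
     (\<lambda>i. of_real (b i)) (\<lambda>i. of_real (b ((i + n - 1) mod n))))"
  shows "Determinant.det (M (- s)) = Determinant.det (M s)"
proof -
  define P where "P i = of_real (p i) + \<i> * of_real (s * \<sigma> i)" for i
  define N where "N i = of_real (p i) - \<i> * of_real (s * \<sigma> i)" for i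
  define pr where "pr i = (i + n - 1) mod n" for i
  define nx where "nx i = (i + 1) mod n" for i
  have lt: "pr i < n" "nx i < n" for i using n by (auto simp: pr_def nx_def)
  have pn: "pr (nx i) = i" "nx (pr i) = i" if "i < n" for i
  proof -
    show "pr (nx i) = i" using that n unfolding pr_def nx_def by (cases "i + 1 = n") auto
    show "nx (pr i) = i" using that n unfolding pr_def nx_def by (cases "i = 0") (auto simp: mod_if)
  qed
  \<comment> \<open>The identity behind the intertwining: this quantity does not depend on i, so
    neighbouring positions can be exchanged.\<close>
  have c: "P i * N i - of_real (b i) ^ 2 = of_real (1 / 4 + s\<^sup>2)" if "i < n" for i
  proof -
    have "P i * N i = of_real ((p i)\<^sup>2 + s\<^sup>2 * (\<sigma> i)\<^sup>2)"
      unfolding P_def N_def by (simp add: algebra_simps power2_eq_square)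
    then show ?thesis using pb[OF that] \<sigma>[OF that] by (simp add: algebra_simps flip: of_real_power of_real_diff of_real_add)
  qed
  let ?B = "\<lambda>i. complex_of_real (b i)"
  define Rm where "Rm = mat3 n P ?B (\<lambda>_. 0)"
  define Z where "Z = mat3 n (\<lambda>i. P (pr i)) ?B (\<lambda>_. 0)"
  define C where "C = mat3 n (\<lambda>_. 0) ?B (\<lambda>_. 0)"
  have Mp: "M s = mat3 n (\<lambda>i. P i + N (pr i)) ?B (\<lambda>i. ?B (pr i))"
    unfolding M_def P_def N_def pr_def by (simp add: algebra_simps)
  have Mm: "M (- s) = mat3 n (\<lambda>i. N i + P (pr i)) ?B (\<lambda>i. ?B (pr i))"
    unfolding M_def P_def N_def pr_def by (simp add: algebra_simps)
  have car: "M t \<in> carrier_mat n n" "Rm \<in> carrier_mat n n" "Z \<in> carrier_mat n n" "C \<in> carrier_mat n n" for t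
    by (simp_all add: M_def Rm_def Z_def C_def)
  have mv: "vec_index (mat3 n f g h *\<^sub>v x) i = f i * vec_index x i + g i * vec_index x (nx i) + h i * vec_index x (pr i)"
    if "i < n" "x \<in> carrier_vec n" for i x f g h
    using mat3_vec[OF that] by (simp only: pr_def nx_def)
  have cv: "A *\<^sub>v x \<in> carrier_vec n" if "A \<in> carrier_mat n n" "x \<in> carrier_vec n" for A :: "complex mat" and x
    using that by simp
  have 1: "M (- s) * Rm = Z * M s"
  proof (rule mat_eq_vecI[of _ n])
    fix x :: "complex vec" and i assume x: "x \<in> carrier_vec n" and i: "i < n"
    have l: "vec_index (M (- s) * Rm *\<^sub>v x) i = (N i + P (pr i)) * (P i * vec_index x i + ?B i * vec_index x (nx i))
        + ?B i * (P (nx i) * vec_index x (nx i) + ?B (nx i) * vec_index x (nx (nx i)))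
        + ?B (pr i) * (P (pr i) * vec_index x (pr i) + ?B (pr i) * vec_index x i)"
      unfolding assoc_mult_mat_vec[OF car(1,2) x]
      unfolding Mm Rm_def by (simp add: mv i lt x cv pn del: index_mult_mat_vec)
    have r: "vec_index (Z * M s *\<^sub>v x) i = P (pr i) * ((P i + N (pr i)) * vec_index x i + ?B i * vec_index x (nx i) + ?B (pr i) * vec_index x (pr i))
        + ?B i * ((P (nx i) + N i) * vec_index x (nx i) + ?B (nx i) * vec_index x (nx (nx i)) + ?B i * vec_index x i)"
      unfolding assoc_mult_mat_vec[OF car(3,1) x]
      unfolding Mp Z_def by (simp add: mv i lt x cv pn del: index_mult_mat_vec)
    have "P i * N i - ?B i ^ 2 = P (pr i) * N (pr i) - ?B (pr i) ^ 2" using c[OF i] c[OF lt(1)] by simp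
    then have "N i * P i = P (pr i) * N (pr i) - ?B (pr i) ^ 2 + ?B i ^ 2" by (simp add: algebra_simps)
    then have nn: "N i * (P i * w) = (P (pr i) * N (pr i) - ?B (pr i) ^ 2 + ?B i ^ 2) * w" for w by (metis mult.assoc)
    show "vec_index (M (- s) * Rm *\<^sub>v x) i = vec_index (Z * M s *\<^sub>v x) i"
      unfolding l r by (simp add: distrib_right distrib_left nn) (simp add: algebra_simps power2_eq_square)
  qed (rule mult_carrier_mat[OF car(1,2)] mult_carrier_mat[OF car(3,1)])+
  have 2: "Rm * C = C * Z"
  proof (rule mat_eq_vecI[of _ n])
    fix x :: "complex vec" and i assume x: "x \<in> carrier_vec n" and i: "i < n"
    show "vec_index (Rm * C *\<^sub>v x) i = vec_index (C * Z *\<^sub>v x) i"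
      unfolding assoc_mult_mat_vec[OF car(2,4) x] assoc_mult_mat_vec[OF car(4,3) x]
      unfolding Rm_def C_def Z_def by (simp add: mv i lt x cv pn algebra_simps del: index_mult_mat_vec)
  qed (rule mult_carrier_mat[OF car(2,4)] mult_carrier_mat[OF car(4,3)])+
  \<comment> \<open>The surplus 1/4 in \<open>pb\<close> is what makes \<open>Rm\<close> diagonally
    dominant, hence invertible.\<close>
  have pos: "norm (?B i) < norm (P i)" if "i < n" for i
  proof -
    have "(norm (?B i))\<^sup>2 < (norm (P i))\<^sup>2"
    proof -
      have "(norm (P i))\<^sup>2 = (p i)\<^sup>2 + (s * \<sigma> i)\<^sup>2" by (simp add: P_def cmod_power2)
      moreover have "(norm (?B i))\<^sup>2 = (b i)\<^sup>2" by simp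
      ultimately show ?thesis using pb[OF that] zero_le_power2[of "s * \<sigma> i"] by linarith
    qed
    then show ?thesis by (rule power_less_imp_less_base) simp
  qed
  have detR: "Determinant.det Rm \<noteq> 0" unfolding Rm_def by (rule det_mat3_nonzero[OF n pos])
  have detC: "Determinant.det C \<noteq> 0"
  proof
    assume "Determinant.det C = 0"
    then obtain v where v: "v \<in> carrier_vec n" "v \<noteq> 0\<^sub>v n" "C *\<^sub>v v = 0\<^sub>v n"
      using det_0_iff_vec_prod_zero_field[OF car(4)] by metis
    have "vec_index v j = 0" if j: "j < n" for j
    proof -
      have "vec_index (C *\<^sub>v v) (pr j) = 0" using v(3) lt by simp
      then show ?thesis using mv[OF lt(1)[of j] v(1), of "\<lambda>_. 0" ?B "\<lambda>_. 0"] b[OF lt(1)[of j]] pn(2)[OF j] by (simp add: C_def del: index_mult_mat_vec)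
    qed
    then have "v = 0\<^sub>v n" using v(1) by (intro eq_vecI) auto
    then show False using v(2) by simp
  qed
  have "Determinant.det (M (- s)) * Determinant.det Rm = Determinant.det Z * Determinant.det (M s)"
    using arg_cong[OF 1, of Determinant.det] by (simp add: det_mult[OF car(1,2)] det_mult[OF car(3,1)])
  moreover have "Determinant.det Rm * Determinant.det C = Determinant.det C * Determinant.det Z"
    using arg_cong[OF 2, of Determinant.det] by (simp add: det_mult[OF car(2,4)] det_mult[OF car(4,3)])
  ultimately show ?thesis using detR detC by simp
qed

section \<open>The matrices \<Delta>_n: entries, forms over the edges of a cycle, coercivity\<close>

definition pp :: "(nat \<Rightarrow> real) \<Rightarrow> nat \<Rightarrow> real" where "pp u i = 1 / (1 - u i ^ 4) - 1 / 2"
definition bb :: "(nat \<Rightarrow> real) \<Rightarrow> nat \<Rightarrow> real" where "bb u i = - (u i)\<^sup>2 / (1 - u i ^ 4)"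
text \<open>Cyclic predecessor; adding n first avoids truncated subtraction at 0.\<close>

definition pv :: "nat \<Rightarrow> nat \<Rightarrow> nat" where "pv n i = (i + n - 1) mod n"
definition nx :: "nat \<Rightarrow> nat \<Rightarrow> nat" where "nx n i = (i + 1) mod n"

lemma pv_nx:
  assumes "0 < n"
  shows "pv n i < n" "nx n i < n" "i < n \<Longrightarrow> pv n (nx n i) = i" "i < n \<Longrightarrow> nx n (pv n i) = i"
proof -
  show "pv n i < n" "nx n i < n" using assms by (auto simp: pv_def nx_def)
  show "pv n (nx n i) = i" if "i < n" using that assms unfolding pv_def nx_def by (cases "i + 1 = n") auto
  show "nx n (pv n i) = i" if "i < n" using that assms unfolding pv_def nx_def by (cases "i = 0") (auto simp: mod_if)
qed

lemma nx_eq_iff: "i < n \<Longrightarrow> a < n \<Longrightarrow> a = nx n i \<longleftrightarrow> i = pv n a"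
  using pv_nx[of n] by (metis gr_zeroI not_less_zero)

lemma nx_bij: "0 < n \<Longrightarrow> bij_betw (nx n) {..<n} {..<n}"
  by (rule bij_betw_byWitness[where f'="pv n"]) (auto simp: pv_nx)

text \<open>With w = u_i^2 the entries are (1 + w^2) / (2(1 - w^2)) and -w / (1 - w^2), and the
  first claim is (1 + w^2)^2 - (2w)^2 = (1 - w^2)^2. The value 1/4 feeds
  \<open>det_cyclic_real\<close>; the last inequality gives coercivity.\<close>

lemma pp_bb:
  assumes "0 < u i" "u i < 1"
  shows "(pp u i)\<^sup>2 - (bb u i)\<^sup>2 = 1 / 4" "bb u i \<noteq> 0" "pp u i - \<bar>bb u i\<bar> > 0"
proof -
  define w where "w = (u i)\<^sup>2"
  have w: "0 < w" "w < 1" using assms by (auto simp: w_def abs_square_less_1)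
  have w4: "u i ^ 4 = w\<^sup>2" by (simp add: w_def)
  have w2: "w\<^sup>2 < 1" using w by (simp add: abs_square_less_1)
  show "bb u i \<noteq> 0" unfolding bb_def w4 using w w2 by (simp flip: w_def)
  have e: "pp u i = (1 + w\<^sup>2) / (2 * (1 - w\<^sup>2))" "bb u i = - (2 * w) / (2 * (1 - w\<^sup>2))"
    unfolding pp_def bb_def w4 using w2 by (simp_all add: field_simps flip: w_def)
  have q: "(1 + w\<^sup>2)\<^sup>2 - (2 * w)\<^sup>2 = (1 - w\<^sup>2)\<^sup>2" by (simp add: power2_eq_square algebra_simps)
  have h: "(1 - w\<^sup>2) / (2 * (1 - w\<^sup>2)) = 1 / 2" using w2 by simp
  have "(pp u i)\<^sup>2 - (bb u i)\<^sup>2 = ((1 + w\<^sup>2)\<^sup>2 - (2 * w)\<^sup>2) / (2 * (1 - w\<^sup>2))\<^sup>2"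
    unfolding e by (simp only: power_divide power2_minus diff_divide_distrib)
  also have "\<dots> = (1 / 2)\<^sup>2" by (simp only: q power_divide[symmetric] h)
  finally show "(pp u i)\<^sup>2 - (bb u i)\<^sup>2 = 1 / 4" by (simp add: power2_eq_square)
  have "\<bar>bb u i\<bar> = (2 * w) / (2 * (1 - w\<^sup>2))" unfolding e using w w2 by (simp add: abs_mult)
  then have "pp u i - \<bar>bb u i\<bar> = (1 - w)\<^sup>2 / (2 * (1 - w\<^sup>2))"
    unfolding e by (simp add: diff_divide_distrib[symmetric] power2_eq_square algebra_simps)
  then show "pp u i - \<bar>bb u i\<bar> > 0" using w w2 by simp
qed

lemma Delta_entry:
  assumes "a < n" "b < n"
  shows "Delta n u $$ (a, b) = (\<Sum>i<n. ((if a = i \<and> b = i then 1 else 0) + (if a = nx n i \<and> b = nx n i then 1 else 0)) * pp u i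
     + ((if a = i \<and> b = nx n i then 1 else 0) + (if a = nx n i \<and> b = i then 1 else 0)) * bb u i)"
  using assms by (simp add: Delta_def matrix_unit_def pp_def bb_def nx_def)

lemma Delta_sym: "a < n \<Longrightarrow> b < n \<Longrightarrow> Delta n u $$ (a, b) = Delta n u $$ (b, a)"
  unfolding Delta_entry
  by (rule sum.cong[OF refl], rename_tac i, case_tac "a = i"; case_tac "b = i"; case_tac "a = nx n i"; case_tac "b = nx n i"; simp)

lemma Delta_mat3:
  assumes "a < n" "b < n"
  shows "Delta n u $$ (a, b) = (if b = a then pp u a + pp u (pv n a) else 0) + (if b = nx n a then bb u a else 0) + (if b = pv n a then bb u (pv n a) else 0)"
proof -
  have n: "0 < n" using assms by simp
  have "Delta n u $$ (a, b) = (\<Sum>i<n. (if i = a then (if b = a then pp u a else 0) else 0)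
     + (if i = pv n a then (if b = a then pp u (pv n a) else 0) else 0)
     + ((if i = a then (if b = nx n a then bb u a else 0) else 0)
     + (if i = pv n a then (if b = pv n a then bb u (pv n a) else 0) else 0)))"
    unfolding Delta_entry[OF assms]
  proof (rule sum.cong[OF refl])
    fix i assume i: "i \<in> {..<n}"
    then have e: "a = nx n i \<longleftrightarrow> i = pv n a" using nx_eq_iff assms by auto
    have f: "nx n (pv n a) = a" using pv_nx(4)[OF n assms(1)] .
    show "((if a = i \<and> b = i then 1 else 0) + (if a = nx n i \<and> b = nx n i then 1 else 0)) * pp u i
     + ((if a = i \<and> b = nx n i then 1 else 0) + (if a = nx n i \<and> b = i then 1 else 0)) * bb u i =
      (if i = a then (if b = a then pp u a else 0) else 0)
     + (if i = pv n a then (if b = a then pp u (pv n a) else 0) else 0)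
     + ((if i = a then (if b = nx n a then bb u a else 0) else 0)
     + (if i = pv n a then (if b = pv n a then bb u (pv n a) else 0) else 0))"
      unfolding e by (auto simp: f) (metis f)+
  qed
  also have "\<dots> = (if b = a then pp u a else 0) + (if b = a then pp u (pv n a) else 0) + ((if b = nx n a then bb u a else 0) + (if b = pv n a then bb u (pv n a) else 0))"
    using assms pv_nx[OF n] by (simp only: sum.distrib sum.delta finite_lessThan lessThan_iff if_True)
  finally show ?thesis by simp
qed

text \<open>Reads the form as a sum over the edges {i, i + 1} of the cycle. In this shape it is
  estimated edge by edge and matched with a product of Mehler kernels.\<close>

lemma Delta_bilinear:
  fixes z w :: "nat \<Rightarrow> complex"
  assumes n: "0 < n"
  shows "(\<Sum>a<n. \<Sum>b<n. z a * of_real (Delta n u $$ (a, b)) * w b) =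
    (\<Sum>i<n. of_real (pp u i) * (z i * w i + z (nx n i) * w (nx n i)) + of_real (bb u i) * (z i * w (nx n i) + z (nx n i) * w i))"
proof -
  have r: "(\<Sum>b<n. z a * of_real (Delta n u $$ (a, b)) * w b) = z a * (of_real (pp u a + pp u (pv n a)) * w a + of_real (bb u a) * w (nx n a) + of_real (bb u (pv n a)) * w (pv n a))"
    if a: "a < n" for a
  proof -
    have "(\<Sum>b<n. z a * of_real (Delta n u $$ (a, b)) * w b) = (\<Sum>b<n. (if b = a then z a * of_real (pp u a + pp u (pv n a)) * w b else 0)
       + (if b = nx n a then z a * of_real (bb u a) * w b else 0) + (if b = pv n a then z a * of_real (bb u (pv n a)) * w b else 0))"
      by (intro sum.cong refl) (use a in \<open>auto simp: Delta_mat3 distrib_left distrib_right\<close>)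
    also have "\<dots> = z a * of_real (pp u a + pp u (pv n a)) * w a + z a * of_real (bb u a) * w (nx n a) + z a * of_real (bb u (pv n a)) * w (pv n a)"
      using a pv_nx[OF n] by (simp only: sum.distrib sum.delta finite_lessThan lessThan_iff if_True)
    finally show ?thesis by (simp only: distrib_left mult.assoc)
  qed
  have s: "(\<Sum>a<n. g (pv n a) a) = (\<Sum>i<n. g i (nx n i))" for g :: "nat \<Rightarrow> nat \<Rightarrow> complex"
    by (subst sum.reindex_bij_betw[OF nx_bij[OF n], symmetric]) (auto simp: pv_nx[OF n] intro!: sum.cong)
  have "(\<Sum>a<n. \<Sum>b<n. z a * of_real (Delta n u $$ (a, b)) * w b) =
    (\<Sum>a<n. of_real (pp u a) * (z a * w a) + of_real (bb u a) * (z a * w (nx n a))) + (\<Sum>a<n. of_real (pp u (pv n a)) * (z a * w a) + of_real (bb u (pv n a)) * (z a * w (pv n a)))"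
  proof -
    have "(\<Sum>a<n. \<Sum>b<n. z a * of_real (Delta n u $$ (a, b)) * w b) = (\<Sum>a<n. z a * (of_real (pp u a + pp u (pv n a)) * w a + of_real (bb u a) * w (nx n a) + of_real (bb u (pv n a)) * w (pv n a)))"
      by (rule sum.cong[OF refl]) (use r in simp)
    then show ?thesis by (simp add: sum.distrib[symmetric] algebra_simps)
  qed
  also have "(\<Sum>a<n. of_real (pp u (pv n a)) * (z a * w a) + of_real (bb u (pv n a)) * (z a * w (pv n a))) =
     (\<Sum>i<n. of_real (pp u i) * (z (nx n i) * w (nx n i)) + of_real (bb u i) * (z (nx n i) * w i))"
    by (rule s)
  finally show ?thesis by (simp add: sum.distrib[symmetric] algebra_simps)
qed

definition MA :: "nat \<Rightarrow> (nat \<Rightarrow> real) \<Rightarrow> (nat \<Rightarrow> real) \<Rightarrow> nat \<Rightarrow> nat \<Rightarrow> complex" where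
  "MA n u d a b = of_real (Delta n u $$ (a, b)) + (if a = b then \<i> * of_real (d a) else 0)"

lemma MA_bilinear:
  assumes "0 < n"
  shows "(\<Sum>a<n. \<Sum>b<n. z a * MA n u d a b * w b) =
    (\<Sum>i<n. of_real (pp u i) * (z i * w i + z (nx n i) * w (nx n i)) + of_real (bb u i) * (z i * w (nx n i) + z (nx n i) * w i))
    + \<i> * (\<Sum>a<n. of_real (d a) * (z a * w a))"
proof -
  have "(\<Sum>a<n. \<Sum>b<n. z a * MA n u d a b * w b) = (\<Sum>a<n. \<Sum>b<n. z a * of_real (Delta n u $$ (a, b)) * w b + (if b = a then \<i> * (of_real (d a) * (z a * w a)) else 0))"
    unfolding MA_def by (intro sum.cong refl) (auto simp: algebra_simps)
  also have "\<dots> = (\<Sum>a<n. \<Sum>b<n. z a * of_real (Delta n u $$ (a, b)) * w b) + \<i> * (\<Sum>a<n. of_real (d a) * (z a * w a))"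
    by (simp add: sum.distrib sum_distrib_left)
  finally show ?thesis unfolding Delta_bilinear[OF assms] .
qed

text \<open>The imaginary diagonal adds only an imaginary number to the Hermitian form, so one
  \<delta> serves all \<open>d\<close>. This uniformity supplies the dominating function when the
  diagonal is deformed.\<close>

lemma MA_coercive:
  assumes n: "0 < n" and u: "\<And>i. i < n \<Longrightarrow> 0 < u i \<and> u i < 1"
  obtains \<delta> where "\<And>d. coercive n (MA n u d) \<delta>" "\<delta> > 0"
proof
  define \<delta> where "\<delta> = Min ((\<lambda>i. pp u i - \<bar>bb u i\<bar>) ` {..<n})"
  have dle: "\<delta> \<le> pp u i - \<bar>bb u i\<bar>" if "i < n" for i unfolding \<delta>_def using that by (intro Min_le) auto
  have "\<delta> \<in> (\<lambda>i. pp u i - \<bar>bb u i\<bar>) ` {..<n}" unfolding \<delta>_def by (rule Min_in) (use n in auto)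
  then show d0: "\<delta> > 0" using pp_bb(3) u by auto
  fix d
  show "coercive n (MA n u d) \<delta>" unfolding coercive_def
  proof (intro conjI allI d0)
    fix z :: "nat \<Rightarrow> complex"
    have one: "\<delta> * (norm (z i))\<^sup>2 \<le> Re (of_real (pp u i) * (cnj (z i) * z i + cnj (z (nx n i)) * z (nx n i)) + of_real (bb u i) * (cnj (z i) * z (nx n i) + cnj (z (nx n i)) * z i))"
      if i: "i < n" for i
    proof -
      let ?x = "norm (z i)" and ?y = "norm (z (nx n i))"
      have c: "cnj w * w = of_real ((norm w)\<^sup>2)" for w by (simp add: complex_norm_square mult.commute del: of_real_power)
      have r: "Re (cnj (z i) * z (nx n i) + cnj (z (nx n i)) * z i) = 2 * Re (cnj (z i) * z (nx n i))"
        by (simp add: algebra_simps)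
      have "\<bar>Re (cnj (z i) * z (nx n i))\<bar> \<le> ?x * ?y"
        using abs_Re_le_cmod[of "cnj (z i) * z (nx n i)"] by (simp add: norm_mult)
      then have "\<bar>2 * Re (cnj (z i) * z (nx n i))\<bar> \<le> ?x\<^sup>2 + ?y\<^sup>2" using sum_squares_bound[of ?x ?y] by (simp add: abs_mult)
      then have "\<bar>bb u i\<bar> * \<bar>2 * Re (cnj (z i) * z (nx n i))\<bar> \<le> \<bar>bb u i\<bar> * (?x\<^sup>2 + ?y\<^sup>2)" by (rule mult_left_mono) simp
      then have b: "- (\<bar>bb u i\<bar> * (?x\<^sup>2 + ?y\<^sup>2)) \<le> bb u i * (2 * Re (cnj (z i) * z (nx n i)))"
        by (metis abs_le_D2 abs_mult minus_le_iff)
      have "\<delta> * ?x\<^sup>2 \<le> (pp u i - \<bar>bb u i\<bar>) * ?x\<^sup>2" using dle[OF i] by (rule mult_right_mono) simp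
      also have "\<dots> \<le> (pp u i - \<bar>bb u i\<bar>) * (?x\<^sup>2 + ?y\<^sup>2)" using dle[OF i] d0 by (intro mult_left_mono) auto
      also have "\<dots> \<le> pp u i * (?x\<^sup>2 + ?y\<^sup>2) + bb u i * (2 * Re (cnj (z i) * z (nx n i)))" using b by (simp add: left_diff_distrib)
      also have "\<dots> = Re (of_real (pp u i) * (cnj (z i) * z i + cnj (z (nx n i)) * z (nx n i)) + of_real (bb u i) * (cnj (z i) * z (nx n i) + cnj (z (nx n i)) * z i))"
        unfolding plus_complex.sel Re_complex_of_real times_complex.sel(1) c r[simplified plus_complex.sel] by (simp add: c r[symmetric])
      finally show ?thesis .
    qed
    have im: "Re (\<i> * (\<Sum>a<n. of_real (d a) * (cnj (z a) * z a))) = 0"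
    proof -
      have "(\<Sum>a<n. of_real (d a) * (cnj (z a) * z a)) = of_real (\<Sum>a<n. d a * (norm (z a))\<^sup>2)"
        by (simp add: complex_norm_square mult.commute del: of_real_power)
      then show ?thesis by simp
    qed
    have "\<delta> * (\<Sum>i<n. (norm (z i))\<^sup>2) = (\<Sum>i<n. \<delta> * (norm (z i))\<^sup>2)" by (simp add: sum_distrib_left)
    also have "\<dots> \<le> (\<Sum>i<n. Re (of_real (pp u i) * (cnj (z i) * z i + cnj (z (nx n i)) * z (nx n i)) + of_real (bb u i) * (cnj (z i) * z (nx n i) + cnj (z (nx n i)) * z i)))"
      by (rule sum_mono) (use one in auto)
    also have "\<dots> = Re (\<Sum>i<n. \<Sum>j<n. cnj (z i) * MA n u d i j * z j)"
      unfolding MA_bilinear[OF n] plus_complex.sel(1)[of _ "\<i> * _"] im by (simp only: Re_sum add_0_right)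
    finally show "\<delta> * (\<Sum>i<n. (norm (z i))\<^sup>2) \<le> Re (\<Sum>i<n. \<Sum>j<n. cnj (z i) * MA n u d i j * z j)" .
  qed
qed

lemma qf_MA:
  assumes "0 < n"
  shows "qf n (MA n u d) x = of_real (\<Sum>i<n. pp u i * ((x i)\<^sup>2 + (x (nx n i))\<^sup>2) + 2 * bb u i * x i * x (nx n i)) + \<i> * of_real (\<Sum>a<n. d a * (x a)\<^sup>2)"
proof -
  have "qf n (MA n u d) x = (\<Sum>a<n. \<Sum>b<n. of_real (x a) * MA n u d a b * of_real (x b))"
    unfolding qf_def by (simp only: mult_ac)
  then show ?thesis unfolding MA_bilinear[OF assms]
    by (simp add: power2_eq_square algebra_simps)
qed

lemma MA_mat3:
  "mat n n (\<lambda>(i, j). MA n u d i j) = mat3 n (\<lambda>i. of_real (pp u i + pp u ((i + n - 1) mod n)) + \<i> * of_real (d i)) (\<lambda>i. of_real (bb u i)) (\<lambda>i. of_real (bb u ((i + n - 1) mod n)))"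
  unfolding mat3_def MA_def by (rule eq_matI) (auto simp: Delta_mat3 pv_def nx_def)

lemma continuous_nonzero_pos:
  fixes f :: "real \<Rightarrow> real"
  assumes "continuous_on UNIV f" "\<And>t. f t \<noteq> 0" "f 0 > 0" shows "f t > 0"
proof (rule ccontr)
  assume "\<not> f t > 0"
  then have "f t \<le> 0" "0 \<le> f 0" using assms by auto
  moreover have "connected (range f)" using assms(1) connected_continuous_image by blast
  ultimately have "0 \<in> range f" unfolding connected_iff_interval by (metis rangeI)
  then show False using assms(2) by auto
qed

text \<open>The general Gaussian integral is known only through its square. The sign of the real, nonvanishing determinant
  and the branch of the root are followed along \<open>t * d\<close> from \<open>t = 0\<close>, where everything is positive.\<close>

lemma gauss_cyclic:
  assumes n: "0 < n" and u: "\<And>i. i < n \<Longrightarrow> 0 < u i \<and> u i < 1"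
    and d: "\<And>i. i < n \<Longrightarrow> d i = s * (\<sigma> i - \<sigma> (pv n i))" and \<sigma>: "\<And>i. i < n \<Longrightarrow> (\<sigma> i)\<^sup>2 = 1"
  shows "\<exists>D>0. Determinant.det (mat n n (\<lambda>(i, j). MA n u d i j)) = of_real D \<and>
    Determinant.det (mat n n (\<lambda>(i, j). MA n u (\<lambda>i. - d i) i j)) = of_real D \<and>
    (\<integral>x. exp (- qf n (MA n u d) x) \<partial>leb n) = of_real (sqrt (pi ^ n / D))"
proof -
  define A where "A t = MA n u (\<lambda>i. t * d i)" for t
  define I where "I t = (\<integral>x. exp (- qf n (A t) x) \<partial>leb n)" for t
  define E where "E t = Determinant.det (mat n n (\<lambda>(i, j). A t i j))" for t
  obtain \<delta> where co: "\<And>d. coercive n (MA n u d) \<delta>" and d0: "\<delta> > 0" using MA_coercive[of n u, OF n u] by blast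
  have sym: "MA n u d i j = MA n u d j i" if "i < n" "j < n" for d i j
    using Delta_sym[OF that] by (auto simp: MA_def)
  have IE: "I t ^ 2 * E t = of_real (pi ^ n)" for t
    unfolding I_def E_def A_def by (subst gauss_nd[OF co sym]) auto
  have even: "E (- t) = E t" for t
  proof -
    have m: "mat n n (\<lambda>(i, j). A r i j) = mat3 n (\<lambda>i. of_real (pp u i + pp u ((i + n - 1) mod n)) + \<i> * of_real ((r * s) * (\<sigma> i - \<sigma> ((i + n - 1) mod n))))
       (\<lambda>i. of_real (bb u i)) (\<lambda>i. of_real (bb u ((i + n - 1) mod n)))" for r
      unfolding A_def MA_mat3 unfolding mat3_def by (rule cong_mat) (auto simp: d pv_def)
    have h: "- t * s = - (t * s)" by simp
    show ?thesis unfolding E_def m h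
      by (rule det_cyclic_real[of n "bb u" "pp u" \<sigma> "t * s", OF n]) (use pp_bb u \<sigma> in auto)
  qed
  \<comment> \<open>Only the diagonal is not real, and its imaginary part is linear in t; with
    \<open>even\<close> this makes the determinant real.\<close>
  have cn: "cnj (E t) = E (- t)" for t
  proof -
    interpret comm_ring_hom cnj by unfold_locales auto
    have "E (- t) = Determinant.det (map_mat cnj (mat n n (\<lambda>(i, j). A t i j)))"
      unfolding E_def by (intro arg_cong[of _ _ Determinant.det] eq_matI) (auto simp: A_def MA_def)
    then show ?thesis by (simp add: E_def[of t])
  qed
  have Er: "E t = of_real (Re (E t))" for t
    using cn[of t] even[of t] by (simp add: complex_eq_iff)
  have cI: "continuous_on UNIV I"
    unfolding continuous_on_sequentially
  proof (intro allI ballI impI, elim conjE)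
    fix r :: "nat \<Rightarrow> real" and t assume r: "r \<longlonglongrightarrow> t"
    show "(I \<circ> r) \<longlonglongrightarrow> I t" unfolding I_def o_def
    proof (rule integral_dominated_convergence[where w="\<lambda>x. \<Prod>i<n. exp (- \<delta> * (x i)\<^sup>2)"])
      show "integrable (leb n) (\<lambda>x. \<Prod>i<n. exp (- \<delta> * (x i)\<^sup>2))" by (rule gauss_prod_integrable[OF d0])
      show "AE x in leb n. (\<lambda>k. exp (- qf n (A (r k)) x)) \<longlonglongrightarrow> exp (- qf n (A t) x)"
        unfolding A_def qf_MA[OF n] by (intro AE_I2 tendsto_intros r)
      show "AE x in leb n. norm (exp (- qf n (A (r k)) x)) \<le> (\<Prod>i<n. exp (- \<delta> * (x i)\<^sup>2))" for k
        unfolding A_def by (intro AE_I2 norm_exp_qf co)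
    qed simp_all
  qed
  have I0: "I t \<noteq> 0" "E t \<noteq> 0" for t using IE[of t] by auto
  have EI: "E t = of_real (pi ^ n) / (I t)\<^sup>2" for t using IE[of t] I0[of t] by (simp add: field_simps)
  have cE: "continuous_on UNIV (\<lambda>t. Re (E t))"
    unfolding EI by (intro continuous_intros cI) (use I0 in auto)
  have I0r: "\<exists>r\<ge>0. I 0 = of_real r"
  proof -
    have "I 0 = (\<integral>x. complex_of_real (exp (- (\<Sum>i<n. pp u i * ((x i)\<^sup>2 + (x (nx n i))\<^sup>2) + 2 * bb u i * x i * x (nx n i)))) \<partial>leb n)"
      unfolding I_def A_def qf_MA[OF n] by (simp add: exp_of_real del: of_real_sum of_real_add of_real_mult flip: of_real_minus)
    also have "\<dots> = of_real (\<integral>x. exp (- (\<Sum>i<n. pp u i * ((x i)\<^sup>2 + (x (nx n i))\<^sup>2) + 2 * bb u i * x i * x (nx n i))) \<partial>leb n)"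
      by (rule integral_complex_of_real)
    finally show ?thesis by (meson Bochner_Integration.integral_nonneg exp_ge_zero)
  qed
  then obtain r where r: "r > 0" "I 0 = of_real r" using I0(1)[of 0] by (metis less_eq_real_def of_real_0)
  have "complex_of_real (r\<^sup>2 * Re (E 0)) = of_real (pi ^ n)" using IE[of 0] Er[of 0] r(2) by (metis of_real_mult of_real_power)
  then have "r\<^sup>2 * Re (E 0) > 0" by (metis of_real_eq_iff pi_gt_zero zero_less_power)
  then have "Re (E 0) > 0" by (simp add: zero_less_mult_iff)
  moreover have "Re (E t) \<noteq> 0" for t using I0(2)[of t] Er[of t] by auto
  ultimately have Ep: "Re (E t) > 0" for t using continuous_nonzero_pos[OF cE] by blast
  \<comment> \<open>Ratio of the integral to its expected value. It is continuous, squares to 1 and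
    is positive at 0, hence constantly 1.\<close>
  define J where "J t = I t * of_real (sqrt (Re (E t) / pi ^ n))" for t
  have J2: "J t ^ 2 = 1" for t
  proof -
    have "J t ^ 2 = I t ^ 2 * of_real (Re (E t) / pi ^ n)"
      unfolding J_def power_mult_distrib using Ep[of t] by (simp flip: of_real_power)
    also have "\<dots> = (I t ^ 2 * E t) / of_real (pi ^ n)" by (subst (2) Er) simp
    finally show ?thesis unfolding IE by simp
  qed
  have J1: "J t = 1 \<or> J t = - 1" for t using J2[of t] power2_eq_1_iff by blast
  have "Re (J t) > 0" for t
  proof (rule continuous_nonzero_pos[of "\<lambda>t. Re (J t)"])
    show "continuous_on UNIV (\<lambda>t. Re (J t))" unfolding J_def by (intro continuous_intros cI cE) auto
    show "Re (J t) \<noteq> 0" for t using J1[of t] by auto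
    show "Re (J 0) > 0" unfolding J_def r(2) using r(1) Ep[of 0] by simp
  qed
  then have Jt: "J t = 1" for t using J1[of t] by (metis one_complex.sel(1) uminus_complex.sel(1) less_numeral_extra(1) neg_0_less_iff_less not_less_iff_gr_or_eq)
  have "I 1 = of_real (sqrt (pi ^ n / Re (E 1)))"
  proof -
    have "sqrt (Re (E 1) / pi ^ n) * sqrt (pi ^ n / Re (E 1)) = 1"
      using Ep[of 1] by (simp flip: real_sqrt_mult)
    then have "complex_of_real (sqrt (Re (E 1) / pi ^ n)) * of_real (sqrt (pi ^ n / Re (E 1))) = 1" by (metis of_real_1 of_real_mult)
    then have "I 1 = J 1 * of_real (sqrt (pi ^ n / Re (E 1)))" unfolding J_def by (simp add: mult.assoc)
    then show ?thesis by (simp add: Jt)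
  qed
  moreover have "A 1 = MA n u d" "A (- 1) = MA n u (\<lambda>i. - d i)" by (auto simp: A_def)
  ultimately show ?thesis
    using Ep[of 1] Er[of 1] even[of 1] unfolding I_def E_def by (intro exI[of _ "Re (E 1)"]) (auto simp: E_def)
qed

section \<open>Interchange of infinite sums, products and integrals\<close>

lemma infsum_eq_suminf:
  fixes g :: "'i \<Rightarrow> complex"
  assumes h: "bij_betw h UNIV I" and g: "(\<lambda>i. norm (g i)) summable_on I"
  shows "infsum g I = (\<Sum>k. g (h k))"
proof -
  have "(\<lambda>k. norm (g (h k))) summable_on UNIV"
    using g summable_on_reindex_bij_betw[OF h, of "\<lambda>i. norm (g i)"] by simp
  then have "((\<lambda>k. g (h k)) has_sum infsum (\<lambda>k. g (h k)) UNIV) UNIV"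
    by (rule has_sum_infsum[OF abs_summable_summable])
  then have "(\<lambda>k. g (h k)) sums infsum (\<lambda>k. g (h k)) UNIV" by (rule has_sum_imp_sums)
  then show ?thesis using infsum_reindex_bij_betw[OF h, of g] by (simp add: sums_unique)
qed

text \<open>A complex family is summable only if it is absolutely summable, so the sum is a
  measurable case distinction between a convergent series and the default value 0.\<close>

lemma infsum_measurable:
  fixes f :: "'i \<Rightarrow> 'a \<Rightarrow> complex"
  assumes I: "countable I" and m: "\<And>i. i \<in> I \<Longrightarrow> f i \<in> borel_measurable M"
  shows "(\<lambda>x. infsum (\<lambda>i. f i x) I) \<in> borel_measurable M"
proof (cases "finite I")
  case True
  then show ?thesis using m by simp
next
  case False
  define h where "h = from_nat_into I"
  have h: "bij_betw h UNIV I" unfolding h_def using I False by (rule bij_betw_from_nat_into)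
  have [measurable]: "\<And>k. f (h k) \<in> borel_measurable M" using h m by (auto simp: bij_betw_def)
  have "(\<lambda>x. infsum (\<lambda>i. f i x) I) = (\<lambda>x. if summable (\<lambda>k. norm (f (h k) x)) then (\<Sum>k. f (h k) x) else 0)"
  proof
    fix x
    have "(\<lambda>i. norm (f i x)) summable_on I \<longleftrightarrow> summable (\<lambda>k. norm (f (h k) x))"
      using summable_on_reindex_bij_betw[OF h, of "\<lambda>i. norm (f i x)"] summable_on_UNIV_nonneg_real_iff[of "\<lambda>k. norm (f (h k) x)"] by simp
    moreover have "(\<lambda>i. f i x) summable_on I \<longleftrightarrow> (\<lambda>i. norm (f i x)) summable_on I"
      by (rule summable_on_iff_abs_summable_on_complex)
    ultimately show "infsum (\<lambda>i. f i x) I = (if summable (\<lambda>k. norm (f (h k) x)) then (\<Sum>k. f (h k) x) else 0)"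
      using infsum_eq_suminf[OF h, of "\<lambda>i. f i x"] by (auto simp: infsum_not_exists)
  qed
  moreover have "Measurable.pred M (\<lambda>x. summable (\<lambda>k. norm (f (h k) x)))"
    unfolding summable_iff_convergent Cauchy_convergent_iff[symmetric] by measurable
  ultimately show ?thesis by simp
qed

lemma infsum_integral:
  fixes f :: "'i \<Rightarrow> 'a \<Rightarrow> complex"
  assumes I: "countable I" and int: "\<And>i. i \<in> I \<Longrightarrow> integrable M (f i)"
    and s: "(\<lambda>i. \<integral>x. norm (f i x) \<partial>M) summable_on I"
    and p: "AE x in M. (\<lambda>i. norm (f i x)) summable_on I"
  shows "infsum (\<lambda>i. \<integral>x. f i x \<partial>M) I = (\<integral>x. infsum (\<lambda>i. f i x) I \<partial>M)"
proof (cases "finite I")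
  case True
  then show ?thesis by (simp add: int)
next
  case False
  define h where "h = from_nat_into I"
  have h: "bij_betw h UNIV I" unfolding h_def using I False by (rule bij_betw_from_nat_into)
  have hI: "h k \<in> I" for k using h by (auto simp: bij_betw_def)
  have s': "(\<lambda>k. \<integral>x. norm (f (h k) x) \<partial>M) summable_on UNIV"
    using s summable_on_reindex_bij_betw[OF h, of "\<lambda>i. \<integral>x. norm (f i x) \<partial>M"] by simp
  have p': "AE x in M. summable (\<lambda>k. norm (f (h k) x))"
    using p
  proof eventually_elim
    case (elim x)
    then have "(\<lambda>k. norm (f (h k) x)) summable_on UNIV"
      using summable_on_reindex_bij_betw[OF h, of "\<lambda>i. norm (f i x)"] by simp
    then show ?case by (rule summable_on_imp_summable)
  qed
  have n: "(\<lambda>i. norm (\<integral>x. f i x \<partial>M)) summable_on I"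
    by (rule summable_on_comparison_test[OF s]) (auto intro: integral_norm_bound)
  have sm: "summable (\<lambda>k. \<integral>x. norm (f (h k) x) \<partial>M)" by (rule summable_on_imp_summable[OF s'])
  have ih: "\<And>k. integrable M (f (h k))" using int hI by blast
  have "infsum (\<lambda>i. \<integral>x. f i x \<partial>M) I = (\<Sum>k. \<integral>x. f (h k) x \<partial>M)" by (rule infsum_eq_suminf[OF h n])
  also have "\<dots> = (\<integral>x. (\<Sum>k. f (h k) x) \<partial>M)"
    by (rule integral_suminf[OF ih p' sm, symmetric])
  also have "\<dots> = (\<integral>x. infsum (\<lambda>i. f i x) I \<partial>M)"
  proof (rule integral_cong_AE)
    show "(\<lambda>x. \<Sum>k. f (h k) x) \<in> borel_measurable M"
      using ih by (intro borel_measurable_suminf) auto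
    show "(\<lambda>x. infsum (\<lambda>i. f i x) I) \<in> borel_measurable M"
      by (rule infsum_measurable[OF I]) (use int in auto)
    show "AE x in M. (\<Sum>k. f (h k) x) = infsum (\<lambda>i. f i x) I"
      using p by eventually_elim (simp add: infsum_eq_suminf[OF h])
  qed
  finally show ?thesis .
qed

lemma has_sum_prod_PiE:
  fixes g :: "nat \<Rightarrow> 'b \<Rightarrow> complex"
  assumes "\<And>j. j < n \<Longrightarrow> (\<lambda>k. norm (g j k)) summable_on UNIV"
  shows "(\<lambda>m. norm (\<Prod>j<n. g j (m j))) summable_on PiE {..<n} (\<lambda>_. UNIV)"
    and "infsum (\<lambda>m. \<Prod>j<n. g j (m j)) (PiE {..<n} (\<lambda>_. UNIV)) = (\<Prod>j<n. infsum (g j) UNIV)"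
  using assms
proof (induction n)
  case 0
  { case 1 show ?case by simp next case 2 show ?case by simp }
next
  case (Suc n)
  { case 1
    have a: "(\<lambda>m. norm (\<Prod>j<n. g j (m j))) summable_on PiE {..<n} (\<lambda>_. UNIV)" using Suc(1) 1 by simp
    have b: "(\<lambda>k. norm (g n k)) summable_on UNIV" using 1 by simp
    have "(\<lambda>(k, m). norm ((\<Prod>j<n. g j (m j)) * g n k)) summable_on UNIV \<times> PiE {..<n} (\<lambda>_. UNIV)"
    proof (rule summable_on_SigmaI[where g="\<lambda>k. infsum (\<lambda>m. norm (\<Prod>j<n. g j (m j))) (PiE {..<n} (\<lambda>_. UNIV)) * norm (g n k)"])
      show "((\<lambda>m. case (k, m) of (k, m) \<Rightarrow> norm ((\<Prod>j<n. g j (m j)) * g n k)) has_sum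
        infsum (\<lambda>m. norm (\<Prod>j<n. g j (m j))) (PiE {..<n} (\<lambda>_. UNIV)) * norm (g n k)) (PiE {..<n} (\<lambda>_. UNIV))" for k
        using has_sum_cmult_left[OF has_sum_infsum[OF a], of "norm (g n k)"] by (simp add: norm_mult)
      show "(\<lambda>k. infsum (\<lambda>m. norm (\<Prod>j<n. g j (m j))) (PiE {..<n} (\<lambda>_. UNIV)) * norm (g n k)) summable_on UNIV"
        using b by (rule summable_on_cmult_right)
    qed auto
    then show ?case unfolding PiE_lessThan_Suc
      by (subst summable_on_reindex[OF inj_PiE_Suc]) (simp add: o_def case_prod_unfold)
  next
    case 2
    have a: "(\<lambda>m. norm (\<Prod>j<n. g j (m j))) summable_on PiE {..<n} (\<lambda>_. UNIV)" using Suc(1) 2 by simp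
    have b: "(\<lambda>k. norm (g n k)) summable_on UNIV" using 2 by simp
    have "(\<lambda>(k, m). norm ((\<Prod>j<n. g j (m j)) * g n k)) summable_on UNIV \<times> PiE {..<n} (\<lambda>_. UNIV)"
    proof (rule summable_on_SigmaI[where g="\<lambda>k. infsum (\<lambda>m. norm (\<Prod>j<n. g j (m j))) (PiE {..<n} (\<lambda>_. UNIV)) * norm (g n k)"])
      show "((\<lambda>m. case (k, m) of (k, m) \<Rightarrow> norm ((\<Prod>j<n. g j (m j)) * g n k)) has_sum
        infsum (\<lambda>m. norm (\<Prod>j<n. g j (m j))) (PiE {..<n} (\<lambda>_. UNIV)) * norm (g n k)) (PiE {..<n} (\<lambda>_. UNIV))" for k
        using has_sum_cmult_left[OF has_sum_infsum[OF a], of "norm (g n k)"] by (simp add: norm_mult)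
      show "(\<lambda>k. infsum (\<lambda>m. norm (\<Prod>j<n. g j (m j))) (PiE {..<n} (\<lambda>_. UNIV)) * norm (g n k)) summable_on UNIV"
        using b by (rule summable_on_cmult_right)
    qed auto
    then have s: "(\<lambda>(k, m). (\<Prod>j<n. g j (m j)) * g n k) summable_on UNIV \<times> PiE {..<n} (\<lambda>_. UNIV)"
      by (rule_tac abs_summable_summable) (simp add: case_prod_unfold)
    have "infsum (\<lambda>m. \<Prod>j<Suc n. g j (m j)) (PiE {..<Suc n} (\<lambda>_. UNIV)) = infsum (\<lambda>(k, m). (\<Prod>j<n. g j (m j)) * g n k) (UNIV \<times> PiE {..<n} (\<lambda>_. UNIV))"
      unfolding PiE_lessThan_Suc by (subst infsum_reindex[OF inj_PiE_Suc]) (simp add: o_def case_prod_unfold)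
    also have "\<dots> = infsum (\<lambda>k. infsum (\<lambda>m. (\<Prod>j<n. g j (m j)) * g n k) (PiE {..<n} (\<lambda>_. UNIV))) UNIV"
      by (rule infsum_Sigma'_banach[OF s, symmetric])
    also have "\<dots> = infsum (\<lambda>k. (\<Prod>j<n. infsum (g j) UNIV) * g n k) UNIV"
      using Suc(2) 2 by (simp add: infsum_cmult_left')
    finally show ?case by (simp add: infsum_cmult_right')
  }
qed

section \<open>Path sums as integrals over the cube\<close>

text \<open>Matrix entry, in the Hermite basis, of multiplication by the chirp exp(i c x^2).\<close>

definition Wc :: "real \<Rightarrow> nat \<Rightarrow> nat \<Rightarrow> complex" where
  "Wc c m k = (\<integral>x. hf m x * hf k x * exp (\<i> * of_real (c * x\<^sup>2)) \<partial>lborel)"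

lemma hf_sq: "sq (hf m) = 1"
  using hf_sp[of m m] sp_self[of "hf m"] by (metis of_real_eq_1_iff)

lemma Wc_integrable: "integrable lborel (\<lambda>x. hf m x * hf k x * exp (\<i> * of_real (c * x\<^sup>2)))"
proof (rule Bochner_Integration.integrable_bound[OF l2_norm_mult[OF hf_l2 hf_l2]])
  note [measurable] = l2_meas[OF hf_l2]
  show "(\<lambda>x. hf m x * hf k x * exp (\<i> * of_real (c * x\<^sup>2))) \<in> borel_measurable lborel" by measurable
qed (auto simp: norm_mult)

lemma Wc_norm_integral: "(\<integral>x. norm (hf m x * hf k x * exp (\<i> * of_real (c * x\<^sup>2))) \<partial>lborel) \<le> 1"
  using l2_CS_norm[OF hf_l2 hf_l2, of m k] by (simp add: norm_mult hf_sq)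

lemma mehler_abs:
  assumes w: "0 \<le> w" "w < 1"
  shows "(\<lambda>m. norm (of_real w ^ m * (hf m x * hf m y))) summable_on UNIV"
    and "infsum (\<lambda>m. of_real w ^ m * (hf m x * hf m y)) UNIV = of_real (mehler w x y)"
proof -
  have s: "summable (\<lambda>m. w ^ m * (norm (hf m z))\<^sup>2)" for z
  proof -
    have "hf m z * hf m z = of_real ((norm (hf m z))\<^sup>2)" for m
      using complex_norm_square[of "hf m z"] by (simp add: hf_real)
    then have e: "complex_of_real (w ^ m * (norm (hf m z))\<^sup>2) = of_real w ^ m * (hf m z * hf m z)" for m
      by (simp only: of_real_mult of_real_power)
    have "summable (\<lambda>m. complex_of_real (w ^ m * (norm (hf m z))\<^sup>2))"
      unfolding e by (rule sums_summable[OF mehler_sums[OF w]])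
    then show ?thesis by (simp only: summable_of_real_iff)
  qed
  have "summable (\<lambda>m. norm (of_real w ^ m * (hf m x * hf m y)))"
  proof (rule summable_comparison_test'[of "\<lambda>m. w ^ m * (norm (hf m x))\<^sup>2 + w ^ m * (norm (hf m y))\<^sup>2" 0])
    show "summable (\<lambda>m. w ^ m * (norm (hf m x))\<^sup>2 + w ^ m * (norm (hf m y))\<^sup>2)" by (intro summable_add s)
    fix m
    have "norm (hf m x) * norm (hf m y) \<le> (norm (hf m x))\<^sup>2 + (norm (hf m y))\<^sup>2"
      using sum_squares_bound[of "norm (hf m x)" "norm (hf m y)"] mult_nonneg_nonneg[OF norm_ge_zero norm_ge_zero, of "hf m x" "hf m y"] by linarith
    then have "w ^ m * (norm (hf m x) * norm (hf m y)) \<le> w ^ m * ((norm (hf m x))\<^sup>2 + (norm (hf m y))\<^sup>2)"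
      using w by (intro mult_left_mono) auto
    then show "norm (norm (of_real w ^ m * (hf m x * hf m y))) \<le> w ^ m * (norm (hf m x))\<^sup>2 + w ^ m * (norm (hf m y))\<^sup>2"
      using w by (simp add: norm_mult norm_power distrib_left)
  qed
  then show a: "(\<lambda>m. norm (of_real w ^ m * (hf m x * hf m y))) summable_on UNIV"
    by (simp add: summable_on_UNIV_nonneg_real_iff)
  have "(\<lambda>m. of_real w ^ m * (hf m x * hf m y)) sums infsum (\<lambda>m. of_real w ^ m * (hf m x * hf m y)) UNIV"
    by (rule has_sum_imp_sums[OF has_sum_infsum[OF abs_summable_summable[OF a]]])
  then show "infsum (\<lambda>m. of_real w ^ m * (hf m x * hf m y)) UNIV = of_real (mehler w x y)"
    using mehler_sums[OF w, of x y] by (rule sums_unique2)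
qed

text \<open>Each \<open>Wc\<close> is an integral in its own variable, so the product is an integral
  over n variables. Summing over the oscillator indices under it gives a Mehler kernel for each pair
  of neighbouring variables. The chirp exp(i c x^2) enters \<open>exp (- qf ...)\<close> with
  reversed sign, hence the diagonal -c.\<close>

lemma path_gauss:
  assumes n: "0 < n" and u: "\<And>i. i < n \<Longrightarrow> 0 < u i \<and> u i < 1"
  shows "(\<lambda>m. norm (\<Prod>j<n. of_real ((u j)\<^sup>2) ^ m j * Wc (c j) (m (pv n j)) (m j))) summable_on PiE {..<n} (\<lambda>_. UNIV)"
    and "infsum (\<lambda>m. \<Prod>j<n. of_real ((u j)\<^sup>2) ^ m j * Wc (c j) (m (pv n j)) (m j)) (PiE {..<n} (\<lambda>_. UNIV)) =
      of_real (\<Prod>j<n. 1 / sqrt (pi * (1 - u j ^ 4))) * (\<integral>x. exp (- qf n (MA n u (\<lambda>j. - c j)) x) \<partial>leb n)"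
proof -
  let ?P = "PiE {..<n} (\<lambda>_. UNIV :: nat set)"
  define w where "w j = (u j)\<^sup>2" for j
  have w: "0 \<le> w j" "w j < 1" if "j < n" for j using u[OF that] by (auto simp: w_def abs_square_less_1)
  define f where "f m x = (\<Prod>j<n. of_real (w j) ^ m j * (hf (m (pv n j)) (x j) * hf (m j) (x j) * exp (\<i> * of_real (c j * (x j)\<^sup>2))))" for m and x :: "nat \<Rightarrow> real"
  have fi: "integrable (leb n) (f m)" for m
    unfolding f_def by (rule lebp.product_integrable_prod[OF finite_lessThan integrable_mult_right[OF Wc_integrable]])
  have fI: "(\<integral>x. f m x \<partial>leb n) = (\<Prod>j<n. of_real (w j) ^ m j * Wc (c j) (m (pv n j)) (m j))" for m
    unfolding f_def Wc_def
    by (subst lebp.product_integral_prod[OF finite_lessThan integrable_mult_right[OF Wc_integrable]]) (simp only: integral_mult_right_zero)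
  \<comment> \<open>Chirps have modulus 1 and Hermite functions norm 1, so only the geometric
    factors remain; they are summable because every u_j is strictly below 1.\<close>
  have fN: "(\<integral>x. norm (f m x) \<partial>leb n) \<le> (\<Prod>j<n. w j ^ m j)" for m
  proof -
    have "(\<integral>x. norm (f m x) \<partial>leb n) = (\<Prod>j<n. \<integral>x. norm (of_real (w j) ^ m j * (hf (m (pv n j)) x * hf (m j) x * exp (\<i> * of_real (c j * x\<^sup>2)))) \<partial>lborel)"
      unfolding f_def prod_norm[symmetric]
      by (rule lebp.product_integral_prod[OF finite_lessThan integrable_norm[OF integrable_mult_right[OF Wc_integrable]]])
    also have "\<dots> \<le> (\<Prod>j<n. w j ^ m j)"
    proof (rule prod_mono, safe)
      fix j assume "j < n"
      have "(\<integral>x. norm (of_real (w j) ^ m j * (hf (m (pv n j)) x * hf (m j) x * exp (\<i> * of_real (c j * x\<^sup>2)))) \<partial>lborel)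
         = w j ^ m j * (\<integral>x. norm (hf (m (pv n j)) x * hf (m j) x * exp (\<i> * of_real (c j * x\<^sup>2))) \<partial>lborel)"
        unfolding norm_mult[of "of_real (w j) ^ m j"] using w[OF \<open>j < n\<close>] by (simp only: integral_mult_right_zero norm_power norm_of_real abs_of_nonneg)
      also have "\<dots> \<le> w j ^ m j * 1" using w[OF \<open>j < n\<close>] by (intro mult_left_mono Wc_norm_integral) auto
      finally show "(\<integral>x. norm (of_real (w j) ^ m j * (hf (m (pv n j)) x * hf (m j) x * exp (\<i> * of_real (c j * x\<^sup>2)))) \<partial>lborel) \<le> w j ^ m j" by simp
    qed simp
    finally show ?thesis .
  qed
  have geo: "(\<lambda>m. \<Prod>j<n. w j ^ m j) summable_on ?P"
  proof -
    have "(\<lambda>k. norm (complex_of_real (w j) ^ k)) summable_on UNIV" if "j < n" for j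
      using w[OF that] by (simp add: norm_power summable_on_UNIV_nonneg_real_iff summable_geometric)
    from has_sum_prod_PiE(1)[of n "\<lambda>j k. complex_of_real (w j) ^ k", OF this]
    have "(\<lambda>m. norm (\<Prod>j<n. complex_of_real (w j) ^ m j)) summable_on ?P" .
    moreover have "norm (\<Prod>j<n. complex_of_real (w j) ^ m j) = (\<Prod>j<n. w j ^ m j)" for m
      unfolding prod_norm[symmetric] norm_power using w by (intro prod.cong) auto
    ultimately show ?thesis by simp
  qed
  have sI: "(\<lambda>m. \<integral>x. norm (f m x) \<partial>leb n) summable_on ?P"
    by (rule summable_on_comparison_test[OF geo fN]) simp
  \<comment> \<open>Regrouping from variables to oscillator indices: \<open>m j\<close> occurs at
    position j and at its successor, so a cyclic shift brings both Hermite functions with index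
    \<open>m j\<close> together.\<close>
  have re: "f m x = (\<Prod>j<n. exp (\<i> * of_real (c j * (x j)\<^sup>2))) * (\<Prod>j<n. of_real (w j) ^ m j * (hf (m j) (x j) * hf (m j) (x (nx n j))))" for m x
  proof -
    have "(\<Prod>j<n. hf (m (pv n j)) (x j)) = (\<Prod>i<n. hf (m i) (x (nx n i)))"
      by (subst prod.reindex_bij_betw[OF nx_bij[OF n], symmetric]) (auto simp: pv_nx[OF n] intro!: prod.cong)
    then show ?thesis unfolding f_def prod.distrib by (simp add: mult_ac)
  qed
  have ab: "(\<lambda>m. norm (\<Prod>j<n. of_real (w j) ^ m j * (hf (m j) (x j) * hf (m j) (x (nx n j))))) summable_on ?P"
    "infsum (\<lambda>m. \<Prod>j<n. of_real (w j) ^ m j * (hf (m j) (x j) * hf (m j) (x (nx n j)))) ?P = (\<Prod>j<n. of_real (mehler (w j) (x j) (x (nx n j))))" for x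
    using has_sum_prod_PiE[of n "\<lambda>j k. of_real (w j) ^ k * (hf k (x j) * hf k (x (nx n j)))"] mehler_abs w by simp_all
  have sp: "(\<lambda>m. norm (f m x)) summable_on ?P" for x
    unfolding re norm_mult[of "prod _ _"] by (rule summable_on_cmult_right[OF ab(1)])
  have fs: "infsum (\<lambda>m. f m x) ?P = of_real (\<Prod>j<n. 1 / sqrt (pi * (1 - u j ^ 4))) * exp (- qf n (MA n u (\<lambda>j. - c j)) x)" for x
  proof -
    have w4: "(w j)\<^sup>2 = u j ^ 4" for j by (simp add: w_def)
    have "infsum (\<lambda>m. f m x) ?P = (\<Prod>j<n. exp (\<i> * of_real (c j * (x j)\<^sup>2))) * of_real (\<Prod>j<n. mehler (w j) (x j) (x (nx n j)))"
      unfolding re by (simp add: infsum_cmult_right' ab(2))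
    also have "(\<Prod>j<n. mehler (w j) (x j) (x (nx n j))) = (\<Prod>j<n. 1 / sqrt (pi * (1 - u j ^ 4))) * exp (- (\<Sum>i<n. pp u i * ((x i)\<^sup>2 + (x (nx n i))\<^sup>2) + 2 * bb u i * x i * x (nx n i)))"
      unfolding mehler_def prod.distrib w4 exp_sum[OF finite_lessThan, symmetric] sum_negf[symmetric]
      by (intro arg_cong2[of _ _ _ _ times] refl arg_cong[of _ _ exp] sum.cong) (simp add: pp_def bb_def w_def field_simps)
    also have "(\<Prod>j<n. exp (\<i> * complex_of_real (c j * (x j)\<^sup>2))) = exp (\<i> * of_real (\<Sum>j<n. c j * (x j)\<^sup>2))"
      by (simp add: exp_sum[symmetric] sum_distrib_left)
    finally have 1: "infsum (\<lambda>m. f m x) ?P = exp (\<i> * of_real (\<Sum>j<n. c j * (x j)\<^sup>2)) * of_real ((\<Prod>j<n. 1 / sqrt (pi * (1 - u j ^ 4))) * exp (- (\<Sum>i<n. pp u i * ((x i)\<^sup>2 + (x (nx n i))\<^sup>2) + 2 * bb u i * x i * x (nx n i))))" .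
    have "- qf n (MA n u (\<lambda>j. - c j)) x = \<i> * of_real (\<Sum>j<n. c j * (x j)\<^sup>2) + of_real (- (\<Sum>i<n. pp u i * ((x i)\<^sup>2 + (x (nx n i))\<^sup>2) + 2 * bb u i * x i * x (nx n i)))"
      unfolding qf_MA[OF n] by (simp add: sum_negf)
    then show ?thesis unfolding 1 by (simp only: exp_add exp_of_real of_real_mult mult_ac)
  qed
  have cP: "countable ?P" by (rule countable_PiE) auto
  have "infsum (\<lambda>m. \<integral>x. f m x \<partial>leb n) ?P = (\<integral>x. infsum (\<lambda>m. f m x) ?P \<partial>leb n)"
    by (rule infsum_integral[OF cP fi sI]) (use sp in auto)
  then show "infsum (\<lambda>m. \<Prod>j<n. of_real ((u j)\<^sup>2) ^ m j * Wc (c j) (m (pv n j)) (m j)) ?P =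
      of_real (\<Prod>j<n. 1 / sqrt (pi * (1 - u j ^ 4))) * (\<integral>x. exp (- qf n (MA n u (\<lambda>j. - c j)) x) \<partial>leb n)"
    unfolding fI fs by (simp only: integral_mult_right_zero w_def)
  have "(\<lambda>m. norm (\<integral>x. f m x \<partial>leb n)) summable_on ?P"
    by (rule summable_on_comparison_test[OF sI]) (auto intro: integral_norm_bound)
  then show "(\<lambda>m. norm (\<Prod>j<n. of_real ((u j)\<^sup>2) ^ m j * Wc (c j) (m (pv n j)) (m j))) summable_on ?P"
    unfolding fI w_def .
qed

lemma csqrt_measurable [measurable]: "csqrt \<in> borel_measurable borel"
proof -
  have "(\<lambda>z. Complex (sqrt ((cmod z + Re z) / 2)) ((if Im z = 0 then 1 else sgn (Im z)) * sqrt ((cmod z - Re z) / 2))) \<in> borel_measurable borel"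
    unfolding borel_measurable_complex_iff complex.sel by measurable
  moreover have "csqrt = (\<lambda>z. Complex (sqrt ((cmod z + Re z) / 2)) ((if Im z = 0 then 1 else sgn (Im z)) * sqrt ((cmod z - Re z) / 2)))"
    by (rule ext, rule complex_eqI) simp_all
  ultimately show ?thesis by simp
qed

lemma det_measurable:
  assumes "\<And>i j. i < n \<Longrightarrow> j < n \<Longrightarrow> (\<lambda>u. F u i j) \<in> borel_measurable M"
  shows "(\<lambda>u. Determinant.det (mat n n (\<lambda>(i, j). F u i j)) :: complex) \<in> borel_measurable M"
proof -
  have "Determinant.det (mat n n (\<lambda>(i, j). F u i j)) = (\<Sum>p | p permutes {0..<n}. signof p * (\<Prod>i\<in>{0..<n}. F u i (p i)))" for u
  proof -
    have "(\<Prod>i\<in>{0..<n}. mat n n (\<lambda>(i, j). F u i j) $$ (i, p i)) = (\<Prod>i\<in>{0..<n}. F u i (p i))"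
      if "p permutes {0..<n}" for p
      using permutes_in_image[OF that] by (intro prod.cong) auto
    then show ?thesis by (subst det_def'[of _ n]) auto
  qed
  moreover have "(\<lambda>u. \<Sum>p | p permutes {0..<n}. signof p * (\<Prod>i\<in>{0..<n}. F u i (p i))) \<in> borel_measurable M"
  proof (intro borel_measurable_sum borel_measurable_times borel_measurable_const borel_measurable_prod)
    fix p i assume "p \<in> {p. p permutes {0..<n}}" "i \<in> {0..<n}"
    then show "(\<lambda>u. F u i (p i)) \<in> borel_measurable M"
      using permutes_in_image[of p "{0..<n}" i] by (intro assms) auto
  qed
  ultimately show ?thesis by simp
qed

lemma comp_measurable: "i < n \<Longrightarrow> (\<lambda>u. u i) \<in> borel_measurable (leb n)"
  using measurable_component_singleton[of i "{..<n}" "\<lambda>_. lborel"] by simp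

lemma MA_measurable:
  assumes "i < n" "j < n" shows "(\<lambda>u. MA n u d i j) \<in> borel_measurable (leb n)"
proof -
  have n: "0 < n" using assms by simp
  have [measurable]: "(\<lambda>u. u i) \<in> borel_measurable (leb n)" "(\<lambda>u. u (pv n i)) \<in> borel_measurable (leb n)"
    using comp_measurable assms pv_nx[OF n] by auto
  show ?thesis unfolding MA_def Delta_mat3[OF assms] pp_def bb_def by measurable
qed

text \<open>The indicator of the point a in slot j, multiplied by 1 in all other slots, has product
  integral 0 because one factor does.\<close>

lemma AE_component_neq:
  assumes j: "j < n" shows "AE u in leb n. u j \<noteq> (a :: real)"
proof -
  define f where "f i v = (if i = j then indicator {a} v else 1 :: ennreal)" for i :: nat and v :: real
  have "(\<integral>\<^sup>+u. (\<Prod>i<n. f i (u i)) \<partial>leb n) = (\<Prod>i<n. \<integral>\<^sup>+v. f i v \<partial>lborel)"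
    by (rule lebp.product_nn_integral_prod) (auto simp: f_def)
  also have "\<dots> = 0"
  proof -
    have "(\<integral>\<^sup>+v. f j v \<partial>lborel) = 0" by (simp add: f_def)
    then show ?thesis using j by (meson finite_lessThan lessThan_iff prod_zero)
  qed
  finally have z: "(\<integral>\<^sup>+u. (\<Prod>i<n. f i (u i)) \<partial>leb n) = 0" .
  have fm: "(\<lambda>u. \<Prod>i<n. f i (u i)) \<in> borel_measurable (leb n)"
  proof (rule borel_measurable_prod_ennreal)
    fix i assume "i \<in> {..<n}"
    then have [measurable]: "(\<lambda>u. u i) \<in> borel_measurable (leb n)" by (simp add: comp_measurable)
    show "(\<lambda>u. f i (u i)) \<in> borel_measurable (leb n)" unfolding f_def by measurable
  qed
  have "AE u in leb n. (\<Prod>i<n. f i (u i)) = 0"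
    using z nn_integral_0_iff_AE[OF fm] by simp
  then show ?thesis
  proof eventually_elim
    case (elim u)
    show ?case
    proof
      assume "u j = a"
      then have "(\<Prod>i<n. f i (u i)) = 1" by (intro prod.neutral) (auto simp: f_def)
      then show False using elim by simp
    qed
  qed
qed

lemma unit_power_integral:
  "has_bochner_integral lborel (\<lambda>v. 2 * v ^ (2 * k) * indicator {0..1} v) (1 / (real k + 1 / 2))"
proof -
  have D: "((\<lambda>v. 2 / real (Suc (2 * k)) * v ^ Suc (2 * k)) has_real_derivative 2 * v ^ (2 * k)) (at v)" for v
    using DERIV_cmult[OF DERIV_pow[of "Suc (2 * k)" v], of "2 / real (Suc (2 * k))"] by (simp del: of_nat_Suc power_Suc)
  have "has_bochner_integral lborel (\<lambda>v. (2 * v ^ (2 * k)) * indicator {0..1} v) (2 / real (Suc (2 * k)) * 1 ^ Suc (2 * k) - 2 / real (Suc (2 * k)) * 0 ^ Suc (2 * k))"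
    by (rule has_bochner_integral_FTC_Icc_nonneg[OF _ D]) auto
  then show ?thesis by (simp add: field_simps)
qed

lemma prod_inverse_sqrt: "(\<Prod>j<n. 1 / sqrt (c * f j)) = 1 / sqrt (c ^ n * (\<Prod>j<n. f j))" for f :: "nat \<Rightarrow> real"
  by (induction n) (simp_all add: real_sqrt_mult)

text \<open>The geometric bounds of \<open>path_gauss\<close> degenerate at the boundary of the
  cube, so they do not justify integrating the sum over u. The domination comes from
  \<open>summ\<close>, which the Hilbert-Schmidt summability of closed paths supplies.\<close>

lemma trace_integral:
  assumes n: "0 < n"
    and d: "\<And>i. i < n \<Longrightarrow> d i = s * (\<sigma> i - \<sigma> (pv n i))" and \<sigma>: "\<And>i. i < n \<Longrightarrow> (\<sigma> i)\<^sup>2 = 1"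
    and summ: "(\<lambda>m. norm (\<Prod>j<n. of_real (1 / (real (m j) + 1 / 2)) * Wc (- d j) (m (pv n j)) (m j))) summable_on PiE {..<n} (\<lambda>_. UNIV)"
  shows "infsum (\<lambda>m. \<Prod>j<n. of_real (1 / (real (m j) + 1 / 2)) * Wc (- d j) (m (pv n j)) (m j)) (PiE {..<n} (\<lambda>_. UNIV)) =
    set_lebesgue_integral (leb n) ({..<n} \<rightarrow>\<^sub>E {0..1})
      (\<lambda>u. 2 ^ n / csqrt (Determinant.det (mat n n (\<lambda>(i, j). MA n u d i j)) * of_real (\<Prod>j<n. 1 - u j ^ 4)))"
proof -
  let ?P = "PiE {..<n} (\<lambda>_. UNIV :: nat set)"
  let ?R = "\<lambda>u. 2 ^ n / csqrt (Determinant.det (mat n n (\<lambda>(i, j). MA n u d i j)) * of_real (\<Prod>j<n. 1 - u j ^ 4))"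
  define W where "W m = (\<Prod>j<n. Wc (- d j) (m (pv n j)) (m j))" for m
  define g where "g k v = 2 * v ^ (2 * k) * indicator {0..1} v" for k :: nat and v :: real
  have gi: "integrable lborel (g k)" "(\<integral>v. g k v \<partial>lborel) = 1 / (real k + 1 / 2)" for k
    using unit_power_integral[of k] unfolding g_def by (auto simp: has_bochner_integral_iff)
  have g0: "g k v \<ge> 0" for k v by (auto simp: g_def indicator_def)
  define f where "f m u = of_real (\<Prod>j<n. g (m j) (u j)) * W m" for m u
  have gp: "integrable (leb n) (\<lambda>u. \<Prod>j<n. g (m j) (u j))" "(\<integral>u. (\<Prod>j<n. g (m j) (u j)) \<partial>leb n) = (\<Prod>j<n. 1 / (real (m j) + 1 / 2))" for m
    using lebp.product_integrable_prod[of "{..<n}" "\<lambda>j. g (m j)"] lebp.product_integral_prod[of "{..<n}" "\<lambda>j. g (m j)"] gi by auto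
  have fi: "integrable (leb n) (f m)" for m
    unfolding f_def by (intro integrable_mult_left integrable_of_real gp)
  have fI: "(\<integral>u. f m u \<partial>leb n) = (\<Prod>j<n. of_real (1 / (real (m j) + 1 / 2)) * Wc (- d j) (m (pv n j)) (m j))" for m
    unfolding f_def integral_mult_left_zero integral_complex_of_real gp(2)
    unfolding W_def prod.distrib of_real_prod ..
  have fN: "(\<integral>u. norm (f m u) \<partial>leb n) = norm (\<Prod>j<n. of_real (1 / (real (m j) + 1 / 2)) * Wc (- d j) (m (pv n j)) (m j))" for m
  proof -
    have "norm (f m u) = (\<Prod>j<n. g (m j) (u j)) * norm (W m)" for u
      using prod_nonneg[of "{..<n}" "\<lambda>j. g (m j) (u j)"] g0 by (simp add: f_def norm_mult del: of_real_prod)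
    then have "(\<integral>u. norm (f m u) \<partial>leb n) = (\<Prod>j<n. 1 / (real (m j) + 1 / 2)) * norm (W m)"
      by (simp only: integral_mult_left_zero gp(2))
    also have "\<dots> = norm (of_real (\<Prod>j<n. 1 / (real (m j) + 1 / 2)) * W m)"
      using prod_nonneg[of "{..<n}" "\<lambda>j. 1 / (real (m j) + 1 / 2)"] by (simp add: norm_mult del: of_real_prod)
    finally show ?thesis unfolding W_def prod.distrib of_real_prod .
  qed
  \<comment> \<open>Away from the null set where some u_j is 0 or 1 there are two cases: inside the
    cube the sum is evaluated by \<open>path_gauss\<close> and \<open>gauss_cyclic\<close>, outside
    it every term is 0.\<close>
  have val: "(\<lambda>m. norm (f m u)) summable_on ?P \<and> infsum (\<lambda>m. f m u) ?P = indicator ({..<n} \<rightarrow>\<^sub>E {0..1}) u *\<^sub>R ?R u"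
    if u: "u \<in> space (leb n)" "\<forall>j<n. u j \<noteq> 0 \<and> u j \<noteq> 1" for u
  proof (cases "\<forall>j<n. 0 \<le> u j \<and> u j \<le> 1")
    case True
    then have u01: "\<And>j. j < n \<Longrightarrow> 0 < u j \<and> u j < 1" using u(2) by (metis less_eq_real_def)
    have ind: "u \<in> {..<n} \<rightarrow>\<^sub>E {0..1}" using u(1) True by (auto simp: space_PiM PiE_iff)
    have fu: "f m u = 2 ^ n * (\<Prod>j<n. of_real ((u j)\<^sup>2) ^ m j * Wc (- d j) (m (pv n j)) (m j))" for m
    proof -
      have "(\<Prod>j<n. g (m j) (u j)) = (\<Prod>j<n. 2 * ((u j)\<^sup>2) ^ m j)"
        using True by (intro prod.cong) (auto simp: g_def power_mult)
      then show ?thesis unfolding f_def W_def by (simp add: prod.distrib)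
    qed
    obtain D where D: "D > 0" "Determinant.det (mat n n (\<lambda>(i, j). MA n u d i j)) = of_real D"
      "(\<integral>x. exp (- qf n (MA n u d) x) \<partial>leb n) = of_real (sqrt (pi ^ n / D))"
      using gauss_cyclic[where u=u and d=d and s=s and \<sigma>=\<sigma>, OF n u01 d \<sigma>] by blast
    note pg = path_gauss[OF n u01, where c="\<lambda>j. - d j"]
    define P where "P = (\<Prod>j<n. 1 - u j ^ 4)"
    have P0: "P > 0" unfolding P_def
    proof (rule prod_pos)
      fix j assume "j \<in> {..<n}"
      then show "0 < 1 - u j ^ 4" using u01[of j] by (simp add: power_less_one_iff)
    qed
    have "(\<Prod>j<n. 1 / sqrt (pi * (1 - u j ^ 4))) = 1 / sqrt (pi ^ n * P)"
      unfolding P_def by (rule prod_inverse_sqrt)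
    moreover have "1 / sqrt (pi ^ n * P) * sqrt (pi ^ n / D) = 1 / sqrt (D * P)"
      using P0 D(1) by (simp add: real_sqrt_mult real_sqrt_divide)
    ultimately have "(\<Prod>j<n. 1 / sqrt (pi * (1 - u j ^ 4))) * sqrt (pi ^ n / D) = 1 / sqrt (D * P)" by simp
    moreover have "infsum (\<lambda>m. \<Prod>j<n. of_real ((u j)\<^sup>2) ^ m j * Wc (- d j) (m (pv n j)) (m j)) ?P =
        of_real ((\<Prod>j<n. 1 / sqrt (pi * (1 - u j ^ 4))) * sqrt (pi ^ n / D))"
      using pg(2) D(3) by simp
    ultimately have "infsum (\<lambda>m. f m u) ?P = 2 ^ n * of_real (1 / sqrt (D * P))"
      unfolding fu infsum_cmult_right' by simp
    also have "\<dots> = ?R u"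
    proof -
      \<comment> \<open>Positivity of the determinant, not merely its realness, is used here: the
        principal root is the positive real one.\<close>
      have "csqrt (of_real D * of_real P) = of_real (sqrt (D * P))"
        using D(1) P0 by (simp add: csqrt_of_real_nonneg flip: of_real_mult)
      then show ?thesis unfolding D(2) P_def[symmetric] by simp
    qed
    finally have "infsum (\<lambda>m. f m u) ?P = indicator ({..<n} \<rightarrow>\<^sub>E {0..1}) u *\<^sub>R ?R u" using ind by simp
    moreover have "(\<lambda>m. norm (f m u)) summable_on ?P"
      unfolding fu norm_mult[of "2 ^ n"] by (rule summable_on_cmult_right[OF pg(1)])
    ultimately show ?thesis by blast
  next
    case False
    then obtain j where j: "j < n" "\<not> (0 \<le> u j \<and> u j \<le> 1)" by blast
    have "(\<Prod>i<n. g (m i) (u i)) = 0" for m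
      using j by (intro prod_zero) (auto simp: g_def intro!: bexI[of _ j])
    then have "f m u = 0" for m by (simp add: f_def del: of_real_prod)
    moreover have "u \<notin> {..<n} \<rightarrow>\<^sub>E {0..1}" using j by (auto simp: PiE_iff)
    ultimately show ?thesis by simp
  qed
  have ae: "AE u in leb n. \<forall>j<n. u j \<noteq> 0 \<and> u j \<noteq> 1"
  proof -
    have "AE u in leb n. \<forall>j\<in>{..<n}. u j \<noteq> 0 \<and> u j \<noteq> 1"
      by (rule AE_finite_allI) (auto intro: AE_component_neq)
    then show ?thesis by auto
  qed
  have cP: "countable ?P" by (rule countable_PiE) auto
  have "infsum (\<lambda>m. \<integral>u. f m u \<partial>leb n) ?P = (\<integral>u. infsum (\<lambda>m. f m u) ?P \<partial>leb n)"
  proof (rule infsum_integral[OF cP fi])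
    show "(\<lambda>m. \<integral>u. norm (f m u) \<partial>leb n) summable_on ?P" unfolding fN by (rule summ)
    show "AE u in leb n. (\<lambda>m. norm (f m u)) summable_on ?P"
      using ae AE_space by eventually_elim (use val in blast)
  qed
  also have "\<dots> = (\<integral>u. indicator ({..<n} \<rightarrow>\<^sub>E {0..1}) u *\<^sub>R ?R u \<partial>leb n)"
  proof (rule integral_cong_AE)
    have Rm: "(\<lambda>u. indicator ({..<n} \<rightarrow>\<^sub>E {0..1}) u *\<^sub>R ?R u) \<in> borel_measurable (leb n)"
    proof (intro borel_measurable_scaleR borel_measurable_indicator borel_measurable_divide borel_measurable_const)
      show "{..<n} \<rightarrow>\<^sub>E {0..1} \<in> sets (leb n)" by (intro sets_PiM_I_finite) auto
      have "(\<lambda>u. complex_of_real (\<Prod>j<n. 1 - u j ^ 4)) \<in> borel_measurable (leb n)"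
        by (intro measurable_compose[OF _ borel_measurable_of_real] borel_measurable_prod borel_measurable_diff borel_measurable_const borel_measurable_power comp_measurable) auto
      then show "(\<lambda>u. csqrt (Determinant.det (mat n n (\<lambda>(i, j). MA n u d i j)) * of_real (\<Prod>j<n. 1 - u j ^ 4))) \<in> borel_measurable (leb n)"
        by (intro measurable_compose[OF _ csqrt_measurable] borel_measurable_times det_measurable MA_measurable)
    qed
    show "(\<lambda>u. indicator ({..<n} \<rightarrow>\<^sub>E {0..1}) u *\<^sub>R ?R u) \<in> borel_measurable (leb n)" by (rule Rm)
    show "AE u in leb n. infsum (\<lambda>m. f m u) ?P = indicator ({..<n} \<rightarrow>\<^sub>E {0..1}) u *\<^sub>R ?R u"
      using ae AE_space by eventually_elim (use val in blast)
    show "(\<lambda>u. infsum (\<lambda>m. f m u) ?P) \<in> borel_measurable (leb n)"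
      by (rule infsum_measurable[OF cP]) (use fi in auto)
  qed
  finally show ?thesis unfolding fI set_lebesgue_integral_def .
qed

section \<open>The oscillator in the chirped Hermite basis\<close>

abbreviation "v1 v \<equiv> vec_nth v (1 :: 2)"
abbreviation "v2 v \<equiv> vec_nth v (2 :: 2)"

lemma norm2_sq: "(norm (v :: complex ^ 2))\<^sup>2 = (norm (v1 v))\<^sup>2 + (norm (v2 v))\<^sup>2"
  by (simp add: norm_vec_def L2_set_def sum_2)

lemma vec2_eq: "(v :: complex ^ 2) = w \<longleftrightarrow> v1 v = v1 w \<and> v2 v = v2 w"
proof
  assume a: "v1 v = v1 w \<and> v2 v = v2 w"
  have "vec_nth v i = vec_nth w i" for i using exhaust_2[of i] a by auto
  then show "v = w" by (simp add: Finite_Cartesian_Product.vec_eq_iff)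
qed simp

lemma v_vector [simp]: "v1 (vector [x, y]) = x" "v2 (vector [x, y]) = y"
  by (simp_all add: vector_2)

text \<open>Differentiation transported to the polynomial factor of \<open>pg\<close>; its iterates
  provide all derivatives that \<open>schwartz\<close> asks for.\<close>

definition dpg :: "complex \<Rightarrow> complex poly \<Rightarrow> complex poly" where
  "dpg z p = pderiv p - [:0, 2 * z:] * p"

lemma pg_dpg: "(pg p z has_vector_derivative pg (dpg z p) z x) (at x)"
  unfolding dpg_def by (rule pg_deriv)

lemma pg_bounded: assumes "Re z > 0" shows "\<exists>C. \<forall>x. norm (pg p z x) \<le> C"
proof -
  obtain B where B: "B \<ge> 0" "\<And>x. norm (pg p z x) \<le> B * \<bar>x\<bar> ^ 0 * exp (1 * \<bar>x\<bar> - Re z * x\<^sup>2)"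
    using pg_bound[of p z] by metis
  obtain C where C: "C \<ge> 0" "\<And>x. \<bar>x\<bar> ^ 0 * exp (1 * \<bar>x\<bar> - Re z * x\<^sup>2) \<le> C * exp (- (Re z / 2) * x\<^sup>2)"
    using gauss_dom[OF assms, of 0 1] by metis
  have "norm (pg p z x) \<le> B * C" for x
  proof -
    have "norm (pg p z x) \<le> B * (\<bar>x\<bar> ^ 0 * exp (1 * \<bar>x\<bar> - Re z * x\<^sup>2))" using B(2)[of x] by (simp add: mult.assoc)
    also have "\<dots> \<le> B * (C * exp (- (Re z / 2) * x\<^sup>2))" by (intro mult_left_mono B C)
    also have "\<dots> \<le> B * (C * 1)" using assms by (intro mult_left_mono B C) auto
    finally show ?thesis by simp
  qed
  then show ?thesis by blast
qed

lemma pg_pow: "of_real x ^ j * pg p z x = pg (monom 1 j * p) z x"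
  by (simp add: pg_def poly_monom)

lemma bounded_linear_vector: "bounded_linear (\<lambda>p. vector [fst p, snd p] :: complex ^ 2)"
  unfolding linear_conv_bounded_linear[symmetric]
  by (rule linearI) (simp_all add: vec2_eq)

lemma norm_vector_le: "norm (vector [u, w] :: complex ^ 2) \<le> norm u + norm w"
proof -
  have "(norm (vector [u, w] :: complex ^ 2))\<^sup>2 \<le> (norm u + norm w)\<^sup>2"
    by (simp add: norm2_sq power2_sum)
  then show ?thesis by (rule power2_le_imp_le) simp
qed

lemma schwartz_pg:
  assumes z: "\<And>s. s \<in> S \<Longrightarrow> Re (z s) > 0" and S: "finite S"
  shows "schwartz (\<lambda>x. vector [\<Sum>s\<in>S. pg (p s) (z s) x, \<Sum>s\<in>S. pg (r s) (z s) x])"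
  unfolding schwartz_def
proof (intro exI[of _ "\<lambda>k x. vector [\<Sum>s\<in>S. pg ((dpg (z s) ^^ k) (p s)) (z s) x, \<Sum>s\<in>S. pg ((dpg (z s) ^^ k) (r s)) (z s) x]"] conjI allI)
  fix k x
  have d: "((\<lambda>x. \<Sum>s\<in>S. pg ((dpg (z s) ^^ k) (q s)) (z s) x) has_vector_derivative (\<Sum>s\<in>S. pg ((dpg (z s) ^^ Suc k) (q s)) (z s) x)) (at x)" for q
    unfolding funpow.simps o_def by (intro has_vector_derivative_sum pg_dpg)
  from bounded_linear.has_vector_derivative[OF bounded_linear_vector has_vector_derivative_Pair[OF d[of p] d[of r]]]
  show "((\<lambda>x. vector [\<Sum>s\<in>S. pg ((dpg (z s) ^^ k) (p s)) (z s) x, \<Sum>s\<in>S. pg ((dpg (z s) ^^ k) (r s)) (z s) x] :: complex ^ 2)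
    has_vector_derivative vector [\<Sum>s\<in>S. pg ((dpg (z s) ^^ Suc k) (p s)) (z s) x, \<Sum>s\<in>S. pg ((dpg (z s) ^^ Suc k) (r s)) (z s) x]) (at x)"
    by simp
next
  fix j k
  have "\<exists>C. \<forall>x. norm (\<Sum>s\<in>S. pg (monom 1 j * q s) (z s) x) \<le> C" for q
  proof -
    have "\<forall>s\<in>S. \<exists>C. \<forall>x. norm (pg (monom 1 j * q s) (z s) x) \<le> C" using pg_bounded z by blast
    then obtain C where C: "\<And>s x. s \<in> S \<Longrightarrow> norm (pg (monom 1 j * q s) (z s) x) \<le> C s" by metis
    have "norm (\<Sum>s\<in>S. pg (monom 1 j * q s) (z s) x) \<le> (\<Sum>s\<in>S. C s)" for x
      by (rule sum_norm_le) (rule C)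
    then show ?thesis by blast
  qed
  then obtain C where C: "\<And>q x. norm (\<Sum>s\<in>S. pg (monom 1 j * q s) (z s) x) \<le> C q" by metis
  have "norm (x ^ j *\<^sub>R (vector [\<Sum>s\<in>S. pg (q s) (z s) x, \<Sum>s\<in>S. pg (q' s) (z s) x] :: complex ^ 2)) \<le> C q + C q'" for q q' x
  proof -
    have "x ^ j *\<^sub>R (vector [\<Sum>s\<in>S. pg (q s) (z s) x, \<Sum>s\<in>S. pg (q' s) (z s) x] :: complex ^ 2) =
       vector [\<Sum>s\<in>S. pg (monom 1 j * q s) (z s) x, \<Sum>s\<in>S. pg (monom 1 j * q' s) (z s) x]"
      unfolding vec2_eq vector_scaleR_component v_vector pg_pow[symmetric] by (simp add: scaleR_conv_of_real sum_distrib_left)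
    then show ?thesis using norm_vector_le C[of q x] C[of q' x] by (smt (verit))
  qed
  then show "bounded (range (\<lambda>x. x ^ j *\<^sub>R (vector [\<Sum>s\<in>S. pg ((dpg (z s) ^^ k) (p s)) (z s) x, \<Sum>s\<in>S. pg ((dpg (z s) ^^ k) (r s)) (z s) x] :: complex ^ 2)))"
    unfolding bounded_iff by (intro exI[of _ "C (\<lambda>s. (dpg (z s) ^^ k) (p s)) + C (\<lambda>s. (dpg (z s) ^^ k) (r s))"]) auto
qed simp

lemma ncho_expr_components:
  assumes "\<And>x. (F has_vector_derivative F' x) (at x)" "\<And>x. (F' has_vector_derivative F'' x) (at x)"
  shows "v1 (ncho_expr \<alpha> \<beta> F x) = of_real \<alpha> * (- (1/2) * v1 (F'' x) + of_real (x\<^sup>2 / 2) * v1 (F x)) - (of_real x * v2 (F' x) + 1/2 * v2 (F x))"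
    and "v2 (ncho_expr \<alpha> \<beta> F x) = of_real \<beta> * (- (1/2) * v2 (F'' x) + of_real (x\<^sup>2 / 2) * v2 (F x)) + (of_real x * v1 (F' x) + 1/2 * v1 (F x))"
proof -
  have 1: "(\<lambda>y. vector_derivative F (at y)) = F'" using vector_derivative_at[OF assms(1)] by auto
  have 2: "vector_derivative F' (at x) = F'' x" by (rule vector_derivative_at[OF assms(2)])
  show "v1 (ncho_expr \<alpha> \<beta> F x) = of_real \<alpha> * (- (1/2) * v1 (F'' x) + of_real (x\<^sup>2 / 2) * v1 (F x)) - (of_real x * v2 (F' x) + 1/2 * v2 (F x))"
    "v2 (ncho_expr \<alpha> \<beta> F x) = of_real \<beta> * (- (1/2) * v2 (F'' x) + of_real (x\<^sup>2 / 2) * v2 (F x)) + (of_real x * v1 (F' x) + 1/2 * v1 (F x))"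
    unfolding ncho_expr_def Let_def 1 2
    by (simp_all only: matrix_vector_mult_def vec_lambda_beta sum_2 vector_2 vector_add_component vector_scaleR_component)
       (simp_all add: scaleR_conv_of_real algebra_simps)
qed

lemma integrable_decay:
  fixes g :: "real \<Rightarrow> 'a :: euclidean_space"
  assumes [measurable]: "g \<in> borel_measurable borel" and b: "\<And>x. norm (g x) \<le> C" "\<And>x. x\<^sup>2 * norm (g x) \<le> C"
  shows "integrable lborel (\<lambda>x. (norm (g x))\<^sup>2)"
proof (rule Bochner_Integration.integrable_bound)
  have "integrable lborel (\<lambda>x::real. inverse (1 + x\<^sup>2))"
    using integrable_inverse_1_plus_square by (simp add: set_integrable_def)
  then show "integrable lborel (\<lambda>x::real. 2 * C * C * inverse (1 + x\<^sup>2))" by (rule integrable_mult_right)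
  show "AE x in lborel. norm ((norm (g x))\<^sup>2) \<le> norm (2 * C * C * inverse (1 + x\<^sup>2))"
  proof (rule AE_I2)
    fix x :: real
    have C: "C \<ge> 0" using b(1)[of x] norm_ge_zero order_trans by blast
    have p: "1 + x\<^sup>2 > 0" by (simp add: add_pos_nonneg)
    have "(norm (g x))\<^sup>2 * (1 + x\<^sup>2) = norm (g x) * (norm (g x) + x\<^sup>2 * norm (g x))"
      by (simp add: power2_eq_square algebra_simps)
    also have "\<dots> \<le> C * (C + C)" using b[of x] C by (intro mult_mono add_mono) auto
    finally have "(norm (g x))\<^sup>2 \<le> 2 * C * C / (1 + x\<^sup>2)" using p by (simp add: field_simps)
    then show "norm ((norm (g x))\<^sup>2) \<le> norm (2 * C * C * inverse (1 + x\<^sup>2))" using C p by (simp add: divide_inverse abs_mult)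
  qed
qed simp

lemma schwartz_props:
  assumes "schwartz F"
  obtains D where "D 0 = F" "\<And>k x. (D k has_vector_derivative D (Suc k) x) (at x)" "\<And>k. continuous_on UNIV (D k)"
    "\<And>j k. \<exists>C. \<forall>x. \<bar>x\<bar> ^ j * norm (D k x) \<le> C"
proof -
  obtain D where D: "D 0 = F" "\<And>k x. (D k has_vector_derivative D (Suc k) x) (at x)"
    "\<And>j k. bounded (range (\<lambda>x. x ^ j *\<^sub>R D k x))"
    using assms unfolding schwartz_def by blast
  have "continuous_on UNIV (D k)" for k
    using D(2) by (intro continuous_at_imp_continuous_on) (auto intro: has_vector_derivative_continuous)
  moreover have "\<exists>C. \<forall>x. \<bar>x\<bar> ^ j * norm (D k x) \<le> C" for j k
    using D(3)[of j k] by (auto simp: bounded_iff power_abs)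
  ultimately show ?thesis using that D by blast
qed

lemma L2_I: "F \<in> borel_measurable borel \<Longrightarrow> (\<And>x. norm (F x) \<le> C) \<Longrightarrow> (\<And>x. x\<^sup>2 * norm (F x) \<le> C) \<Longrightarrow> F \<in> L2"
  unfolding L2_def using integrable_decay[of F C] by simp

text \<open>Coefficients pass to the limit along Schwartz approximants only when both the
  approximants and their images lie in \<open>L2\<close>.\<close>

lemma schwartz_L2: assumes "schwartz F" shows "F \<in> L2" "ncho_expr \<alpha> \<beta> F \<in> L2"
proof -
  obtain D where D: "D 0 = F" "\<And>k x. (D k has_vector_derivative D (Suc k) x) (at x)" "\<And>k. continuous_on UNIV (D k)"
    "\<And>j k. \<exists>C. \<forall>x. \<bar>x\<bar> ^ j * norm (D k x) \<le> C" using schwartz_props[OF assms] by metis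
  obtain K where K: "\<And>j k x. \<bar>x\<bar> ^ j * norm (D k x) \<le> K j k" using D(4) by metis
  have K0: "K j k \<ge> 0" for j k using K[of 1 j k] K[where x=1] norm_ge_zero by (metis abs_one mult_1 order_trans power_one)
  have [measurable]: "D k \<in> borel_measurable borel" for k by (rule borel_measurable_continuous_onI[OF D(3)])
  show "F \<in> L2"
  proof (rule L2_I[where C="K 0 0 + K 2 0"])
    show "F \<in> borel_measurable borel" unfolding D(1)[symmetric] by simp
    show "norm (F x) \<le> K 0 0 + K 2 0" "x\<^sup>2 * norm (F x) \<le> K 0 0 + K 2 0" for x
      using K[of x 0 0] K[of x 2 0] K0[of 0 0] K0[of 2 0] by (simp_all add: D(1))
  qed
  have d01: "(D 0 has_vector_derivative D 1 x) (at x)" for x using D(2)[of 0 x] by simp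
  have d12: "(D 1 has_vector_derivative D 2 x) (at x)" for x using D(2)[of 1 x] by (simp add: numeral_2_eq_2)
  note comp = ncho_expr_components[of "D 0" "D 1" "D 2", OF d01 d12, unfolded D(1)]
  have n12: "norm (v1 w) \<le> norm w" "norm (v2 w) \<le> norm w" for w :: "complex ^ 2"
    using Finite_Cartesian_Product.norm_nth_le by blast+
  define M where "M = \<bar>\<alpha>\<bar> + \<bar>\<beta>\<bar> + 1"
  have nb: "norm (ncho_expr \<alpha> \<beta> F x) \<le> 2 * M * (norm (D 2 x) + \<bar>x\<bar>\<^sup>2 * norm (D 0 x) + \<bar>x\<bar> * norm (D 1 x) + norm (D 0 x))" for x
  proof -
    have gen: "norm (of_real c * (- (1/2) * p + of_real (x\<^sup>2 / 2) * q) + e * (of_real x * r + 1/2 * t)) \<le> M * (norm p + \<bar>x\<bar>\<^sup>2 * norm q + \<bar>x\<bar> * norm r + norm t)"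
      if "\<bar>c\<bar> \<le> M" "norm e = 1" for c and p q r t e :: complex
    proof -
      have M1: "M \<ge> 1" by (simp add: M_def)
      have "norm (- (1/2) * p + of_real (x\<^sup>2 / 2) * q) \<le> 1/2 * norm p + x\<^sup>2 / 2 * norm q"
        by (rule order_trans[OF norm_triangle_ineq]) (simp only: norm_mult norm_of_real, simp)
      then have "norm (of_real c * (- (1/2) * p + of_real (x\<^sup>2 / 2) * q)) \<le> \<bar>c\<bar> * (1/2 * norm p + x\<^sup>2 / 2 * norm q)"
        unfolding norm_mult norm_of_real by (intro mult_left_mono) auto
      moreover have "norm (e * (of_real x * r + 1/2 * t)) \<le> \<bar>x\<bar> * norm r + 1/2 * norm t"
        unfolding norm_mult that(2) mult_1 by (rule order_trans[OF norm_triangle_ineq]) (simp only: norm_mult norm_of_real, simp)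
      ultimately have "norm (of_real c * (- (1/2) * p + of_real (x\<^sup>2 / 2) * q) + e * (of_real x * r + 1/2 * t))
        \<le> \<bar>c\<bar> * (1/2 * norm p + x\<^sup>2 / 2 * norm q) + (\<bar>x\<bar> * norm r + 1/2 * norm t)"
        by (intro norm_triangle_le add_mono)
      also have "\<dots> \<le> M * (1/2 * norm p + x\<^sup>2 / 2 * norm q) + M * (\<bar>x\<bar> * norm r + 1/2 * norm t)"
        using that(1) M1 mult_right_mono[of 1 M "\<bar>x\<bar> * norm r + 1/2 * norm t"]
        by (intro add_mono mult_right_mono) auto
      also have "\<dots> \<le> M * (norm p + \<bar>x\<bar>\<^sup>2 * norm q + \<bar>x\<bar> * norm r + norm t)"
        unfolding distrib_left[symmetric] using M1 by (intro mult_left_mono) (auto intro!: add_mono)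
      finally show ?thesis .
    qed
    have M0: "M \<ge> 0" by (simp add: M_def)
    have mono: "M * (norm p + \<bar>x\<bar>\<^sup>2 * norm q + \<bar>x\<bar> * norm r + norm t) \<le> M * (norm (D 2 x) + \<bar>x\<bar>\<^sup>2 * norm (D 0 x) + \<bar>x\<bar> * norm (D 1 x) + norm (D 0 x))"
      if "norm p \<le> norm (D 2 x)" "norm q \<le> norm (D 0 x)" "norm r \<le> norm (D 1 x)" "norm t \<le> norm (D 0 x)" for p q r t :: complex
      using that M0 by (intro mult_left_mono add_mono) auto
    have "norm (v1 (ncho_expr \<alpha> \<beta> F x)) \<le> M * (norm (D 2 x) + \<bar>x\<bar>\<^sup>2 * norm (D 0 x) + \<bar>x\<bar> * norm (D 1 x) + norm (D 0 x))"
    proof -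
      have "norm (v1 (ncho_expr \<alpha> \<beta> F x)) \<le> M * (norm (v1 (D 2 x)) + \<bar>x\<bar>\<^sup>2 * norm (v1 (D 0 x)) + \<bar>x\<bar> * norm (v2 (D 1 x)) + norm (v2 (D 0 x)))"
        using gen[of \<alpha> "-1" "v1 (D 2 x)" "v1 (D 0 x)" "v2 (D 1 x)" "v2 (D 0 x)"]
        unfolding comp(1) D(1) mult_minus1 diff_conv_add_uminus[symmetric] by (simp only: M_def norm_minus_cancel norm_one)
      then show ?thesis by (rule order_trans) (intro mono n12)
    qed
    moreover have "norm (v2 (ncho_expr \<alpha> \<beta> F x)) \<le> M * (norm (D 2 x) + \<bar>x\<bar>\<^sup>2 * norm (D 0 x) + \<bar>x\<bar> * norm (D 1 x) + norm (D 0 x))"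
    proof -
      have "norm (v2 (ncho_expr \<alpha> \<beta> F x)) \<le> M * (norm (v2 (D 2 x)) + \<bar>x\<bar>\<^sup>2 * norm (v2 (D 0 x)) + \<bar>x\<bar> * norm (v1 (D 1 x)) + norm (v1 (D 0 x)))"
        using gen[of \<beta> "1" "v2 (D 2 x)" "v2 (D 0 x)" "v1 (D 1 x)" "v1 (D 0 x)"]
        unfolding comp(2) D(1) mult_1 by (simp only: M_def norm_one)
      then show ?thesis by (rule order_trans) (intro mono n12)
    qed
    moreover have "norm w \<le> norm (v1 w) + norm (v2 w)" for w :: "complex ^ 2"
    proof -
      have "vector [v1 w, v2 w] = w" unfolding vec2_eq by simp
      then show ?thesis using norm_vector_le[of "v1 w" "v2 w"] by metis
    qed
    ultimately have "norm (ncho_expr \<alpha> \<beta> F x) \<le> M * (norm (D 2 x) + \<bar>x\<bar>\<^sup>2 * norm (D 0 x) + \<bar>x\<bar> * norm (D 1 x) + norm (D 0 x)) +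
       M * (norm (D 2 x) + \<bar>x\<bar>\<^sup>2 * norm (D 0 x) + \<bar>x\<bar> * norm (D 1 x) + norm (D 0 x))"
      by (meson add_mono order_trans)
    moreover have "2 * M * E = M * E + M * E" for E by simp
    ultimately show ?thesis by (simp only:)
  qed
  have cm: "continuous_on UNIV (ncho_expr \<alpha> \<beta> F)"
  proof -
    have e: "(\<lambda>x. vector [v1 (ncho_expr \<alpha> \<beta> F x), v2 (ncho_expr \<alpha> \<beta> F x)] :: complex ^ 2) = ncho_expr \<alpha> \<beta> F"
      by (auto simp: vec2_eq)
    have c: "continuous_on UNIV (\<lambda>x. v1 (D k x))" "continuous_on UNIV (\<lambda>x. v2 (D k x))" for k
      by (rule bounded_linear.continuous_on[OF bounded_linear_vec_nth D(3)])+
    have "continuous_on UNIV (\<lambda>x. v1 (ncho_expr \<alpha> \<beta> F x))" "continuous_on UNIV (\<lambda>x. v2 (ncho_expr \<alpha> \<beta> F x))"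
      unfolding comp by (auto intro!: continuous_intros c c[of 0, unfolded D(1)])
    from bounded_linear.continuous_on[OF bounded_linear_vector continuous_on_Pair[OF this]]
    have "continuous_on UNIV (\<lambda>x. vector [v1 (ncho_expr \<alpha> \<beta> F x), v2 (ncho_expr \<alpha> \<beta> F x)] :: complex ^ 2)"
      by simp
    then show ?thesis unfolding e .
  qed
  show "ncho_expr \<alpha> \<beta> F \<in> L2"
  proof (rule L2_I[where C="2 * M * (K 0 2 + K 2 0 + K 1 1 + K 0 0) + 2 * M * (K 2 2 + K 4 0 + K 3 1 + K 2 0)"])
    show "ncho_expr \<alpha> \<beta> F \<in> borel_measurable borel" by (rule borel_measurable_continuous_onI[OF cm])
    have M0: "0 \<le> 2 * M" by (simp add: M_def)
    fix x
    have "norm (ncho_expr \<alpha> \<beta> F x) \<le> 2 * M * (K 0 2 + K 2 0 + K 1 1 + K 0 0)"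
      using K[of x 0 2] K[of x 2 0] K[of x 1 1] K[of x 0 0] M0 by (intro order_trans[OF nb] mult_left_mono add_mono) auto
    moreover have "x\<^sup>2 * norm (ncho_expr \<alpha> \<beta> F x) \<le> 2 * M * (K 2 2 + K 4 0 + K 3 1 + K 2 0)"
    proof -
      have "x\<^sup>2 * norm (ncho_expr \<alpha> \<beta> F x) \<le> x\<^sup>2 * (2 * M * (norm (D 2 x) + \<bar>x\<bar>\<^sup>2 * norm (D 0 x) + \<bar>x\<bar> * norm (D 1 x) + norm (D 0 x)))"
        by (intro mult_left_mono nb) auto
      also have "\<dots> = 2 * M * (\<bar>x\<bar> ^ 2 * norm (D 2 x) + \<bar>x\<bar> ^ 4 * norm (D 0 x) + \<bar>x\<bar> ^ 3 * norm (D 1 x) + \<bar>x\<bar> ^ 2 * norm (D 0 x))"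
        by (simp add: algebra_simps power2_eq_square power3_eq_cube power4_eq_xxxx)
      also have "\<dots> \<le> 2 * M * (K 2 2 + K 4 0 + K 3 1 + K 2 0)"
        using M0 by (intro mult_left_mono add_mono K)
      finally show ?thesis .
    qed
    moreover have "0 \<le> 2 * M * (K 0 2 + K 2 0 + K 1 1 + K 0 0)" "0 \<le> 2 * M * (K 2 2 + K 4 0 + K 3 1 + K 2 0)"
      using M0 K0 by (auto intro!: mult_nonneg_nonneg add_nonneg_nonneg simp del: mult_nonneg_nonneg)
    ultimately show "norm (ncho_expr \<alpha> \<beta> F x) \<le> 2 * M * (K 0 2 + K 2 0 + K 1 1 + K 0 0) + 2 * M * (K 2 2 + K 4 0 + K 3 1 + K 2 0)"
      "x\<^sup>2 * norm (ncho_expr \<alpha> \<beta> F x) \<le> 2 * M * (K 0 2 + K 2 0 + K 1 1 + K 0 0) + 2 * M * (K 2 2 + K 4 0 + K 3 1 + K 2 0)" by linarith+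
  qed
qed

lemma pg_times_bounded:
  assumes z: "Re z > 0" and f: "continuous_on UNIV f" "\<And>x. norm (f x) \<le> C"
  shows "integrable lborel (\<lambda>x. pg p z x * f x)" "((\<lambda>x. pg p z x * f x) \<longlongrightarrow> 0) at_top" "((\<lambda>x. pg p z x * f x) \<longlongrightarrow> 0) at_bot"
proof -
  have b: "norm (pg p z x * f x) \<le> norm (pg p z x) * C" for x by (simp add: norm_mult f mult_left_mono)
  have [measurable]: "f \<in> borel_measurable borel" by (rule borel_measurable_continuous_onI[OF f(1)])
  have C: "C \<ge> 0" using f(2)[of 0] norm_ge_zero order_trans by blast
  show "integrable lborel (\<lambda>x. pg p z x * f x)"
    by (rule Bochner_Integration.integrable_bound[of _ "\<lambda>x. pg p z x * of_real C"])
       (use b C in \<open>auto intro!: pg_integrable z simp: norm_mult\<close>)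
  show "((\<lambda>x. pg p z x * f x) \<longlongrightarrow> 0) at_top" "((\<lambda>x. pg p z x * f x) \<longlongrightarrow> 0) at_bot"
    by (rule Lim_null_comparison[OF always_eventually[OF allI[OF b]]],
        use tendsto_mult_left_zero[OF tendsto_norm_zero[OF pg_tendsto(1)[OF z]]] tendsto_mult_left_zero[OF tendsto_norm_zero[OF pg_tendsto(2)[OF z]]] in blast)+
qed

text \<open>Integration by parts in a pairing without conjugation: the second order part is
  symmetric, while x d/dx + 1/2 is antisymmetric, so the sign of k is reversed.\<close>

lemma ncho_symm_scalar:
  fixes k :: real
  assumes z: "Re z > 0"
    and d: "\<And>x. (f0 has_vector_derivative f1 x) (at x)" "\<And>x. (f1 has_vector_derivative f2 x) (at x)"
    and c: "continuous_on UNIV f0" "continuous_on UNIV f1" "continuous_on UNIV f2"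
    and b: "\<And>x. norm (f0 x) \<le> C" "\<And>x. norm (f1 x) \<le> C" "\<And>x. norm (f2 x) \<le> C"
  shows "(\<integral>x. pg p z x * (- (1/2) * f2 x + of_real (x\<^sup>2 / 2) * f0 x + \<i> * of_real k * (of_real x * f1 x + 1/2 * f0 x)) \<partial>lborel) =
    (\<integral>x. (- (1/2) * pg (dpg z (dpg z p)) z x + of_real (x\<^sup>2 / 2) * pg p z x - \<i> * of_real k * (of_real x * pg (dpg z p) z x + 1/2 * pg p z x)) * f0 x \<partial>lborel)"
    (is "integral\<^sup>L lborel ?A = integral\<^sup>L lborel ?B")
proof -
  have x1: "of_real x * pg q z x = pg ([:0, 1:] * q) z x" and x2: "of_real (x\<^sup>2 / 2) * pg q z x = pg ([:0, 0, 1/2:] * q) z x" for q x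
    by (simp_all add: pg_def power2_eq_square)
  have pga: "pg (q + r) z x = pg q z x + pg r z x" for q r x by (simp add: pg_def algebra_simps)
  \<comment> \<open>The boundary term: its derivative is the difference of the two integrands, and
    it vanishes at both ends.\<close>
  let ?F = "\<lambda>x. - (1/2) * (pg p z x * f1 x) + 1/2 * (pg (dpg z p) z x * f0 x) + \<i> * of_real k * (pg ([:0, 1:] * p) z x * f0 x)"
  let ?f = "\<lambda>x. ?A x - ?B x"
  have Ae: "?A x = - (1/2) * (pg p z x * f2 x) + pg ([:0, 0, 1/2:] * p) z x * f0 x + \<i> * of_real k * (pg ([:0, 1:] * p) z x * f1 x + 1/2 * (pg p z x * f0 x))" for x
    unfolding x1[symmetric] x2[symmetric] by (simp add: algebra_simps)
  have Be: "?B x = - (1/2) * (pg (dpg z (dpg z p)) z x * f0 x) + pg ([:0, 0, 1/2:] * p) z x * f0 x - \<i> * of_real k * (pg ([:0, 1:] * dpg z p) z x * f0 x + 1/2 * (pg p z x * f0 x))" for x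
    unfolding x1[symmetric] x2[symmetric] by (simp add: algebra_simps)
  note i = pg_times_bounded(1)[OF z c(1) b(1)] pg_times_bounded(1)[OF z c(2) b(2)] pg_times_bounded(1)[OF z c(3) b(3)]
  have iA: "integrable lborel ?A" unfolding Ae
    by (intro Bochner_Integration.integrable_add integrable_mult_right i)
  have iB: "integrable lborel ?B" unfolding Be
    by (intro Bochner_Integration.integrable_add Bochner_Integration.integrable_diff integrable_mult_right i)
  have "(\<integral>x. ?f x \<partial>lborel) = 0"
  proof (rule integral_derivative_zero)
    fix x
    have dx: "dpg z ([:0, 1:] * p) = p + [:0, 1:] * dpg z p"
      by (simp add: dpg_def pderiv_mult pderiv_pCons algebra_simps)
    have "(?F has_vector_derivative - (1/2) * (pg p z x * f2 x + pg (dpg z p) z x * f1 x) + 1/2 * (pg (dpg z p) z x * f1 x + pg (dpg z (dpg z p)) z x * f0 x)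
        + \<i> * of_real k * (pg ([:0, 1:] * p) z x * f1 x + pg (dpg z ([:0, 1:] * p)) z x * f0 x)) (at x)"
      by (intro has_vector_derivative_add has_vector_derivative_mult_right has_vector_derivative_mult pg_dpg d)
    moreover have "- (1/2) * (pg p z x * f2 x + pg (dpg z p) z x * f1 x) + 1/2 * (pg (dpg z p) z x * f1 x + pg (dpg z (dpg z p)) z x * f0 x)
        + \<i> * of_real k * (pg ([:0, 1:] * p) z x * f1 x + pg (dpg z ([:0, 1:] * p)) z x * f0 x) = ?f x"
      unfolding Ae Be dx pga x1[symmetric] x2[symmetric] by (simp add: algebra_simps)
    ultimately show "(?F has_vector_derivative ?f x) (at x)" by simp
  next
    show "continuous_on UNIV ?f" unfolding Ae Be
      by (intro continuous_on_diff continuous_on_add continuous_on_mult continuous_on_const pg_continuous c)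
    show "integrable lborel ?f" by (rule Bochner_Integration.integrable_diff[OF iA iB])
    show "(?F \<longlongrightarrow> 0) at_top" "(?F \<longlongrightarrow> 0) at_bot"
      by (intro tendsto_add_zero tendsto_mult_right_zero pg_times_bounded[OF z c(1) b(1)] pg_times_bounded[OF z c(2) b(2)])+
  qed
  then show ?thesis using Bochner_Integration.integral_diff[OF iA iB] by simp
qed

definition sg :: "bool \<Rightarrow> real" where "sg s = (if s then 1 else -1)"

lemma sg_simps [simp]: "sg (\<not> s) = - sg s" "sg s * sg s = 1" "\<bar>sg s\<bar> = 1" "(sg s)\<^sup>2 = 1"
  by (auto simp: sg_def)

lemma csg_simps [simp]: "complex_of_real (sg s) * complex_of_real (sg s) = 1" "(complex_of_real (sg s))\<^sup>2 = 1"
  by (auto simp: sg_def)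

lemma sum_bool: "(\<Sum>s\<in>UNIV. f s) = f True + f False" by (simp add: UNIV_bool add.commute)

section \<open>Splitting into two chirped scalar oscillators\<close>

locale ncho_par =
  fixes \<alpha> \<beta> :: real
  assumes pos: "\<alpha> > 0" "\<beta> > 0" and gt1: "\<alpha> * \<beta> > 1"
begin

text \<open>\<open>\<kappa>\<close> measures the skew part after conjugation with A^(-1/2). Removing
  it by a chirp lowers the oscillator frequency from 1 to \<open>\<nu>\<close>, and
  \<open>\<rho>\<close> is the corresponding dilation of the Hermite functions.\<close>

definition \<kappa> :: real where "\<kappa> = 1 / sqrt (\<alpha> * \<beta>)"
definition \<nu> :: real where "\<nu> = sqrt (1 - \<kappa>\<^sup>2)"
definition \<rho> :: real where "\<rho> = sqrt \<nu>"

lemma ab: "sqrt \<alpha> > 0" "sqrt \<beta> > 0" "sqrt \<alpha> * sqrt \<alpha> = \<alpha>" "sqrt \<beta> * sqrt \<beta> = \<beta>" "sqrt \<alpha> * \<kappa> = 1 / sqrt \<beta>" "sqrt \<beta> * \<kappa> = 1 / sqrt \<alpha>"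
  using pos by (simp_all add: \<kappa>_def real_sqrt_mult)

lemma \<kappa>_sq: "\<kappa>\<^sup>2 = 1 / (\<alpha> * \<beta>)" using pos by (simp add: \<kappa>_def power_divide)

lemma \<nu>_sq: "\<nu>\<^sup>2 = 1 - \<kappa>\<^sup>2" and \<nu>_pos: "\<nu> > 0" and \<rho>_sq: "\<rho>\<^sup>2 = \<nu>" and \<rho>_pos: "\<rho> > 0"
proof -
  have k: "\<kappa>\<^sup>2 < 1" using gt1 by (simp add: \<kappa>_sq)
  then show n: "\<nu> > 0" by (simp add: \<nu>_def)
  show "\<nu>\<^sup>2 = 1 - \<kappa>\<^sup>2" using k by (simp add: \<nu>_def)
  show "\<rho>\<^sup>2 = \<nu>" "\<rho> > 0" using n by (simp_all add: \<rho>_def)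
qed

sublocale l2_basis "eta \<rho>" by (rule l2_basis_eta[OF \<rho>_pos])

definition ph :: "bool \<Rightarrow> real \<Rightarrow> complex" where "ph s x = exp (\<i> * of_real (sg s * \<kappa> / 2 * x\<^sup>2))"
text \<open>Chosen so that exp(-\<open>zz s\<close> x^2) is the chirp \<open>ph s\<close> times the
  Gaussian factor of \<open>eta \<rho>\<close>.\<close>

definition zz :: "bool \<Rightarrow> complex" where "zz s = (of_real \<nu> - \<i> * of_real (sg s * \<kappa>)) / 2"
definition osc_poly :: "nat \<Rightarrow> complex poly" where "osc_poly m = Polynomial.smult (of_real (sqrt \<rho> / hh m)) (pcompose (hp m) [:0, of_real \<rho>:])"

lemma zz_pos: "Re (zz s) > 0" using \<nu>_pos by (simp add: zz_def)

lemma norm_ph [simp]: "norm (ph s x) = 1" unfolding ph_def by (rule norm_exp_i_times)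

lemma cnj_ph: "cnj (ph s x) = ph (\<not> s) x" by (simp add: ph_def exp_cnj)

lemma ph_ph [simp]: "ph s x * ph (\<not> s) x = 1" "ph (\<not> s) x * ph s x = 1"
  by (simp_all add: ph_def flip: exp_add)

lemma ph_continuous: "continuous_on UNIV (ph s)" unfolding ph_def by (intro continuous_intros)

lemma ph_measurable [measurable]: "ph s \<in> borel_measurable borel"
  by (rule borel_measurable_continuous_onI[OF ph_continuous])

lemma phi_eq: "pg (osc_poly m) (zz s) x = ph s x * eta \<rho> m x"
proof -
  have r4: "of_real (\<rho>\<^sup>2 / 2) = (of_real \<nu> / 2 :: complex)" by (simp add: \<rho>_sq)
  have "exp (- zz s * of_real x ^ 2) = ph s x * exp (- of_real (\<rho>\<^sup>2 / 2) * of_real x ^ 2)"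
    unfolding ph_def exp_add[symmetric] r4 zz_def by (simp add: algebra_simps diff_divide_distrib)
  then show ?thesis unfolding eta_pg osc_poly_def pg_def by (simp add: mult_ac)
qed

lemma osc_poly_ode: "poly (pderiv (pderiv (osc_poly m))) y = of_real (2 * \<nu>) * (y * poly (pderiv (osc_poly m)) y - of_nat m * poly (osc_poly m) y)"
proof -
  have "poly (pderiv (pderiv (hp m)) - [:0, 2:] * pderiv (hp m) + Polynomial.smult (2 * of_nat m) (hp m)) (of_real \<rho> * y) = 0"
    unfolding hp_ode by simp
  then have o: "poly (pderiv (pderiv (hp m))) (of_real \<rho> * y) = 2 * (of_real \<rho> * y) * poly (pderiv (hp m)) (of_real \<rho> * y) - 2 * of_nat m * poly (hp m) (of_real \<rho> * y)"
    by (simp add: algebra_simps)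
  have n: "of_real \<nu> = (of_real \<rho> * of_real \<rho> :: complex)" by (simp add: \<rho>_sq[symmetric] power2_eq_square)
  have "pderiv [:0, of_real \<rho>:] = ([:of_real \<rho>:] :: complex poly)" by (simp add: pderiv_pCons)
  define C where "C = complex_of_real (sqrt \<rho> / hh m)"
  from \<open>pderiv [:0, of_real \<rho>:] = _\<close> have "pderiv (osc_poly m) = Polynomial.smult (C * of_real \<rho>) (pcompose (pderiv (hp m)) [:0, of_real \<rho>:])"
    "pderiv (pderiv (osc_poly m)) = Polynomial.smult (C * of_real \<rho> * of_real \<rho>) (pcompose (pderiv (pderiv (hp m))) [:0, of_real \<rho>:])"
    unfolding osc_poly_def C_def[symmetric] by (simp_all add: pderiv_smult pderiv_pcompose mult_ac)
  then have 1: "poly (pderiv (osc_poly m)) y = C * of_real \<rho> * poly (pderiv (hp m)) (of_real \<rho> * y)"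
    and 2: "poly (pderiv (pderiv (osc_poly m))) y = C * of_real \<rho> * of_real \<rho> * poly (pderiv (pderiv (hp m))) (of_real \<rho> * y)"
    by (simp_all add: poly_pcompose mult.commute)
  have 3: "poly (osc_poly m) y = C * poly (hp m) (of_real \<rho> * y)"
    unfolding osc_poly_def C_def[symmetric] by (simp add: poly_pcompose mult.commute)
  show ?thesis unfolding of_real_mult n 1 2 3 o by (simp add: algebra_simps)
qed

lemma phi_ode:
  "- (1/2) * pg (dpg (zz s) (dpg (zz s) (osc_poly m))) (zz s) x + of_real (x\<^sup>2 / 2) * pg (osc_poly m) (zz s) x
     + \<i> * of_real (sg s * \<kappa>) * (of_real x * pg (dpg (zz s) (osc_poly m)) (zz s) x + 1/2 * pg (osc_poly m) (zz s) x)
   = of_real (\<nu> * (m + 1/2)) * pg (osc_poly m) (zz s) x"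
proof -
  define p0 p1 y E z k where d: "p0 = poly (osc_poly m) (of_real x)" "p1 = poly (pderiv (osc_poly m)) (of_real x)" "y = complex_of_real x"
    "E = exp (- zz s * of_real x ^ 2)" "z = zz s" "k = \<i> * complex_of_real (sg s * \<kappa>)"
  \<comment> \<open>The only two facts about the constants are 2z + k = \<open>\<nu>\<close> and
    \<open>\<nu>\<close>^2 - k^2 = 1, the latter being \<open>\<nu>\<close>^2 +
    \<open>\<kappa>\<close>^2 = 1. Written through z and k, the claim is a polynomial
    identity.\<close>
  have z: "2 * z + k = of_real \<nu>" by (simp add: d zz_def field_simps)
  have "(complex_of_real \<nu>)\<^sup>2 - k\<^sup>2 = of_real (\<nu>\<^sup>2 + (sg s * \<kappa>)\<^sup>2)"
    by (simp add: d power_mult_distrib)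
  also have "\<dots> = 1" by (simp add: power_mult_distrib \<nu>_sq)
  finally have k2: "(2 * z + k)\<^sup>2 - k\<^sup>2 = 1" by (simp add: z)
  have e: "pg (osc_poly m) z x = p0 * E" "pg (dpg z (osc_poly m)) z x = (p1 - 2 * z * y * p0) * E"
    "pg (dpg z (dpg z (osc_poly m))) z x = (2 * (2 * z + k) * (y * p1 - of_nat m * p0) - 2 * z * p0 - 2 * z * y * p1 - 2 * z * y * (p1 - 2 * z * y * p0)) * E"
    unfolding z using osc_poly_ode[of m y]
    by (simp_all add: pg_def dpg_def pderiv_mult pderiv_diff pderiv_pCons pderiv_smult d)
  have y2: "of_real (x\<^sup>2 / 2) = y\<^sup>2 * ((2 * z + k)\<^sup>2 - k\<^sup>2) / 2" unfolding k2 by (simp add: d)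
  have nn: "of_real (\<nu> * (m + 1/2)) = (2 * z + k) * (of_nat m + 1/2)" unfolding z by simp
  show ?thesis
    unfolding d(5)[symmetric] d(6)[symmetric] e y2 nn d(3)[symmetric] by (simp add: field_simps power2_eq_square)
qed

text \<open>The component along the eigenvector \<open>(1, -\<i>\<sigma>)/\<surd>2\<close> of the skew matrix, with the chirp removed. The
  coefficients of \<open>f\<close> with respect to \<open>A\<psi>\<^bsub>m\<sigma>\<^esub>\<close> and \<open>\<psi>\<^bsub>m\<sigma>\<^esub>\<close> are the Hermite coefficients of \<open>cup\<close> and \<open>cdn\<close>.\<close>

definition spin_comp :: "real \<Rightarrow> real \<Rightarrow> bool \<Rightarrow> (real \<Rightarrow> complex ^ 2) \<Rightarrow> real \<Rightarrow> complex" where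
  "spin_comp A B s f x = ph (\<not> s) x * (of_real A * v1 (f x) + \<i> * of_real (sg s * B) * v2 (f x)) / of_real (sqrt 2)"

text \<open>Parallelogram law. The two components together control the weighted norm of f, so L2
  convergence and vanishing can be tested on them.\<close>

lemma spin_comp_norm: "(norm (spin_comp A B True f x))\<^sup>2 + (norm (spin_comp A B False f x))\<^sup>2 = A\<^sup>2 * (norm (v1 (f x)))\<^sup>2 + B\<^sup>2 * (norm (v2 (f x)))\<^sup>2"
proof -
  have "(norm (u + \<i> * w))\<^sup>2 + (norm (u - \<i> * w))\<^sup>2 = 2 * (norm u)\<^sup>2 + 2 * (norm w)\<^sup>2" for u w
    unfolding cmod_power2 by (simp add: power2_eq_square algebra_simps)
  from this[of "of_real A * v1 (f x)" "of_real B * v2 (f x)"] show ?thesis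
    by (simp add: spin_comp_def norm_mult norm_divide power_mult_distrib power_divide sg_def mult.assoc)
qed

lemma L2_meas: assumes "f \<in> L2" shows "(\<lambda>x. v1 (f x)) \<in> borel_measurable borel" "(\<lambda>x. v2 (f x)) \<in> borel_measurable borel"
proof -
  have f: "f \<in> borel_measurable borel" using assms by (simp add: L2_def)
  have "(\<lambda>v :: complex ^ 2. vec_nth v i) \<in> borel_measurable borel" for i
    by (intro borel_measurable_continuous_onI linear_continuous_on bounded_linear_vec_nth)
  from measurable_compose[OF f this[of 1]] measurable_compose[OF f this[of 2]] show "(\<lambda>x. v1 (f x)) \<in> borel_measurable borel" "(\<lambda>x. v2 (f x)) \<in> borel_measurable borel" by simp_all
qed

lemma L2_v: assumes "f \<in> L2" shows "l2 (\<lambda>x. v1 (f x))" "l2 (\<lambda>x. v2 (f x))"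
proof -
  have i: "integrable lborel (\<lambda>x. (norm (f x))\<^sup>2)" using assms by (simp add: L2_def)
  show "l2 (\<lambda>x. v1 (f x))" "l2 (\<lambda>x. v2 (f x))" unfolding l2_def
    using L2_meas[OF assms] by (auto intro!: Bochner_Integration.integrable_bound[OF i] simp: norm2_sq)
qed

lemma L2_iff: "f \<in> L2 \<longleftrightarrow> l2 (\<lambda>x. v1 (f x)) \<and> l2 (\<lambda>x. v2 (f x))"
proof
  assume l: "l2 (\<lambda>x. v1 (f x)) \<and> l2 (\<lambda>x. v2 (f x))"
  have e: "f = (\<lambda>x. (\<lambda>p. vector [fst p, snd p]) (v1 (f x), v2 (f x)))" by (auto simp: vec2_eq)
  have [measurable]: "(\<lambda>x. v1 (f x)) \<in> borel_measurable borel" "(\<lambda>x. v2 (f x)) \<in> borel_measurable borel" using l l2_meas by auto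
  have "(\<lambda>p. vector [fst p, snd p] :: complex ^ 2) \<in> borel_measurable borel"
    by (intro borel_measurable_continuous_onI linear_continuous_on bounded_linear_vector)
  from measurable_compose[OF _ this, of "\<lambda>x. (v1 (f x), v2 (f x))"] have "f \<in> borel_measurable borel"
    by (subst e) simp
  then show "f \<in> L2" using l by (simp add: L2_def norm2_sq l2_sq_int)
qed (simp add: L2_v)

lemma spin_comp_l2: assumes "f \<in> L2" shows "l2 (spin_comp A B s f)"
proof -
  have e: "spin_comp A B s f = (\<lambda>x. (ph (\<not> s) x / of_real (sqrt 2)) * (of_real A * v1 (f x) + \<i> * of_real (sg s * B) * v2 (f x)))"
    by (auto simp: spin_comp_def)
  show ?thesis unfolding e
    by (rule l2_bounded_mult[where K=1]) (use L2_v[OF assms] in \<open>auto intro!: l2_add l2_scale simp: norm_divide\<close>)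
qed

lemma spin_comp_sq: assumes "f \<in> L2"
  shows "sq (spin_comp A B True f) + sq (spin_comp A B False f) = A\<^sup>2 * sq (\<lambda>x. v1 (f x)) + B\<^sup>2 * sq (\<lambda>x. v2 (f x))"
proof -
  have "sq (spin_comp A B True f) + sq (spin_comp A B False f) = (\<integral>x. (norm (spin_comp A B True f x))\<^sup>2 + (norm (spin_comp A B False f x))\<^sup>2 \<partial>lborel)"
    unfolding sq_def by (rule Bochner_Integration.integral_add[symmetric]; rule l2_sq_int[OF spin_comp_l2[OF assms]])
  also have "\<dots> = (\<integral>x. A\<^sup>2 * (norm (v1 (f x)))\<^sup>2 + B\<^sup>2 * (norm (v2 (f x)))\<^sup>2 \<partial>lborel)" unfolding spin_comp_norm ..
  also have "\<dots> = A\<^sup>2 * sq (\<lambda>x. v1 (f x)) + B\<^sup>2 * sq (\<lambda>x. v2 (f x))"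
    unfolding sq_def by (subst Bochner_Integration.integral_add) (auto intro!: integrable_mult_right l2_sq_int L2_v assms)
  finally show ?thesis .
qed

lemma L2_int: assumes "f \<in> L2" shows "(\<integral>x. (norm (f x))\<^sup>2 \<partial>lborel) = sq (\<lambda>x. v1 (f x)) + sq (\<lambda>x. v2 (f x))"
  unfolding norm2_sq sq_def by (rule Bochner_Integration.integral_add; rule l2_sq_int[OF L2_v(1)[OF assms]] l2_sq_int[OF L2_v(2)[OF assms]])

lemma L2_diff: "f \<in> L2 \<Longrightarrow> g \<in> L2 \<Longrightarrow> (\<lambda>x. f x - g x) \<in> L2"
  unfolding L2_iff by (auto intro: l2_diff)

lemma spin_comp_diff: "spin_comp A B s (\<lambda>x. f x - g x) x = spin_comp A B s f x - spin_comp A B s g x"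
  by (simp add: spin_comp_def algebra_simps diff_divide_distrib)

lemma spin_comp_tendsto:
  assumes "\<And>k. F k \<in> L2" "f \<in> L2" "L2_tendsto F f"
  shows "(\<lambda>k. sp (eta \<rho> m) (spin_comp A B s (F k))) \<longlonglongrightarrow> sp (eta \<rho> m) (spin_comp A B s f)"
proof (rule sp_tendsto[OF l2 spin_comp_l2 spin_comp_l2])
  have "(\<lambda>k. sq (spin_comp A B s (\<lambda>x. F k x - f x))) \<longlonglongrightarrow> 0"
  proof (rule Lim_null_comparison)
    have "sq (spin_comp A B s (\<lambda>x. F k x - f x)) \<le> (A\<^sup>2 + B\<^sup>2) * (\<integral>x. (norm (F k x - f x))\<^sup>2 \<partial>lborel)" for k
    proof -
      have l: "(\<lambda>x. F k x - f x) \<in> L2" by (intro L2_diff assms)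
      have "sq (spin_comp A B s (\<lambda>x. F k x - f x)) \<le> sq (spin_comp A B True (\<lambda>x. F k x - f x)) + sq (spin_comp A B False (\<lambda>x. F k x - f x))"
        by (cases s) auto
      also have "\<dots> \<le> (A\<^sup>2 + B\<^sup>2) * (\<integral>x. (norm (F k x - f x))\<^sup>2 \<partial>lborel)"
        unfolding spin_comp_sq[OF l] L2_int[OF l] by (simp add: algebra_simps)
      finally show ?thesis .
    qed
    then show "\<forall>\<^sub>F k in sequentially. norm (sq (spin_comp A B s (\<lambda>x. F k x - f x))) \<le> (A\<^sup>2 + B\<^sup>2) * (\<integral>x. (norm (F k x - f x))\<^sup>2 \<partial>lborel)"
      by (intro always_eventually allI) simp
    show "(\<lambda>k. (A\<^sup>2 + B\<^sup>2) * (\<integral>x. (norm (F k x - f x))\<^sup>2 \<partial>lborel)) \<longlonglongrightarrow> 0"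
      using assms(3) unfolding L2_tendsto_def by (rule tendsto_mult_right_zero)
  qed
  then show "(\<lambda>k. sq (\<lambda>x. spin_comp A B s (F k) x - spin_comp A B s f x)) \<longlonglongrightarrow> 0"
    unfolding spin_comp_diff[symmetric] .
qed (use assms in auto)

abbreviation "cup \<equiv> spin_comp (sqrt \<alpha>) (sqrt \<beta>)"
abbreviation "cdn \<equiv> spin_comp (1 / sqrt \<alpha>) (1 / sqrt \<beta>)"

text \<open>A^(-1/2) J A^(-1/2) = \<open>\<kappa>\<close> J is diagonal in the spin vectors. A
  component of the image is therefore a scalar operator, with imaginary first order term, applied to
  the combination \<open>u\<close> taken from A^(1/2) F.\<close>

lemma cdn_ncho:
  assumes "\<And>x. (F has_vector_derivative F' x) (at x)" "\<And>x. (F' has_vector_derivative F'' x) (at x)"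
    and u: "\<And>v. u v = of_real (sqrt \<alpha>) * v1 v + \<i> * of_real (sg s * sqrt \<beta>) * v2 v"
  shows "cdn s (ncho_expr \<alpha> \<beta> F) x = ph (\<not> s) x / of_real (sqrt 2) *
    (- (1/2) * u (F'' x) + of_real (x\<^sup>2 / 2) * u (F x) + \<i> * of_real (sg s * \<kappa>) * (of_real x * u (F' x) + 1/2 * u (F x)))"
proof -
  define a b :: complex where "a = of_real (sqrt \<alpha>)" "b = of_real (sqrt \<beta>)"
  define k \<sigma> :: complex where "k = of_real \<kappa>" "\<sigma> = of_real (sg s)"
  have aa: "of_real \<alpha> = a * a" "of_real \<beta> = b * b" unfolding a_b_def of_real_mult[symmetric] using pos by simp_all
  have nz: "a \<noteq> 0" "b \<noteq> 0" using ab(1,2) by (auto simp: a_b_def)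
  have kk: "k = 1 / (a * b)" unfolding a_b_def k_\<sigma>_def using pos by (simp add: \<kappa>_def real_sqrt_mult)
  have ss: "\<sigma> * \<sigma> = 1" unfolding k_\<sigma>_def of_real_mult[symmetric] by simp
  have "cdn s (ncho_expr \<alpha> \<beta> F) x = ph (\<not> s) x / of_real (sqrt 2) * (1 / a * v1 (ncho_expr \<alpha> \<beta> F x) + \<i> * \<sigma> / b * v2 (ncho_expr \<alpha> \<beta> F x))"
    by (simp add: spin_comp_def a_b_def k_\<sigma>_def)
  also have "1 / a * v1 (ncho_expr \<alpha> \<beta> F x) + \<i> * \<sigma> / b * v2 (ncho_expr \<alpha> \<beta> F x) =
     - (1/2) * u (F'' x) + of_real (x\<^sup>2 / 2) * u (F x) + \<i> * of_real (sg s * \<kappa>) * (of_real x * u (F' x) + 1/2 * u (F x))"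
  proof -
    have gen: "1 / a * (a * a * (- (1/2) * p1 + y2 * q1) - (y * r2 + 1/2 * q2)) + \<i> * \<sigma> / b * (b * b * (- (1/2) * p2 + y2 * q2) + (y * r1 + 1/2 * q1))
      = - (1/2) * (a * p1 + \<i> * (\<sigma> * b) * p2) + y2 * (a * q1 + \<i> * (\<sigma> * b) * q2) +
         \<i> * (\<sigma> * k) * (y * (a * r1 + \<i> * (\<sigma> * b) * r2) + 1/2 * (a * q1 + \<i> * (\<sigma> * b) * q2))" for p1 p2 q1 q2 r1 r2 y y2 :: complex
    proof -
      have 1: "\<i> * (\<sigma> * k) * (y * (a * r1 + \<i> * (\<sigma> * b) * r2) + 1/2 * (a * q1 + \<i> * (\<sigma> * b) * q2))
        = \<i> * \<sigma> * (k * a) * (y * r1 + 1/2 * q1) + (\<i> * \<i>) * (\<sigma> * \<sigma>) * (k * b) * (y * r2 + 1/2 * q2)"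
        by (simp add: algebra_simps)
      have 2: "k * a = 1 / b" "k * b = 1 / a" using nz by (simp_all add: kk)
      show ?thesis unfolding 1 2 ss using nz by (simp add: field_simps)
    qed
    show ?thesis unfolding ncho_expr_components[OF assms(1,2)] u aa of_real_mult
      unfolding a_b_def[symmetric] k_\<sigma>_def[symmetric] by (rule gen)
  qed
  finally show ?thesis .
qed

text \<open>\<open>cdn_ncho\<close> reduces to a scalar pairing, \<open>ncho_symm_scalar\<close>
  moves the operator to the chirped Hermite function and reverses the sign, and
  \<open>phi_ode\<close> for the opposite sign evaluates it.\<close>

lemma coef_schwartz:
  assumes F: "schwartz F"
  shows "sp (eta \<rho> m) (cdn s (ncho_expr \<alpha> \<beta> F)) = of_real (\<nu> * (m + 1/2)) * sp (eta \<rho> m) (cup s F)"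
proof -
  obtain D where D: "D 0 = F" "\<And>k x. (D k has_vector_derivative D (Suc k) x) (at x)" "\<And>k. continuous_on UNIV (D k)"
    "\<And>j k. \<exists>C. \<forall>x. \<bar>x\<bar> ^ j * norm (D k x) \<le> C" using schwartz_props[OF F] by metis
  have d01: "(D 0 has_vector_derivative D 1 x) (at x)" for x using D(2)[of 0 x] by simp
  have d12: "(D 1 has_vector_derivative D 2 x) (at x)" for x using D(2)[of 1 x] by (simp add: numeral_2_eq_2)
  define u :: "complex ^ 2 \<Rightarrow> complex" where "u = (\<lambda>v. of_real (sqrt \<alpha>) * v1 v + \<i> * of_real (sg s * sqrt \<beta>) * v2 v)"
  have ue: "u v = of_real (sqrt \<alpha>) * v1 v + \<i> * of_real (sg s * sqrt \<beta>) * v2 v" for v by (simp add: u_def)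
  have bl: "bounded_linear u" unfolding u_def
    by (intro bounded_linear_add bounded_linear_mult_const bounded_linear_const_mult bounded_linear_vec_nth)
  obtain K where K: "\<And>v. norm (u v) \<le> norm v * K" using bounded_linear.bounded[OF bl] by blast
  have "\<exists>C. \<forall>x. norm (u (D k x)) \<le> C" for k
  proof -
    obtain C where C: "\<And>x. norm (D k x) \<le> C" using D(4)[of 0 k] by auto
    have "norm (u (D k x)) \<le> C * \<bar>K\<bar>" for x
    proof -
      have "norm (u (D k x)) \<le> norm (D k x) * \<bar>K\<bar>" by (rule order_trans[OF K]) (simp add: mult_left_mono)
      also have "\<dots> \<le> C * \<bar>K\<bar>" by (rule mult_right_mono[OF C]) simp
      finally show ?thesis .
    qed
    then show ?thesis by blast
  qed
  then obtain C0 where C0: "\<And>k x. norm (u (D k x)) \<le> C0 k" by metis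
  define C where "C = \<bar>C0 0\<bar> + \<bar>C0 1\<bar> + \<bar>C0 2\<bar>"
  have C: "norm (u (D 0 x)) \<le> C" "norm (u (D 1 x)) \<le> C" "norm (u (D 2 x)) \<le> C" for x
    using C0[of 0 x] C0[of 1 x] C0[of 2 x] by (simp_all add: C_def)
  note du = bounded_linear.has_vector_derivative[OF bl d01] bounded_linear.has_vector_derivative[OF bl d12]
  note cu = bounded_linear.continuous_on[OF bl D(3)]
  let ?z = "zz (\<not> s)"
  have "sp (eta \<rho> m) (cdn s (ncho_expr \<alpha> \<beta> F)) = (\<integral>x. 1 / of_real (sqrt 2) * (pg (osc_poly m) ?z x *
     (- (1/2) * u (D 2 x) + of_real (x\<^sup>2 / 2) * u (D 0 x) + \<i> * of_real (sg s * \<kappa>) * (of_real x * u (D 1 x) + 1/2 * u (D 0 x)))) \<partial>lborel)"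
    unfolding sp_def cdn_ncho[OF d01 d12 ue, unfolded D(1)] D(1)
    by (rule Bochner_Integration.integral_cong[OF refl]) (simp only: phi_eq eta_real, simp)
  also have "\<dots> = 1 / of_real (sqrt 2) * (\<integral>x. pg (osc_poly m) ?z x *
     (- (1/2) * u (D 2 x) + of_real (x\<^sup>2 / 2) * u (D 0 x) + \<i> * of_real (sg s * \<kappa>) * (of_real x * u (D 1 x) + 1/2 * u (D 0 x))) \<partial>lborel)"
    by (rule integral_mult_right_zero)
  also have "\<dots> = 1 / of_real (sqrt 2) * (\<integral>x. (- (1/2) * pg (dpg ?z (dpg ?z (osc_poly m))) ?z x + of_real (x\<^sup>2 / 2) * pg (osc_poly m) ?z x
      - \<i> * of_real (sg s * \<kappa>) * (of_real x * pg (dpg ?z (osc_poly m)) ?z x + 1/2 * pg (osc_poly m) ?z x)) * u (D 0 x) \<partial>lborel)"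
    by (subst ncho_symm_scalar[OF zz_pos du cu cu cu C]) (rule refl)
  also have "\<dots> = 1 / of_real (sqrt 2) * (\<integral>x. of_real (\<nu> * (m + 1/2)) * (pg (osc_poly m) ?z x * u (D 0 x)) \<partial>lborel)"
    using phi_ode[of "\<not> s" m] by (simp add: mult.assoc)
  also have "\<dots> = of_real (\<nu> * (m + 1/2)) * sp (eta \<rho> m) (cup s F)"
  proof -
    have "sp (eta \<rho> m) (cup s F) = (\<integral>x. 1 / of_real (sqrt 2) * (pg (osc_poly m) ?z x * u (D 0 x)) \<partial>lborel)"
      unfolding sp_def spin_comp_def D(1)
      by (rule Bochner_Integration.integral_cong[OF refl]) (simp add: phi_eq eta_real ue)
    then show ?thesis unfolding integral_mult_right_zero by simp
  qed
  finally show ?thesis .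
qed

text \<open>Both sides are L2-continuous, so the relation survives the closure of the graph.\<close>

lemma coef_ncho:
  assumes "(f, g) \<in> ncho \<alpha> \<beta>"
  shows "sp (eta \<rho> m) (cdn s g) = of_real (\<nu> * (m + 1/2)) * sp (eta \<rho> m) (cup s f)"
proof -
  obtain F where F: "\<And>k. schwartz (F k)" "L2_tendsto F f" "L2_tendsto (\<lambda>k. ncho_expr \<alpha> \<beta> (F k)) g" and fg: "f \<in> L2" "g \<in> L2"
    using assms by (auto simp: ncho_def)
  have "(\<lambda>k. sp (eta \<rho> m) (cdn s (ncho_expr \<alpha> \<beta> (F k)))) \<longlonglongrightarrow> sp (eta \<rho> m) (cdn s g)"
    by (rule spin_comp_tendsto[OF _ fg(2) F(3)]) (rule schwartz_L2[OF F(1)])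
  moreover have "(\<lambda>k. of_real (\<nu> * (m + 1/2)) * sp (eta \<rho> m) (cup s (F k))) \<longlonglongrightarrow> of_real (\<nu> * (m + 1/2)) * sp (eta \<rho> m) (cup s f)"
    by (intro tendsto_mult_left spin_comp_tendsto fg F schwartz_L2)
  ultimately show ?thesis unfolding coef_schwartz[OF F(1)] by (rule LIMSEQ_unique)
qed

end

section \<open>The Gram matrix and the matching of eigenspaces\<close>

lemma has_sum_bool:
  fixes f :: "'a \<times> bool \<Rightarrow> 'b :: {topological_comm_monoid_add, t2_space}"
  assumes "\<And>s. ((\<lambda>m. f (m, s)) has_sum l s) UNIV"
  shows "(f has_sum (l True + l False)) UNIV"
proof -
  have r: "(f has_sum l s) ((\<lambda>m. (m, s)) ` UNIV)" for s
    by (subst has_sum_reindex) (auto simp: inj_on_def o_def assms)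
  have "(f has_sum (l True + l False)) ((\<lambda>m. (m, True)) ` UNIV \<union> (\<lambda>m. (m, False)) ` UNIV)"
    by (intro has_sum_Un_disjoint r) auto
  moreover have "(\<lambda>m :: 'a. (m, True)) ` UNIV \<union> (\<lambda>m. (m, False)) ` UNIV = UNIV"
    by (auto simp: image_iff)
  ultimately show ?thesis by simp
qed

lemma ell2_bool:
  fixes x :: "nat \<times> bool \<Rightarrow> complex"
  assumes "\<And>s. summable (\<lambda>m. (norm (x (m, s)))\<^sup>2)"
  shows "ell2 x" "nsq x = (\<Sum>m. (norm (x (m, True)))\<^sup>2) + (\<Sum>m. (norm (x (m, False)))\<^sup>2)"
proof -
  have "((\<lambda>m. (norm (x (m, s)))\<^sup>2) has_sum (\<Sum>m. (norm (x (m, s)))\<^sup>2)) UNIV" for s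
    by (rule norm_summable_imp_has_sum) (use assms[of s] in \<open>auto intro: summable_sums\<close>)
  from has_sum_bool[of "\<lambda>i. (norm (x i))\<^sup>2", OF this]
  have h: "((\<lambda>i. (norm (x i))\<^sup>2) has_sum ((\<Sum>m. (norm (x (m, True)))\<^sup>2) + (\<Sum>m. (norm (x (m, False)))\<^sup>2))) UNIV" .
  show "ell2 x" unfolding ell2_def by (rule has_sum_imp_summable[OF h])
  show "nsq x = (\<Sum>m. (norm (x (m, True)))\<^sup>2) + (\<Sum>m. (norm (x (m, False)))\<^sup>2)" unfolding nsq_def by (rule infsumI[OF h])
qed

lemma ell2_boolD:
  fixes x :: "nat \<times> bool \<Rightarrow> complex"
  assumes "ell2 x" shows "summable (\<lambda>m. (norm (x (m, s)))\<^sup>2)"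
proof -
  have "(\<lambda>i. (norm (x i))\<^sup>2) summable_on ((\<lambda>m. (m, s)) ` UNIV)"
    by (rule summable_on_subset_banach[OF assms[unfolded ell2_def]]) simp
  then have "(\<lambda>m. (norm (x (m, s)))\<^sup>2) summable_on UNIV"
    by (subst (asm) summable_on_reindex) (auto simp: inj_on_def o_def)
  then show ?thesis by (rule summable_on_imp_summable)
qed

context ncho_par begin

text \<open>Inverse of the passage from f to its two \<open>cup\<close> components; builds
  eigenfunctions out of coordinates.\<close>

definition recombine :: "(bool \<Rightarrow> real \<Rightarrow> complex) \<Rightarrow> real \<Rightarrow> complex ^ 2" where
  "recombine g x = vector [(\<Sum>s\<in>UNIV. ph s x * g s x) / of_real (sqrt \<alpha> * sqrt 2),
     (\<Sum>s\<in>UNIV. - \<i> * of_real (sg s) * (ph s x * g s x)) / of_real (sqrt \<beta> * sqrt 2)]"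

lemma sqrt2: "of_real (sqrt 2) * (of_real (sqrt 2) * w) = 2 * (w :: complex)"
  by (simp flip: mult.assoc of_real_mult)

lemma cup_rcp: "cup s (recombine g) x = g s x"
proof -
  have "cup s (recombine g) x = ph (\<not> s) x * ((\<Sum>s\<in>UNIV. ph s x * g s x) + of_real (sg s) * (\<Sum>s\<in>UNIV. of_real (sg s) * (ph s x * g s x))) / 2"
    using ab(1,2) sqrt2[of 1] by (simp add: spin_comp_def recombine_def sum_bool sg_def field_simps) 
  also have "\<dots> = (ph (\<not> s) x * ph s x) * g s x"
    by (cases s) (simp_all add: sum_bool sg_def algebra_simps)
  finally show ?thesis by simp
qed

lemma recombine_L2: assumes "\<And>s. l2 (g s)" shows "recombine g \<in> L2"
proof -
  have l: "l2 (\<lambda>x. ph s x * g s x)" for s by (rule l2_bounded_mult[where K=1, OF assms]) simp_all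
  show ?thesis unfolding L2_iff recombine_def v_vector divide_inverse mult.commute[of _ "inverse _"]
    by (intro conjI l2_scale l2_sum l) auto
qed

text \<open>Entry of A^(-1) between the normalised spin vectors
  \<open>(1, -\<i>\<sigma>) / sqrt 2\<close> of two signs.\<close>

definition Cc :: "bool \<Rightarrow> bool \<Rightarrow> real" where "Cc s s' = (1 / \<alpha> + sg s * sg s' / \<beta>) / 2"

text \<open>The chirps cancel for equal signs; opposite signs leave a net chirp, the only source of
  entries that are off-diagonal in the oscillator index.\<close>

definition wv :: "bool \<Rightarrow> bool \<Rightarrow> nat \<Rightarrow> real \<Rightarrow> complex" where
  "wv s s' m x = ph s x * ph (\<not> s') x * eta \<rho> m x"

lemma wv_l2: "l2 (wv s s' m)"
  unfolding wv_def[abs_def] by (rule l2_bounded_mult[OF l2, of _ 1]) (auto simp: norm_mult)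

lemma wv_sq: "sq (wv s s' m) = 1"
proof -
  have "sq (wv s s' m) = sq (eta \<rho> m)" unfolding sq_def wv_def by (simp add: norm_mult)
  also have "complex_of_real \<dots> = 1" unfolding sp_self[symmetric] by (simp add: on)
  finally show ?thesis by (metis of_real_eq_1_iff)
qed

lemma cdn_cup: "cdn s f x = (\<Sum>s'\<in>UNIV. of_real (Cc s s') * (ph (\<not> s) x * ph s' x * cup s' f x))"
proof -
  define a b :: complex where "a = of_real (sqrt \<alpha>)" "b = of_real (sqrt \<beta>)"
  define r :: complex where "r = of_real (sqrt 2)"
  have aa: "of_real \<alpha> = a * a" "of_real \<beta> = b * b" unfolding a_b_def of_real_mult[symmetric] using pos by simp_all
  have nz: "a \<noteq> 0" "b \<noteq> 0" "r \<noteq> 0" using ab(1,2) by (auto simp: a_b_def r_def)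
  have p: "ph (\<not> s) x * ph s' x * cup s' f x = ph (\<not> s) x * (a * v1 (f x) + \<i> * of_real (sg s') * b * v2 (f x)) / r" for s'
  proof -
    have "ph (\<not> s) x * ph s' x * cup s' f x = ph (\<not> s) x * (ph s' x * ph (\<not> s') x) * (a * v1 (f x) + \<i> * of_real (sg s') * b * v2 (f x)) / r"
      by (simp add: spin_comp_def a_b_def r_def mult_ac)
    then show ?thesis by simp
  qed
  have "cdn s f x = ph (\<not> s) x * (v1 (f x) / a + \<i> * of_real (sg s) * v2 (f x) / b) / r"
    by (simp add: spin_comp_def a_b_def r_def)
  also have "\<dots> = (\<Sum>s'\<in>UNIV. of_real (Cc s s') * (ph (\<not> s) x * (a * v1 (f x) + \<i> * of_real (sg s') * b * v2 (f x)) / r))"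
    using nz by (cases s) (simp_all add: sum_bool Cc_def sg_def aa field_simps)
  finally show ?thesis unfolding p .
qed

lemma coef_cdn:
  assumes f: "f \<in> L2"
  shows "sp (eta \<rho> m) (cdn s f) = (\<Sum>s'\<in>UNIV. of_real (Cc s s') * sp (wv s s' m) (cup s' f))"
proof -
  have l: "l2 (\<lambda>x. ph (\<not> s) x * ph s' x * cup s' f x)" for s'
    by (rule l2_bounded_mult[OF spin_comp_l2[OF f], of _ 1]) (auto simp: norm_mult)
  have "sp (eta \<rho> m) (\<lambda>x. ph (\<not> s) x * ph s' x * cup s' f x) = sp (wv s s' m) (cup s' f)" for s'
    unfolding sp_def wv_def by (rule Bochner_Integration.integral_cong[OF refl]) (simp add: cnj_ph mult_ac)
  then show ?thesis unfolding cdn_cup[abs_def]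
    by (subst sp_sum_right[OF _ l2 l2_scale[OF l]]) (simp_all add: sp_scale_right)
qed

text \<open>Spin factor times oscillator factor of an inner product of two vectors \<psi>. In the
  notation of the overview, \<open>gram\<close> is \<Gamma>, \<open>dd\<close> the diagonal of D,
  and \<open>gram_scaled\<close> is G.\<close>

definition gram :: "nat \<times> bool \<Rightarrow> nat \<times> bool \<Rightarrow> complex" where
  "gram i j = of_real (Cc (snd i) (snd j)) * sp (wv (snd i) (snd j) (fst i)) (eta \<rho> (fst j))"

definition dd :: "nat \<times> bool \<Rightarrow> real" where "dd i = real (fst i) + 1 / 2"

definition gram_scaled :: "nat \<times> bool \<Rightarrow> nat \<times> bool \<Rightarrow> complex" where
  "gram_scaled i j = gram i j / of_real (\<nu> * sqrt (dd i) * sqrt (dd j))"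

lemma dd_pos: "dd i > 0" by (simp add: dd_def add_nonneg_pos)

lemma sqrt_dd: "complex_of_real (sqrt (dd i)) \<noteq> 0" "of_real (sqrt (dd i)) * of_real (sqrt (dd i)) = complex_of_real (dd i)"
  using dd_pos[of i] by (auto simp flip: of_real_mult)

lemma inv_sqrt_dd: "norm (complex_of_real (1 / sqrt (dd i))) \<le> 2"
proof -
  have "1 / 4 \<le> dd i" by (simp add: dd_def)
  then have "1 / 2 \<le> sqrt (dd i)" by (intro real_le_rsqrt) (simp add: power2_eq_square)
  moreover from this have "\<bar>sqrt (dd i)\<bar> = sqrt (dd i)" by simp
  ultimately show ?thesis using dd_pos[of i] unfolding norm_of_real abs_divide by (simp add: divide_le_eq)
qed

lemma gram_herm: "cnj (gram i j) = gram j i"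
proof -
  have "cnj (sp (wv s s' m) (eta \<rho> k)) = sp (wv s' s k) (eta \<rho> m)" for s s' m k
    unfolding sp_cnj by (auto simp: sp_def wv_def eta_real cnj_ph mult_ac intro!: Bochner_Integration.integral_cong)
  then show ?thesis by (simp add: gram_def Cc_def mult.commute)
qed

lemma wv_coef_summable: "summable (\<lambda>k. (norm (sp (wv s s' m) (eta \<rho> k)))\<^sup>2)" "(\<Sum>k. (norm (sp (wv s s' m) (eta \<rho> k)))\<^sup>2) \<le> 1"
proof -
  have e: "norm (sp (wv s s' m) (eta \<rho> k)) = norm (sp (eta \<rho> k) (wv s s' m))" for k
    by (metis complex_mod_cnj sp_cnj)
  show s: "summable (\<lambda>k. (norm (sp (wv s s' m) (eta \<rho> k)))\<^sup>2)" unfolding e by (rule bessel_summable[OF wv_l2])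
  show "(\<Sum>k. (norm (sp (wv s s' m) (eta \<rho> k)))\<^sup>2) \<le> 1"
    by (rule suminf_le_const[OF s]) (use bessel[OF wv_l2[of s s' m]] in \<open>simp add: e wv_sq\<close>)
qed

text \<open>Within one sign a row is a multiple of the Hermite coefficients of the unit vector
  \<open>wv\<close>, so Bessel's inequality bounds all rows uniformly.\<close>

lemma gram_row: "ell2 (gram i)" "nsq (gram i) \<le> 2 * (1 / \<alpha> + 1 / \<beta>)\<^sup>2"
proof -
  obtain m s where i: "i = (m, s)" by force
  have n: "(norm (gram i (k, s')))\<^sup>2 = (Cc s s')\<^sup>2 * (norm (sp (wv s s' m) (eta \<rho> k)))\<^sup>2" for k s'
    by (simp add: gram_def i norm_mult power_mult_distrib)
  have su: "summable (\<lambda>k. (norm (gram i (k, s')))\<^sup>2)" for s' unfolding n by (intro summable_mult wv_coef_summable)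
  show "ell2 (gram i)" by (rule ell2_bool(1)[OF su])
  have "(\<Sum>k. (norm (gram i (k, s')))\<^sup>2) \<le> (1 / \<alpha> + 1 / \<beta>)\<^sup>2" for s'
  proof -
    have "\<bar>Cc s s'\<bar> \<le> 1 / \<alpha> + 1 / \<beta>" using pos by (auto simp: Cc_def sg_def abs_if field_simps)
    then have "(Cc s s')\<^sup>2 \<le> (1 / \<alpha> + 1 / \<beta>)\<^sup>2" using power_mono[of "\<bar>Cc s s'\<bar>" _ 2] by simp
    moreover have "(\<Sum>k. (norm (gram i (k, s')))\<^sup>2) \<le> (Cc s s')\<^sup>2 * 1"
      unfolding n suminf_mult[OF wv_coef_summable(1)] by (intro mult_left_mono wv_coef_summable(2)) auto
    ultimately show ?thesis by simp
  qed
  from this[of True] this[of False] show "nsq (gram i) \<le> 2 * (1 / \<alpha> + 1 / \<beta>)\<^sup>2" unfolding ell2_bool(2)[OF su] by simp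
qed

text \<open>Rows of \<open>gram\<close> are uniformly bounded and 1 / \<open>dd\<close> is
  square-summable, so weighting by 1 / \<open>dd i\<close> or by 1 / \<open>dd j\<close> gives
  Hilbert-Schmidt matrices. The symmetric weight is dominated by the sum of the two.\<close>

sublocale hs_hermitian gram_scaled
proof
  fix i j show "cnj (gram_scaled i j) = gram_scaled j i" by (simp add: gram_scaled_def gram_herm mult_ac)
next
  let ?X = "\<lambda>i j. complex_of_real (1 / dd i) * gram i j"
  have X: "ell2 (\<lambda>(i, j). ?X i j)"
  proof (rule ell2_pairI)
    show "ell2 (?X i)" for i by (intro ell2_scale gram_row)
    have "nsq (?X i) = (1 / dd i)\<^sup>2 * nsq (gram i)" for i
      unfolding nsq_def norm_mult norm_of_real power_mult_distrib power2_abs infsum_cmult_right' ..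
    also have "\<dots> i \<le> (1 / dd i)\<^sup>2 * (2 * (1 / \<alpha> + 1 / \<beta>)\<^sup>2)" for i by (intro mult_left_mono gram_row) auto
    finally show "nsq (?X i) \<le> (1 / dd i)\<^sup>2 * (2 * (1 / \<alpha> + 1 / \<beta>)\<^sup>2)" for i .
    have "summable (\<lambda>m. (1 / (real m + 1 / 2))\<^sup>2)"
    proof (rule summable_comparison_test)
      show "summable (\<lambda>m. 4 * inverse (real (Suc m) ^ 2))" by (intro summable_mult) (use inverse_power_summable[of 2, where 'a=real] in \<open>subst summable_Suc_iff, simp\<close>)
      have "norm ((1 / (real m + 1 / 2))\<^sup>2) \<le> 4 * inverse (real (Suc m) ^ 2)" for m
      proof -
        have "norm ((1 / (real m + 1 / 2))\<^sup>2) = 4 * inverse ((2 * real m + 1)\<^sup>2)" by (simp add: field_simps power2_eq_square)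
        also have "\<dots> \<le> 4 * inverse (real (Suc m) ^ 2)" by (intro mult_left_mono le_imp_inverse_le power_mono) auto
        finally show ?thesis .
      qed
      then show "\<exists>N. \<forall>m\<ge>N. norm ((1 / (real m + 1 / 2))\<^sup>2) \<le> 4 * inverse (real (Suc m) ^ 2)" by blast
    qed
    then have "((\<lambda>m. (1 / dd (m, s))\<^sup>2) has_sum (\<Sum>m. (1 / (real m + 1 / 2))\<^sup>2)) UNIV" for s
      by (intro norm_summable_imp_has_sum) (auto simp: dd_def intro: summable_sums)
    from has_sum_imp_summable[OF has_sum_bool[of "\<lambda>i. (1 / dd i)\<^sup>2", OF this]]
    show "(\<lambda>i. (1 / dd i)\<^sup>2 * (2 * (1 / \<alpha> + 1 / \<beta>)\<^sup>2)) summable_on UNIV" by (rule summable_on_cmult_left)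
  qed
  let ?Y = "\<lambda>i j. cnj (complex_of_real (1 / dd j) * gram j i)"
  have "ell2 (\<lambda>(i, j). complex_of_real (1 / dd j) * gram j i)" using X by (subst ell2_swap) (simp add: case_prod_unfold)
  then have Y: "ell2 (\<lambda>(i, j). of_real (norm (complex_of_real (1 / dd j) * gram j i)))"
    by (rule ell2_le) auto
  have X': "ell2 (\<lambda>(i, j). of_real (norm (?X i j)))" using X by (rule ell2_le) auto
  have "ell2 (\<lambda>p. complex_of_real (1 / \<nu>) * ((case p of (i, j) \<Rightarrow> of_real (norm (?X i j))) + (case p of (i, j) \<Rightarrow> of_real (norm (complex_of_real (1 / dd j) * gram j i)))))"
    by (intro ell2_scale ell2_add X' Y)
  then show "ell2 (\<lambda>(i, j). gram_scaled i j)"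
  proof (rule ell2_le)
    fix p :: "(nat \<times> bool) \<times> nat \<times> bool"
    obtain i j where p: "p = (i, j)" by (cases p)
    \<comment> \<open>The inequality of arithmetic and geometric mean, divided by x y.\<close>
    have m: "1 / (sqrt x * sqrt y) \<le> 1 / x + 1 / y" if "x > 0" "y > 0" for x y :: real
    proof -
      have "sqrt x * sqrt y \<le> x + y" using arith_geo_mean_sqrt[of x y] that by (simp add: real_sqrt_mult)
      then have "1 / (sqrt x * sqrt y) \<le> (x + y) * (1 / ((sqrt x * sqrt x) * (sqrt y * sqrt y)))"
        using that by (simp add: divide_le_eq mult.assoc del: real_sqrt_mult_self)
      also have "\<dots> = 1 / x + 1 / y" using that by (simp add: field_simps)
      finally show ?thesis .
    qed
    have gg: "norm (gram j i) = norm (gram i j)" by (metis gram_herm complex_mod_cnj)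
    have "norm (gram_scaled i j) = 1 / \<nu> * (norm (gram i j) * (1 / (sqrt (dd i) * sqrt (dd j))))"
      using \<nu>_pos dd_pos[of i] dd_pos[of j] by (simp add: gram_scaled_def norm_divide norm_mult)
    also have "\<dots> \<le> 1 / \<nu> * (norm (gram i j) * (1 / dd i + 1 / dd j))"
      using \<nu>_pos by (intro mult_left_mono m dd_pos) auto
    also have "\<dots> = norm (complex_of_real (1 / \<nu> * (norm (gram i j) * (1 / dd i + 1 / dd j))))"
      unfolding norm_of_real using \<nu>_pos dd_pos[of i] dd_pos[of j] by (intro abs_of_nonneg[symmetric] mult_nonneg_nonneg add_nonneg_nonneg) auto
    also have "complex_of_real (1 / \<nu> * (norm (gram i j) * (1 / dd i + 1 / dd j))) =
       complex_of_real (1 / \<nu>) * (of_real (norm (?X i j)) + of_real (norm (complex_of_real (1 / dd j) * gram j i)))"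
      using dd_pos[of i] dd_pos[of j] unfolding norm_mult norm_of_real gg by (simp add: algebra_simps)
    finally show "norm (case p of (i, j) \<Rightarrow> gram_scaled i j) \<le> norm (complex_of_real (1 / \<nu>) * ((case p of (i, j) \<Rightarrow> of_real (norm (?X i j))) + (case p of (i, j) \<Rightarrow> of_real (norm (complex_of_real (1 / dd j) * gram j i)))))"
      by (simp add: p)
  qed
qed

text \<open>Expresses the coefficients of f against \<psi> through those against A\<psi>: A^(-1)
  mixes the two signs, and Parseval expands each contribution in the Hermite basis.\<close>

lemma coef_has_sum:
  assumes f: "f \<in> L2"
  shows "((\<lambda>j. gram i j * sp (eta \<rho> (fst j)) (cup (snd j) f)) has_sum sp (eta \<rho> (fst i)) (cdn (snd i) f)) UNIV"
proof -
  obtain m s where i: "i = (m, s)" by force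
  have "((\<lambda>k. sp (wv s s' m) (eta \<rho> k) * sp (eta \<rho> k) (cup s' f)) has_sum sp (wv s s' m) (cup s' f)) UNIV" for s'
  proof (rule norm_summable_imp_has_sum[OF _ parseval[OF wv_l2 spin_comp_l2[OF f]]])
    have xy: "norm x * norm y \<le> (norm x)\<^sup>2 + (norm y)\<^sup>2" for x y :: complex
      using sum_squares_bound[of "norm x" "norm y", unfolded mult.assoc] mult_nonneg_nonneg[OF norm_ge_zero[of x] norm_ge_zero[of y]] by linarith
    then show "summable (\<lambda>k. norm (sp (wv s s' m) (eta \<rho> k) * sp (eta \<rho> k) (cup s' f)))"
      by (intro summable_comparison_test[OF _ summable_add[OF wv_coef_summable(1)[of s s' m] bessel_summable[OF spin_comp_l2[OF f, of "sqrt \<alpha>" "sqrt \<beta>" s']]]])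
         (auto simp: norm_mult xy)
  qed
  from has_sum_cmult_right[OF this, of "of_real (Cc s s')" for s']
  have "((\<lambda>k. gram i (k, s') * sp (eta \<rho> k) (cup s' f)) has_sum of_real (Cc s s') * sp (wv s s' m) (cup s' f)) UNIV" for s'
    by (simp add: gram_def i mult.assoc)
  from has_sum_bool[of "\<lambda>j. gram i j * sp (eta \<rho> (fst j)) (cup (snd j) f)" "\<lambda>s'. of_real (Cc s s') * sp (wv s s' m) (cup s' f)"] this
  show ?thesis by (simp add: i coef_cdn[OF f] sum_bool)
qed

text \<open>The factor m + 1/2 of the eigenvalue equation is split evenly between both sides; this
  makes the resulting matrix Hermitian.\<close>

definition level_coords :: "(real \<Rightarrow> complex ^ 2) \<Rightarrow> nat \<times> bool \<Rightarrow> complex" where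
  "level_coords f i = of_real (sqrt (dd i)) * sp (eta \<rho> (fst i)) (cup (snd i) f)"

lemma mapp_Yc:
  assumes f: "f \<in> L2"
  shows "mapp gram_scaled (level_coords f) i = sp (eta \<rho> (fst i)) (cdn (snd i) f) / of_real (\<nu> * sqrt (dd i))"
proof -
  have "gram_scaled i j * level_coords f j = gram i j * sp (eta \<rho> (fst j)) (cup (snd j) f) * (1 / of_real (\<nu> * sqrt (dd i)))" for j
    using sqrt_dd(1)[of j] by (simp add: gram_scaled_def level_coords_def)
  then show ?thesis unfolding mapp_def using infsumI[OF has_sum_cmult_left[OF coef_has_sum[OF f, of i], of "1 / of_real (\<nu> * sqrt (dd i))"]]
    by simp
qed

lemma coef_ell2: assumes "f \<in> L2" shows "ell2 (\<lambda>i. sp (eta \<rho> (fst i)) (spin_comp A B (snd i) f))"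
  by (rule ell2_bool(1)) (simp add: bessel_summable[OF spin_comp_l2[OF assms]])

text \<open>The weights sqrt(\<open>dd i\<close>) grow, so for general f in \<open>L2\<close> these
  coordinates need not be square-summable. For an eigenfunction the relation between
  \<open>cup\<close> and \<open>cdn\<close> coefficients replaces the growing weight by a bounded
  one.\<close>

lemma level_coords_eigen:
  assumes f: "f \<in> ncho_eigenspace \<alpha> \<beta> (of_real l)" and l: "l \<noteq> 0"
  shows "ell2 (level_coords f)" "mapp gram_scaled (level_coords f) = (\<lambda>i. of_real (1 / l) * level_coords f i)"
proof -
  have fL: "f \<in> L2" using f by (auto simp: ncho_eigenspace_def ncho_def)
  have "of_real l * sp (eta \<rho> m) (cdn s f) = of_real (\<nu> * (m + 1/2)) * sp (eta \<rho> m) (cup s f)" for m s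
  proof -
    have "cdn s (\<lambda>x. of_real l *s f x) = (\<lambda>x. of_real l * cdn s f x)" by (auto simp: spin_comp_def algebra_simps)
    then show ?thesis using coef_ncho[of f "\<lambda>x. of_real l *s f x" m s] f
      unfolding ncho_eigenspace_def mem_Collect_eq by (metis sp_scale_right)
  qed
  then have k0: "of_real l * sp (eta \<rho> (fst i)) (cdn (snd i) f) = of_real \<nu> * of_real (dd i) * sp (eta \<rho> (fst i)) (cup (snd i) f)" for i
    by (simp add: dd_def)
  have k: "sp (eta \<rho> (fst i)) (cdn (snd i) f) = of_real (\<nu> / l) * of_real (sqrt (dd i)) * level_coords f i" for i
  proof -
    have "of_real (\<nu> / l) * of_real (sqrt (dd i)) * level_coords f i = of_real (\<nu> / l) * (of_real (sqrt (dd i)) * of_real (sqrt (dd i))) * sp (eta \<rho> (fst i)) (cup (snd i) f)"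
      by (simp only: level_coords_def mult.assoc)
    also have "\<dots> = sp (eta \<rho> (fst i)) (cdn (snd i) f)"
      unfolding sqrt_dd(2) using k0[of i] l by (simp add: field_simps)
    finally show ?thesis ..
  qed
  show e: "mapp gram_scaled (level_coords f) = (\<lambda>i. of_real (1 / l) * level_coords f i)"
    unfolding mapp_Yc[OF fL] k using sqrt_dd(1) \<nu>_pos by (auto simp: field_simps)
  have yf: "level_coords f i = of_real (l / \<nu>) * (of_real (1 / sqrt (dd i)) * sp (eta \<rho> (fst i)) (cdn (snd i) f))" for i
    unfolding k using sqrt_dd(1)[of i] \<nu>_pos l by simp
  have "ell2 (\<lambda>i. of_real (l / \<nu>) * (of_real (1 / sqrt (dd i)) * sp (eta \<rho> (fst i)) (cdn (snd i) f)))"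
    by (intro ell2_scale ell2_bounded_mult[OF coef_ell2[OF fL], where K=2] inv_sqrt_dd)
  then show "ell2 (level_coords f)" unfolding yf[symmetric] .
qed

lemma level_coords_inj:
  assumes f: "f \<in> L2" and y: "level_coords f = (\<lambda>_. 0)"
  shows "AE x in lborel. f x = 0"
proof -
  have "sp (eta \<rho> m) (cup s f) = 0" for m s using fun_cong[OF y, of "(m, s)"] sqrt_dd(1)[of "(m, s)"] by (simp add: level_coords_def)
  then have z: "AE x in lborel. cup s f x = 0" for s by (intro total spin_comp_l2 f)
  have nz: "\<alpha> \<noteq> 0" "\<beta> \<noteq> 0" using pos by auto
  have "AE x in lborel. cup True f x = 0 \<and> cup False f x = 0" using z by simp
  then show ?thesis
  proof eventually_elim
    fix x assume "cup True f x = 0 \<and> cup False f x = 0"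
    then have "\<alpha> * (norm (v1 (f x)))\<^sup>2 + \<beta> * (norm (v2 (f x)))\<^sup>2 = 0"
      using spin_comp_norm[of "sqrt \<alpha>" "sqrt \<beta>" f x] pos by simp
    then show "f x = 0" using pos nz by (simp add: add_nonneg_eq_0_iff vec2_eq)
  qed
qed

lemma level_coords_sum:
  fixes b :: "nat \<Rightarrow> real \<Rightarrow> complex ^ 2"
  assumes b: "\<And>i. i < d \<Longrightarrow> b i \<in> L2"
  shows "level_coords (\<lambda>x. \<Sum>i<d. c i *s b i x) = (\<lambda>j. \<Sum>i<d. c i * level_coords (b i) j)"
proof
  fix j
  have "cup s (\<lambda>x. \<Sum>i<d. c i *s b i x) x = (\<Sum>i<d. c i * cup s (b i) x)" for s x
    by (simp add: spin_comp_def sum_distrib_left sum_divide_distrib sum.distrib[symmetric] algebra_simps add_divide_distrib)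
  then have e: "cup s (\<lambda>x. \<Sum>i<d. c i *s b i x) = (\<lambda>x. \<Sum>i<d. c i * cup s (b i) x)" for s by auto
  show "level_coords (\<lambda>x. \<Sum>i<d. c i *s b i x) j = (\<Sum>i<d. c i * level_coords (b i) j)"
    unfolding level_coords_def e by (subst sp_sum_right[OF _ l2 l2_scale[OF spin_comp_l2[OF b]]]) (auto simp: sp_scale_right sum_distrib_left mult_ac)
qed

lemma level_coords_AE:
  assumes "f \<in> L2" "g \<in> L2" "AE x in lborel. f x = g x" shows "level_coords f = level_coords g"
proof
  fix j
  have "sp (eta \<rho> m) (cup s f) = sp (eta \<rho> m) (cup s g)" for m s
    unfolding sp_def
  proof (rule integral_cong_AE)
    show "AE x in lborel. cnj (eta \<rho> m x) * cup s f x = cnj (eta \<rho> m x) * cup s g x"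
      using assms(3) by eventually_elim (simp add: spin_comp_def)
  qed (use l2_ip[OF l2 spin_comp_l2[OF assms(1)]] l2_ip[OF l2 spin_comp_l2[OF assms(2)]] in \<open>auto dest: borel_measurable_integrable\<close>)
  then show "level_coords f j = level_coords g j" by (simp add: level_coords_def)
qed

lemma L2_tendsto_cmp:
  assumes AB: "A > 0" "B > 0" and F: "\<And>k. F k \<in> L2" and f: "f \<in> L2"
    and t: "\<And>s. (\<lambda>k. sq (\<lambda>x. spin_comp A B s (F k) x - spin_comp A B s f x)) \<longlonglongrightarrow> 0"
  shows "L2_tendsto F f"
  unfolding L2_tendsto_def
proof (rule Lim_null_comparison)
  let ?S = "\<lambda>k. sq (\<lambda>x. spin_comp A B True (F k) x - spin_comp A B True f x) + sq (\<lambda>x. spin_comp A B False (F k) x - spin_comp A B False f x)"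
  show "(\<lambda>k. (1 / A\<^sup>2 + 1 / B\<^sup>2) * ?S k) \<longlonglongrightarrow> 0"
    by (intro tendsto_mult_right_zero tendsto_add_zero t)
  have "(\<integral>x. (norm (F k x - f x))\<^sup>2 \<partial>lborel) \<le> (1 / A\<^sup>2 + 1 / B\<^sup>2) * ?S k" for k
  proof -
    have l: "(\<lambda>x. F k x - f x) \<in> L2" by (intro L2_diff F f)
    have S: "?S k = A\<^sup>2 * sq (\<lambda>x. v1 (F k x - f x)) + B\<^sup>2 * sq (\<lambda>x. v2 (F k x - f x))"
      unfolding spin_comp_sq[OF l, symmetric] spin_comp_diff[abs_def] ..
    have "0 \<le> (1 / A\<^sup>2) * (B\<^sup>2 * sq (\<lambda>x. v2 (F k x - f x)))" "0 \<le> (1 / B\<^sup>2) * (A\<^sup>2 * sq (\<lambda>x. v1 (F k x - f x)))"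
      by (intro mult_nonneg_nonneg; simp)+
    then show ?thesis unfolding S L2_int[OF l] using AB by (simp add: algebra_simps)
  qed
  then show "\<forall>\<^sub>F k in sequentially. norm (\<integral>x. (norm (F k x - f x))\<^sup>2 \<partial>lborel) \<le> (1 / A\<^sup>2 + 1 / B\<^sup>2) * ?S k"
    by (intro always_eventually allI) simp
qed

lemma recombine_schwartz: "schwartz (recombine (\<lambda>s x. \<Sum>m<N. c m s * eta \<rho> m x))"
proof -
  let ?Q = "\<lambda>s. \<Sum>m<N. Polynomial.smult (c m s) (osc_poly m)"
  have q: "ph s x * (\<Sum>m<N. c m s * eta \<rho> m x) = pg (?Q s) (zz s) x" for s x
  proof -
    have "pg (?Q s) (zz s) x = (\<Sum>m<N. c m s * pg (osc_poly m) (zz s) x)"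
      by (simp add: pg_def poly_sum sum_distrib_right mult.assoc)
    then show ?thesis by (simp add: phi_eq sum_distrib_left mult_ac)
  qed
  have "schwartz (\<lambda>x. vector [\<Sum>s\<in>UNIV. pg (Polynomial.smult (1 / of_real (sqrt \<alpha> * sqrt 2)) (?Q s)) (zz s) x,
     \<Sum>s\<in>UNIV. pg (Polynomial.smult (- \<i> * of_real (sg s) / of_real (sqrt \<beta> * sqrt 2)) (?Q s)) (zz s) x])"
    by (rule schwartz_pg) (auto simp: zz_pos)
  also have "(\<lambda>x. vector [\<Sum>s\<in>UNIV. pg (Polynomial.smult (1 / of_real (sqrt \<alpha> * sqrt 2)) (?Q s)) (zz s) x,
     \<Sum>s\<in>UNIV. pg (Polynomial.smult (- \<i> * of_real (sg s) / of_real (sqrt \<beta> * sqrt 2)) (?Q s)) (zz s) x] :: complex ^ 2)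
     = recombine (\<lambda>s x. \<Sum>m<N. c m s * eta \<rho> m x)"
  proof
    fix x
    have p: "pg (Polynomial.smult k p) z x = k * pg p z x" for k p z by (simp add: pg_def)
    show "(vector [\<Sum>s\<in>UNIV. pg (Polynomial.smult (1 / of_real (sqrt \<alpha> * sqrt 2)) (?Q s)) (zz s) x,
     \<Sum>s\<in>UNIV. pg (Polynomial.smult (- \<i> * of_real (sg s) / of_real (sqrt \<beta> * sqrt 2)) (?Q s)) (zz s) x] :: complex ^ 2) =
      recombine (\<lambda>s x. \<Sum>m<N. c m s * eta \<rho> m x) x"
      unfolding recombine_def q p sum_divide_distrib by simp
  qed
  finally show ?thesis .
qed

text \<open>Riesz-Fischer turns the unweighted coordinates into the two components of f. Truncations
  of the expansion are Schwartz functions and witness that f belongs to the closed graph.\<close>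

lemma level_coords_surj:
  assumes y: "ell2 y" "mapp gram_scaled y = (\<lambda>i. of_real (1 / l) * y i)" and l: "l \<noteq> 0"
  shows "\<exists>f\<in>ncho_eigenspace \<alpha> \<beta> (of_real l). level_coords f = y"
proof -
  define c where "c m s = of_real (1 / sqrt (dd (m, s))) * y (m, s)" for m s
  have "ell2 (\<lambda>i. of_real (1 / sqrt (dd i)) * y i)"
    by (rule ell2_bounded_mult[OF y(1), where K=2]) (rule inv_sqrt_dd)
  then have "summable (\<lambda>m. (norm (c m s))\<^sup>2)" for s unfolding c_def by (rule ell2_boolD)
  then have "\<forall>s. \<exists>g. l2 g \<and> (\<forall>m. sp (eta \<rho> m) g = c m s) \<and> (\<lambda>N. sq (\<lambda>x. (\<Sum>m<N. c m s * eta \<rho> m x) - g x)) \<longlonglongrightarrow> 0"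
    by (intro allI riesz_fischer)
  from choice[OF this]
  obtain g where g: "\<And>s. l2 (g s)" "\<And>m s. sp (eta \<rho> m) (g s) = c m s"
    "\<And>s. (\<lambda>N. sq (\<lambda>x. (\<Sum>m<N. c m s * eta \<rho> m x) - g s x)) \<longlonglongrightarrow> 0" by blast
  let ?f = "recombine g"
  have fL: "?f \<in> L2" by (rule recombine_L2[OF g(1)])
  have cup: "cup s (recombine g) = g s" for s g by (rule ext) (rule cup_rcp)
  have Y: "level_coords ?f = y"
  proof
    fix i show "level_coords ?f i = y i" using sqrt_dd(1)[of i] unfolding level_coords_def cup g(2) c_def by simp
  qed
  have h: "sp (eta \<rho> m) (cdn s ?f) = of_real (\<nu> * (m + 1/2) / l) * c m s" for m s
  proof -
    have "sp (eta \<rho> m) (cdn s ?f) = mapp gram_scaled y (m, s) * of_real (\<nu> * sqrt (dd (m, s)))"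
      using mapp_Yc[OF fL, of "(m, s)"] sqrt_dd(1)[of "(m, s)"] \<nu>_pos unfolding Y by simp
    also have "\<dots> = of_real (\<nu> / l) * of_real (sqrt (dd (m, s))) * y (m, s)" unfolding y(2) by simp
    also have "y (m, s) = of_real (sqrt (dd (m, s))) * c m s" using sqrt_dd(1)[of "(m, s)"] by (simp add: c_def)
    also have "of_real (\<nu> / l) * of_real (sqrt (dd (m, s))) * (of_real (sqrt (dd (m, s))) * c m s) = of_real (\<nu> / l) * of_real (dd (m, s)) * c m s"
      unfolding sqrt_dd(2)[symmetric] by (simp only: mult.assoc)
    finally show ?thesis by (simp add: dd_def)
  qed
  let ?h = "\<lambda>x. complex_of_real l *s ?f x"
  have hL: "?h \<in> L2" using L2_v[OF fL] unfolding L2_iff by (simp add: l2_scale)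
  have ch: "sp (eta \<rho> m) (cdn s ?h) = of_real (\<nu> * (m + 1/2)) * c m s" for m s
  proof -
    have "cdn s ?h = (\<lambda>x. of_real l * cdn s ?f x)" by (auto simp: spin_comp_def algebra_simps)
    then show ?thesis using l by (simp add: sp_scale_right h)
  qed
  let ?F = "\<lambda>N. recombine (\<lambda>s x. \<Sum>m<N. c m s * eta \<rho> m x)"
  have F: "schwartz (?F N)" for N by (rule recombine_schwartz)
  have t1: "L2_tendsto ?F ?f"
    by (rule L2_tendsto_cmp[of "sqrt \<alpha>" "sqrt \<beta>"]) (use ab g(3) schwartz_L2[OF F] fL in \<open>simp_all add: cup\<close>)
  have t2: "L2_tendsto (\<lambda>N. ncho_expr \<alpha> \<beta> (?F N)) ?h"
  proof (rule L2_tendsto_cmp[of "1 / sqrt \<alpha>" "1 / sqrt \<beta>"])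
    fix s
    have "sq (\<lambda>x. cdn s (ncho_expr \<alpha> \<beta> (?F N)) x - cdn s ?h x) = sq (\<lambda>x. (\<Sum>m<N. sp (eta \<rho> m) (cdn s ?h) * eta \<rho> m x) - cdn s ?h x)" for N
    proof -
      have l1: "l2 (cdn s (ncho_expr \<alpha> \<beta> (?F N)))" by (intro spin_comp_l2 schwartz_L2 F)
      \<comment> \<open>The image of a truncation has, in the \<open>cdn\<close> components, exactly
        the truncated coefficients of the target. By totality it is its N-th partial sum, which
        converges.\<close>
      have z: "AE x in lborel. cdn s (ncho_expr \<alpha> \<beta> (?F N)) x - (\<Sum>m<N. sp (eta \<rho> m) (cdn s ?h) * eta \<rho> m x) = 0"
        by (rule total[OF l2_diff[OF l1 l2_comb]])
           (simp add: sp_diff_right l2 l1 l2_comb sp_comb coef_schwartz[OF F] cup ch)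
      show ?thesis unfolding sq_def
      proof (rule integral_cong_AE)
        show "AE x in lborel. (norm (cdn s (ncho_expr \<alpha> \<beta> (?F N)) x - cdn s ?h x))\<^sup>2 = (norm ((\<Sum>m<N. sp (eta \<rho> m) (cdn s ?h) * eta \<rho> m x) - cdn s ?h x))\<^sup>2"
          using z by eventually_elim simp
      qed (use l2_sq_int[OF l2_diff[OF l1 spin_comp_l2[OF hL]]] l2_sq_int[OF l2_diff[OF l2_comb spin_comp_l2[OF hL]]] in \<open>auto dest: borel_measurable_integrable\<close>)
    qed
    then show "(\<lambda>N. sq (\<lambda>x. cdn s (ncho_expr \<alpha> \<beta> (?F N)) x - cdn s ?h x)) \<longlonglongrightarrow> 0"
      using expansion[OF spin_comp_l2[OF hL]] by simp
  qed (use ab schwartz_L2[OF F] hL in simp_all)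
  have "?f \<in> ncho_eigenspace \<alpha> \<beta> (of_real l)"
    unfolding ncho_eigenspace_def ncho_def mem_Collect_eq prod.case
    by (intro conjI fL hL exI[of _ ?F] t1 t2 allI F)
  then show ?thesis using Y by blast
qed

text \<open>\<open>level_coords\<close> is injective up to null sets and onto the eigenspace, so it
  carries bases to bases: the multiplicity of l for Q is that of 1 / l for G.\<close>

lemma eigenfamily_transfer:
  assumes "has_dim_ae (ncho_eigenspace \<alpha> \<beta> (of_real l)) d" and l: "l \<noteq> 0"
  shows "\<exists>b. eigenfamily gram_scaled (1 / l) d b \<and> independent_family d b"
proof -
  let ?V = "ncho_eigenspace \<alpha> \<beta> (of_real l)"
  have VL: "f \<in> ?V \<Longrightarrow> f \<in> L2" for f by (auto simp: ncho_eigenspace_def ncho_def)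
  obtain b where b: "\<And>i. i < d \<Longrightarrow> b i \<in> ?V" "\<And>c. AE x in lborel. (\<Sum>i<d. c i *s b i x) = 0 \<Longrightarrow> \<forall>i<d. c i = 0"
    "\<And>f. f \<in> ?V \<Longrightarrow> \<exists>c. AE x in lborel. f x = (\<Sum>i<d. c i *s b i x)"
    using assms(1) unfolding has_dim_ae_def by blast
  have bL: "b i \<in> L2" if "i < d" for i using VL b(1) that by blast
  have cL: "(\<lambda>x. \<Sum>i<d. c i *s b i x) \<in> L2" for c
    unfolding L2_iff by (auto intro!: l2_sum l2_scale L2_v bL)
  have Ys: "level_coords (\<lambda>x. \<Sum>i<d. c i *s b i x) = (\<lambda>j. \<Sum>i<d. c i * level_coords (b i) j)" for c
    by (rule level_coords_sum) (rule bL)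
  have "eigenfamily gram_scaled (1 / l) d (\<lambda>i. level_coords (b i))"
    unfolding eigenfamily_def
  proof (intro conjI allI impI)
    show "ell2 (level_coords (b i))" "mapp gram_scaled (level_coords (b i)) = (\<lambda>x. of_real (1 / l) * level_coords (b i) x)" if "i < d" for i
      by (rule level_coords_eigen[OF b(1)[OF that] l])+
    fix y assume "ell2 y" "mapp gram_scaled y = (\<lambda>x. of_real (1 / l) * y x)"
    then obtain f where f: "f \<in> ?V" "level_coords f = y" using level_coords_surj l by blast
    obtain c where "AE x in lborel. f x = (\<Sum>i<d. c i *s b i x)" using b(3)[OF f(1)] by blast
    from level_coords_AE[OF VL[OF f(1)] cL this]
    show "\<exists>c. y = (\<lambda>x. \<Sum>i<d. c i * level_coords (b i) x)" unfolding Ys f(2) by blast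
  qed
  moreover have "independent_family d (\<lambda>i. level_coords (b i))"
    unfolding independent_family_def
  proof (rule allI, rule impI)
    fix c assume "(\<lambda>x. \<Sum>i<d. c i * level_coords (b i) x) = (\<lambda>_. 0)"
    then have "level_coords (\<lambda>x. \<Sum>i<d. c i *s b i x) = (\<lambda>_. 0)" unfolding Ys .
    from level_coords_inj[OF cL this] show "\<forall>i<d. c i = 0" by (rule b(2))
  qed
  ultimately show ?thesis by blast
qed

end

section \<open>Sign sequences and their flips\<close>

lemma pv_bij: "0 < n \<Longrightarrow> bij_betw (pv n) {..<n} {..<n}"
  by (rule bij_betw_byWitness[where f'="nx n"]) (auto simp: pv_nx)

lemma pv_eq: "0 < n \<Longrightarrow> j < n \<Longrightarrow> pv n j = (if j = 0 then n - 1 else j - 1)"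
  by (cases j) (auto simp: pv_def)

definition flips :: "nat \<Rightarrow> (nat \<Rightarrow> bool) \<Rightarrow> nat set" where
  "flips n \<sigma> = {j. j < n \<and> \<sigma> (pv n j) \<noteq> \<sigma> j}"

text \<open>The sign sequence with flips exactly in \<open>F\<close> and last entry \<open>b\<close>; closing up the cycle requires \<open>card F\<close> to be even.\<close>

definition flip_pattern :: "nat \<Rightarrow> bool \<Rightarrow> nat set \<Rightarrow> nat \<Rightarrow> bool" where
  "flip_pattern n b F = (\<lambda>j\<in>{..<n}. b \<noteq> odd (card (F \<inter> {..j})))"

lemma card_Int_atMost_Suc: "card (F \<inter> {..Suc j}) = card (F \<inter> {..j}) + (if Suc j \<in> F then 1 else 0)"
  by (simp add: atMost_Suc)

lemma Int_atMost_last: "F \<subseteq> {..<n} \<Longrightarrow> 0 < n \<Longrightarrow> F \<inter> {..n - Suc 0} = F"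
  by (cases n) (auto simp: lessThan_Suc_atMost)

lemma flip_pattern_last: "F \<subseteq> {..<n} \<Longrightarrow> even (card F) \<Longrightarrow> 0 < n \<Longrightarrow> flip_pattern n b F (n - 1) = b"
  by (simp add: flip_pattern_def Int_atMost_last)

lemma flips_pat:
  assumes F: "F \<subseteq> {..<n}" "even (card F)" and n: "0 < n"
  shows "flips n (flip_pattern n b F) = F"
proof -
  have "flip_pattern n b F (pv n j) \<noteq> flip_pattern n b F j \<longleftrightarrow> j \<in> F" if j: "j < n" for j
  proof (cases j)
    case 0
    have "F \<inter> {..0} = (if 0 \<in> F then {0} else {})" by auto
    then show ?thesis using flip_pattern_last[OF F n, of b] 0 n by (simp add: pv_eq) (simp add: flip_pattern_def)
  next
    case (Suc i)
    then show ?thesis using j n by (simp add: pv_eq) (simp add: flip_pattern_def card_Int_atMost_Suc)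
  qed
  then show ?thesis using F(1) by (auto simp: flips_def)
qed

lemma flip_pattern_flips:
  assumes \<sigma>: "\<sigma> \<in> PiE {..<n} (\<lambda>_. UNIV)" and n: "0 < n"
  shows "even (card (flips n \<sigma>))" "flip_pattern n (\<sigma> (n - 1)) (flips n \<sigma>) = \<sigma>"
proof -
  let ?F = "flips n \<sigma>"
  \<comment> \<open>Starting from the last entry and crossing the edge into position 0, every flip
    toggles the sign; at j = n - 1 this forces the number of flips to be even.\<close>
  have s: "\<sigma> j = (\<sigma> (n - 1) \<noteq> odd (card (?F \<inter> {..j})))" if "j < n" for j
    using that
  proof (induction j)
    case 0
    have "?F \<inter> {..0} = (if 0 \<in> ?F then {0} else {})" by auto
    moreover have "0 \<in> ?F \<longleftrightarrow> \<sigma> (n - 1) \<noteq> \<sigma> 0" using n by (simp add: flips_def pv_eq)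
    ultimately show ?case by auto
  next
    case (Suc j)
    have "Suc j \<in> ?F \<longleftrightarrow> \<sigma> j \<noteq> \<sigma> (Suc j)" using n Suc.prems by (simp add: flips_def pv_eq)
    then show ?case using Suc by (auto simp: card_Int_atMost_Suc)
  qed
  have F: "?F \<subseteq> {..<n}" by (auto simp: flips_def)
  show "even (card ?F)" using s[of "n - 1"] n Int_atMost_last[OF F n] by simp blast
  show "flip_pattern n (\<sigma> (n - 1)) ?F = \<sigma>"
  proof
    fix j show "flip_pattern n (\<sigma> (n - 1)) ?F j = \<sigma> j"
      using s[of j] \<sigma> by (cases "j < n") (auto simp: flip_pattern_def PiE_iff extensional_def)
  qed
qed

lemma sum_pat:
  assumes n: "0 < n"
  shows "(\<Sum>\<sigma>\<in>PiE {..<n} (\<lambda>_. UNIV). f \<sigma>) = (\<Sum>F | F \<subseteq> {..<n} \<and> even (card F). f (flip_pattern n True F) + f (flip_pattern n False F))"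
proof -
  have "bij_betw (\<lambda>(F, b). flip_pattern n b F) ({F. F \<subseteq> {..<n} \<and> even (card F)} \<times> UNIV) (PiE {..<n} (\<lambda>_. UNIV))"
  proof (rule bij_betw_byWitness[where f'="\<lambda>\<sigma>. (flips n \<sigma>, \<sigma> (n - 1))"])
    show "\<forall>a\<in>{F. F \<subseteq> {..<n} \<and> even (card F)} \<times> UNIV. (\<lambda>\<sigma>. (flips n \<sigma>, \<sigma> (n - 1))) ((\<lambda>(F, b). flip_pattern n b F) a) = a"
      using flips_pat[OF _ _ n] flip_pattern_last[OF _ _ n] by (intro ballI) clarsimp
    show "\<forall>\<sigma>\<in>PiE {..<n} (\<lambda>_. UNIV). (\<lambda>(F, b). flip_pattern n b F) (flips n \<sigma>, \<sigma> (n - 1)) = \<sigma>"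
      unfolding prod.case by (intro ballI flip_pattern_flips(2) n)
    show "(\<lambda>(F, b). flip_pattern n b F) ` ({F. F \<subseteq> {..<n} \<and> even (card F)} \<times> UNIV) \<subseteq> PiE {..<n} (\<lambda>_. UNIV)"
      by (rule image_subsetI) (simp add: flip_pattern_def case_prod_unfold)
    show "(\<lambda>\<sigma>. (flips n \<sigma>, \<sigma> (n - 1))) ` PiE {..<n} (\<lambda>_. UNIV) \<subseteq> {F. F \<subseteq> {..<n} \<and> even (card F)} \<times> UNIV"
      using flip_pattern_flips(1)[OF _ n] by (intro image_subsetI) (auto simp: flips_def)
  qed
  from sum.reindex_bij_betw[OF this, of f]
  have "(\<Sum>\<sigma>\<in>PiE {..<n} (\<lambda>_. UNIV). f \<sigma>) = (\<Sum>(F, b)\<in>{F. F \<subseteq> {..<n} \<and> even (card F)} \<times> UNIV. f (flip_pattern n b F))"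
    by (simp add: case_prod_unfold)
  also have "\<dots> = (\<Sum>F | F \<subseteq> {..<n} \<and> even (card F). \<Sum>b\<in>UNIV. f (flip_pattern n b F))"
    by (rule sum.cartesian_product[symmetric])
  finally show ?thesis by (simp add: sum_bool)
qed

lemma sum_sorted_lists:
  "(\<Sum>js | sorted_wrt (<) js \<and> length js = k \<and> set js \<subseteq> {..<n :: nat}. f js) =
   (\<Sum>F | F \<subseteq> {..<n} \<and> card F = k. f (sorted_list_of_set F))"
proof (rule sum.reindex_bij_witness[where i=sorted_list_of_set and j=set], goal_cases)
  case (1 js)
  then show ?case by (auto simp: strict_sorted_iff sorted_list_of_set.idem_if_sorted_distinct)
next
  case (2 js)
  then show ?case by (auto simp: strict_sorted_iff distinct_card)
next
  case (3 F)
  then have "finite F" using finite_subset by blast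
  then show ?case by simp
next
  case (4 F)
  then have "finite F" using finite_subset by blast
  then show ?case using 4 by (auto simp: strict_sorted_list_of_set)
next
  case (5 js)
  then show ?case by (auto simp: strict_sorted_iff sorted_list_of_set.idem_if_sorted_distinct)
qed

text \<open>The diagonal of \<open>q\<Xi>\<^sub>n\<close>: at \<open>a = j\<^sub>r\<close> the number of \<open>j\<close>'s up to \<open>a\<close> is \<open>r\<close>.\<close>

definition alt_diag :: "real \<Rightarrow> nat set \<Rightarrow> nat \<Rightarrow> real" where
  "alt_diag q F a = (if a \<in> F then q * (-1) ^ card (F \<inter> {..a}) else 0)"

text \<open>The sign in \<open>Xi\<close> depends on the position in the list, that in
  \<open>alt_diag\<close> on a count inside the set; this identifies position r, counted from 0,
  with count r + 1.\<close>

lemma sorted_nth_card: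
  assumes F: "finite F" and r: "r < card F"
  shows "card (F \<inter> {..sorted_list_of_set F ! r}) = Suc r"
proof -
  let ?js = "sorted_list_of_set F"
  have so: "sorted_wrt (<) ?js" by (rule strict_sorted_list_of_set)
  have l: "length ?js = card F" using F by simp
  have lt: "?js ! i < ?js ! j \<longleftrightarrow> i < j" if "i < card F" "j < card F" for i j
    using sorted_wrt_nth_less[OF so, of i j] sorted_wrt_nth_less[OF so, of j i] that l by (metis linorder_neqE_nat not_less_iff_gr_or_eq)
  have FI: "x \<in> F \<longleftrightarrow> (\<exists>i<card F. ?js ! i = x)" for x
    using in_set_conv_nth[of x ?js] F l by simp
  have le: "?js ! i \<le> ?js ! r \<longleftrightarrow> i \<le> r" if "i < card F" for i
    using lt[OF r that] by (simp add: not_less[symmetric])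
  have "F \<inter> {..?js ! r} = (!) ?js ` {..r}"
  proof (intro equalityI subsetI)
    fix x assume x: "x \<in> F \<inter> {..?js ! r}"
    then obtain i where i: "i < card F" "?js ! i = x" using FI by blast
    then show "x \<in> (!) ?js ` {..r}" using le[of i] x by (intro image_eqI[of _ _ i]) auto
  next
    fix x assume "x \<in> (!) ?js ` {..r}"
    then obtain i where i: "i \<le> r" "x = ?js ! i" by auto
    then have "i < card F" using r by simp
    then show "x \<in> F \<inter> {..?js ! r}" using le[of i] i FI by auto
  qed
  moreover have "inj_on ((!) ?js) {..r}"
    using r l distinct_sorted_list_of_set[of F] by (intro inj_on_nth) auto
  ultimately show ?thesis by (simp add: card_image)
qed

lemma Xi_entry:
  assumes F: "F \<subseteq> {..<n}" and ab: "a < n" "b < n"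
  shows "Xi n (sorted_list_of_set F) $$ (a, b) = (if a = b \<and> a \<in> F then \<i> * (-1) ^ card (F \<inter> {..a}) else 0)"
proof -
  let ?js = "sorted_list_of_set F"
  have fin: "finite F" using F finite_subset by blast
  have s: "?js ! r \<in> F" if "r < card F" for r using that fin nth_mem[of r ?js] by simp
  have x: "Xi n ?js $$ (a, b) = \<i> * (\<Sum>r<card F. (-1) ^ (r + 1) * (if a = ?js ! r \<and> b = ?js ! r then 1 else 0))"
  proof -
    have "matrix_unit n (?js ! r) (?js ! r) $$ (a, b) = (if a = ?js ! r \<and> b = ?js ! r then 1 else 0 :: complex)" if "r < card F" for r
      using s[OF that] F ab by (auto simp: matrix_unit_def)
    then show ?thesis using ab fin by (simp add: Xi_def)
  qed
  show ?thesis
  proof (cases "a = b \<and> a \<in> F")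
    case True
    then obtain r0 where r0: "r0 < card F" "?js ! r0 = a" using fin by (metis in_set_conv_nth set_sorted_list_of_set length_sorted_list_of_set)
    have "a = ?js ! r \<longleftrightarrow> r = r0" if "r < card F" for r
      using that r0 fin distinct_sorted_list_of_set[of F] by (metis nth_eq_iff_index_eq length_sorted_list_of_set)
    then have "(\<Sum>r<card F. (-1) ^ (r + 1) * (if a = ?js ! r \<and> b = ?js ! r then 1 else 0)) = (\<Sum>r<card F. if r = r0 then (-1) ^ (r + 1) else (0 :: complex))"
      using True by (intro sum.cong) auto
    also have "\<dots> = (-1) ^ card (F \<inter> {..a})" using r0 sorted_nth_card[OF fin r0(1)] by simp
    finally show ?thesis unfolding x using True by auto
  next
    case False
    then have "(\<Sum>r<card F. (-1) ^ (r + 1) * (if a = ?js ! r \<and> b = ?js ! r then 1 else 0)) = (0 :: complex)"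
      using s by (intro sum.neutral) auto
    then show ?thesis using x False by simp
  qed
qed

definition cube_integral :: "nat \<Rightarrow> (nat \<Rightarrow> real) \<Rightarrow> complex" where
  "cube_integral n d = set_lebesgue_integral (leb n) ({..<n} \<rightarrow>\<^sub>E {0..1})
      (\<lambda>u. 2 ^ n / csqrt (Determinant.det (mat n n (\<lambda>(i, j). MA n u d i j)) * of_real (\<Prod>j<n. 1 - u j ^ 4)))"

lemma cube_integral_cong: "(\<And>i. i < n \<Longrightarrow> d i = d' i) \<Longrightarrow> cube_integral n d = cube_integral n d'"
proof -
  assume "\<And>i. i < n \<Longrightarrow> d i = d' i"
  then have "mat n n (\<lambda>(i, j). MA n u d i j) = mat n n (\<lambda>(i, j). MA n u d' i j)" for u
    by (intro cong_mat) (auto simp: MA_def)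
  then show ?thesis by (simp add: cube_integral_def)
qed

text \<open>Reversing the imaginary diagonal leaves the positive determinant of
  \<open>gauss_cyclic\<close> unchanged. Hence the two sign sequences with the same flips give equal
  integrals.\<close>

lemma cube_integral_neg:
  assumes n: "0 < n" and d: "\<And>i. i < n \<Longrightarrow> d i = s * (\<sigma> i - \<sigma> (pv n i))" and \<sigma>: "\<And>i. i < n \<Longrightarrow> (\<sigma> i)\<^sup>2 = 1"
  shows "cube_integral n (\<lambda>i. - d i) = cube_integral n d"
  unfolding cube_integral_def set_lebesgue_integral_def
proof (rule integral_cong_AE)
  have "(\<lambda>u. indicator ({..<n} \<rightarrow>\<^sub>E {0..1}) u *\<^sub>R (2 ^ n / csqrt (Determinant.det (mat n n (\<lambda>(i, j). MA n u d i j)) * of_real (\<Prod>j<n. 1 - u j ^ 4)))) \<in> borel_measurable (leb n)" for d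
  proof (intro borel_measurable_scaleR borel_measurable_indicator borel_measurable_divide borel_measurable_const)
    show "{..<n} \<rightarrow>\<^sub>E {0..1} \<in> sets (leb n)" by (intro sets_PiM_I_finite) auto
    have "(\<lambda>u. complex_of_real (\<Prod>j<n. 1 - u j ^ 4)) \<in> borel_measurable (leb n)"
      by (intro measurable_compose[OF _ borel_measurable_of_real] borel_measurable_prod borel_measurable_diff borel_measurable_const borel_measurable_power comp_measurable) auto
    then show "(\<lambda>u. csqrt (Determinant.det (mat n n (\<lambda>(i, j). MA n u d i j)) * of_real (\<Prod>j<n. 1 - u j ^ 4))) \<in> borel_measurable (leb n)"
      by (intro measurable_compose[OF _ csqrt_measurable] borel_measurable_times det_measurable MA_measurable)
  qed
  then show "(\<lambda>u. indicator ({..<n} \<rightarrow>\<^sub>E {0..1}) u *\<^sub>R (2 ^ n / csqrt (Determinant.det (mat n n (\<lambda>(i, j). MA n u (\<lambda>i. - d i) i j)) * of_real (\<Prod>j<n. 1 - u j ^ 4)))) \<in> borel_measurable (leb n)"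
    "(\<lambda>u. indicator ({..<n} \<rightarrow>\<^sub>E {0..1}) u *\<^sub>R (2 ^ n / csqrt (Determinant.det (mat n n (\<lambda>(i, j). MA n u d i j)) * of_real (\<Prod>j<n. 1 - u j ^ 4)))) \<in> borel_measurable (leb n)"
    by blast+
  have "AE u in leb n. \<forall>j\<in>{..<n}. u j \<noteq> 0 \<and> u j \<noteq> 1"
    by (rule AE_finite_allI) (auto intro: AE_component_neq)
  then show "AE u in leb n. indicator ({..<n} \<rightarrow>\<^sub>E {0..1}) u *\<^sub>R (2 ^ n / csqrt (Determinant.det (mat n n (\<lambda>(i, j). MA n u (\<lambda>i. - d i) i j)) * of_real (\<Prod>j<n. 1 - u j ^ 4)))
    = indicator ({..<n} \<rightarrow>\<^sub>E {0..1}) u *\<^sub>R (2 ^ n / csqrt (Determinant.det (mat n n (\<lambda>(i, j). MA n u d i j)) * of_real (\<Prod>j<n. 1 - u j ^ 4)))"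
  proof eventually_elim
    case (elim u)
    show ?case
    proof (cases "u \<in> {..<n} \<rightarrow>\<^sub>E {0..1}")
      case True
      then have u01: "\<And>j. j < n \<Longrightarrow> 0 < u j \<and> u j < 1" using elim by (force simp: PiE_iff less_le)
      show ?thesis using gauss_cyclic[where u=u and d=d and s=s and \<sigma>=\<sigma>, OF n u01 d \<sigma>] by auto
    qed simp
  qed
qed

lemma R_eq: "R n k q = (\<Sum>F | F \<subseteq> {..<n} \<and> card F = 2 * k. cube_integral n (alt_diag q F))"
proof -
  have "map_mat complex_of_real (Delta n u) + complex_of_real q \<cdot>\<^sub>m Xi n (sorted_list_of_set F) = mat n n (\<lambda>(i, j). MA n u (alt_diag q F) i j)"
    if F: "F \<subseteq> {..<n}" for F u
  proof (rule eq_matI)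
    fix i j assume ij: "i < dim_row (mat n n (\<lambda>(i, j). MA n u (alt_diag q F) i j))" "j < dim_col (mat n n (\<lambda>(i, j). MA n u (alt_diag q F) i j))"
    have dims: "dim_row (Xi n js) = n" "dim_col (Xi n js) = n" "dim_row (Delta n u) = n" "dim_col (Delta n u) = n" for js
      by (simp_all add: Xi_def Delta_def)
    show "(map_mat complex_of_real (Delta n u) + complex_of_real q \<cdot>\<^sub>m Xi n (sorted_list_of_set F)) $$ (i, j) = mat n n (\<lambda>(i, j). MA n u (alt_diag q F) i j) $$ (i, j)"
      using ij Xi_entry[OF F, of i j] by (simp add: dims MA_def alt_diag_def)
  qed (simp_all add: Xi_def Delta_def)
  then show ?thesis unfolding R_def sum_sorted_lists cube_integral_def by (intro sum.cong refl) auto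
qed

lemma of_real_powr_minus_nat: assumes "x > 0" shows "complex_of_real x powr (- of_nat n) = of_real (1 / x) ^ n"
proof -
  have "complex_of_real x powr (- of_nat n) = exp (- (of_nat n * Ln (of_real x)))" using assms by (simp add: powr_def)
  also have "\<dots> = inverse (exp (Ln (of_real x)) ^ n)" by (simp add: exp_minus exp_of_nat_mult)
  also have "\<dots> = of_real (1 / x) ^ n" using assms by (simp add: divide_inverse power_inverse)
  finally show ?thesis .
qed

lemma Wc_0: "Wc 0 m k = (if m = k then 1 else 0)"
  using hf_sp[of m k] by (simp add: Wc_def sp_def hf_real)

context ncho_par begin

definition qq :: real where "qq = \<kappa> / \<nu>"

lemma qq_eq: "qq = 1 / sqrt (\<alpha> * \<beta> - 1)"
proof -
  have ab0: "\<alpha> * \<beta> > 0" using pos by simp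
  have "\<nu> = sqrt ((\<alpha> * \<beta> - 1) / (\<alpha> * \<beta>))" using ab0 pos by (simp add: \<nu>_def \<kappa>_sq diff_divide_distrib)
  then show ?thesis using ab0 gt1 pos by (simp add: qq_def \<kappa>_def real_sqrt_divide del: real_sqrt_mult)
qed

text \<open>The substitution y = \<open>\<rho>\<close> x turns the chirp rate
  \<open>\<kappa>\<close>/2 into \<open>\<kappa>\<close> / (2 \<open>\<nu>\<close>), which is where
  q comes from. Equal signs give rate 0, opposite signs give rate plus or minus q.\<close>

lemma wv_Wc: "sp (wv s s' m) (eta \<rho> k) = Wc ((sg s' - sg s) * (qq / 2)) m k"
proof -
  have aff: "(\<integral>x. f (\<rho> * x) \<partial>lborel) = (\<integral>x. f x \<partial>lborel) / of_real \<rho>" for f :: "real \<Rightarrow> complex"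
    using lborel_integral_real_affine[of \<rho> f 0] \<rho>_pos by (simp add: scaleR_conv_of_real)
  let ?c = "(sg s' - sg s) * (qq / 2)"
  let ?f = "\<lambda>y. of_real \<rho> * (hf m y * hf k y * exp (\<i> * of_real (?c * y\<^sup>2)))"
  have kq: "\<kappa> = qq * \<rho>\<^sup>2" using \<nu>_pos by (simp add: qq_def \<rho>_sq)
  have "cnj (wv s s' m x) * eta \<rho> k x = ?f (\<rho> * x)" for x
  proof -
    have r: "of_real (sqrt \<rho>) * of_real (sqrt \<rho>) = complex_of_real \<rho>" using \<rho>_pos by (simp flip: of_real_mult)
    have e: "ph (\<not> s) x * ph s' x = exp (\<i> * of_real (?c * (\<rho> * x)\<^sup>2))"
    proof -
      have "sg (\<not> s) * \<kappa> / 2 * x\<^sup>2 + sg s' * \<kappa> / 2 * x\<^sup>2 = ?c * (\<rho> * x)\<^sup>2"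
        unfolding kq by (simp add: power_mult_distrib field_simps)
      then show ?thesis unfolding ph_def exp_add[symmetric] distrib_left[symmetric] of_real_add[symmetric] by (simp only:)
    qed
    have "cnj (wv s s' m x) * eta \<rho> k x = (ph (\<not> s) x * ph s' x) * (of_real (sqrt \<rho>) * of_real (sqrt \<rho>)) * (hf m (\<rho> * x) * hf k (\<rho> * x))"
      by (simp add: wv_def cnj_ph eta_def hf_real mult_ac)
    then show ?thesis unfolding e r by (simp only: mult_ac)
  qed
  then have "sp (wv s s' m) (eta \<rho> k) = (\<integral>x. ?f x \<partial>lborel) / of_real \<rho>" unfolding sp_def aff[of ?f, symmetric] by simp
  also have "\<dots> = Wc ?c m k" unfolding Wc_def integral_mult_right_zero using \<rho>_pos by simp
  finally show ?thesis .
qed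

definition c0 :: real where "c0 = (1 / \<alpha> + 1 / \<beta>) / 2"
text \<open>Spin factor of a flip relative to a non-flip. It is the negative of the quotient in the
  theorem, which even powers do not distinguish.\<close>

definition g0 :: real where "g0 = (\<beta> - \<alpha>) / (\<alpha> + \<beta>)"

lemma Cc_flip: "Cc s s' = c0 * (if s \<noteq> s' then g0 else 1)"
proof -
  have "c0 = (\<alpha> + \<beta>) * (1 / (2 * \<alpha> * \<beta>))" using pos by (simp add: c0_def field_simps)
  then have "c0 * g0 = (\<beta> - \<alpha>) / (2 * \<alpha> * \<beta>)" using pos by (simp add: g0_def)
  also have "\<dots> = (1 / \<alpha> - 1 / \<beta>) / 2" using pos by (simp add: field_simps)
  finally show ?thesis by (auto simp: Cc_def sg_def) (simp_all add: c0_def)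
qed

lemma prod_Cc: "(\<Prod>j<n. Cc (\<sigma> (pv n j)) (\<sigma> j) / \<nu>) = (c0 / \<nu>) ^ n * g0 ^ card (flips n \<sigma>)"
proof -
  have "(\<Prod>j<n. Cc (\<sigma> (pv n j)) (\<sigma> j) / \<nu>) = (\<Prod>j<n. c0 / \<nu> * (if \<sigma> (pv n j) \<noteq> \<sigma> j then g0 else 1))"
    by (simp add: Cc_flip)
  also have "\<dots> = (c0 / \<nu>) ^ n * (\<Prod>j<n. if \<sigma> (pv n j) \<noteq> \<sigma> j then g0 else 1)" by (simp only: prod.distrib prod_constant card_lessThan)
  also have "(\<Prod>j<n. if \<sigma> (pv n j) \<noteq> \<sigma> j then g0 else 1) = g0 ^ card (flips n \<sigma>)"
    by (simp add: prod.If_cases flips_def Int_def)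
  finally show ?thesis .
qed

text \<open>Written as a difference of signs at neighbouring positions, the form that
  \<open>gauss_cyclic\<close> asks of the diagonal.\<close>

definition dsig :: "nat \<Rightarrow> (nat \<Rightarrow> bool) \<Rightarrow> nat \<Rightarrow> real" where
  "dsig n \<sigma> j = - (qq / 2) * (sg (\<sigma> j) - sg (\<sigma> (pv n j)))"

definition wprod :: "nat \<Rightarrow> (nat \<Rightarrow> real) \<Rightarrow> (nat \<Rightarrow> nat) \<Rightarrow> complex" where
  "wprod n d m = (\<Prod>j<n. of_real (1 / (real (m j) + 1 / 2)) * Wc (- d j) (m (pv n j)) (m j))"

definition zip_path :: "nat \<Rightarrow> (nat \<Rightarrow> bool) \<Rightarrow> (nat \<Rightarrow> nat) \<Rightarrow> nat \<Rightarrow> nat \<times> bool" where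
  "zip_path n \<sigma> m = (\<lambda>i\<in>{..<n}. (m i, \<sigma> i))"

lemma cycw_val:
  assumes n: "0 < n"
  shows "cycw gram_scaled n (zip_path n \<sigma> m) = of_real ((c0 / \<nu>) ^ n * g0 ^ card (flips n \<sigma>)) * wprod n (dsig n \<sigma>) m"
proof -
  let ?r = "\<lambda>j. complex_of_real (1 / sqrt (real (m j) + 1 / 2))"
  have "cycw gram_scaled n (zip_path n \<sigma> m) = (\<Prod>j<n. gram_scaled (m (pv n j), \<sigma> (pv n j)) (m j, \<sigma> j))"
    unfolding cycw_def
  proof (rule prod.cong[OF refl])
    fix j assume j: "j \<in> {..<n}"
    then have "(if j = 0 then n - 1 else j - 1) = pv n j" using n by (simp add: pv_eq)
    then show "gram_scaled (zip_path n \<sigma> m (if j = 0 then n - 1 else j - 1)) (zip_path n \<sigma> m j) = gram_scaled (m (pv n j), \<sigma> (pv n j)) (m j, \<sigma> j)"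
      using j pv_nx(1)[OF n, of j] by (simp add: zip_path_def)
  qed
  also have "\<dots> = (\<Prod>j<n. of_real (Cc (\<sigma> (pv n j)) (\<sigma> j) / \<nu>) * (?r (pv n j) * ?r j * Wc (- dsig n \<sigma> j) (m (pv n j)) (m j)))"
    by (intro prod.cong refl) (simp add: gram_scaled_def gram_def wv_Wc dd_def dsig_def mult.commute)
  also have "\<dots> = of_real (\<Prod>j<n. Cc (\<sigma> (pv n j)) (\<sigma> j) / \<nu>) * ((\<Prod>j<n. ?r (pv n j)) * (\<Prod>j<n. ?r j) * (\<Prod>j<n. Wc (- dsig n \<sigma> j) (m (pv n j)) (m j)))"
    unfolding prod.distrib of_real_prod ..
  \<comment> \<open>Every vertex lies on two edges, each carrying an inverse square root; a cyclic
    shift joins the two halves to 1/(m + 1/2).\<close>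
  also have "(\<Prod>j<n. ?r (pv n j)) = (\<Prod>j<n. ?r j)" by (rule prod.reindex_bij_betw[OF pv_bij[OF n]])
  also have "(\<Prod>j<n. ?r j) * (\<Prod>j<n. ?r j) = (\<Prod>j<n. of_real (1 / (real (m j) + 1 / 2)))"
    unfolding prod.distrib[symmetric] of_real_mult[symmetric] by (intro prod.cong refl) (simp add: add_nonneg_nonneg)
  finally show ?thesis unfolding prod_Cc wprod_def prod.distrib .
qed

end

section \<open>Evaluation of the trace over closed paths\<close>

context ncho_par begin

lemma zip_path_bij:
  "bij_betw (\<lambda>(\<sigma>, m). zip_path n \<sigma> m) (PiE {..<n} (\<lambda>_. UNIV) \<times> PiE {..<n} (\<lambda>_. UNIV)) (PiE {..<n} (\<lambda>_. UNIV))"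
proof (rule bij_betw_byWitness[where f'="\<lambda>p. (\<lambda>i\<in>{..<n}. snd (p i), \<lambda>i\<in>{..<n}. fst (p i))"])
  have "restrict (\<lambda>i. snd (zip_path n \<sigma> m i)) {..<n} = \<sigma>" "restrict (\<lambda>i. fst (zip_path n \<sigma> m i)) {..<n} = m"
    if "\<sigma> \<in> PiE {..<n} (\<lambda>_. UNIV)" "m \<in> PiE {..<n} (\<lambda>_. UNIV)" for \<sigma> m
    using that by (auto simp: zip_path_def PiE_iff extensional_def fun_eq_iff)
  then show "\<forall>a\<in>PiE {..<n} (\<lambda>_. UNIV) \<times> PiE {..<n} (\<lambda>_. UNIV).
     (\<lambda>p. (\<lambda>i\<in>{..<n}. snd (p i), \<lambda>i\<in>{..<n}. fst (p i))) ((\<lambda>(\<sigma>, m). zip_path n \<sigma> m) a) = a"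
    by (intro ballI) clarsimp
  show "\<forall>p\<in>PiE {..<n} (\<lambda>_. UNIV). (\<lambda>(\<sigma>, m). zip_path n \<sigma> m) (\<lambda>i\<in>{..<n}. snd (p i), \<lambda>i\<in>{..<n}. fst (p i)) = p"
    by (auto simp: zip_path_def PiE_iff extensional_def fun_eq_iff)
  show "(\<lambda>(\<sigma>, m). zip_path n \<sigma> m) ` (PiE {..<n} (\<lambda>_. UNIV) \<times> PiE {..<n} (\<lambda>_. UNIV)) \<subseteq> PiE {..<n} (\<lambda>_. UNIV)"
    by (rule image_subsetI) (simp add: zip_path_def case_prod_unfold)
  show "(\<lambda>p. (\<lambda>i\<in>{..<n}. snd (p i), \<lambda>i\<in>{..<n}. fst (p i))) ` PiE {..<n} (\<lambda>_. UNIV) \<subseteq> PiE {..<n} (\<lambda>_. UNIV) \<times> PiE {..<n} (\<lambda>_. UNIV)"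
    by (rule image_subsetI) simp
qed

context
  fixes n N :: nat
  assumes n: "n = Suc (Suc N)"
begin

lemma cycw_summable: "(\<lambda>p. norm (case p of (\<sigma>, m) \<Rightarrow> cycw gram_scaled n (zip_path n \<sigma> m))) summable_on (PiE {..<n} (\<lambda>_. UNIV) \<times> PiE {..<n} (\<lambda>_. UNIV))"
proof -
  have "(\<lambda>p. norm (cycw gram_scaled n p)) summable_on PiE {..<n} (\<lambda>_. UNIV)" unfolding n by (rule cyc_sum(1)[OF hs])
  then show ?thesis by (subst (asm) summable_on_reindex_bij_betw[OF zip_path_bij, symmetric]) (simp add: case_prod_unfold)
qed

text \<open>Summability over all closed paths is inherited by the paths with fixed signs. Dividing
  out the constant spin factor needs it to be nonzero.\<close>

lemma wprod_summable:
  assumes \<sigma>: "\<sigma> \<in> PiE {..<n} (\<lambda>_. UNIV)" and K: "(c0 / \<nu>) ^ n * g0 ^ card (flips n \<sigma>) \<noteq> 0"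
  shows "(\<lambda>m. norm (wprod n (dsig n \<sigma>) m)) summable_on PiE {..<n} (\<lambda>_. UNIV)"
proof -
  have n0: "0 < n" using n by simp
  have "(\<lambda>m. norm (cycw gram_scaled n (zip_path n \<sigma> m))) summable_on PiE {..<n} (\<lambda>_. UNIV)"
    by (rule summable_on_SigmaD1[OF _ \<sigma>]) (use cycw_summable in \<open>simp add: case_prod_unfold\<close>)
  from summable_on_cmult_right[OF this[unfolded cycw_val[OF n0] norm_mult norm_of_real], of "inverse \<bar>(c0 / \<nu>) ^ n * g0 ^ card (flips n \<sigma>)\<bar>"]
  show ?thesis using K by (simp only: mult.assoc[symmetric] left_inverse abs_eq_0 mult_1 simp_thms)
qed

lemma term_value:
  assumes F: "F \<subseteq> {..<n}" "even (card F)" "F \<noteq> {}"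
  shows "infsum (\<lambda>m. cycw gram_scaled n (zip_path n (flip_pattern n b F) m)) (PiE {..<n} (\<lambda>_. UNIV)) =
     of_real ((c0 / \<nu>) ^ n * g0 ^ card F) * cube_integral n (alt_diag qq F)"
proof (cases "(c0 / \<nu>) ^ n * g0 ^ card F = 0")
  \<comment> \<open>Occurs when \<alpha> = \<beta>: the spin factor vanishes, both sides are 0, and
    no convergence statement about \<open>wprod\<close> enters.\<close>
  case True
  have n0: "0 < n" using n by simp
  show ?thesis unfolding cycw_val[OF n0] flips_pat[OF F(1,2) n0] True by simp
next
  case False
  have n0: "0 < n" using n by simp
  define \<sigma> where "\<sigma> = flip_pattern n b F"
  have fl: "flips n \<sigma> = F" unfolding \<sigma>_def by (rule flips_pat[OF F(1,2) n0])
  have \<sigma>S: "\<sigma> \<in> PiE {..<n} (\<lambda>_. UNIV)" by (simp add: \<sigma>_def flip_pattern_def)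
  have "infsum (wprod n (dsig n \<sigma>)) (PiE {..<n} (\<lambda>_. UNIV)) = cube_integral n (dsig n \<sigma>)"
    unfolding wprod_def[abs_def] cube_integral_def
  proof (rule trace_integral[where s="- (qq / 2)" and \<sigma>="\<lambda>i. sg (\<sigma> i)", OF n0])
    show "(\<lambda>m. norm (\<Prod>j<n. of_real (1 / (real (m j) + 1 / 2)) * Wc (- dsig n \<sigma> j) (m (pv n j)) (m j))) summable_on PiE {..<n} (\<lambda>_. UNIV)"
      using wprod_summable[OF \<sigma>S] False unfolding wprod_def fl by blast
  qed (simp_all add: dsig_def)
  also have "\<dots> = cube_integral n (alt_diag qq F)"
  proof -
    \<comment> \<open>At a flip the difference of signs is twice the new sign, which is that of
      \<open>b\<close> times the parity of the flips so far. The choice \<open>b = True\<close>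
      reverses the diagonal, which \<open>cube_integral_neg\<close> repairs.\<close>
    have d: "dsig n \<sigma> j = - sg b * alt_diag qq F j" if j: "j < n" for j
    proof -
      have fj: "j \<in> F \<longleftrightarrow> \<sigma> (pv n j) \<noteq> \<sigma> j" using j unfolding fl[symmetric] by (simp add: flips_def)
      have "sg (\<sigma> j) = sg b * (-1) ^ card (F \<inter> {..j})"
        using j by (cases b; cases "even (card (F \<inter> {..j}))") (auto simp: \<sigma>_def flip_pattern_def sg_def)
      then show ?thesis using fj by (auto simp: dsig_def alt_diag_def)
    qed
    show ?thesis
    proof (cases b)
      case True
      have "cube_integral n (alt_diag qq F) = cube_integral n (\<lambda>i. - dsig n \<sigma> i)" by (rule cube_integral_cong) (simp add: d True sg_def)
      also have "\<dots> = cube_integral n (dsig n \<sigma>)" by (rule cube_integral_neg[where s="- (qq / 2)" and \<sigma>="\<lambda>i. sg (\<sigma> i)", OF n0]) (simp_all add: dsig_def)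
      finally show ?thesis ..
    next
      case False
      then show ?thesis by (intro cube_integral_cong) (simp add: d sg_def)
    qed
  qed
  finally show ?thesis unfolding \<sigma>_def[symmetric] cycw_val[OF n0] fl infsum_cmult_right' by simp
qed

text \<open>Without flips there is no chirp, so each \<open>Wc\<close> is a Kronecker delta by
  orthonormality and only constant paths survive. The sum over their common value is the Hurwitz
  series, whose summability is read off from the path sum as well.\<close>

lemma zeta_value:
  shows "(\<lambda>k. of_real (1 / (real k + 1 / 2)) ^ n :: complex) summable_on UNIV"
    and "infsum (\<lambda>m. cycw gram_scaled n (zip_path n (flip_pattern n b {}) m)) (PiE {..<n} (\<lambda>_. UNIV)) =
      of_real ((c0 / \<nu>) ^ n) * infsum (\<lambda>k. of_real (1 / (real k + 1 / 2)) ^ n) UNIV"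
proof -
  have n0: "0 < n" using n by simp
  define \<sigma> where "\<sigma> = flip_pattern n b {}"
  let ?P = "PiE {..<n} (\<lambda>_. UNIV :: nat set)"
  have fl: "flips n \<sigma> = {}" unfolding \<sigma>_def by (rule flips_pat[OF _ _ n0]) auto
  have \<sigma>S: "\<sigma> \<in> PiE {..<n} (\<lambda>_. UNIV)" by (simp add: \<sigma>_def flip_pattern_def)
  have "dsig n \<sigma> j = 0" if "j < n" for j
    using pv_nx(1)[OF n0, of j] that by (simp add: dsig_def \<sigma>_def flip_pattern_def)
  then have w: "wprod n (dsig n \<sigma>) m = (\<Prod>j<n. of_real (1 / (real (m j) + 1 / 2)) * (if m (pv n j) = m j then 1 else 0))" for m
    unfolding wprod_def by (intro prod.cong refl) (simp add: Wc_0)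
  let ?c = "\<lambda>k :: nat. \<lambda>i\<in>{..<n}. k"
  have cc: "wprod n (dsig n \<sigma>) (?c k) = of_real (1 / (real k + 1 / 2)) ^ n" for k
    unfolding w using pv_nx(1)[OF n0] by simp
  have nz: "wprod n (dsig n \<sigma>) m = 0" if m: "m \<in> ?P - range ?c" for m
  proof (rule ccontr)
    assume "wprod n (dsig n \<sigma>) m \<noteq> 0"
    then have e: "m (pv n j) = m j" if "j < n" for j
      using that unfolding w by (auto simp: prod_zero_iff split: if_splits)
    have m0: "m j = m 0" if "j < n" for j
      using that
    proof (induction j)
      case (Suc j)
      then show ?case using e[of "Suc j"] n0 by (simp add: pv_eq)
    qed simp
    have "m = ?c (m 0)"
    proof
      fix j show "m j = ?c (m 0) j" using m m0[of j] by (cases "j < n") (auto simp: PiE_iff extensional_def)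
    qed
    then have "m \<in> range ?c" by (rule range_eqI)
    then show False using m by blast
  qed
  have inj: "inj ?c" using n0 by (intro injI) (drule fun_cong[of _ _ 0], simp)
  have sub: "range ?c \<subseteq> ?P" by (rule image_subsetI) (simp add: restrict_PiE_iff)
  have "c0 > 0" using pos by (simp add: c0_def add_pos_pos)
  with \<nu>_pos have "(c0 / \<nu>) ^ n * g0 ^ card (flips n \<sigma>) \<noteq> 0" by (simp add: fl)
  from wprod_summable[OF \<sigma>S this] have "wprod n (dsig n \<sigma>) summable_on ?P" by (rule abs_summable_summable)
  also have "?this \<longleftrightarrow> wprod n (dsig n \<sigma>) summable_on range ?c"
    by (rule summable_on_cong_neutral) (use sub nz in auto)
  also have "\<dots> \<longleftrightarrow> (\<lambda>k. of_real (1 / (real k + 1 / 2)) ^ n :: complex) summable_on UNIV"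
    unfolding summable_on_reindex[OF inj] by (simp add: o_def cc del: of_real_divide)
  finally show "(\<lambda>k. of_real (1 / (real k + 1 / 2)) ^ n :: complex) summable_on UNIV" .
  have "infsum (wprod n (dsig n \<sigma>)) ?P = infsum (wprod n (dsig n \<sigma>)) (range ?c)"
    by (rule infsum_cong_neutral) (use sub nz in auto)
  also have "\<dots> = infsum (\<lambda>k. of_real (1 / (real k + 1 / 2)) ^ n) UNIV"
    unfolding infsum_reindex[OF inj] by (simp add: o_def cc del: of_real_divide)
  finally show "infsum (\<lambda>m. cycw gram_scaled n (zip_path n (flip_pattern n b {}) m)) ?P = of_real ((c0 / \<nu>) ^ n) * infsum (\<lambda>k. of_real (1 / (real k + 1 / 2)) ^ n) UNIV"
    unfolding \<sigma>_def[symmetric] cycw_val[OF n0] fl infsum_cmult_right' by simp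
qed

lemma hurwitz_value: "hurwitz_zeta (of_nat n) (1 / 2) = infsum (\<lambda>k. of_real (1 / (real k + 1 / 2)) ^ n) UNIV"
proof -
  have "hurwitz_zeta (of_nat n) (1 / 2) = (\<Sum>k. of_real (1 / (real k + 1 / 2)) ^ n)"
    unfolding hurwitz_zeta_def by (intro arg_cong[where f=suminf] ext of_real_powr_minus_nat) simp
  also have "\<dots> = infsum (\<lambda>k. of_real (1 / (real k + 1 / 2)) ^ n) UNIV"
    by (rule sums_unique[symmetric, OF has_sum_imp_sums[OF has_sum_infsum[OF zeta_value(1)]]])
  finally show ?thesis .
qed

lemma trace_value:
  "infsum (cycw gram_scaled n) (PiE {..<n} (\<lambda>_. UNIV)) = 2 * of_real (c0 / \<nu>) ^ n *
     (hurwitz_zeta (of_nat n) (1 / 2) + (\<Sum>k | 0 < 2 * k \<and> 2 * k \<le> n. of_real (- g0) ^ (2 * k) * R n k qq))"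
proof -
  let ?S = "PiE {..<n} (\<lambda>_. UNIV :: bool set)" and ?P = "PiE {..<n} (\<lambda>_. UNIV :: nat set)"
  let ?T = "\<lambda>\<sigma>. infsum (\<lambda>m. cycw gram_scaled n (zip_path n \<sigma> m)) ?P"
  let ?E = "{F. F \<subseteq> {..<n} \<and> even (card F)}"
  let ?C = "complex_of_real (c0 / \<nu>) ^ n"
  define h where "h F = complex_of_real g0 ^ card F * cube_integral n (alt_diag qq F)" for F
  have n0: "0 < n" using n by simp
  have finE: "finite ?E" by (rule finite_subset[of _ "Pow {..<n}"]) auto
  have "infsum (cycw gram_scaled n) (PiE {..<n} (\<lambda>_. UNIV)) = infsum (\<lambda>(\<sigma>, m). cycw gram_scaled n (zip_path n \<sigma> m)) (?S \<times> ?P)"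
    by (subst infsum_reindex_bij_betw[OF zip_path_bij, symmetric]) (simp add: case_prod_unfold)
  also have "\<dots> = infsum ?T ?S"
    using infsum_Sigma_banach[OF abs_summable_summable[OF cycw_summable]] by simp
  also have "\<dots> = (\<Sum>\<sigma>\<in>?S. ?T \<sigma>)" by (rule infsum_finite) (auto intro: finite_PiE)
  also have "\<dots> = (\<Sum>F\<in>?E. ?T (flip_pattern n True F) + ?T (flip_pattern n False F))" by (rule sum_pat[OF n0])
  also have "\<dots> = (?T (flip_pattern n True {}) + ?T (flip_pattern n False {})) + (\<Sum>F\<in>?E - {{}}. ?T (flip_pattern n True F) + ?T (flip_pattern n False F))"
    by (rule sum.remove[OF finE]) simp
  also have "(\<Sum>F\<in>?E - {{}}. ?T (flip_pattern n True F) + ?T (flip_pattern n False F)) = (\<Sum>F\<in>?E - {{}}. 2 * ?C * h F)"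
    by (intro sum.cong refl) (simp add: term_value h_def)
  also have "\<dots> = 2 * ?C * (\<Sum>F\<in>?E - {{}}. h F)" by (rule sum_distrib_left[symmetric])
  also have "?T (flip_pattern n True {}) + ?T (flip_pattern n False {}) = 2 * ?C * hurwitz_zeta (of_nat n) (1 / 2)"
    unfolding zeta_value(2) hurwitz_value by simp
  \<comment> \<open>Nonempty even flip sets are grouped by half their size; a group is exactly the
    range of summation in \<open>R_eq\<close>.\<close>
  also have "(\<Sum>F\<in>?E - {{}}. h F) = (\<Sum>k | 0 < 2 * k \<and> 2 * k \<le> n. \<Sum>F\<in>{F\<in>?E - {{}}. card F div 2 = k}. h F)"
  proof (rule sum.group[symmetric])
    show "finite (?E - {{}})" using finE by simp
    show "finite {k. 0 < 2 * k \<and> 2 * k \<le> n}" by (rule finite_subset[of _ "{..n}"]) auto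
    show "(\<lambda>F. card F div 2) ` (?E - {{}}) \<subseteq> {k. 0 < 2 * k \<and> 2 * k \<le> n}"
    proof (rule image_subsetI)
      fix F assume F: "F \<in> ?E - {{}}"
      then have fin: "finite F" using finite_subset by blast
      have "card F \<le> n" using F card_mono[of "{..<n}" F] by simp
      moreover have "card F > 0" using F fin by (simp add: card_gt_0_iff)
      ultimately show "card F div 2 \<in> {k. 0 < 2 * k \<and> 2 * k \<le> n}" using F by auto
    qed
  qed
  also have "\<dots> = (\<Sum>k | 0 < 2 * k \<and> 2 * k \<le> n. of_real (- g0) ^ (2 * k) * R n k qq)"
  proof (intro sum.cong refl)
    fix k assume k: "k \<in> {k. 0 < 2 * k \<and> 2 * k \<le> n}"
    have s: "{F\<in>?E - {{}}. card F div 2 = k} = {F. F \<subseteq> {..<n} \<and> card F = 2 * k}"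
      using k by auto
    have g: "complex_of_real (- g0) ^ (2 * k) = of_real g0 ^ (2 * k)" by simp
    show "(\<Sum>F\<in>{F\<in>?E - {{}}. card F div 2 = k}. h F) = of_real (- g0) ^ (2 * k) * R n k qq"
      unfolding s g R_eq sum_distrib_left by (intro sum.cong refl) (simp add: h_def)
  qed
  finally show ?thesis by (simp add: distrib_left)
qed

text \<open>The reciprocals of the listed eigenvalues, with their multiplicities, form a list to
  which \<open>eigenbasis\<close> applies. The trace of the n-th power is then computed both from
  the spectrum and from closed paths.\<close>

lemma spectral_zeta_value:
  assumes lam: "ncho_eigenvalues \<alpha> \<beta> lam"
  shows "spectral_zeta lam (of_nat n) = infsum (cycw gram_scaled n) (PiE {..<n} (\<lambda>_. UNIV))"
proof -
  have lpos: "lam m > 0" for m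
    using lam unfolding ncho_eigenvalues_def incseq_def by (metis less_le_trans zero_le)
  define mu where "mu m = 1 / lam m" for m
  \<comment> \<open>Passing to reciprocals preserves the index sets, so the finiteness and
    multiplicity assumptions on \<open>lam\<close> transfer verbatim to \<open>mu\<close>.\<close>
  have set: "{m. mu m = z} = {m. complex_of_real (lam m) = of_real (1 / z)}" if "z \<noteq> 0" for z
  proof -
    have "mu m = z \<longleftrightarrow> lam m = 1 / z" for m using lpos[of m] that unfolding mu_def by (auto simp: field_simps)
    then show ?thesis by (simp only: of_real_eq_iff)
  qed
  have ev: "finite {m. complex_of_real (lam m) = w}" "has_dim_ae (ncho_eigenspace \<alpha> \<beta> w) (card {m. complex_of_real (lam m) = w})" for w
    using lam unfolding ncho_eigenvalues_def by blast+
  obtain e where e: "ortho e UNIV" "\<And>m. mapp gram_scaled (e m) = (\<lambda>x. complex_of_real (mu m) * e m x)"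
    "\<And>y z. ell2 y \<Longrightarrow> \<forall>m. ip (e m) y = 0 \<Longrightarrow> z \<noteq> 0 \<Longrightarrow> mapp gram_scaled y = (\<lambda>x. complex_of_real z * y x) \<Longrightarrow> y = (\<lambda>_. 0)"
  proof (rule eigenbasis[of mu])
    fix z :: real assume z: "z \<noteq> 0"
    show "finite {m. mu m = z}" unfolding set[OF z] by (rule ev)
    show "\<exists>b. eigenfamily gram_scaled z (card {m. mu m = z}) b \<and> independent_family (card {m. mu m = z}) b"
      using eigenfamily_transfer[OF ev(2)[of "of_real (1 / z)"]] z unfolding set[OF z] by simp
  next
    show "mu m \<noteq> 0" for m using lpos[of m] by (simp add: mu_def)
  qed blast
  interpret he: hs_eigen gram_scaled e mu by unfold_locales (use e in blast)+
  have s: "(\<lambda>m. complex_of_real (mu m) ^ n) summable_on UNIV"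
    unfolding n by (rule abs_summable_summable[OF he.trace_pw(1)])
  have "spectral_zeta lam (of_nat n) = (\<Sum>m. complex_of_real (mu m) ^ n)"
    unfolding spectral_zeta_def mu_def by (intro arg_cong[where f=suminf] ext of_real_powr_minus_nat lpos)
  also have "\<dots> = infsum (\<lambda>m. complex_of_real (mu m) ^ n) UNIV"
    by (rule sums_unique[symmetric, OF has_sum_imp_sums[OF has_sum_infsum[OF s]]])
  also have "\<dots> = infsum (cycw gram_scaled n) (PiE {..<n} (\<lambda>_. UNIV))"
    unfolding n cyc_sum(2)[OF hs] he.trace_pw(2) ..
  finally show ?thesis .
qed

end

lemma c0_\<nu>: "c0 / \<nu> = (\<alpha> + \<beta>) / (2 * sqrt (\<alpha> * \<beta> * (\<alpha> * \<beta> - 1)))"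
proof -
  have ab0: "\<alpha> * \<beta> > 0" using pos by simp
  have "\<nu> = sqrt ((\<alpha> * \<beta> * (\<alpha> * \<beta> - 1)) / (\<alpha> * \<beta>)\<^sup>2)"
  proof -
    have "1 - 1 / (\<alpha> * \<beta>) = (\<alpha> * \<beta> * (\<alpha> * \<beta> - 1)) / (\<alpha> * \<beta>)\<^sup>2" using pos by (simp add: field_simps power2_eq_square)
    then show ?thesis unfolding \<nu>_def \<kappa>_sq by (rule arg_cong)
  qed
  also have "\<dots> = sqrt (\<alpha> * \<beta> * (\<alpha> * \<beta> - 1)) / (\<alpha> * \<beta>)" using ab0 by (simp add: real_sqrt_divide del: real_sqrt_mult)
  finally have v: "\<nu> = sqrt (\<alpha> * \<beta> * (\<alpha> * \<beta> - 1)) / (\<alpha> * \<beta>)" .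
  have "c0 = (\<alpha> + \<beta>) / (2 * (\<alpha> * \<beta>))" using pos by (simp add: c0_def field_simps)
  then show ?thesis unfolding v using ab0 by simp
qed

end

theorem theorem4p2:
  fixes \<alpha> \<beta> q :: real and lam :: "nat \<Rightarrow> real" and n :: nat
  assumes "\<alpha> > 0" and "\<beta> > 0" and "\<alpha> * \<beta> > 1"
    and "ncho_eigenvalues \<alpha> \<beta> lam"
    and "q = 1 / sqrt (\<alpha> * \<beta> - 1)"
    and "n \<ge> 2"
  shows "spectral_zeta lam (of_nat n) =
    2 * complex_of_real ((\<alpha> + \<beta>) / (2 * sqrt (\<alpha> * \<beta> * (\<alpha> * \<beta> - 1)))) ^ n *
    (hurwitz_zeta (of_nat n) (1/2) +
      (\<Sum>k | 0 < 2 * k \<and> 2 * k \<le> n. complex_of_real ((\<alpha> - \<beta>) / (\<alpha> + \<beta>)) ^ (2 * k) * R n k q))"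
proof -
  interpret ncho_par \<alpha> \<beta> using assms(1-3) by unfold_locales
  obtain N where n: "n = Suc (Suc N)" using assms(6) by (metis Suc_le_D numeral_2_eq_2 Suc_le_mono)
  have g: "- g0 = (\<alpha> - \<beta>) / (\<alpha> + \<beta>)" by (simp add: g0_def minus_divide_left)
  have q: "q = qq" using assms(5) by (simp add: qq_eq)
  show ?thesis
    unfolding spectral_zeta_value[OF n assms(4)] trace_value[OF n] c0_\<nu> g q ..
qed

end
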